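(* Let $S$ be a connected closed oriented surface with a simple triangulation $G$ with sets of vertices, edges and triangles $V,E,F$. For any $\vec T=(T_v)_{v\in V}\in\partial_0\Omega_T$ and $\vec k(0)\in\Omega_k$, the flow ray $\vec k(t)$, $t\ge0$, from $\vec k(0)$ of the combinatorial Ricci flow $$\frac{\mathrm d k_v(t)}{\mathrm d t}=-\big(T_v(\vec k(t))-T_v\big)\,k_v(t),\qquad v\in V,$$ diverges in $\Omega_k$ (does not converge to a point of $\Omega_k$). However, it converges in $\overline\Omega_k=\mathbb R_{\ge0}^V$ as $t\to+\infty$, and the limit point is exactly $\widehat\Phi^{-1}(\vec T)\in\partial\Omega_k$.
   Context: Generalized circles. A generalized circle of geodesic curvature $k\ge0$ in $\mathbb H^2$ is: for $k>1$ a circle of radius $r$, $k=\coth r$ (center: its usual center); for $k=1$ a horocycle (center: its ideal point); for $0<k<1$ a hypercycle, i.e. one component of the set of points at distance $r$ from a complete geodesic (its axis, also called its center), $k=\tanh r$; for $k=0$ a complete geodesic (its own center and axis). Its convex side is the closed disk, closed horoball, closed region bounded by the hypercycle containing its axis, or, for $k=0$, a chosen closed half-plane. Two generalized circles are externally tangent if they are tangent at a point of $\mathbb H^2$ and their convex sides have disjoint interiors; two geodesics ($k=0$) count as externally tangent if they are distinct, share an ideal endpoint (their tangency point) and their chosen half-planes have disjoint interiors. Triangles. For $(k_1,k_2,k_3)\in\mathbb R_{\ge0}^3$ there is, up to isometry, a unique triple of pairwise externally tangent generalized circles $C_1,C_2,C_3$, arranged counterclockwise, with $C_i$ of geodesic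 curvature $k_i$. The edge $e_{ij}$ is the geodesic joining the centers of $C_i,C_j$ through their tangency point $t_{ij}$ (perpendicular to the axis of any of them with curvature $<1$; it degenerates to the ideal point $t_{ij}$ if $k_i=k_j=0$); the vertex $v_i$ is the center of $C_i$ if $k_i\ge1$ and the part of the axis of $C_i$ between the two edges if $k_i<1$. The (possibly degenerated) circle packed triangle is the closed polygon bounded by vertices and edges. If $k_i>0$ let $l_i$ be the length of the arc of $C_i$ inside this triangle joining its two tangency points, and $T_i(k_1,k_2,k_3)=k_il_i$; if $k_i=0$ put $T_i=0$. For $\vec k=(k_v)\in\mathbb R_{\ge0}^V$ and $f=(uvw)\in F$, realize $f$ as the circle packed triangle of curvature $(k_u,k_v,k_w)$, let $T_v^f(\vec k)$ be the total geodesic curvature of the arc at $v$ in it, and $T_v(\vec k)=\sum_{f\ni v}T_v^f(\vec k)$. Sets. $\Omega_k=\mathbb R_{>0}^V$, $\overline\Omega_k=\mathbb R_{\ge0}^V$, $\partial\Omega_k=\overline\Omega_k\setminus\Omega_k$. For non-empty $I\subset V$, $F_I$ is the set of triangles with at least one vertex in $I$, and $\eta^I(\vec T)=\pi|F_I|-\sum_{i\in I}T_i$. $\Omega_T=\{\vec T\in\mathbb R_{>0}^V:\eta^I(\vec T)>0\ \forall\,\varnothing\ne I\subset V\}$, $\widehat\Omega_T=\{\vec T\in\mathbb R_{\ge0}^V:\eta^I(\vec T)>0\ \forall\,\varnothing\ne I\subset V\}$, $\partial_0\Omega_T=\widehat\Omega_T\setminus\Omega_T$. $\widehat\Phi:\overline\Omega_k\to\widehat\Omega_T$,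 $\vec k\mapsto(T_v(\vec k))_{v\in V}$, is a homeomorphism mapping $\partial\Omega_k$ onto $\partial_0\Omega_T$. *)

theory Defs
  imports "HOL-Analysis.Analysis"
begin

section \<open>The hyperbolic plane\<close>

text \<open>
  We use the Beltrami--Klein model: \<open>\<H>\<^sup>2\<close> is the open unit disk, its ideal boundary is the unit
  circle, and complete geodesics are the open chords. The model is not conformal; angles and lengths
  are those of \<open>klein_metric\<close>, the Riemannian metric of curvature \<open>-1\<close>.
\<close>

definition hyp_plane :: "complex set" where
  "hyp_plane = ball 0 1"

definition ideal_boundary :: "complex set" where
  "ideal_boundary = sphere 0 1"

definition klein_metric :: "complex \<Rightarrow> complex \<Rightarrow> complex \<Rightarrow> real" where
  "klein_metric x u v =
     (u \<bullet> v) / (1 - x \<bullet> x) + (x \<bullet> u) * (x \<bullet> v) / (1 - x \<bullet> x)^2"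

definition hyp_length :: "(real \<Rightarrow> complex) \<Rightarrow> real" where
  "hyp_length g = integral {0..1} (\<lambda>s.
     sqrt (klein_metric (g s) (vector_derivative g (at s)) (vector_derivative g (at s))))"

definition hyp_dist :: "complex \<Rightarrow> complex \<Rightarrow> real" where
  "hyp_dist x y = arcosh ((1 - x \<bullet> y) / sqrt ((1 - x \<bullet> x) * (1 - y \<bullet> y)))"

definition hyp_dist_set :: "complex \<Rightarrow> complex set \<Rightarrow> real" where
  "hyp_dist_set x A = (INF a\<in>A. hyp_dist x a)"

definition complete_geodesic :: "complex set \<Rightarrow> bool" where
  "complete_geodesic A \<longleftrightarrow>
     (\<exists>a\<in>ideal_boundary. \<exists>b\<in>ideal_boundary. a \<noteq> b \<and> A = open_segment a b)"

text \<open>The exponential of the Busemann function of the ideal point \<open>\<xi>\<close>; its level sets are the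
  horocycles centered at \<open>\<xi>\<close> and its sublevel sets are the closed horoballs.\<close>

definition exp_busemann :: "complex \<Rightarrow> complex \<Rightarrow> real" where
  "exp_busemann \<xi> x = (1 - x \<bullet> \<xi>) / sqrt (1 - x \<bullet> x)"


section \<open>Generalized circles\<close>

text \<open>The field \<open>center\<close> is a singleton when the center is a point (ordinary or ideal), and the axis
  when it is a geodesic. The field \<open>side\<close> is the convex side.\<close>

record gen_circle =
  curv :: real
  center :: "complex set"
  curve :: "complex set"
  side :: "complex set"

definition circle_of_radius :: "gen_circle \<Rightarrow> bool" where
  "circle_of_radius c \<longleftrightarrow> (\<exists>p\<in>hyp_plane. \<exists>r>0.
     curv c = 1 / tanh r \<and> center c = {p} \<and>
     curve c = {x \<in> hyp_plane. hyp_dist x p = r} \<and>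
     side c = {x \<in> hyp_plane. hyp_dist x p \<le> r})"

definition horocycle :: "gen_circle \<Rightarrow> bool" where
  "horocycle c \<longleftrightarrow> (\<exists>\<xi>\<in>ideal_boundary. \<exists>s>0.
     curv c = 1 \<and> center c = {\<xi>} \<and>
     curve c = {x \<in> hyp_plane. exp_busemann \<xi> x = s} \<and>
     side c = {x \<in> hyp_plane. exp_busemann \<xi> x \<le> s})"

definition hypercycle :: "gen_circle \<Rightarrow> bool" where
  "hypercycle c \<longleftrightarrow> (\<exists>r>0.
     curv c = tanh r \<and> complete_geodesic (center c) \<and>
     curve c \<in> components {x \<in> hyp_plane. hyp_dist_set x (center c) = r} \<and>
     (\<exists>U \<in> components (hyp_plane - curve c). center c \<subseteq> U \<and> side c = curve c \<union> U))"

definition geodesic_with_half_plane :: "gen_circle \<Rightarrow> bool" where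
  "geodesic_with_half_plane c \<longleftrightarrow>
     curv c = 0 \<and> complete_geodesic (center c) \<and> curve c = center c \<and>
     (\<exists>U \<in> components (hyp_plane - curve c). side c = curve c \<union> U)"

definition generalized_circle :: "gen_circle \<Rightarrow> bool" where
  "generalized_circle c \<longleftrightarrow>
     circle_of_radius c \<or> horocycle c \<or> hypercycle c \<or> geodesic_with_half_plane c"

definition tangent_curves_at :: "complex set \<Rightarrow> complex set \<Rightarrow> complex \<Rightarrow> bool" where
  "tangent_curves_at C C' p \<longleftrightarrow> (\<exists>(g :: real \<Rightarrow> complex) (h :: real \<Rightarrow> complex) u.
     range g \<subseteq> C \<and> range h \<subseteq> C' \<and> g 0 = p \<and> h 0 = p \<and> u \<noteq> 0 \<and>
     (g has_vector_derivative u) (at 0) \<and> (h has_vector_derivative u) (at 0))"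

text \<open>\<open>t\<close> is the tangency point. It is an ideal point exactly for two geodesics, where it is a common
  endpoint of the two chords.\<close>

definition externally_tangent_at :: "gen_circle \<Rightarrow> gen_circle \<Rightarrow> complex \<Rightarrow> bool" where
  "externally_tangent_at c c' t \<longleftrightarrow>
     interior (side c) \<inter> interior (side c') = {} \<and>
     (if curv c = 0 \<and> curv c' = 0
      then curve c \<noteq> curve c' \<and> t \<in> ideal_boundary \<inter> closure (curve c) \<inter> closure (curve c')
      else t \<in> hyp_plane \<and> tangent_curves_at (curve c) (curve c') t)"


section \<open>Circle packed triangles\<close>

definition counterclockwise :: "complex \<Rightarrow> complex \<Rightarrow> complex \<Rightarrow> bool" where
  "counterclockwise p q r \<longleftrightarrow> Im (cnj (q - p) * (r - p)) > 0"

text \<open>Three circles with disjoint convex sides are arranged counterclockwise iff their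
  tangency points \<open>t12, t23, t31\<close> are.\<close>

definition tangent_triple ::
  "gen_circle \<Rightarrow> gen_circle \<Rightarrow> gen_circle \<Rightarrow> complex \<Rightarrow> complex \<Rightarrow> complex \<Rightarrow> bool" where
  "tangent_triple c1 c2 c3 t12 t23 t31 \<longleftrightarrow>
     generalized_circle c1 \<and> generalized_circle c2 \<and> generalized_circle c3 \<and>
     externally_tangent_at c1 c2 t12 \<and> externally_tangent_at c2 c3 t23 \<and>
     externally_tangent_at c3 c1 t31 \<and> counterclockwise t12 t23 t31"

text \<open>The edge joining the centers of \<open>c\<close> and \<open>c'\<close> through \<open>t\<close> is the chord segment from \<open>p\<close> to \<open>q\<close>.
  If a center is an axis, the edge ends at a point of the axis and is perpendicular to it there. If
  both curvatures vanish, the edge is the ideal point \<open>t\<close>.\<close>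

definition perpendicular_end :: "gen_circle \<Rightarrow> complex \<Rightarrow> complex \<Rightarrow> bool" where
  "perpendicular_end c p q \<longleftrightarrow> p \<in> center c \<and>
     (curv c < 1 \<longrightarrow> (\<forall>z\<in>center c. klein_metric p (z - p) (q - p) = 0))"

definition edge_ends ::
  "gen_circle \<Rightarrow> gen_circle \<Rightarrow> complex \<Rightarrow> complex \<Rightarrow> complex \<Rightarrow> bool" where
  "edge_ends c c' t p q \<longleftrightarrow>
     (if curv c = 0 \<and> curv c' = 0 then p = t \<and> q = t
      else t \<in> closed_segment p q \<and> perpendicular_end c p q \<and> perpendicular_end c' q p)"

text \<open>The edge \<open>e\<^sub>i\<^sub>j\<close> is the segment from \<open>pij\<close> to \<open>pji\<close>, with \<open>pij\<close> in the center of \<open>ci\<close>. The vertex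
  \<open>v\<^sub>i\<close> is the segment between the ends of the two edges at \<open>ci\<close>: a part of the axis if the curvature
  is less than 1, and otherwise a single point, as both ends are then the center. Ideal vertices
  are kept, so that the boundary is a closed curve in the closed disk.\<close>

definition circle_packed_triangle ::
  "gen_circle \<Rightarrow> gen_circle \<Rightarrow> gen_circle \<Rightarrow> complex \<Rightarrow> complex \<Rightarrow> complex \<Rightarrow> complex set \<Rightarrow> bool" where
  "circle_packed_triangle c1 c2 c3 t12 t23 t31 \<Delta> \<longleftrightarrow>
     (\<exists>p12 p21 p23 p32 p31 p13.
        edge_ends c1 c2 t12 p12 p21 \<and> edge_ends c2 c3 t23 p23 p32 \<and> edge_ends c3 c1 t31 p31 p13 \<and>
        (let P = closed_segment p12 p21 \<union> closed_segment p23 p32 \<union> closed_segment p31 p13 \<union>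
                 closed_segment p13 p12 \<union> closed_segment p21 p23 \<union> closed_segment p32 p31
         in \<Delta> = P \<union> inside P))"

text \<open>\<open>T\<^sub>1(k1, k2, k3)\<close>. As the arrangement is only cyclically ordered, \<open>T\<^sub>2\<close> and \<open>T\<^sub>3\<close> are
  \<open>arc_curvature k2 k3 k1\<close> and \<open>arc_curvature k3 k1 k2\<close>.\<close>

definition arc_curvature :: "real \<Rightarrow> real \<Rightarrow> real \<Rightarrow> real" where
  "arc_curvature k1 k2 k3 = (if k1 = 0 then 0 else
     (THE T. \<exists>c1 c2 c3 t12 t23 t31 \<Delta> g.
        curv c1 = k1 \<and> curv c2 = k2 \<and> curv c3 = k3 \<and>
        tangent_triple c1 c2 c3 t12 t23 t31 \<and>
        circle_packed_triangle c1 c2 c3 t12 t23 t31 \<Delta> \<and>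
        valid_path g \<and> arc g \<and> pathstart g = t12 \<and> pathfinish g = t31 \<and>
        path_image g \<subseteq> curve c1 \<inter> \<Delta> \<and>
        T = k1 * hyp_length g))"


section \<open>Triangulated surfaces\<close>

definition closed_surface :: "'s topology \<Rightarrow> bool" where
  "closed_surface S \<longleftrightarrow> compact_space S \<and> Hausdorff_space S \<and> topspace S \<noteq> {} \<and>
     (\<forall>p\<in>topspace S. \<exists>U. openin S U \<and> p \<in> U \<and>
        subtopology S U homeomorphic_space (euclidean :: (real^2) topology))"

text \<open>The vertex set \<open>V\<close> is a finite type, and every triangle is given by one ordered triple \<open>(u, v, w)\<close>
  of its vertices, of which only the cyclic order matters.\<close>

type_synonym 'v face = "'v \<times> 'v \<times> 'v"

fun verts :: "'v face \<Rightarrow> 'v set" where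
  "verts (u, v, w) = {u, v, w}"

fun directed_edges :: "'v face \<Rightarrow> ('v \<times> 'v) set" where
  "directed_edges (u, v, w) = {(u, v), (v, w), (w, u)}"

definition face_simplex :: "'v::finite face \<Rightarrow> (real^'v) set" where
  "face_simplex f = {x. (\<forall>v. 0 \<le> x $ v) \<and> (\<Sum>v\<in>UNIV. x $ v) = 1 \<and> {v. x $ v \<noteq> 0} \<subseteq> verts f}"

text \<open>\<open>S\<close> is the union of closed triangles, parametrized by barycentric coordinates. The
  triangles are embedded, have disjoint interiors, and meet along edges and vertices. Different
  vertices are different points of \<open>S\<close>, and sides with the same end points coincide, so the graph
  formed by the vertices and edges is simple. Two triangles with the same three vertices are not
  excluded; this occurs only for the sphere made of two triangles.\<close>

definition simple_triangulation :: "'s topology \<Rightarrow> 'v::finite face set \<Rightarrow> bool" where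
  "simple_triangulation S F \<longleftrightarrow>
     (\<forall>f\<in>F. card (verts f) = 3) \<and> (\<Union>f\<in>F. verts f) = UNIV \<and>
     (\<exists>\<phi>.
        (\<forall>f\<in>F. continuous_map (top_of_set (face_simplex f)) S (\<phi> f)) \<and>
        (\<Union>f\<in>F. \<phi> f ` face_simplex f) = topspace S \<and>
        (\<forall>f\<in>F. \<forall>g\<in>F. \<forall>x\<in>face_simplex f. \<forall>y\<in>face_simplex g.
           \<phi> f x = \<phi> g y \<longleftrightarrow> x = y \<and> (f = g \<or> card {v. x $ v \<noteq> 0} \<le> 2)))"

text \<open>An orientation of a triangulated surface is given by orienting its triangles so that no two
  of them induce the same direction on a common edge. In particular \<open>F\<close> contains each oriented
  triangle only once, not together with its cyclic rotations.\<close>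

definition coherently_oriented :: "'v face set \<Rightarrow> bool" where
  "coherently_oriented F \<longleftrightarrow>
     (\<forall>f\<in>F. \<forall>g\<in>F. f \<noteq> g \<longrightarrow> directed_edges f \<inter> directed_edges g = {})"


section \<open>Total geodesic curvatures and the flow\<close>

fun face_curvature :: "real^'v::finite \<Rightarrow> 'v face \<Rightarrow> 'v \<Rightarrow> real" where
  "face_curvature k (a, b, c) v =
     (if v = a then arc_curvature (k $ a) (k $ b) (k $ c)
      else if v = b then arc_curvature (k $ b) (k $ c) (k $ a)
      else if v = c then arc_curvature (k $ c) (k $ a) (k $ b)
      else 0)"

text \<open>The map \<open>\<Phi>\<close>, and on \<open>\<Omega>k_closed\<close> the map \<open>\<Phi>\<close> with a hat.\<close>

definition total_curvature :: "'v::finite face set \<Rightarrow> real^'v \<Rightarrow> real^'v" where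
  "total_curvature F k = (\<chi> v. \<Sum>f | f \<in> F \<and> v \<in> verts f. face_curvature k f v)"

definition \<Omega>k :: "(real^'v::finite) set" where
  "\<Omega>k = {k. \<forall>v. k $ v > 0}"

definition \<Omega>k_closed :: "(real^'v::finite) set" where
  "\<Omega>k_closed = {k. \<forall>v. k $ v \<ge> 0}"

definition \<Omega>k_boundary :: "(real^'v::finite) set" where
  "\<Omega>k_boundary = \<Omega>k_closed - \<Omega>k"

definition \<eta> :: "'v::finite face set \<Rightarrow> 'v set \<Rightarrow> real^'v \<Rightarrow> real" where
  "\<eta> F I T = pi * real (card {f \<in> F. verts f \<inter> I \<noteq> {}}) - (\<Sum>i\<in>I. T $ i)"

definition \<Omega>T :: "'v::finite face set \<Rightarrow> (real^'v) set" where
  "\<Omega>T F = {T. (\<forall>v. T $ v > 0) \<and> (\<forall>I. I \<noteq> {} \<longrightarrow> \<eta> F I T > 0)}"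

definition \<Omega>T_hat :: "'v::finite face set \<Rightarrow> (real^'v) set" where
  "\<Omega>T_hat F = {T. (\<forall>v. T $ v \<ge> 0) \<and> (\<forall>I. I \<noteq> {} \<longrightarrow> \<eta> F I T > 0)}"

definition \<Omega>T_boundary0 :: "'v::finite face set \<Rightarrow> (real^'v) set" where
  "\<Omega>T_boundary0 F = \<Omega>T_hat F - \<Omega>T F"

definition flow_ray ::
  "'v::finite face set \<Rightarrow> real^'v \<Rightarrow> real^'v \<Rightarrow> (real \<Rightarrow> real^'v) \<Rightarrow> bool" where
  "flow_ray F T k0 k \<longleftrightarrow>
     k 0 = k0 \<and> (\<forall>t\<ge>0. k t \<in> \<Omega>k) \<and>
     (\<forall>t\<ge>0. (k has_vector_derivative
        (\<chi> v. - (total_curvature F (k t) $ v - T $ v) * k t $ v)) (at t within {0..}))"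

end

theory Submission
  imports Defs
begin

text \<open>In the Klein model a generalized circle of curvature \<open>k\<close> is the zero set of
  \<open>x \<mapsto> \<langle>P, x\<rangle> + k\<close> on the hyperboloid for a vector \<open>P\<close> of Minkowski space with
  \<open>\<langle>P, P\<rangle> = 1 - k\<^sup>2\<close>. Two generalized circles are externally tangent iff
  \<open>\<langle>P\<^sub>1, P\<^sub>2\<rangle> = - 1 - k\<^sub>1 k\<^sub>2\<close>, and the tangency point is then spanned by \<open>P\<^sub>1 + P\<^sub>2\<close>.
  Parametrizing the arc rationally gives its curvature
  \<open>2 k\<^sub>1 \<integral> du / (1 + (k\<^sub>1\<^sup>2 - 1) u\<^sup>2)\<close> over \<open>0 \<le> u \<le> 1 / sqrt (1 + k\<^sub>1 k\<^sub>2 + k\<^sub>2 k\<^sub>3 + k\<^sub>3 k\<^sub>1)\<close>.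

  Hence the total curvature at a vertex decreases in the curvatures of the other vertices and
  increases when all curvatures are scaled up. The prescribed curvature problem is therefore solved
  by the largest subsolution, which exists because the curvatures of the subsolutions stay bounded
  as long as \<open>T\<close> satisfies the strict inequalities, and solutions are unique by scaling. In logarithmic
  coordinates the flow satisfies a maximum principle: multiples of the solution for a slightly
  larger \<open>T\<close> bound it from above, and on the vertices with \<open>T\<^sub>v > 0\<close> multiples of the solution bound it
  from below, so it converges to the solution.\<close>

section \<open>The Minkowski form\<close>

text \<open>The value of \<open>arc_curvature\<close> is a definite description over all
  configurations, all triangles and all parametrizations of the arc. A formula for it needs one
  configuration that realizes the value and a computation that every configuration obeys. Vectors
  serve both purposes, since all configurations share one Gram matrix and the length depends on
  nothing else. The filled polygon enters only through two inclusions: it lies in the cone spanned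
  by the three vectors, and it contains the part of this cone that the axes cut off.

  For the flow the obstacle is that some entries of \<open>T\<close> vanish. The limit then has zero
  coordinates, so its logarithm does not exist and no multiple of it dominates a positive vector;
  this is why the upper barrier uses a slightly larger \<open>T\<close>. Only vanishing entries are
  raised, which makes the barrier positive, and monotone dependence on the increase together with
  uniqueness brings it back to the limit. The logarithm also settles existence for all times: in it
  the vector field is bounded and globally Lipschitz.\<close>

type_synonym mvec = "complex \<times> real"

definition mink :: "mvec \<Rightarrow> mvec \<Rightarrow> real" where
  "mink P Q = fst P \<bullet> fst Q - snd P * snd Q"

text \<open>The chart at height 1, not the unit hyperboloid: affine combinations in the disk become
  linear ones in Minkowski space. The normalizing factor is kept apart in \<open>lor\<close>, so
  that \<open>lift x\<close> divided by \<open>lor x\<close> is the hyperboloid point of x.\<close>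

definition lift :: "complex \<Rightarrow> mvec" where
  "lift x = (x, 1)"

definition proj :: "mvec \<Rightarrow> complex" where
  "proj X = fst X /\<^sub>R snd X"

definition lor :: "complex \<Rightarrow> real" where
  "lor x = sqrt (1 - x \<bullet> x)"

text \<open>The Euclidean cross product with its last entry negated. The sign makes it orthogonal to
  both arguments for \<open>mink\<close> and turns \<open>det3\<close> into the ordinary determinant
  of three vectors.\<close>

definition lcross :: "mvec \<Rightarrow> mvec \<Rightarrow> mvec" where
  "lcross P Q = (Complex (Im (fst P) * snd Q - snd P * Im (fst Q)) (snd P * Re (fst Q) - Re (fst P) * snd Q),
     Im (fst P) * Re (fst Q) - Re (fst P) * Im (fst Q))"

definition det3 :: "mvec \<Rightarrow> mvec \<Rightarrow> mvec \<Rightarrow> real" where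
  "det3 P Q R = mink (lcross P Q) R"

lemmas mvec_simps = mink_def lcross_def det3_def inner_complex_def

lemma mink_commute: "mink P Q = mink Q P"
  by (simp add: mink_def inner_commute mult.commute)

lemma mink_add_left: "mink (P + Q) R = mink P R + mink Q R"
  and mink_diff_left: "mink (P - Q) R = mink P R - mink Q R"
  and mink_scale_left: "mink (a *\<^sub>R P) R = a * mink P R"
  and mink_minus_left: "mink (- P) R = - mink P R"
  and mink_add_right: "mink R (P + Q) = mink R P + mink R Q"
  and mink_diff_right: "mink R (P - Q) = mink R P - mink R Q"
  and mink_scale_right: "mink R (a *\<^sub>R P) = a * mink R P"
  and mink_minus_right: "mink R (- P) = - mink R P"
  by (simp_all add: mink_def inner_add_left inner_add_right inner_diff_left inner_diff_right algebra_simps)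

lemmas mink_linear = mink_add_left mink_diff_left mink_scale_left mink_minus_left
  mink_add_right mink_diff_right mink_scale_right mink_minus_right

lemma mink_zero [simp]: "mink 0 Q = 0" "mink P 0 = 0"
  by (simp_all add: mink_def)

lemma mvec_eqI: "Re (fst P) = Re (fst Q) \<Longrightarrow> Im (fst P) = Im (fst Q) \<Longrightarrow> snd P = snd Q \<Longrightarrow> P = (Q::mvec)"
  by (simp add: prod_eq_iff complex_eq_iff)

lemma det3_eq: "det3 P Q P = 0" "det3 P P Q = 0" "det3 Q P P = 0"
  by (simp_all add: mvec_simps algebra_simps)

lemma mink_lcross_self [simp]:
  "mink (lcross P Q) P = 0" "mink (lcross P Q) Q = 0" "mink P (lcross P Q) = 0" "mink Q (lcross P Q) = 0"
  by (simp_all add: mvec_simps algebra_simps)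

text \<open>The Binet-Cauchy identity, with its sign reversed by the Lorentzian signature.\<close>

lemma mink_lcross_lcross:
  "mink (lcross P Q) (lcross R S) = mink P S * mink Q R - mink P R * mink Q S"
  by (simp add: mvec_simps algebra_simps)

text \<open>Cramer's rule, cleared of denominators.\<close>

lemma expand_coords:
  "det3 A B C *\<^sub>R Z = det3 Z B C *\<^sub>R A + det3 A Z C *\<^sub>R B + det3 A B Z *\<^sub>R C"
  by (rule mvec_eqI) (simp_all add: mvec_simps algebra_simps)

text \<open>Up to the factor \<open>det3 A B C\<close>, the cross products of pairs form the dual
  basis of A, B, C.\<close>

lemma expand_dual:
  "det3 A B C *\<^sub>R Z = mink Z A *\<^sub>R lcross B C + mink Z B *\<^sub>R lcross C A + mink Z C *\<^sub>R lcross A B"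
  by (rule mvec_eqI) (simp_all add: mvec_simps algebra_simps)

text \<open>The form has determinant -1, so the Gram determinant is minus the square of the
  determinant. Its sign is what yields the lower bound for the distance to a geodesic.\<close>

lemma gram_det:
  "(det3 A B C)\<^sup>2 = - (mink A A * (mink B B * mink C C - mink B C * mink B C)
     - mink A B * (mink A B * mink C C - mink B C * mink A C)
     + mink A C * (mink A B * mink B C - mink B B * mink A C))"
  by (simp add: mvec_simps power2_eq_square algebra_simps)

lemma mink_eq_0_basis:
  assumes "det3 A B C \<noteq> 0" "mink Z A = 0" "mink Z B = 0" "mink Z C = 0"
  shows "Z = 0"
  using expand_dual[of A B C Z] assms by simp

section \<open>Points of the disk\<close>

lemma lift_simps [simp]: "fst (lift x) = x" "snd (lift x) = 1"
  by (simp_all add: lift_def)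

lemma proj_lift [simp]: "proj (lift x) = x"
  by (simp add: proj_def)

lemma lift_proj: "snd X \<noteq> 0 \<Longrightarrow> lift (proj X) = X /\<^sub>R snd X"
  by (simp add: prod_eq_iff proj_def lift_def)

lemma proj_scale: "a \<noteq> 0 \<Longrightarrow> proj (a *\<^sub>R X) = proj X"
  by (simp add: proj_def)

lemma lift_affine: "u + v = 1 \<Longrightarrow> lift (u *\<^sub>R x + v *\<^sub>R y) = u *\<^sub>R lift x + v *\<^sub>R lift y"
  by (simp add: lift_def prod_eq_iff)

lemma hyp_plane_iff: "x \<in> hyp_plane \<longleftrightarrow> x \<bullet> x < 1"
  using abs_square_less_1[of "norm x"] by (simp add: hyp_plane_def dot_square_norm)

lemma ideal_boundary_iff: "x \<in> ideal_boundary \<longleftrightarrow> x \<bullet> x = 1"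
  by (simp add: ideal_boundary_def dot_square_norm power2_eq_1_iff) (use norm_ge_zero[of x] in linarith)

lemma open_hyp_plane: "open hyp_plane"
  by (simp add: hyp_plane_def)

lemma mink_lift: "mink (lift x) (lift y) = x \<bullet> y - 1"
  by (simp add: mink_def)

lemma lor_pos: "x \<in> hyp_plane \<Longrightarrow> lor x > 0"
  by (simp add: lor_def hyp_plane_iff)

lemma lor_square: "x \<bullet> x \<le> 1 \<Longrightarrow> (lor x)\<^sup>2 = - mink (lift x) (lift x)"
  by (simp add: lor_def mink_lift)

lemma hyp_plane_square: "x \<in> hyp_plane \<Longrightarrow> (lor x)\<^sup>2 = - mink (lift x) (lift x)"
  by (intro lor_square) (simp add: hyp_plane_iff)

lemma mink_lift_self: "x \<in> hyp_plane \<Longrightarrow> mink (lift x) (lift x) = - (lor x)\<^sup>2"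
  by (simp add: hyp_plane_square)

definition future :: "mvec \<Rightarrow> bool" where
  "future X \<longleftrightarrow> snd X > 0 \<and> mink X X \<le> 0"

lemma future_lift: "x \<bullet> x \<le> 1 \<Longrightarrow> future (lift x)"
  by (simp add: future_def mink_lift)

lemma future_norm: "future X \<longleftrightarrow> snd X > 0 \<and> norm (fst X) \<le> snd X"
proof -
  have "snd X > 0 \<Longrightarrow> (norm (fst X))\<^sup>2 \<le> (snd X)\<^sup>2 \<longleftrightarrow> norm (fst X) \<le> snd X"
    using abs_le_square_iff[of "norm (fst X)" "snd X"] by simp
  then show ?thesis
    by (auto simp: future_def mink_def dot_square_norm power2_eq_square)
qed

lemma mink_timelike_norm: "snd X > 0 \<Longrightarrow> mink X X < 0 \<longleftrightarrow> norm (fst X) < snd X"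
proof -
  assume s: "snd X > 0"
  have "(norm (fst X))\<^sup>2 < (snd X)\<^sup>2 \<longleftrightarrow> norm (fst X) < snd X"
    using s abs_square_less_1 power2_less_imp_less[of "norm (fst X)" "snd X"]
      power_strict_mono[of "norm (fst X)" "snd X" 2] by auto
  then show ?thesis
    by (auto simp: mink_def dot_square_norm power2_eq_square)
qed

lemma mink_future_neg:
  assumes "future X" "future Y" "mink X X < 0"
  shows "mink X Y < 0"
proof -
  have "fst X \<bullet> fst Y \<le> norm (fst X) * norm (fst Y)"
    by (rule norm_cauchy_schwarz)
  also have "\<dots> \<le> norm (fst X) * snd Y"
    using assms by (intro mult_left_mono) (auto simp: future_norm)
  also have "\<dots> < snd X * snd Y"
    using assms mink_timelike_norm[of X] by (intro mult_strict_right_mono) (auto simp: future_norm)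
  finally show ?thesis by (simp add: mink_def)
qed

text \<open>The standard way below to see that a constructed vector has positive last coordinate: a
  causal vector lies in the same half of the light cone as a future vector once their product is
  negative.\<close>

lemma future_of_mink_neg:
  assumes "future X" "mink Y Y \<le> 0" "mink X Y < 0"
  shows "future Y"
proof -
  have "snd Y > 0"
  proof (rule ccontr)
    assume "\<not> snd Y > 0"
    then have s: "- snd Y \<ge> 0" by simp
    have "(norm (fst Y))\<^sup>2 \<le> (- snd Y)\<^sup>2"
      using assms(2) by (simp add: mink_def dot_square_norm power2_eq_square)
    then have n: "norm (fst Y) \<le> - snd Y"
      using s by (rule power2_le_imp_le)
    have "- (fst X \<bullet> fst Y) \<le> norm (fst X) * norm (fst Y)"
      using Cauchy_Schwarz_ineq2[of "fst X" "fst Y"] by linarith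
    also have "\<dots> \<le> snd X * (- snd Y)"
      using assms(1) n by (intro mult_mono) (auto simp: future_norm)
    finally show False using assms(3) by (simp add: mink_def)
  qed
  then show ?thesis using assms(2) by (simp add: future_def)
qed

lemma proj_in_hyp_plane:
  assumes "snd X > 0" "mink X X < 0"
  shows "proj X \<in> hyp_plane"
  using assms by (simp add: hyp_plane_def proj_def mink_timelike_norm field_simps)

text \<open>The reversed Cauchy-Schwarz inequality with its equality case. The defect is |x - y|^2
  minus the Gram determinant of x and y. That determinant equals the one of x and x - y, so it is at
  most |x|^2 |x - y|^2, and a multiple of |x - y|^2 with the positive factor 1 - |x|^2 is left
  over.\<close>

lemma timelike_gap: 
  assumes "x \<in> hyp_plane" "y \<in> hyp_plane" 
  shows "lor x * lor y \<le> - mink (lift x) (lift y)" 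
    "lor x * lor y = - mink (lift x) (lift y) \<Longrightarrow> x = y"
proof -
  have xx: "x \<bullet> x < 1" "y \<bullet> y < 1" using assms by (auto simp: hyp_plane_iff)
  have m: "mink (lift x) (lift y) < 0"
    by (rule mink_future_neg[OF future_lift future_lift]) (use xx in \<open>auto simp: mink_lift\<close>)
  have l: "(lor x * lor y)\<^sup>2 = (1 - x \<bullet> x) * (1 - y \<bullet> y)"
    using xx by (simp add: power_mult_distrib lor_def)
  have e: "(mink (lift x) (lift y))\<^sup>2 - (lor x * lor y)\<^sup>2 = (x - y) \<bullet> (x - y) - ((x \<bullet> x) * (y \<bullet> y) - (x \<bullet> y)\<^sup>2)"
    unfolding l by (simp add: mink_lift inner_diff_left inner_diff_right inner_commute power2_eq_square algebra_simps)
  have e2: "(x \<bullet> x) * (y \<bullet> y) - (x \<bullet> y)\<^sup>2 \<le> (x \<bullet> x) * ((x - y) \<bullet> (x - y))"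
    using zero_le_power2[of "x \<bullet> (x - y)"] by (simp add: inner_diff_left inner_diff_right inner_commute power2_eq_square algebra_simps)
  have e3: "(1 - x \<bullet> x) * ((x - y) \<bullet> (x - y)) \<le> (mink (lift x) (lift y))\<^sup>2 - (lor x * lor y)\<^sup>2"
    using e e2 by (simp add: algebra_simps)
  have pos: "0 \<le> (1 - x \<bullet> x) * ((x - y) \<bullet> (x - y))" using xx by simp
  have "(lor x * lor y)\<^sup>2 \<le> (- mink (lift x) (lift y))\<^sup>2" using e3 pos by simp
  then show "lor x * lor y \<le> - mink (lift x) (lift y)"
    by (rule power2_le_imp_le) (use m in simp)
  show "x = y" if "lor x * lor y = - mink (lift x) (lift y)"
  proof -
    have "(1 - x \<bullet> x) * ((x - y) \<bullet> (x - y)) \<le> 0" using e3 that by simp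
    then have "(x - y) \<bullet> (x - y) \<le> 0" using xx by (simp add: mult_le_0_iff)
    then have "x - y = 0" by (metis inner_eq_zero_iff inner_ge_zero order_antisym)
    then show ?thesis by simp
  qed
qed

lemma complex_parallel:
  assumes "Re v * Im w = Im v * Re w" "w \<noteq> 0"
  obtains u where "v = u *\<^sub>R w"
proof (cases "Re w = 0")
  case True
  then have "Im w \<noteq> 0" using assms(2) by (simp add: complex_eq_iff)
  then show ?thesis
    using assms(1) by (intro that[of "Im v / Im w"]) (simp add: complex_eq_iff field_simps)
next
  case False
  then show ?thesis
    using assms(1) by (intro that[of "Re v / Re w"]) (simp add: complex_eq_iff field_simps)
qed

lemma lor_proj:
  assumes "snd X > 0" "mink X X \<le> 0"
  shows "lor (proj X) = sqrt (- mink X X) / snd X"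
proof -
  have "1 - proj X \<bullet> proj X = - mink X X / (snd X)\<^sup>2"
    using assms(1) by (simp add: proj_def mink_def field_simps power2_eq_square)
  then have "lor (proj X) = sqrt (- mink X X / (snd X)\<^sup>2)"
    unfolding lor_def by (rule arg_cong)
  then show ?thesis
    using assms(1) unfolding real_sqrt_divide by simp
qed

lemma mink_lift_proj: "mink P (lift (proj X)) = mink P X / snd X" if "snd X \<noteq> 0"
  using that by (simp add: lift_proj mink_scale_right field_simps)

lemma continuous_on_lor [continuous_intros]:
  "continuous_on A f \<Longrightarrow> continuous_on A (\<lambda>x. lor (f x))"
  unfolding lor_def by (intro continuous_intros)

lemma continuous_on_mink_lift [continuous_intros]:
  "continuous_on A f \<Longrightarrow> continuous_on A (\<lambda>x. mink P (lift (f x)))"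
  unfolding mink_def lift_simps by (intro continuous_intros)

text \<open>The reversed triangle inequality for the Lorentzian length; the mixed term is the
  reversed Cauchy-Schwarz inequality.\<close>

lemma lor_concave:
  assumes "x \<in> hyp_plane" "y \<in> hyp_plane" "u \<ge> 0" "v \<ge> 0" "u + v = 1"
  shows "u * lor x + v * lor y \<le> lor (u *\<^sub>R x + v *\<^sub>R y)"
proof -
  have m: "u *\<^sub>R x + v *\<^sub>R y \<in> hyp_plane"
    using assms convex_ball[of "0::complex" 1] unfolding hyp_plane_def convex_def by blast
  have "(u * lor x + v * lor y)\<^sup>2 = u\<^sup>2 * (lor x)\<^sup>2 + v\<^sup>2 * (lor y)\<^sup>2 + 2 * (u * v) * (lor x * lor y)"
    by (simp add: power2_eq_square algebra_simps)
  also have "\<dots> \<le> u\<^sup>2 * (lor x)\<^sup>2 + v\<^sup>2 * (lor y)\<^sup>2 + 2 * (u * v) * (- mink (lift x) (lift y))"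
    using timelike_gap(1)[OF assms(1,2)] assms(3,4) by (intro add_left_mono mult_left_mono) auto
  also have "\<dots> = - mink (lift (u *\<^sub>R x + v *\<^sub>R y)) (lift (u *\<^sub>R x + v *\<^sub>R y))"
    using assms(1,2) unfolding lift_affine[OF assms(5)]
    by (simp add: mink_lift_self mink_linear mink_commute[of "lift y" "lift x"] power2_eq_square algebra_simps)
  also have "\<dots> = (lor (u *\<^sub>R x + v *\<^sub>R y))\<^sup>2"
    using m by (simp add: hyp_plane_square)
  finally show ?thesis
    by (rule power2_le_imp_le) (use lor_pos[OF m] in simp)
qed

section \<open>Generalized circles as vectors\<close>

text \<open>The defining function on the hyperboloid, transported to the chart and multiplied by
  \<open>lor x\<close>. The factor is positive in the disk, so signs are unchanged, and for k \<ge>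
  0 the product is concave in the Euclidean sense.\<close>

definition gfun :: "mvec \<Rightarrow> real \<Rightarrow> complex \<Rightarrow> real" where
  "gfun P k x = mink P (lift x) + k * lor x"

lemma continuous_on_gfun [continuous_intros]:
  "continuous_on A f \<Longrightarrow> continuous_on A (\<lambda>x. gfun P k (f x))"
  unfolding gfun_def by (intro continuous_intros)

lemma gfun_concave:
  assumes "x \<in> hyp_plane" "y \<in> hyp_plane" "u \<ge> 0" "v \<ge> 0" "u + v = 1" "k \<ge> 0"
  shows "u * gfun P k x + v * gfun P k y \<le> gfun P k (u *\<^sub>R x + v *\<^sub>R y)"
proof -
  have "k * (u * lor x + v * lor y) \<le> k * lor (u *\<^sub>R x + v *\<^sub>R y)"
    using lor_concave[OF assms(1-5)] assms(6) by (rule mult_left_mono)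
  then show ?thesis
    using assms(5) by (simp add: gfun_def lift_affine mink_linear algebra_simps)
qed

lemma convex_gfun_pos:
  assumes "k \<ge> 0"
  shows "convex {x \<in> hyp_plane. gfun P k x > 0}"
  unfolding convex_def
proof (intro ballI allI impI)
  fix x y u v
  assume *: "x \<in> {x \<in> hyp_plane. gfun P k x > 0}" "y \<in> {x \<in> hyp_plane. gfun P k x > 0}"
    "0 \<le> (u::real)" "0 \<le> v" "u + v = 1"
  have m: "u *\<^sub>R x + v *\<^sub>R y \<in> hyp_plane"
    using * convex_ball[of "0::complex" 1] unfolding hyp_plane_def convex_def by blast
  have "0 < u * gfun P k x + v * gfun P k y"
  proof (cases "u = 0")
    case False
    then have "0 < u * gfun P k x" using * by simp
    moreover have "0 \<le> v * gfun P k y" using * by simp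
    ultimately show ?thesis by simp
  qed (use * in auto)
  also have "\<dots> \<le> gfun P k (u *\<^sub>R x + v *\<^sub>R y)"
    using * assms by (intro gfun_concave) auto
  finally show "u *\<^sub>R x + v *\<^sub>R y \<in> {x \<in> hyp_plane. gfun P k x > 0}"
    using m by simp
qed

lemma open_gfun_pos: "open {x \<in> hyp_plane. gfun P k x > 0}"
  and open_gfun_neg: "open {x \<in> hyp_plane. gfun P k x < 0}"
proof -
  have c: "continuous_on hyp_plane (gfun P k)"
    by (intro continuous_intros)
  have "hyp_plane \<inter> gfun P k -` {0<..} = {x \<in> hyp_plane. gfun P k x > 0}"
    "hyp_plane \<inter> gfun P k -` {..<0} = {x \<in> hyp_plane. gfun P k x < 0}" by auto
  then show "open {x \<in> hyp_plane. gfun P k x > 0}" "open {x \<in> hyp_plane. gfun P k x < 0}"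
    using continuous_open_preimage[OF c open_hyp_plane, of "{0<..}"]
      continuous_open_preimage[OF c open_hyp_plane, of "{..<0}"] by auto
qed

text \<open>A larger connected subset of S would be split by the open sets U and W.\<close>

lemma component_of_split:
  assumes "connected A" "A \<noteq> {}" "A = S \<inter> U" "S - A \<subseteq> W" "open U" "open W" "U \<inter> W \<inter> S = {}"
  shows "A \<in> components S"
proof -
  obtain a where a: "a \<in> A" using assms(2) by blast
  have "connected_component_set S a = A"
  proof
    show "A \<subseteq> connected_component_set S a"
      using assms a by (intro connected_component_maximal) auto
    show "connected_component_set S a \<subseteq> A"
    proof (rule ccontr)
      let ?C = "connected_component_set S a"
      assume "\<not> ?C \<subseteq> A"
      moreover have "?C \<subseteq> S" by (rule connected_component_subset)
      moreover have "a \<in> ?C" using a assms(3) by auto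
      moreover have "connected ?C" by simp
      ultimately show False
        using connectedD[of ?C U W] assms a by blast
    qed
  qed
  then show ?thesis
    using a assms(3) unfolding components_def by blast
qed

lemma components_eqI:
  assumes "C \<in> components S" "D \<in> components S" "x \<in> C" "x \<in> D"
  shows "C = D"
  using components_eq[OF assms(1,2)] assms(3,4) by blast

section \<open>Axes and the distance to them\<close>

definition hyp_axis :: "mvec \<Rightarrow> complex set" where
  "hyp_axis P = {x \<in> hyp_plane. mink P (lift x) = 0}"

lemma fst_spacelike: "mink P P > 0 \<Longrightarrow> fst P \<noteq> 0"
  by (auto simp: mink_def)

lemma axis_nonempty:
  assumes "mink P P > 0"
  obtains y where "y \<in> hyp_axis P"
proof -
  have n: "fst P \<bullet> fst P > 0" using fst_spacelike[OF assms] by simp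
  define y where "y = (snd P / (fst P \<bullet> fst P)) *\<^sub>R fst P"
  have "y \<bullet> y = (snd P)\<^sup>2 / (fst P \<bullet> fst P)"
    using n by (simp add: y_def power2_eq_square field_simps)
  also have "\<dots> < 1" using n assms by (simp add: mink_def power2_eq_square)
  finally have "y \<in> hyp_axis P"
    using n by (simp add: hyp_axis_def hyp_plane_iff mink_def y_def)
  then show ?thesis ..
qed

lemma axis_scale: "a \<noteq> 0 \<Longrightarrow> hyp_axis (a *\<^sub>R P) = hyp_axis P"
  by (simp add: hyp_axis_def mink_linear)

lemma convex_axis: "convex (hyp_axis P)"
  unfolding convex_def
proof (intro ballI allI impI)
  fix x y u v assume *: "x \<in> hyp_axis P" "y \<in> hyp_axis P" "0 \<le> (u::real)" "0 \<le> v" "u + v = 1"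
  have "u *\<^sub>R x + v *\<^sub>R y \<in> hyp_plane"
    using * convex_ball[of "0::complex" 1] unfolding hyp_plane_def convex_def hyp_axis_def by blast
  then show "u *\<^sub>R x + v *\<^sub>R y \<in> hyp_axis P"
    using * by (simp add: hyp_axis_def lift_affine mink_linear)
qed

text \<open>Along the line through a and b the quantity 1 - |x|^2 equals 2 u (1 - u) (1 - a
  \<bullet> b), so lying in the disk is the same as 0 < u < 1.\<close>

lemma open_segment_axis:
  assumes "a \<bullet> a = 1" "b \<bullet> b = 1" "a \<noteq> b" "fst N \<noteq> 0" "mink N (lift a) = 0" "mink N (lift b) = 0"
  shows "open_segment a b = hyp_axis N"
proof
  have ab: "a \<bullet> b < 1"
  proof -
    have "0 < (a - b) \<bullet> (a - b)" using assms(3) by simp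
    then show ?thesis
      using assms(1,2) by (simp add: inner_diff_left inner_diff_right inner_commute[of b a])
  qed
  have sq: "((1 - u) *\<^sub>R a + u *\<^sub>R b) \<bullet> ((1 - u) *\<^sub>R a + u *\<^sub>R b) = 1 - 2 * (u * (1 - u)) * (1 - a \<bullet> b)" for u :: real
    using assms(1,2) by (simp add: inner_add_left inner_add_right inner_commute[of b a] algebra_simps)
  show "open_segment a b \<subseteq> hyp_axis N"
  proof
    fix x assume "x \<in> open_segment a b"
    then obtain u where u: "0 < u" "u < 1" and x: "x = (1 - u) *\<^sub>R a + u *\<^sub>R b"
      by (auto simp: in_segment)
    have "0 < 2 * (u * (1 - u)) * (1 - a \<bullet> b)" using u ab by simp
    moreover have "mink N (lift x) = 0"
      using assms(5,6) unfolding x by (simp add: lift_affine mink_linear)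
    ultimately show "x \<in> hyp_axis N"
      unfolding hyp_axis_def hyp_plane_iff using sq[of u] unfolding x by simp
  qed
  show "hyp_axis N \<subseteq> open_segment a b"
  proof
    fix x assume x: "x \<in> hyp_axis N"
    have p: "fst N \<bullet> (b - a) = 0" "fst N \<bullet> (x - a) = 0"
      using x assms(5,6) by (auto simp: hyp_axis_def mink_def inner_diff_right)
    obtain u where u: "x - a = u *\<^sub>R (b - a)"
    proof -
      have *: "Re (fst N) * Re (b - a) = - (Im (fst N) * Im (b - a))"
        "Re (fst N) * Re (x - a) = - (Im (fst N) * Im (x - a))"
        using p unfolding inner_complex_def by linarith+
      have "Re (x - a) * Im (b - a) = Im (x - a) * Re (b - a)"
      proof (cases "Re (fst N) = 0")
        case True
        then have "Im (fst N) \<noteq> 0" using assms(4) by (simp add: complex_eq_iff)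
        then show ?thesis using * True by simp
      next
        case False
        have "Re (fst N) * (Re (x - a) * Im (b - a) - Im (x - a) * Re (b - a)) = 0"
          using * by algebra
        then show ?thesis using False by simp
      qed
      then show ?thesis
        using complex_parallel[of "x - a" "b - a"] assms(3) that by auto
    qed
    then have xu: "x = (1 - u) *\<^sub>R a + u *\<^sub>R b" by (simp add: algebra_simps)
    have "x \<bullet> x < 1" using x by (simp add: hyp_axis_def hyp_plane_iff)
    then have "0 < 2 * (u * (1 - u)) * (1 - a \<bullet> b)" using sq[of u] unfolding xu by simp
    then have "0 < u * (1 - u)" using ab by (simp add: zero_less_mult_iff)
    then have "0 < u" "u < 1" by (auto simp: zero_less_mult_iff)
    then show "x \<in> open_segment a b"
      using xu assms(3) by (auto simp: in_segment)
  qed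
qed

text \<open>The normal of a chord is the cross product of its lifted end points. Conversely the end
  points are found where the line with normal N meets the unit circle.\<close>

lemma complete_geodesic_iff:
  "complete_geodesic A \<longleftrightarrow> (\<exists>N. mink N N = 1 \<and> A = hyp_axis N)"
proof
  assume "complete_geodesic A"
  then obtain a b where ab: "a \<bullet> a = 1" "b \<bullet> b = 1" "a \<noteq> b" and A: "A = open_segment a b"
    by (auto simp: complete_geodesic_def ideal_boundary_iff)
  define M :: mvec where "M = lcross (lift a) (lift b)"
  have "mink M M = (1 - a \<bullet> b)\<^sup>2"
    using ab by (simp add: M_def mink_lcross_lcross mink_lift inner_commute power2_eq_square algebra_simps)
  moreover have "a \<bullet> b < 1"
  proof -
    have "0 < (a - b) \<bullet> (a - b)" using ab(3) by simp
    then show ?thesis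
      using ab(1,2) by (simp add: inner_diff_left inner_diff_right inner_commute[of b a])
  qed
  ultimately have MM: "mink M M > 0" by simp
  define N where "N = (1 / sqrt (mink M M)) *\<^sub>R M"
  have "mink N N = 1" using MM by (simp add: N_def mink_linear)
  moreover have "A = hyp_axis N" unfolding A
    using ab MM by (intro open_segment_axis fst_spacelike) (auto simp: N_def mink_linear M_def)
  ultimately show "\<exists>N. mink N N = 1 \<and> A = hyp_axis N" by blast
next
  assume "\<exists>N. mink N N = 1 \<and> A = hyp_axis N"
  then obtain N where N: "mink N N = 1" and A: "A = hyp_axis N" by blast
  have f: "fst N \<noteq> 0" using N by (intro fst_spacelike) auto
  define m where "m = fst N \<bullet> fst N"
  have m: "m > 0" "m = 1 + (snd N)\<^sup>2" using f N by (auto simp: m_def mink_def power2_eq_square)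
  \<comment> \<open>Here m is |fst N|^2 = 1 + (snd N)^2. The chord has midpoint (snd N / m)
    \<open>fst N\<close>, and half of it has length 1 / sqrt m in the rotated direction.\<close>
  define a b where "a = (snd N / m) *\<^sub>R fst N + (1 / m) *\<^sub>R Complex (- Im (fst N)) (Re (fst N))"
    and "b = (snd N / m) *\<^sub>R fst N - (1 / m) *\<^sub>R Complex (- Im (fst N)) (Re (fst N))"
  have nn: "fst N \<bullet> Complex (- Im (fst N)) (Re (fst N)) = 0"
    "Complex (- Im (fst N)) (Re (fst N)) \<bullet> fst N = 0"
    "Complex (- Im (fst N)) (Re (fst N)) \<bullet> Complex (- Im (fst N)) (Re (fst N)) = m"
    "fst N \<bullet> fst N = m"
    by (simp_all add: inner_complex_def m_def)
  have "a \<bullet> a = ((snd N)\<^sup>2 + 1) / m" "b \<bullet> b = ((snd N)\<^sup>2 + 1) / m"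
    using m(1) by (simp_all add: a_def b_def inner_add_left inner_add_right inner_diff_left inner_diff_right nn power2_eq_square add_divide_distrib)
  then have 1: "a \<bullet> a = 1" "b \<bullet> b = 1" using m by simp_all
  have 2: "mink N (lift a) = 0" "mink N (lift b) = 0"
    using m(1) by (simp_all add: mink_def a_def b_def inner_add_right inner_diff_right nn)
  have 3: "a \<noteq> b"
  proof
    assume "a = b"
    then have "(2 / m) *\<^sub>R Complex (- Im (fst N)) (Re (fst N)) = 0"
      by (simp add: a_def b_def complex_eq_iff)
    then show False using m(1) f by (simp add: complex_eq_iff)
  qed
  have "hyp_axis N = open_segment a b" using open_segment_axis[OF 1 3 f 2] by simp
  then show "complete_geodesic A"
    unfolding complete_geodesic_def A ideal_boundary_iff Bex_def using 1 3 by blast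
qed

lemma hyp_dist_le_iff:
  assumes "x \<in> hyp_plane" "y \<in> hyp_plane" "r \<ge> 0"
  shows "hyp_dist x y \<le> r \<longleftrightarrow> - mink (lift x) (lift y) \<le> cosh r * (lor x * lor y)"
    and "r \<le> hyp_dist x y \<longleftrightarrow> cosh r * (lor x * lor y) \<le> - mink (lift x) (lift y)"
proof -
  define A where "A = - mink (lift x) (lift y) / (lor x * lor y)"
  have l: "lor x * lor y > 0" using assms by (simp add: lor_pos)
  have A1: "A \<ge> 1" unfolding A_def
    using timelike_gap(1)[OF assms(1,2)] l by (subst le_divide_eq_1_pos) auto
  have d: "hyp_dist x y = arcosh A"
    by (simp add: hyp_dist_def A_def mink_lift lor_def real_sqrt_mult)
  have c: "cosh (hyp_dist x y) = A" "hyp_dist x y \<ge> 0"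
    using A1 by (simp_all add: d)
  have "hyp_dist x y \<le> r \<longleftrightarrow> A \<le> cosh r" "r \<le> hyp_dist x y \<longleftrightarrow> cosh r \<le> A"
    using cosh_real_nonneg_le_iff[of "hyp_dist x y" r] cosh_real_nonneg_le_iff[of r "hyp_dist x y"] c assms(3) by simp_all
  then show "hyp_dist x y \<le> r \<longleftrightarrow> - mink (lift x) (lift y) \<le> cosh r * (lor x * lor y)"
    "r \<le> hyp_dist x y \<longleftrightarrow> cosh r * (lor x * lor y) \<le> - mink (lift x) (lift y)"
    using l by (simp_all add: A_def field_simps)
qed

text \<open>For every point y of the axis the lower bound is the nonnegativity of a squared
  determinant. It is attained at the orthogonal projection Y of x, so the infimum in
  \<open>hyp_dist_set\<close> is a minimum.\<close>

lemma hyp_dist_set_axis: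
  assumes "mink N N = 1" "x \<in> hyp_plane"
  shows "hyp_dist_set x (hyp_axis N) = arsinh (\<bar>mink N (lift x)\<bar> / lor x)"
proof -
  define h where "h = mink N (lift x)"
  define \<rho> where "\<rho> = arsinh (\<bar>h\<bar> / lor x)"
  have lx: "lor x > 0" using assms by (simp add: lor_pos)
  have "sinh \<rho> \<ge> 0" using lx by (simp add: \<rho>_def)
  then have r0: "\<rho> \<ge> 0" by (simp add: sinh_real_nonneg_iff)
  have ch: "cosh \<rho> = sqrt ((lor x)\<^sup>2 + h\<^sup>2) / lor x"
  proof -
    have "(cosh \<rho>)\<^sup>2 = 1 + (\<bar>h\<bar> / lor x)\<^sup>2" by (simp add: cosh_square_eq \<rho>_def)
    also have "\<dots> = (sqrt ((lor x)\<^sup>2 + h\<^sup>2) / lor x)\<^sup>2"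
      using lx by (simp add: power_divide field_simps)
    finally show ?thesis by (rule power2_eq_imp_eq) (use lx in simp_all)
  qed
  have lower: "\<rho> \<le> hyp_dist x y" if "y \<in> hyp_axis N" for y
  proof -
    have y: "y \<in> hyp_plane" "mink N (lift y) = 0" using that by (auto simp: hyp_axis_def)
    have ly: "lor y > 0" using y by (simp add: lor_pos)
    have "(det3 (lift x) (lift y) N)\<^sup>2 = (mink (lift x) (lift y))\<^sup>2 - ((lor x)\<^sup>2 + h\<^sup>2) * (lor y)\<^sup>2"
      unfolding gram_det mink_commute[of "lift x" N] mink_commute[of "lift y" N]
      by (simp add: mink_lift_self[OF assms(2)] mink_lift_self[OF y(1)] y(2) assms(1) h_def[symmetric]
          power2_eq_square algebra_simps)
    then have "((lor x)\<^sup>2 + h\<^sup>2) * (lor y)\<^sup>2 \<le> (mink (lift x) (lift y))\<^sup>2"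
      using zero_le_power2[of "det3 (lift x) (lift y) N"] by linarith
    then have "sqrt ((lor x)\<^sup>2 + h\<^sup>2) * lor y \<le> \<bar>mink (lift x) (lift y)\<bar>"
      using real_sqrt_le_mono ly by (fastforce simp: real_sqrt_mult)
    moreover have "mink (lift x) (lift y) \<le> 0"
      using timelike_gap(1)[OF assms(2) y(1)] mult_pos_pos[OF lx ly] by linarith
    ultimately show ?thesis
      using hyp_dist_le_iff(2)[OF assms(2) y(1) r0] lx by (simp add: ch)
  qed
  define Y where "Y = lift x - h *\<^sub>R N"
  have Y: "mink Y N = 0" "mink Y Y = - ((lor x)\<^sup>2 + h\<^sup>2)" "mink (lift x) Y = - ((lor x)\<^sup>2 + h\<^sup>2)"
    using assms by (simp_all add: Y_def mink_linear mink_commute[of "lift x" N] h_def[symmetric] mink_lift_self power2_eq_square)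
  have p: "(lor x)\<^sup>2 + h\<^sup>2 > 0" using lx by (simp add: add_pos_nonneg)
  have "future Y"
    using assms(2) p by (intro future_of_mink_neg[OF future_lift[of x]]) (auto simp: Y hyp_plane_iff)
  then have s: "snd Y > 0" by (simp add: future_def)
  define y where "y = proj Y"
  have y: "y \<in> hyp_axis N"
    unfolding hyp_axis_def y_def using s p proj_in_hyp_plane[of Y]
    by (simp add: Y mink_lift_proj mink_commute[of N Y])
  define q where "q = (lor x)\<^sup>2 + h\<^sup>2"
  have q: "q > 0" "mink Y Y = - q" "mink (lift x) Y = - q" "cosh \<rho> = sqrt q / lor x"
    using p Y ch by (simp_all only: q_def)
  have ly: "lor y = sqrt q / snd Y" unfolding y_def using s q by (simp add: lor_proj)
  have "cosh \<rho> * (lor x * lor y) = sqrt q * sqrt q / snd Y" using lx by (simp add: q(4) ly)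
  also have "\<dots> = - mink (lift x) (lift y)" using s q by (simp add: y_def mink_lift_proj)
  finally have "hyp_dist x y \<le> \<rho>"
    using hyp_dist_le_iff(1)[OF assms(2) _ r0, of y] y by (simp add: hyp_axis_def)
  then have "hyp_dist x y = \<rho>" using lower[OF y] by simp
  then have "hyp_dist_set x (hyp_axis N) = \<rho>"
    unfolding hyp_dist_set_def using lower y
    by (intro cInf_eq_minimum) auto
  then show ?thesis by (simp add: \<rho>_def h_def)
qed

lemma hyp_dist_set_axis_eq:
  assumes "mink N N = 1" "x \<in> hyp_plane"
  shows "hyp_dist_set x (hyp_axis N) = r \<longleftrightarrow> \<bar>mink N (lift x)\<bar> = sinh r * lor x"
proof -
  have "arsinh (\<bar>mink N (lift x)\<bar> / lor x) = r \<longleftrightarrow> \<bar>mink N (lift x)\<bar> / lor x = sinh r"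
    by (metis arsinh_sinh_real sinh_arsinh_real)
  then show ?thesis
    using hyp_dist_set_axis[OF assms] lor_pos[OF assms(2)] by (simp add: field_simps)
qed

text \<open>Below curvature 1 the vectors P and - P have the same axis, and the sign decides which
  branch or which half-plane is meant. From curvature 1 on, \<open>snd P > 0\<close> selects the
  half of the light cone in which the center lies.\<close>

definition rep :: "gen_circle \<Rightarrow> mvec \<Rightarrow> bool" where
  "rep c P \<longleftrightarrow> 0 \<le> curv c \<and> mink P P = 1 - (curv c)\<^sup>2 \<and>
     curve c = {x \<in> hyp_plane. gfun P (curv c) x = 0} \<and>
     side c = {x \<in> hyp_plane. gfun P (curv c) x \<ge> 0} \<and>
     (if curv c < 1 then center c = hyp_axis P else snd P > 0 \<and> center c = {proj P})"

lemma gfun_axis: "x \<in> hyp_axis P \<Longrightarrow> gfun P k x = k * lor x"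
  by (simp add: hyp_axis_def gfun_def)

lemma gfun_pos_nonempty:
  assumes "0 \<le> k" "k < 1" "mink P P = 1 - k\<^sup>2"
  obtains x where "x \<in> hyp_plane" "gfun P k x > 0"
proof -
  have k2: "k\<^sup>2 < 1" "0 \<le> k\<^sup>2" using assms by (auto simp: power_less_one_iff)
  then have PP: "mink P P > 0" using assms by simp
  obtain y where y: "y \<in> hyp_axis P" using axis_nonempty[OF PP] .
  then have yh: "y \<in> hyp_plane" "mink P (lift y) = 0" by (auto simp: hyp_axis_def)
  have ly: "lor y > 0" using yh by (simp add: lor_pos)
  \<comment> \<open>Half a step away from the axis along P; as \<open>mink P P\<close> is at most 1,
    the vector stays timelike.\<close>
  define X where "X = lift y + (lor y / 2) *\<^sub>R P"
  have X: "mink X X = - (lor y)\<^sup>2 + (lor y)\<^sup>2 / 4 * mink P P" "mink (lift y) X = - (lor y)\<^sup>2"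
    "mink P X = lor y / 2 * mink P P"
    using yh by (simp_all add: X_def mink_linear mink_lift_self mink_commute[of "lift y" P] power2_eq_square algebra_simps)
  have "(lor y)\<^sup>2 * mink P P \<le> (lor y)\<^sup>2 * 1" using k2 assms(3) by (intro mult_left_mono) auto
  then have neg: "mink X X < 0" using X(1) ly zero_less_power2[of "lor y"] by simp
  have "future X"
    using yh neg ly by (intro future_of_mink_neg[OF future_lift[of y]]) (auto simp: X hyp_plane_iff)
  then have s: "snd X > 0" by (simp add: future_def)
  have p: "proj X \<in> hyp_plane" using s neg by (rule proj_in_hyp_plane)
  have "0 < mink P (lift (proj X))" using s ly PP by (simp add: mink_lift_proj X)
  moreover have "0 \<le> k * lor (proj X)" using assms(1) lor_pos[OF p] by simp
  ultimately show ?thesis using that[OF p] by (simp add: gfun_def)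
qed

lemma gfun_pos_component:
  assumes "0 \<le> k" "k < 1" "mink P P = 1 - k\<^sup>2"
  shows "{x \<in> hyp_plane. gfun P k x > 0} \<in> components (hyp_plane - {x \<in> hyp_plane. gfun P k x = 0})"
proof (rule component_of_split[where U = "{x \<in> hyp_plane. gfun P k x > 0}" and W = "{x \<in> hyp_plane. gfun P k x < 0}"])
  show "connected {x \<in> hyp_plane. gfun P k x > 0}"
    using convex_gfun_pos[OF assms(1)] by (rule convex_connected)
  show "{x \<in> hyp_plane. gfun P k x > 0} \<noteq> {}"
    using gfun_pos_nonempty[OF assms] by blast
  show "open {x \<in> hyp_plane. gfun P k x > 0}" "open {x \<in> hyp_plane. gfun P k x < 0}"
    by (rule open_gfun_pos open_gfun_neg)+
qed auto

text \<open>The curve is the image of the axis under displacement along the common perpendiculars,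
  so it inherits both properties from a convex set. The factor \<kappa> = k / sqrt (1 - k^2) is the
  one for which the displaced points satisfy the equation.\<close>

lemma curve_nonempty_connected:
  assumes "0 \<le> k" "k < 1" "mink P P = 1 - k\<^sup>2"
  shows "{x \<in> hyp_plane. gfun P k x = 0} \<noteq> {}" "connected {x \<in> hyp_plane. gfun P k x = 0}"
proof -
  have k2: "k\<^sup>2 < 1" "0 \<le> k\<^sup>2" using assms by (auto simp: power_less_one_iff)
  then have PP: "mink P P > 0" using assms by simp
  define d where "d = sqrt (1 - k\<^sup>2)"
  have d: "d > 0" "d\<^sup>2 = 1 - k\<^sup>2" "mink P P = d\<^sup>2" using k2 assms(3) by (auto simp: d_def)
  define \<kappa> where "\<kappa> = k / d"
  have kd: "\<kappa>\<^sup>2 * d\<^sup>2 = k\<^sup>2" "\<kappa> * d = k" using d(1) by (auto simp: \<kappa>_def power_divide)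
  define X where "X y = lift y - (\<kappa> * lor y) *\<^sub>R P" for y
  have Xm: "mink (X y) (X y) = - (lor y)\<^sup>2 * (1 - k\<^sup>2)" 
      "mink P (X y) = - k * d * lor y" "snd (X y) > 0"
    if "y \<in> hyp_axis P" for y
  proof -
    have yh: "y \<in> hyp_plane" "mink P (lift y) = 0" using that by (auto simp: hyp_axis_def)
    have "mink (X y) (X y) = - (lor y)\<^sup>2 + (\<kappa> * lor y)\<^sup>2 * mink P P" "mink (lift y) (X y) = - (lor y)\<^sup>2"
      "mink P (X y) = - (\<kappa> * lor y) * mink P P"
      using yh by (simp_all add: X_def mink_linear mink_lift_self mink_commute[of "lift y" P] power2_eq_square algebra_simps)
    moreover have "(\<kappa> * lor y)\<^sup>2 * mink P P = k\<^sup>2 * (lor y)\<^sup>2" "(\<kappa> * lor y) * mink P P = k * d * lor y"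
      by (simp_all add: d(3) kd(2)[symmetric] power2_eq_square)
    ultimately show m: "mink (X y) (X y) = - (lor y)\<^sup>2 * (1 - k\<^sup>2)" "mink P (X y) = - k * d * lor y"
      by (simp_all add: algebra_simps)
    have ly: "lor y > 0" using yh by (simp add: lor_pos)
    have "mink (X y) (X y) < 0" unfolding m using ly k2 by (simp add: mult_neg_pos)
    then have "future (X y)"
      using yh ly \<open>mink (lift y) (X y) = - (lor y)\<^sup>2\<close>
      by (intro future_of_mink_neg[OF future_lift[of y]]) (auto simp: hyp_plane_iff)
    then show "snd (X y) > 0" by (simp add: future_def)
  qed
  have img: "(\<lambda>y. proj (X y)) ` hyp_axis P = {x \<in> hyp_plane. gfun P k x = 0}"
  proof
    show "(\<lambda>y. proj (X y)) ` hyp_axis P \<subseteq> {x \<in> hyp_plane. gfun P k x = 0}"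
    proof (intro image_subsetI CollectI conjI)
      fix y assume y: "y \<in> hyp_axis P"
      have ly: "lor y > 0" using y by (simp add: hyp_axis_def lor_pos)
      have neg: "mink (X y) (X y) < 0" unfolding Xm(1)[OF y] using ly k2 by (simp add: mult_neg_pos)
      show "proj (X y) \<in> hyp_plane" using Xm(3)[OF y] neg by (rule proj_in_hyp_plane)
      have "lor (proj (X y)) = sqrt ((lor y)\<^sup>2 * d\<^sup>2) / snd (X y)"
        using Xm(1,3)[OF y] neg by (simp add: lor_proj d(2))
      also have "\<dots> = lor y * d / snd (X y)"
        using ly d(1) by (simp add: real_sqrt_mult)
      finally show "gfun P k (proj (X y)) = 0"
        using Xm(2,3)[OF y] by (simp add: gfun_def mink_lift_proj)
    qed
    show "{x \<in> hyp_plane. gfun P k x = 0} \<subseteq> (\<lambda>y. proj (X y)) ` hyp_axis P"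
    proof
      fix x assume "x \<in> {x \<in> hyp_plane. gfun P k x = 0}"
      then have x: "x \<in> hyp_plane" "mink P (lift x) = - k * lor x" by (auto simp: gfun_def)
      have lx: "lor x > 0" using x by (simp add: lor_pos)
      \<comment> \<open>The inverse displacement: Y is x without its component along P, hence on the
        axis.\<close>
      define Y where "Y = lift x + (k * lor x / d\<^sup>2) *\<^sub>R P"
      have d2: "d\<^sup>2 \<noteq> 0" using d(1) by simp
      have Y1: "mink P Y = 0" using x d2 d(3) by (simp add: Y_def mink_linear)
      have Y2: "mink (lift x) Y = - (lor x)\<^sup>2 - k\<^sup>2 * (lor x)\<^sup>2 / d\<^sup>2"
        using x by (simp add: Y_def mink_linear mink_lift_self mink_commute[of "lift x" P] power2_eq_square)
      have "mink Y Y = mink (lift x) Y + (k * lor x / d\<^sup>2) * mink P Y"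
        by (simp add: Y_def mink_linear algebra_simps mink_commute[of "lift x" P])
      also have "\<dots> = - (lor x)\<^sup>2 * (d\<^sup>2 + k\<^sup>2) / d\<^sup>2"
        using d2 by (simp add: Y1 Y2 field_simps)
      finally have Y3: "mink Y Y = - (lor x / d)\<^sup>2" using d(2) by (simp add: power_divide)
      have "mink Y Y < 0" using lx d(1) by (simp add: Y3)
      moreover have "mink (lift x) Y < 0"
      proof -
        have "k\<^sup>2 * (lor x)\<^sup>2 / d\<^sup>2 \<ge> 0" "(lor x)\<^sup>2 > 0" using lx by auto
        then show ?thesis unfolding Y2 by linarith
      qed
      ultimately have "future Y"
        using x by (intro future_of_mink_neg[OF future_lift[of x]]) (auto simp: hyp_plane_iff)
      then have s: "snd Y > 0" by (simp add: future_def)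
      have yax: "proj Y \<in> hyp_axis P"
        using s \<open>mink Y Y < 0\<close> Y1 proj_in_hyp_plane[of Y] by (simp add: hyp_axis_def mink_lift_proj)
      have ly: "lor (proj Y) = lor x / d / snd Y"
        using s \<open>mink Y Y < 0\<close> lx d(1) by (simp add: lor_proj Y3 real_sqrt_divide)
      have "X (proj Y) = (1 / snd Y) *\<^sub>R (Y - (\<kappa> * (lor x / d)) *\<^sub>R P)"
        using s unfolding X_def by (simp add: ly lift_proj scaleR_diff_right divide_inverse mult.commute)
      also have "Y - (\<kappa> * (lor x / d)) *\<^sub>R P = lift x"
        using d(1) by (simp add: Y_def \<kappa>_def power2_eq_square)
      finally have "proj (X (proj Y)) = x" using s by (simp add: proj_scale)
      then show "x \<in> (\<lambda>y. proj (X y)) ` hyp_axis P" using yax by (metis imageI)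
    qed
  qed
  have "continuous_on (hyp_axis P) X"
    unfolding X_def lift_def by (intro continuous_intros)
  then have "continuous_on (hyp_axis P) (\<lambda>y. proj (X y))"
    unfolding proj_def using Xm(3) by (intro continuous_intros) force+
  then have "connected ((\<lambda>y. proj (X y)) ` hyp_axis P)"
    using convex_connected[OF convex_axis] by (rule connected_continuous_image)
  then show "connected {x \<in> hyp_plane. gfun P k x = 0}" unfolding img .
  show "{x \<in> hyp_plane. gfun P k x = 0} \<noteq> {}"
    unfolding img[symmetric] using axis_nonempty[OF PP] by auto
qed

section \<open>Each kind of generalized circle as a vector\<close>

lemma tanh_artanh_real:
  assumes "0 < k" "k < 1"
  shows "tanh (artanh k) = (k :: real)"
proof -
  have "exp (- 2 * artanh k) = exp (- ln ((1 + k) / (1 - k)))"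
    by (simp add: artanh_def)
  also have "\<dots> = (1 - k) / (1 + k)" using assms by (simp add: exp_minus)
  finally have e: "exp (- 2 * artanh k) = (1 - k) / (1 + k)" .
  show ?thesis unfolding tanh_real_altdef e using assms by (simp add: field_simps)
qed

lemma tanh_gt_one_inverse:
  assumes "r > 0" shows "1 / tanh r > (1::real)" "(1 / tanh r)\<^sup>2 - 1 = 1 / (sinh r)\<^sup>2" "1 / tanh r = cosh r / sinh r"
proof -
  have s: "sinh r > 0" using assms by simp
  show "1 / tanh r > 1" using assms tanh_real_lt_1[of r] by simp
  show "1 / tanh r = cosh r / sinh r" by (simp add: tanh_def)
  then show "(1 / tanh r)\<^sup>2 - 1 = 1 / (sinh r)\<^sup>2"
    using s by (simp add: power_divide cosh_square_eq add_divide_distrib)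
qed

text \<open>P is the hyperboloid point of the center divided by sinh r. Then \<open>mink P P\<close>
  is 1 - coth^2 r, and the equation says that the hyperbolic cosine of the distance to the center is
  cosh r.\<close>

lemma circle_vector:
  assumes "p \<in> hyp_plane" "r > 0"
  defines "P \<equiv> (1 / (lor p * sinh r)) *\<^sub>R lift p"
  shows "mink P P = 1 - (1 / tanh r)\<^sup>2" "snd P > 0" "proj P = p"
    "{x \<in> hyp_plane. gfun P (1 / tanh r) x = 0} = {x \<in> hyp_plane. hyp_dist x p = r}"
    "{x \<in> hyp_plane. gfun P (1 / tanh r) x \<ge> 0} = {x \<in> hyp_plane. hyp_dist x p \<le> r}"
proof -
  have lp: "lor p > 0" "sinh r > 0" using assms by (auto simp: lor_pos)
  show "mink P P = 1 - (1 / tanh r)\<^sup>2"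
    using tanh_gt_one_inverse(2)[OF assms(2)] lp
    by (simp add: P_def mink_linear mink_lift_self[OF assms(1)] power2_eq_square)
  show "snd P > 0" "proj P = p" using lp by (auto simp: P_def proj_scale)
  have g: "gfun P (1 / tanh r) x = (cosh r * (lor x * lor p) + mink (lift x) (lift p)) / (lor p * sinh r)" for x
    using lp unfolding gfun_def tanh_gt_one_inverse(3)[OF assms(2)] P_def
    by (simp add: mink_linear mink_commute[of "lift p"] field_simps)
  have pos: "lor p * sinh r > 0" using lp by simp
  have i: "gfun P (1 / tanh r) x \<ge> 0 \<longleftrightarrow> hyp_dist x p \<le> r" "gfun P (1 / tanh r) x \<le> 0 \<longleftrightarrow> r \<le> hyp_dist x p"
    if "x \<in> hyp_plane" for x
    using hyp_dist_le_iff[OF that assms(1), of r] assms(2) pos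
    by (auto simp: g zero_le_divide_iff divide_le_0_iff)
  show "{x \<in> hyp_plane. gfun P (1 / tanh r) x \<ge> 0} = {x \<in> hyp_plane. hyp_dist x p \<le> r}"
    using i by auto
  have "gfun P (1 / tanh r) x = 0 \<longleftrightarrow> hyp_dist x p = r" if "x \<in> hyp_plane" for x
    unfolding order_eq_iff[of "gfun P (1 / tanh r) x" 0] order_eq_iff[of "hyp_dist x p" r]
    using i[OF that] by blast
  then show "{x \<in> hyp_plane. gfun P (1 / tanh r) x = 0} = {x \<in> hyp_plane. hyp_dist x p = r}"
    by auto
qed

lemma rep_circle_of_radius: "circle_of_radius c \<Longrightarrow> \<exists>P. rep c P"
proof -
  assume "circle_of_radius c"
  then obtain p r where p: "p \<in> hyp_plane" "r > 0" and c: "curv c = 1 / tanh r" "center c = {p}"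
     "curve c = {x \<in> hyp_plane. hyp_dist x p = r}" "side c = {x \<in> hyp_plane. hyp_dist x p \<le> r}"
    unfolding circle_of_radius_def by blast
  have "rep c ((1 / (lor p * sinh r)) *\<^sub>R lift p)"
    using circle_vector[OF p] tanh_gt_one_inverse(1)[OF p(2)] p(2) unfolding rep_def c by simp
  then show ?thesis ..
qed

lemma circle_of_radius_rep:
  assumes "rep c P" "curv c > 1"
  shows "circle_of_radius c"
proof -
  define r where "r = artanh (1 / curv c)"
  have t: "tanh r = 1 / curv c" using assms(2) unfolding r_def by (intro tanh_artanh_real) auto
  then have "tanh r > 0" using assms(2) by simp
  then have "r > 0" by (simp only: tanh_real_pos_iff)
  then have r: "r > 0" "1 / tanh r = curv c" using t by simp_all
  have P: "mink P P = 1 - (curv c)\<^sup>2" "snd P > 0" "center c = {proj P}"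
    using assms by (auto simp: rep_def)
  have neg: "mink P P < 0" using P(1) assms(2) one_less_power[of "curv c" 2] by simp
  have p: "proj P \<in> hyp_plane" using P(2) neg by (rule proj_in_hyp_plane)
  have s: "sinh r > 0" using r by simp
  have "mink P P = - (1 / (sinh r))\<^sup>2"
    using tanh_gt_one_inverse(2)[OF r(1)] P(1) r(2) by (simp add: power_divide)
  then have "lor (proj P) = 1 / sinh r / snd P"
    using lor_proj[OF P(2)] neg s by (simp add: real_sqrt_divide)
  then have "(1 / (lor (proj P) * sinh r)) *\<^sub>R lift (proj P) = P"
    using P(2) s by (simp add: lift_proj)
  then show ?thesis
    using circle_vector[OF p r(1)] p r assms unfolding circle_of_radius_def rep_def
    by (intro bexI[of _ "proj P"] exI[of _ r] conjI) auto
qed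

text \<open>A lightlike vector cannot be normalized; its scale is free and encodes the size of the
  horoball.\<close>

lemma horocycle_vector:
  assumes "s > 0"
  shows "{x \<in> hyp_plane. gfun ((1 / s) *\<^sub>R lift \<xi>) 1 x = 0} = {x \<in> hyp_plane. exp_busemann \<xi> x = s}"
    "{x \<in> hyp_plane. gfun ((1 / s) *\<^sub>R lift \<xi>) 1 x \<ge> 0} = {x \<in> hyp_plane. exp_busemann \<xi> x \<le> s}"
proof -
  have e: "exp_busemann \<xi> x = - mink (lift \<xi>) (lift x) / lor x" for x
    by (simp add: exp_busemann_def mink_lift lor_def inner_commute)
  have g: "gfun ((1 / s) *\<^sub>R lift \<xi>) 1 x = mink (lift \<xi>) (lift x) / s + lor x" for x
    by (simp add: gfun_def mink_linear)
  have "gfun ((1 / s) *\<^sub>R lift \<xi>) 1 x = 0 \<longleftrightarrow> exp_busemann \<xi> x = s"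
    "gfun ((1 / s) *\<^sub>R lift \<xi>) 1 x \<ge> 0 \<longleftrightarrow> exp_busemann \<xi> x \<le> s" if "x \<in> hyp_plane" for x
    using assms lor_pos[OF that] unfolding e g by (auto simp: field_simps)
  then show "{x \<in> hyp_plane. gfun ((1 / s) *\<^sub>R lift \<xi>) 1 x = 0} = {x \<in> hyp_plane. exp_busemann \<xi> x = s}"
    "{x \<in> hyp_plane. gfun ((1 / s) *\<^sub>R lift \<xi>) 1 x \<ge> 0} = {x \<in> hyp_plane. exp_busemann \<xi> x \<le> s}"
    by auto
qed

lemma rep_horocycle: "horocycle c \<Longrightarrow> \<exists>P. rep c P"
proof -
  assume "horocycle c"
  then obtain \<xi> s where p: "\<xi> \<bullet> \<xi> = 1" "s > 0" and c: "curv c = 1" "center c = {\<xi>}"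
     "curve c = {x \<in> hyp_plane. exp_busemann \<xi> x = s}" "side c = {x \<in> hyp_plane. exp_busemann \<xi> x \<le> s}"
    unfolding horocycle_def ideal_boundary_iff Bex_def mem_Collect_eq by blast
  have "rep c ((1 / s) *\<^sub>R lift \<xi>)"
    using horocycle_vector[OF p(2)] p unfolding rep_def c by (simp add: proj_scale mink_linear mink_lift)
  then show ?thesis ..
qed

lemma horocycle_rep:
  assumes "rep c P" "curv c = 1"
  shows "horocycle c"
proof -
  have P: "mink P P = 0" "snd P > 0" "center c = {proj P}"
    using assms by (auto simp: rep_def)
  have "proj P \<bullet> proj P = 1"
    using P by (simp add: proj_def mink_def field_simps)
  moreover have "P = (1 / (1 / snd P)) *\<^sub>R lift (proj P)" using P by (simp add: lift_proj)
  ultimately show ?thesis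
    using horocycle_vector[of "1 / snd P" "proj P"] assms P(2)
    unfolding horocycle_def rep_def by (auto simp: ideal_boundary_iff intro!: bexI[of _ "proj P"] exI[of _ "1 / snd P"])
qed

text \<open>The distance to the axis sees only the modulus of the product with the normal, so the
  equidistant set consists of the two curves of P and - P. The axis separates them, and therefore
  each of them is a component.\<close>

lemma hypercycle_set_split:
  assumes "mink P P = 1 - k\<^sup>2" "0 < k" "k < 1"
  defines "r \<equiv> artanh k"
  shows "r > 0" "tanh r = k"
    "{x \<in> hyp_plane. hyp_dist_set x (hyp_axis P) = r} = {x \<in> hyp_plane. gfun P k x = 0} \<union> {x \<in> hyp_plane. gfun (- P) k x = 0}"
    "{x \<in> hyp_plane. gfun P k x = 0} \<in> components {x \<in> hyp_plane. hyp_dist_set x (hyp_axis P) = r}"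
proof -
  show t: "tanh r = k" using assms unfolding r_def by (intro tanh_artanh_real) auto
  then have "tanh r > 0" using assms by simp
  then show r: "r > 0" by simp
  have k2: "k\<^sup>2 < 1" using assms by (auto simp: power_less_one_iff)
  define d where "d = sqrt (1 - k\<^sup>2)"
  have d: "d > 0" "d\<^sup>2 = 1 - k\<^sup>2" using k2 by (auto simp: d_def)
  define N where "N = (1 / d) *\<^sub>R P"
  have N: "mink N N = 1" "hyp_axis N = hyp_axis P"
    using d assms(1) by (auto simp: N_def mink_linear axis_scale power2_eq_square)
  have "sinh r = k * cosh r" using t by (simp add: tanh_def field_simps)
  then have "d\<^sup>2 * (cosh r)\<^sup>2 = (cosh r)\<^sup>2 - (sinh r)\<^sup>2"
    by (simp add: d(2) power_mult_distrib algebra_simps)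
  then have "d\<^sup>2 * (cosh r)\<^sup>2 = 1" by (simp add: hyperbolic_pythagoras)
  then have "d\<^sup>2 = (1 / cosh r)\<^sup>2" by (simp add: power_divide eq_divide_eq)
  then have "d = 1 / cosh r" using d(1) by (auto dest: power2_eq_imp_eq)
  then have s: "sinh r * d = k" using t by (simp add: tanh_def)
  have eq: "hyp_dist_set x (hyp_axis P) = r \<longleftrightarrow> \<bar>mink P (lift x)\<bar> = k * lor x" if "x \<in> hyp_plane" for x
  proof -
    have "hyp_dist_set x (hyp_axis P) = r \<longleftrightarrow> \<bar>mink P (lift x)\<bar> / d = sinh r * lor x"
      using hyp_dist_set_axis_eq[OF N(1) that, of r] N(2) d(1) by (simp add: N_def mink_linear abs_mult)
    also have "\<dots> \<longleftrightarrow> \<bar>mink P (lift x)\<bar> = (sinh r * d) * lor x" using d(1) by (auto simp: field_simps)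
    finally show ?thesis by (simp only: s)
  qed
  have eq2: "\<bar>mink P (lift x)\<bar> = k * lor x \<longleftrightarrow> gfun P k x = 0 \<or> gfun (- P) k x = 0" if "x \<in> hyp_plane" for x
    using mult_pos_pos[OF assms(2) lor_pos[OF that]] unfolding gfun_def mink_minus_left by (smt (verit))
  show un: "{x \<in> hyp_plane. hyp_dist_set x (hyp_axis P) = r} = {x \<in> hyp_plane. gfun P k x = 0} \<union> {x \<in> hyp_plane. gfun (- P) k x = 0}"
    using eq eq2 by auto
  have kl: "0 < k * lor x" if "x \<in> hyp_plane" for x using assms lor_pos[OF that] by simp
  show "{x \<in> hyp_plane. gfun P k x = 0} \<in> components {x \<in> hyp_plane. hyp_dist_set x (hyp_axis P) = r}"
    unfolding un
  proof (rule component_of_split[where U = "{x \<in> hyp_plane. gfun P 0 x < 0}" and W = "{x \<in> hyp_plane. gfun P 0 x > 0}"])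
    show "connected {x \<in> hyp_plane. gfun P k x = 0}" "{x \<in> hyp_plane. gfun P k x = 0} \<noteq> {}"
      using curve_nonempty_connected[of k P] assms by auto
    show "open {x \<in> hyp_plane. gfun P 0 x < 0}" "open {x \<in> hyp_plane. gfun P 0 x > 0}"
      by (rule open_gfun_pos open_gfun_neg)+
    show "{x \<in> hyp_plane. gfun P k x = 0} = ({x \<in> hyp_plane. gfun P k x = 0} \<union> {x \<in> hyp_plane. gfun (- P) k x = 0}) \<inter> {x \<in> hyp_plane. gfun P 0 x < 0}"
      using kl by (fastforce simp: gfun_def mink_linear)
    show "{x \<in> hyp_plane. gfun P k x = 0} \<union> {x \<in> hyp_plane. gfun (- P) k x = 0} - {x \<in> hyp_plane. gfun P k x = 0} \<subseteq> {x \<in> hyp_plane. gfun P 0 x > 0}"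
      using kl by (fastforce simp: gfun_def mink_linear)
  qed auto
qed

lemma side_union:
  "{x \<in> hyp_plane. gfun P k x = 0} \<union> {x \<in> hyp_plane. gfun P k x > 0} = {x \<in> hyp_plane. gfun P k x \<ge> 0}"
  by auto

text \<open>The axis determines P up to sign, and the sign is read off from the branch that the
  curve is. The side must then be the positive set, because that component contains the
  axis.\<close>

lemma rep_hypercycle: "hypercycle c \<Longrightarrow> \<exists>P. rep c P"
proof -
  assume "hypercycle c"
  then obtain r U where r: "r > 0" "curv c = tanh r" and g: "complete_geodesic (center c)"
    and cu: "curve c \<in> components {x \<in> hyp_plane. hyp_dist_set x (center c) = r}"
    and U: "U \<in> components (hyp_plane - curve c)" "center c \<subseteq> U" "side c = curve c \<union> U"
    unfolding hypercycle_def by blast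
  obtain N where N: "mink N N = 1" "center c = hyp_axis N" using g by (auto simp: complete_geodesic_iff)
  define k where "k = curv c"
  have k: "0 < k" "k < 1" "artanh k = r" using r by (auto simp: k_def artanh_tanh_real tanh_real_lt_1)
  have k2: "k\<^sup>2 < 1" using k by (auto simp: power_less_one_iff)
  define P where "P = sqrt (1 - k\<^sup>2) *\<^sub>R N"
  have P: "mink P P = 1 - k\<^sup>2" "hyp_axis P = center c"
    using k2 N by (auto simp: P_def mink_linear axis_scale)
  have mP: "mink (- P) (- P) = 1 - k\<^sup>2" "hyp_axis (- P) = center c"
    using P axis_scale[of "-1" P] by (auto simp: mink_linear)
  have "\<exists>Q. mink Q Q = 1 - k\<^sup>2 \<and> hyp_axis Q = center c \<and> curve c = {x \<in> hyp_plane. gfun Q k x = 0}"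
  proof -
    obtain x where x: "x \<in> curve c" using cu in_components_nonempty by blast
    then have "x \<in> {x \<in> hyp_plane. hyp_dist_set x (center c) = r}"
      using in_components_subset[OF cu] by blast
    then have "x \<in> {x \<in> hyp_plane. gfun P k x = 0} \<or> x \<in> {x \<in> hyp_plane. gfun (- P) k x = 0}"
      using hypercycle_set_split(3)[OF P(1) k(1,2)] unfolding k(3) P(2) by auto
    then show ?thesis
    proof
      assume *: "x \<in> {x \<in> hyp_plane. gfun P k x = 0}"
      have "{x \<in> hyp_plane. gfun P k x = 0} \<in> components {x \<in> hyp_plane. hyp_dist_set x (center c) = r}"
        using hypercycle_set_split(4)[OF P(1) k(1,2)] unfolding k(3) P(2) .
      from components_eqI[OF cu this x *] show ?thesis using P by blast
    next
      assume *: "x \<in> {x \<in> hyp_plane. gfun (- P) k x = 0}"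
      have "{x \<in> hyp_plane. gfun (- P) k x = 0} \<in> components {x \<in> hyp_plane. hyp_dist_set x (center c) = r}"
        using hypercycle_set_split(4)[OF mP(1) k(1,2)] unfolding k(3) mP(2) .
      from components_eqI[OF cu this x *] show ?thesis using mP by blast
    qed
  qed
  then obtain Q where Q: "mink Q Q = 1 - k\<^sup>2" "hyp_axis Q = center c" "curve c = {x \<in> hyp_plane. gfun Q k x = 0}"
    by blast
  have "mink Q Q > 0" using Q(1) k2 by simp
  then obtain y where y: "y \<in> hyp_axis Q" by (rule axis_nonempty)
  have yh: "y \<in> hyp_plane" using y by (simp add: hyp_axis_def)
  have "gfun Q k y > 0" using gfun_axis[OF y] k lor_pos[OF yh] by simp
  then have y1: "y \<in> {x \<in> hyp_plane. gfun Q k x > 0}" using yh by simp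
  have y2: "y \<in> U" using y Q(2) U(2) by auto
  have "U = {x \<in> hyp_plane. gfun Q k x > 0}"
    using components_eqI[OF U(1)[unfolded Q(3)] gfun_pos_component[OF _ k(2) Q(1)] y2 y1] k by simp
  then have "side c = {x \<in> hyp_plane. gfun Q k x \<ge> 0}"
    unfolding U(3) Q(3) by (simp only: side_union)
  then have "rep c Q"
    using Q k unfolding rep_def by (simp add: k_def)
  then show ?thesis ..
qed

lemma hypercycle_rep:
  assumes "rep c P" "0 < curv c" "curv c < 1"
  shows "hypercycle c"
proof -
  have P: "mink P P = 1 - (curv c)\<^sup>2" "center c = hyp_axis P" "curve c = {x \<in> hyp_plane. gfun P (curv c) x = 0}"
    "side c = {x \<in> hyp_plane. gfun P (curv c) x \<ge> 0}"
    using assms by (auto simp: rep_def)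
  have k2: "(curv c)\<^sup>2 < 1" using assms by (auto simp: power_less_one_iff)
  have "complete_geodesic (center c)"
    unfolding complete_geodesic_iff P(2)
    using P(1) k2 by (intro exI[of _ "(1 / sqrt (1 - (curv c)\<^sup>2)) *\<^sub>R P"]) (auto simp: mink_linear axis_scale)
  moreover have "hyp_axis P \<subseteq> {x \<in> hyp_plane. gfun P (curv c) x > 0}"
    using assms(2) by (auto simp: gfun_axis) (auto simp: hyp_axis_def lor_pos)
  ultimately show ?thesis
    unfolding hypercycle_def
    using hypercycle_set_split[OF P(1) assms(2,3)] gfun_pos_component[OF _ assms(3) P(1)] assms(2) side_union[of P "curv c"]
    unfolding P(2,3,4)
    by (intro exI[of _ "artanh (curv c)"] conjI bexI[of _ "{x \<in> hyp_plane. gfun P (curv c) x > 0}"]) auto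
qed

lemma axis_gfun: "hyp_axis P = {x \<in> hyp_plane. gfun P 0 x = 0}"
  by (auto simp: hyp_axis_def gfun_def)

text \<open>The curve alone leaves the sign of the normal open; it is chosen so that a point of the
  given half-plane becomes positive.\<close>

lemma rep_geodesic: "geodesic_with_half_plane c \<Longrightarrow> \<exists>P. rep c P"
proof -
  assume "geodesic_with_half_plane c"
  then obtain U where c: "curv c = 0" "complete_geodesic (center c)" "curve c = center c"
    and U: "U \<in> components (hyp_plane - curve c)" "side c = curve c \<union> U"
    unfolding geodesic_with_half_plane_def by blast
  obtain N where N: "mink N N = 1" "center c = hyp_axis N" using c(2) by (auto simp: complete_geodesic_iff)
  have mN: "mink (- N) (- N) = 1" "center c = hyp_axis (- N)"
    using N axis_scale[of "-1" N] by (auto simp: mink_linear)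
  obtain x where x: "x \<in> U" using U(1) in_components_nonempty by blast
  then have xh: "x \<in> hyp_plane" "gfun N 0 x \<noteq> 0"
    using in_components_subset[OF U(1)] by (auto simp: c(3) N(2) hyp_axis_def gfun_def)
  have "\<exists>Q. mink Q Q = 1 \<and> center c = hyp_axis Q \<and> gfun Q 0 x > 0"
  proof (cases "gfun N 0 x > 0")
    case False
    then have "gfun (- N) 0 x > 0" using xh by (simp add: gfun_def mink_linear)
    then show ?thesis using mN by blast
  qed (use N in blast)
  then obtain Q where Q: "mink Q Q = 1 - 0\<^sup>2" "center c = hyp_axis Q" "gfun Q 0 x > 0" by auto
  have "U = {x \<in> hyp_plane. gfun Q 0 x > 0}"
    using components_eqI[OF U(1)[unfolded c(3) Q(2) axis_gfun] gfun_pos_component[OF _ _ Q(1)] x] xh Q(3) by auto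
  then have "side c = {x \<in> hyp_plane. gfun Q 0 x \<ge> 0}"
    unfolding U(2) c(3) Q(2) axis_gfun by (simp only: side_union)
  then have "rep c Q" using Q c unfolding rep_def by (simp add: axis_gfun)
  then show ?thesis ..
qed

lemma geodesic_rep:
  assumes "rep c P" "curv c = 0"
  shows "geodesic_with_half_plane c"
proof -
  have P: "mink P P = 1" "center c = hyp_axis P" "curve c = hyp_axis P"
    "side c = {x \<in> hyp_plane. gfun P 0 x \<ge> 0}"
    using assms by (auto simp: rep_def axis_gfun)
  have "complete_geodesic (hyp_axis P)" using P(1) complete_geodesic_iff by blast
  then show ?thesis
    unfolding geodesic_with_half_plane_def
    using assms(2) P gfun_pos_component[of 0 P] side_union[of P 0]
    by (auto simp: axis_gfun intro!: bexI[of _ "{x \<in> hyp_plane. gfun P 0 x > 0}"])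
qed

theorem generalized_circle_iff_rep: "generalized_circle c \<longleftrightarrow> (\<exists>P. rep c P)"
proof
  assume "\<exists>P. rep c P"
  then obtain P where P: "rep c P" ..
  then have "curv c = 0 \<or> 0 < curv c \<and> curv c < 1 \<or> curv c = 1 \<or> curv c > 1" by (auto simp: rep_def)
  then show "generalized_circle c"
    using circle_of_radius_rep[OF P] horocycle_rep[OF P] hypercycle_rep[OF P] geodesic_rep[OF P]
    unfolding generalized_circle_def by blast
qed (use rep_circle_of_radius rep_horocycle rep_hypercycle rep_geodesic in \<open>auto simp: generalized_circle_def\<close>)

section \<open>External tangency\<close>

definition frame :: "mvec \<Rightarrow> mvec \<Rightarrow> mvec \<Rightarrow> bool" where
  "frame X n e \<longleftrightarrow> mink X X = -1 \<and> mink n n = 1 \<and> mink e e = 1 \<and>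
     mink X n = 0 \<and> mink X e = 0 \<and> mink n e = 0 \<and> snd X > 0"

lemma frame_lcross:
  assumes "mink X X = -1" "mink n n = 1" "mink X n = 0" "snd X > 0"
  shows "frame X n (lcross X n)"
  using assms by (simp add: frame_def mink_lcross_lcross mink_commute[of n X])

lemma frame_minus: "frame X n e \<Longrightarrow> frame X (- n) e" "frame X n e \<Longrightarrow> frame X n (- e)"
  by (simp_all add: frame_def mink_linear)

lemma frame_cong:
  assumes "frame X n e"
  shows "mink X X = -1" "mink n n = 1" "mink e e = 1" "mink X n = 0" "mink n X = 0" "mink X e = 0"
    "mink e X = 0" "mink n e = 0" "mink e n = 0" "snd X > 0"
  using assms by (auto simp: frame_def mink_commute)

text \<open>A rational parametrization of the curve of curvature \<open>k\<close> through \<open>X\<close> with normal \<open>n\<close> and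
  tangent \<open>e\<close>: stereographic projection from \<open>X\<close>.\<close>

definition curve_vec :: "real \<Rightarrow> mvec \<Rightarrow> mvec \<Rightarrow> mvec \<Rightarrow> real \<Rightarrow> mvec" where
  "curve_vec k X n e s = (2 * k * s\<^sup>2) *\<^sub>R n + (2 * s) *\<^sub>R e + (1 + (1 + k\<^sup>2) * s\<^sup>2) *\<^sub>R X"

lemma curve_vec_mink:
  assumes "frame X n e"
  shows "mink (curve_vec k X n e s) (curve_vec k X n e s) = - (1 + (k\<^sup>2 - 1) * s\<^sup>2)\<^sup>2"
    and "mink (k *\<^sub>R X + n) (curve_vec k X n e s) = - k * (1 + (k\<^sup>2 - 1) * s\<^sup>2)"
    and "mink X (curve_vec k X n e s) = - (1 + (1 + k\<^sup>2) * s\<^sup>2)"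
  by (simp_all add: curve_vec_def mink_linear frame_cong[OF assms]) (simp_all add: power2_eq_square algebra_simps)

lemma curve_vec_point:
  assumes "frame X n e" "1 + (k\<^sup>2 - 1) * s\<^sup>2 > 0"
  shows "snd (curve_vec k X n e s) > 0" "proj (curve_vec k X n e s) \<in> hyp_plane"
    "gfun (k *\<^sub>R X + n) k (proj (curve_vec k X n e s)) = 0"
    "lor (proj (curve_vec k X n e s)) = (1 + (k\<^sup>2 - 1) * s\<^sup>2) / snd (curve_vec k X n e s)"
proof -
  let ?V = "curve_vec k X n e s"
  have neg: "mink ?V ?V < 0" using curve_vec_mink(1)[OF assms(1)] assms(2) by simp
  have "mink X ?V < 0"
  proof -
    have "0 \<le> (1 + k\<^sup>2) * s\<^sup>2" by simp
    then show ?thesis unfolding curve_vec_mink(3)[OF assms(1)] by linarith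
  qed
  moreover have "future X" using frame_cong[OF assms(1)] by (simp add: future_def)
  ultimately have "future ?V"
    using neg future_of_mink_neg[of X ?V] by simp
  then show s: "snd ?V > 0" by (simp add: future_def)
  show "proj ?V \<in> hyp_plane" using s neg by (rule proj_in_hyp_plane)
  show l: "lor (proj ?V) = (1 + (k\<^sup>2 - 1) * s\<^sup>2) / snd ?V"
    using lor_proj[OF s] neg curve_vec_mink(1)[OF assms(1), of k s] assms(2) by simp
  show "gfun (k *\<^sub>R X + n) k (proj ?V) = 0"
    unfolding gfun_def l using s curve_vec_mink(2)[OF assms(1), of k s]
    by (simp add: mink_lift_proj)
qed

lemma proj_has_vector_derivative:
  assumes "(V has_vector_derivative V') (at s within S)" "snd (V s) \<noteq> 0"
  shows "((\<lambda>s. proj (V s)) has_vector_derivative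
    (fst V' /\<^sub>R snd (V s) - (snd V' / (snd (V s))\<^sup>2) *\<^sub>R fst (V s))) (at s within S)"
proof -
  have f: "((\<lambda>s. fst (V s)) has_vector_derivative fst V') (at s within S)"
    using bounded_linear.has_vector_derivative[OF bounded_linear_fst assms(1)] .
  have "((\<lambda>s. snd (V s)) has_vector_derivative snd V') (at s within S)"
    using bounded_linear.has_vector_derivative[OF bounded_linear_snd assms(1)] .
  then have g: "((\<lambda>s. snd (V s)) has_real_derivative snd V') (at s within S)"
    by (simp add: has_real_derivative_iff_has_vector_derivative)
  have "((\<lambda>s. inverse (snd (V s))) has_real_derivative - (snd V' / (snd (V s))\<^sup>2)) (at s within S)"
    using DERIV_inverse_fun[OF g assms(2)] by (simp add: divide_inverse power2_eq_square mult_ac)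
  from has_vector_derivative_scaleR[OF this f] show ?thesis
    by (simp add: proj_def algebra_simps)
qed

lemma curve_vec_has_vector_derivative:
  "(curve_vec k X n e has_vector_derivative
     ((4 * k * s) *\<^sub>R n + 2 *\<^sub>R e + (2 * (1 + k\<^sup>2) * s) *\<^sub>R X)) (at s within S)"
  unfolding curve_vec_def
  by (auto intro!: derivative_eq_intros simp: has_vector_derivative_def scaleR_add_left algebra_simps fun_eq_iff)

text \<open>At parameter 0 the derivative of \<open>curve_vec\<close> is 2 e for every curvature and
  every normal, so the curves with opposite normals n and - n pass through X with the same
  velocity.\<close>

lemma tangent_curves_frame:
  assumes f: "frame X n e"
    and C1: "C1 = {x \<in> hyp_plane. gfun (k1 *\<^sub>R X + n) k1 x = 0}"
    and C2: "C2 = {x \<in> hyp_plane. gfun (k2 *\<^sub>R X - n) k2 x = 0}"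
  shows "tangent_curves_at C1 C2 (proj X)"
proof -
  define u where "u = 2 *\<^sub>R (fst e /\<^sub>R snd X - (snd e / (snd X)\<^sup>2) *\<^sub>R fst X)"
  have q: "1 + (k\<^sup>2 - 1) * s\<^sup>2 > 0" if "\<bar>s\<bar> < 1" for k s :: real
  proof -
    have "s\<^sup>2 < 1" using that by (simp add: abs_square_less_1)
    moreover have "0 \<le> k\<^sup>2 * s\<^sup>2" by simp
    ultimately have "0 < 1 - s\<^sup>2 + k\<^sup>2 * s\<^sup>2" by linarith
    then show ?thesis by (simp add: algebra_simps)
  qed
  have V0: "curve_vec k X m e 0 = X" for k m by (simp add: curve_vec_def)
  \<comment> \<open>\<open>tangent_curves_at\<close> asks for curves on all of the reals, while
    positivity of 1 + (k^2 - 1) s^2 is guaranteed for every k only if |s| < 1. Beyond that the curve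
    rests at the tangency point.\<close>
  define g where "g k m s = (if \<bar>s\<bar> < 1 then proj (curve_vec k X m e s) else proj X)" for k m s
  have ud: "fst (2 *\<^sub>R e) /\<^sub>R snd X - (snd (2 *\<^sub>R e) / (snd X)\<^sup>2) *\<^sub>R fst X = u"
    by (simp add: u_def scaleR_diff_right)
  have gd: "(g k m has_vector_derivative u) (at 0)" for k m
  proof (rule has_vector_derivative_transform_within_open)
    show "((\<lambda>s. proj (curve_vec k X m e s)) has_vector_derivative u) (at 0)"
      using proj_has_vector_derivative[OF curve_vec_has_vector_derivative[of k X m e 0 UNIV]] frame_cong(10)[OF f]
      unfolding V0 by (simp add: ud[simplified])
    show "open {-1<..<1::real}" "0 \<in> {-1<..<1::real}" by auto
    show "proj (curve_vec k X m e s) = g k m s" if "s \<in> {-1<..<1}" for s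
      using that by (simp add: g_def abs_less_iff)
  qed
  have g0: "g k m 0 = proj X" for k m by (simp add: g_def V0)
  have gr: "range (g k m) \<subseteq> {x \<in> hyp_plane. gfun (k *\<^sub>R X + m) k x = 0}" if "frame X m e" for k m
  proof -
    have "proj (curve_vec k X m e s) \<in> {x \<in> hyp_plane. gfun (k *\<^sub>R X + m) k x = 0}" if "\<bar>s\<bar> < 1" for s
      using curve_vec_point(2,3)[OF \<open>frame X m e\<close> q[OF that]] by simp
    from this this[of 0] show ?thesis by (auto simp: g_def V0)
  qed
  have "u \<noteq> 0"
  proof
    assume u0: "u = 0"
    have "e = (snd e / snd X) *\<^sub>R X"
    proof -
      have "fst e /\<^sub>R snd X = (snd e / (snd X)\<^sup>2) *\<^sub>R fst X" using u0 by (simp add: u_def)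
      then have "snd X *\<^sub>R (fst e /\<^sub>R snd X) = snd X *\<^sub>R ((snd e / (snd X)\<^sup>2) *\<^sub>R fst X)" by simp
      then show ?thesis using frame_cong(10)[OF f] by (simp add: prod_eq_iff power2_eq_square)
    qed
    then have "mink e e = (snd e / snd X) * mink X e" by (metis mink_scale_left)
    then show False using frame_cong[OF f] by simp
  qed
  moreover have "range (g k1 n) \<subseteq> C1" "range (g k2 (- n)) \<subseteq> C2"
    using gr[OF f, of k1] gr[OF frame_minus(1)[OF f], of k2] by (simp_all add: C1 C2)
  ultimately show ?thesis
    unfolding tangent_curves_at_def using gd g0
    by (intro exI[of _ "g k1 n"] exI[of _ "g k2 (- n)"] exI[of _ u] conjI)
qed

section \<open>From vectors to external tangency\<close>

lemma sum_tangent_square: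
  assumes "mink P1 P1 = 1 - k1\<^sup>2" "mink P2 P2 = 1 - k2\<^sup>2" "mink P1 P2 = - 1 - k1 * k2"
    "P1 + P2 = \<mu> *\<^sub>R lift t"
  shows "(k1 + k2)\<^sup>2 = \<mu>\<^sup>2 * (1 - t \<bullet> t)"
proof -
  have "mink (P1 + P2) (P1 + P2) = - (k1 + k2)\<^sup>2"
    using assms(1-3) by (simp add: mink_linear mink_commute[of P2 P1] power2_eq_square algebra_simps)
  then show ?thesis unfolding assms(4) by (simp add: mink_linear mink_lift power2_eq_square algebra_simps)
qed

lemma gfun_add: "gfun P1 k1 x + gfun P2 k2 x = mink (P1 + P2) (lift x) + (k1 + k2) * lor x"
  by (simp add: gfun_def mink_linear algebra_simps)

text \<open>The two defining functions add up to a positive multiple of the reversed Cauchy-Schwarz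
  defect between t and x. Hence the sides meet at most in t. Later the same inequality controls the
  sign of a neighbor's function along the first circle.\<close>

lemma tangent_sides_gap:
  assumes "mink P1 P1 = 1 - k1\<^sup>2" "mink P2 P2 = 1 - k2\<^sup>2" "mink P1 P2 = - 1 - k1 * k2"
    "P1 + P2 = \<mu> *\<^sub>R lift t" "\<mu> > 0" "k1 \<ge> 0" "k2 \<ge> 0" "x \<in> hyp_plane"
  shows "gfun P1 k1 x + gfun P2 k2 x \<le> 0"
    "gfun P1 k1 x + gfun P2 k2 x = 0 \<Longrightarrow> x = t"
proof -
  note sq = sum_tangent_square[OF assms(1-4)]
  have tt: "t \<bullet> t \<le> 1"
  proof -
    have "0 \<le> \<mu>\<^sup>2 * (1 - t \<bullet> t)" using sq[symmetric] by simp
    then show ?thesis using assms(5) by (simp add: zero_le_mult_iff)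
  qed
  have "(k1 + k2)\<^sup>2 = (\<mu> * lor t)\<^sup>2" using sq tt by (simp add: power_mult_distrib lor_def)
  then have kl: "k1 + k2 = \<mu> * lor t"
    using assms(5-7) tt by (auto simp: lor_def dest: power2_eq_imp_eq)
  have s: "gfun P1 k1 x + gfun P2 k2 x = \<mu> * (mink (lift t) (lift x) + lor t * lor x)"
    unfolding gfun_add assms(4) kl by (simp add: mink_linear algebra_simps)
  have "mink (lift t) (lift x) + lor t * lor x \<le> 0 \<and> (mink (lift t) (lift x) + lor t * lor x = 0 \<longrightarrow> x = t)"
  proof (cases "t \<in> hyp_plane")
    case True
    then show ?thesis using timelike_gap[OF True assms(8)] by auto
  next
    case False
    then have "lor t = 0" using tt by (simp add: hyp_plane_iff lor_def)
    moreover have "mink (lift x) (lift t) < 0"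
      by (rule mink_future_neg[OF future_lift future_lift]) (use assms(8) tt in \<open>auto simp: hyp_plane_iff mink_lift\<close>)
    ultimately show ?thesis by (simp add: mink_commute[of "lift t"])
  qed
  then show "gfun P1 k1 x + gfun P2 k2 x \<le> 0" "gfun P1 k1 x + gfun P2 k2 x = 0 \<Longrightarrow> x = t"
    unfolding s using assms(5) by (auto simp: mult_le_0_iff)
qed

lemma externally_tangent_of_rep:
  assumes r: "rep c1 P1" "rep c2 P2" and m: "mink P1 P2 = - 1 - curv c1 * curv c2"
    and s: "P1 + P2 = \<mu> *\<^sub>R lift t" "\<mu> > 0"
  shows "externally_tangent_at c1 c2 t"
proof -
  define k1 k2 where "k1 = curv c1" and "k2 = curv c2"
  have c: "curve c1 = {x \<in> hyp_plane. gfun P1 k1 x = 0}" "curve c2 = {x \<in> hyp_plane. gfun P2 k2 x = 0}"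
    "side c1 = {x \<in> hyp_plane. gfun P1 k1 x \<ge> 0}" "side c2 = {x \<in> hyp_plane. gfun P2 k2 x \<ge> 0}"
    and k: "k1 \<ge> 0" "k2 \<ge> 0" and P: "mink P1 P1 = 1 - k1\<^sup>2" "mink P2 P2 = 1 - k2\<^sup>2"
    using r by (auto simp: rep_def k1_def k2_def)
  note m' = m[folded k1_def k2_def]
  note sq = sum_tangent_square[OF P m' s(1)]
  note gap = tangent_sides_gap[OF P m' s k]
  have sub: "side c1 \<inter> side c2 \<subseteq> {t}" 
  proof
    fix x assume "x \<in> side c1 \<inter> side c2"
    then have "x \<in> hyp_plane" "gfun P1 k1 x \<ge> 0" "gfun P2 k2 x \<ge> 0" using c by auto
    then show "x \<in> {t}" using gap(1)[of x] gap(2)[of x] by simp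
  qed
  have "interior (side c1) \<inter> interior (side c2) \<subseteq> interior {t}"
    unfolding interior_Int[symmetric] using sub by (rule interior_mono)
  then have int: "interior (side c1) \<inter> interior (side c2) = {}" by simp
  have e: "mink P1 (P1 + P2) = - k1 * (k1 + k2)" "mink P2 (P1 + P2) = - k2 * (k1 + k2)"
    using P m' by (simp_all add: mink_linear mink_commute[of P2 P1] power2_eq_square algebra_simps)
  show ?thesis
  proof (cases "k1 = 0 \<and> k2 = 0")
    case True
    have tt: "t \<bullet> t = 1" using sq True s(2) by simp
    have mt: "mink P1 (lift t) = 0" "mink P2 (lift t) = 0"
      using e True s by (simp_all add: mink_linear)
    have ne: "t \<notin> hyp_plane" using tt by (simp add: hyp_plane_iff)
    have "curve c1 \<inter> curve c2 = {}"
      using sub ne unfolding c by auto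
    moreover have ne2: "curve c1 \<noteq> {}" "curve c2 \<noteq> {}"
      using curve_nonempty_connected(1)[OF _ _ P(1)] curve_nonempty_connected(1)[OF _ _ P(2)] True unfolding c by auto
    ultimately have "curve c1 \<noteq> curve c2" by auto
    moreover have "t \<in> closure {x \<in> hyp_plane. gfun P 0 x = 0}"
      if Pt: "mink P (lift t) = 0" and Pn: "{x \<in> hyp_plane. gfun P 0 x = 0} \<noteq> {}" for P
    proof -
      obtain y where y: "y \<in> hyp_plane" "mink P (lift y) = 0" using Pn by (auto simp: gfun_def)
      \<comment> \<open>The chord from the ideal point t to a point y of the geodesic stays on the
        geodesic, and its closure contains t.\<close>
      have "open_segment t y \<subseteq> {x \<in> hyp_plane. gfun P 0 x = 0}"
      proof
        fix x assume x: "x \<in> open_segment t y"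
        obtain u where u: "0 < u" "u < 1" "x = (1 - u) *\<^sub>R t + u *\<^sub>R y" using x by (auto simp: in_segment)
        have nt: "norm t = 1" "norm y < 1" using tt y(1) by (simp_all add: norm_eq_sqrt_inner hyp_plane_def)
        have "norm x \<le> norm ((1 - u) *\<^sub>R t) + norm (u *\<^sub>R y)" unfolding u(3) by (rule norm_triangle_ineq)
        also have "\<dots> = (1 - u) + u * norm y" using u nt by simp
        also have "\<dots> < 1" using u nt by simp
        finally have "x \<in> ball 0 1" by simp
        moreover have "mink P (lift x) = 0"
        proof -
          show ?thesis unfolding u(3) using Pt y by (simp add: lift_affine mink_linear)
        qed
        ultimately show "x \<in> {x \<in> hyp_plane. gfun P 0 x = 0}" by (simp add: gfun_def hyp_plane_def)
      qed
      then have "closure (open_segment t y) \<subseteq> closure {x \<in> hyp_plane. gfun P 0 x = 0}"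
        by (rule closure_mono)
      moreover have "t \<noteq> y" using y(1) ne by auto
      ultimately show ?thesis by auto
    qed
    ultimately show ?thesis
      unfolding externally_tangent_at_def using int tt mt ne2 True unfolding c
      by (auto simp: k1_def k2_def ideal_boundary_iff)
  next
    case False
    then have kp: "k1 + k2 > 0" using k by auto
    have tt: "t \<bullet> t < 1"
    proof -
      have "0 < \<mu>\<^sup>2 * (1 - t \<bullet> t)" using sq kp by (metis zero_less_power)
      then show ?thesis using s(2) by (simp add: zero_less_mult_iff)
    qed
    then have th: "t \<in> hyp_plane" by (simp add: hyp_plane_iff)
    note lt = lor_pos[OF th]
    \<comment> \<open>X is the hyperboloid point of t. Splitting both vectors along X leaves
      opposite unit normals n and - n, which is the form needed for the tangent curves.\<close>
    define X where "X = (1 / (k1 + k2)) *\<^sub>R (P1 + P2)"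
    have XP: "P1 + P2 = (k1 + k2) *\<^sub>R X" using kp by (simp add: X_def)
    have mX: "mink P1 X = - k1" "mink P2 X = - k2" 
      using e kp unfolding X_def mink_scale_right by simp_all
    have XX: "mink X X = -1"
    proof -
      have "(k1 + k2) * mink X X = mink (P1 + P2) X" unfolding XP by (simp add: mink_linear)
      also have "\<dots> = - (k1 + k2)" using mX by (simp add: mink_linear)
      finally have "(k1 + k2) * mink X X = (k1 + k2) * -1" by simp
      then show ?thesis using kp by (subst (asm) mult_left_cancel) auto
    qed
    define n where "n = P1 - k1 *\<^sub>R X"
    have P1n: "P1 = k1 *\<^sub>R X + n" by (simp add: n_def)
    have P2n: "P2 = k2 *\<^sub>R X - n" using XP by (simp add: n_def algebra_simps)
    have nn: "mink n n = 1" "mink X n = 0"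
      using mX XX P by (simp_all add: n_def mink_linear mink_commute[of X P1] power2_eq_square)
    have sX: "snd X > 0" using s kp by (simp add: X_def)
    have pX: "proj X = t" using s kp by (simp add: X_def proj_scale)
    have "tangent_curves_at (curve c1) (curve c2) (proj X)"
      by (rule tangent_curves_frame[where ?k1.0 = k1 and ?k2.0 = k2, OF frame_lcross[OF XX nn sX]]) (simp_all add: c P1n[symmetric] P2n[symmetric])
    then show ?thesis
      unfolding externally_tangent_at_def pX using int th False unfolding k1_def k2_def by auto
  qed
qed

section \<open>From external tangency to vectors\<close>

lemma sides_overlap:
  assumes "rep c1 P1" "rep c2 P2" "x \<in> hyp_plane" "gfun P1 (curv c1) x > 0" "gfun P2 (curv c2) x > 0"
  shows "interior (side c1) \<inter> interior (side c2) \<noteq> {}"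
proof -
  have "{x \<in> hyp_plane. gfun P (curv c) x > 0} \<subseteq> interior (side c)" if "rep c P" for c P
    using that by (intro interior_maximal open_gfun_pos) (auto simp: rep_def)
  from this[OF assms(1)] this[OF assms(2)] show ?thesis using assms(3-5) by blast
qed

text \<open>Two circles with the same normal at a common point overlap next to it: a short step d
  along the normal enters both sides. After estimating the square root, the value is at least d (1 -
  k d) up to a positive factor, and d is chosen so that k1 d and k2 d are below 1.\<close>

lemma common_inner_point:
  assumes f: "mink X X = -1" "snd X > 0" "mink n n = 1" "mink X n = 0" and k: "k1 \<ge> 0" "k2 \<ge> 0"
  obtains x where "x \<in> hyp_plane" "gfun (k1 *\<^sub>R X + n) k1 x > 0" "gfun (k2 *\<^sub>R X + n) k2 x > 0"
proof -
  define d where "d = 1 / (k1 + k2 + 2)"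
  have d: "d > 0" "d < 1" using k by (auto simp: d_def)
  have kd: "k1 * d < 1" "k2 * d < 1" using k by (auto simp: d_def divide_less_eq)
  define V where "V = X + d *\<^sub>R n"
  have V: "mink V V = - (1 - d\<^sup>2)" "mink X V = -1" "mink n V = d"
    using f by (simp_all add: V_def mink_linear mink_commute[of n X] power2_eq_square)
  have d2: "0 < 1 - d\<^sup>2" using d by (simp add: abs_square_less_1)
  have "future X" using f by (simp add: future_def)
  then have "future V" using V d2 future_of_mink_neg[of X V] by simp
  then have s: "snd V > 0" by (simp add: future_def)
  have p: "proj V \<in> hyp_plane" using s V d2 by (intro proj_in_hyp_plane) auto
  have "gfun (k *\<^sub>R X + n) k (proj V) > 0" if "k \<ge> 0" "k * d < 1" for k
  proof -
    have "1 - d\<^sup>2 \<le> sqrt (1 - d\<^sup>2)"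
      using d2 by (intro real_le_rsqrt) (simp add: power2_eq_square mult_left_le_one_le)
    then have "k * (1 - d\<^sup>2) \<le> k * sqrt (1 - d\<^sup>2)" using that by (intro mult_left_mono)
    moreover have "(k * d) * d < 1 * d" using that d by (intro mult_strict_right_mono)
    ultimately have "- k + d + k * sqrt (1 - d\<^sup>2) > 0" by (simp add: power2_eq_square algebra_simps)
    moreover have "gfun (k *\<^sub>R X + n) k (proj V) = (- k + d + k * sqrt (1 - d\<^sup>2)) / snd V"
      using s d2 V by (simp add: gfun_def mink_lift_proj mink_linear lor_proj add_divide_distrib diff_divide_distrib)
    ultimately show ?thesis using s by simp
  qed
  from that[OF p this[OF k(1) kd(1)] this[OF k(2) kd(2)]] show ?thesis .
qed

text \<open>The gradient of \<open>gfun\<close> at g 0 in the chart is the first component of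
  \<open>P - (k / lor (g 0)) *\<^sub>R lift (g 0)\<close>, so this is the equation of the curve
  differentiated at 0.\<close>

lemma curve_tangent_normal:
  assumes g: "range g \<subseteq> {x \<in> hyp_plane. gfun P k x = 0}" "(g has_vector_derivative u) (at 0)"
  shows "fst (P - (k / lor (g 0)) *\<^sub>R lift (g 0)) \<bullet> u = 0"
proof -
  have h: "g s \<in> hyp_plane" "gfun P k (g s) = 0" for s using g(1) by auto
  have l: "1 - g 0 \<bullet> g 0 > 0" using h(1)[of 0] by (simp add: hyp_plane_iff)
  have gd: "(g has_derivative (\<lambda>s. s *\<^sub>R u)) (at 0)" using g(2) by (simp add: has_vector_derivative_def)
  have "((\<lambda>s. fst P \<bullet> g s - snd P + k * sqrt (1 - g s \<bullet> g s)) has_derivative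
     (\<lambda>s. s * (fst P \<bullet> u) - k * (s * (2 * (g 0 \<bullet> u))) / (2 * sqrt (1 - g 0 \<bullet> g 0)))) (at 0)"
    using l by (auto intro!: derivative_eq_intros gd simp: inner_commute algebra_simps fun_eq_iff)
      (simp add: divide_inverse)
  moreover have "(\<lambda>s. fst P \<bullet> g s - snd P + k * sqrt (1 - g s \<bullet> g s)) = (\<lambda>s. 0)"
    using h(2) by (simp add: gfun_def mink_def lor_def fun_eq_iff)
  ultimately have "((\<lambda>s. 0::real) has_derivative
     (\<lambda>s. s * (fst P \<bullet> u) - k * (s * (2 * (g 0 \<bullet> u))) / (2 * sqrt (1 - g 0 \<bullet> g 0)))) (at 0)" by simp
  then have "(\<lambda>s. s * (fst P \<bullet> u) - k * (s * (2 * (g 0 \<bullet> u))) / (2 * sqrt (1 - g 0 \<bullet> g 0))) = (\<lambda>s. 0)"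
    by (rule has_derivative_unique) (rule has_derivative_const)
  from fun_cong[OF this, of 1] show ?thesis
    by (simp add: lor_def inner_diff_left)
qed

text \<open>The unit normals of all geodesics ending at the ideal point t form two lines parallel to
  \<open>lift t\<close>. The sign y tells them apart: it is the orientation of the normal as seen
  from t.\<close>

lemma vector_in_tangent_line:
  assumes "t \<bullet> t = 1" "mink P (lift t) = 0" "mink P P = 1"
  obtains y where "y = 1 \<or> y = -1" "P = y *\<^sub>R (\<i> * t, 0) + snd P *\<^sub>R lift t"
proof -
  obtain a b where t: "t = Complex a b" by (cases t)
  obtain p q r where P: "P = (Complex p q, r)" by (metis complex.exhaust surj_pair)
  have ab: "a * a + b * b = 1" using assms(1) by (simp add: t inner_complex_def)
  have r: "r = p * a + q * b" using assms(2) by (simp add: P t mink_def inner_complex_def)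
  define y where "y = a * q - b * p"
  have "y * y = (p * p + q * q) * (a * a + b * b) - r * r" by (simp add: y_def r algebra_simps)
  also have "\<dots> = 1" using assms(3) ab by (simp add: P mink_def inner_complex_def)
  finally have y1: "y = 1 \<or> y = -1" by (simp add: square_eq_1_iff)
  have "- (y * b) + r * a = p * (a * a + b * b)" "y * a + r * b = q * (a * a + b * b)"
    by (simp_all add: y_def r algebra_simps)
  then have "P = y *\<^sub>R (\<i> * t, 0) + snd P *\<^sub>R lift t"
    using ab by (simp add: P t lift_def complex_eq_iff)
  with y1 show ?thesis by (rule that)
qed

text \<open>At an ordinary tangency point the common velocity forces the unit normals to be equal or
  opposite, and equal normals would make the sides overlap. At an ideal one, equal orientation would
  nest the half-planes; for opposite orientation the sign of \<mu> separates disjoint from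
  overlapping half-planes.\<close>

lemma rep_of_externally_tangent:
  assumes r: "rep c1 P1" "rep c2 P2" and t: "externally_tangent_at c1 c2 t"
  obtains \<mu> where "\<mu> > 0" "P1 + P2 = \<mu> *\<^sub>R lift t" "mink P1 P2 = - 1 - curv c1 * curv c2"
proof -
  define k1 k2 where "k1 = curv c1" and "k2 = curv c2"
  have c: "curve c1 = {x \<in> hyp_plane. gfun P1 k1 x = 0}" "curve c2 = {x \<in> hyp_plane. gfun P2 k2 x = 0}"
    "side c1 = {x \<in> hyp_plane. gfun P1 k1 x \<ge> 0}" "side c2 = {x \<in> hyp_plane. gfun P2 k2 x \<ge> 0}"
    and k: "k1 \<ge> 0" "k2 \<ge> 0" and P: "mink P1 P1 = 1 - k1\<^sup>2" "mink P2 P2 = 1 - k2\<^sup>2"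
    using r by (auto simp: rep_def k1_def k2_def)
  have no: "\<not> (gfun P1 k1 x > 0 \<and> gfun P2 k2 x > 0)" if "x \<in> hyp_plane" for x
    using sides_overlap[OF r that] t unfolding externally_tangent_at_def k1_def k2_def by blast
  show ?thesis
  proof (cases "k1 = 0 \<and> k2 = 0")
    case False
    then have th: "t \<in> hyp_plane" and tc: "tangent_curves_at (curve c1) (curve c2) t"
      using t unfolding externally_tangent_at_def k1_def k2_def by auto
    obtain g h u where g: "range g \<subseteq> curve c1" "range h \<subseteq> curve c2" "g 0 = t" "h 0 = t" "u \<noteq> 0"
      "(g has_vector_derivative u) (at 0)" "(h has_vector_derivative u) (at 0)"
      using tc unfolding tangent_curves_at_def by blast
    define X where "X = (1 / lor t) *\<^sub>R lift t"
    note lt = lor_pos[OF th]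
    have X: "mink X X = -1" "snd X > 0"
      using lt by (simp_all add: X_def mink_linear mink_lift_self[OF th] power2_eq_square)
    have "t \<in> curve c1" "t \<in> curve c2" using g(1-4) by (metis range_subsetD)+
    then have PX: "mink P1 X = - k1" "mink P2 X = - k2"
      using lt by (simp_all add: c gfun_def X_def mink_linear field_simps)
    define n1 n2 where "n1 = P1 - k1 *\<^sub>R X" and "n2 = P2 - k2 *\<^sub>R X"
    have u: "fst n1 \<bullet> u = 0" "fst n2 \<bullet> u = 0"
      using curve_tangent_normal[OF g(1)[unfolded c] g(6)] curve_tangent_normal[OF g(2)[unfolded c] g(7)]
      by (simp_all add: n1_def n2_def X_def g(3,4))
    have n: "mink n1 n1 = 1" "mink n2 n2 = 1" "mink X n1 = 0" "mink X n2 = 0"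
      using PX X(1) P by (simp_all add: n1_def n2_def mink_linear mink_commute[of X P1] mink_commute[of X P2] power2_eq_square)
    have sn: "snd n = fst n \<bullet> t" if "mink X n = 0" for n
      using that lt by (simp add: X_def mink_linear) (simp add: mink_def inner_commute)
    have "fst n1 \<noteq> 0" using sn[OF n(3)] n(1) by (auto simp: mink_def)
    moreover have "Re (fst n2) * Im (fst n1) = Im (fst n2) * Re (fst n1)"
    proof (cases "Re u = 0")
      case True
      then have "Im u \<noteq> 0" using g(5) by (simp add: complex_eq_iff)
      then show ?thesis using u True by (simp add: inner_complex_def)
    next
      case False
      have "Re u * (Re (fst n2) * Im (fst n1) - Im (fst n2) * Re (fst n1)) = 0"
        using u unfolding inner_complex_def by algebra
      then show ?thesis using False by simp
    qed
    ultimately obtain l where l: "fst n2 = l *\<^sub>R fst n1" using complex_parallel by metis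
    then have n2: "n2 = l *\<^sub>R n1" using sn[OF n(3)] sn[OF n(4)] by (simp add: prod_eq_iff)
    then have "l * l = 1" using n by (simp add: mink_linear)
    then have "l = 1 \<or> l = -1" by (simp add: square_eq_1_iff)
    moreover have "l \<noteq> 1"
    proof
      assume "l = 1"
      then have "P1 = k1 *\<^sub>R X + n1" "P2 = k2 *\<^sub>R X + n1" using n2 by (simp_all add: n1_def n2_def algebra_simps)
      then show False using common_inner_point[OF X n(1,3) k] no by metis
    qed
    ultimately have "n2 = - n1" using n2 by simp
    then have s: "P1 = k1 *\<^sub>R X + n1" "P2 = k2 *\<^sub>R X - n1" by (simp_all add: n1_def n2_def algebra_simps)
    show ?thesis
    proof (rule that)
      show "(k1 + k2) / lor t > 0" using False k lt by auto
      show "P1 + P2 = ((k1 + k2) / lor t) *\<^sub>R lift t" using s by (simp add: X_def add_divide_distrib scaleR_add_left)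
      show "mink P1 P2 = - 1 - curv c1 * curv c2"
        unfolding s k1_def[symmetric] k2_def[symmetric]
        using n X by (simp add: mink_linear mink_commute[of n1 X])
    qed
  next
    case True
    then have k0: "k1 = 0" "k2 = 0" by auto
    then have tt: "t \<bullet> t = 1" and ne: "curve c1 \<noteq> curve c2" and tcl: "t \<in> closure (curve c1)" "t \<in> closure (curve c2)"
      using t unfolding externally_tangent_at_def k1_def k2_def by (auto simp: ideal_boundary_iff)
    have "mink P (lift t) = 0" if "t \<in> closure {x \<in> hyp_plane. gfun P 0 x = 0}" for P
    proof -
      have "closed {x. mink P (lift x) = 0}"
        by (intro closed_Collect_eq continuous_intros)
      then have "closure {x \<in> hyp_plane. gfun P 0 x = 0} \<subseteq> {x. mink P (lift x) = 0}"
        by (intro closure_minimal) (auto simp: gfun_def)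
      then show ?thesis using that by auto
    qed
    then have Pt: "mink P1 (lift t) = 0" "mink P2 (lift t) = 0" using tcl unfolding c k0 by auto
    have P': "mink P1 P1 = 1" "mink P2 P2 = 1" using P k0 by simp_all
    obtain y1 where y1: "y1 = 1 \<or> y1 = -1" "P1 = y1 *\<^sub>R (\<i> * t, 0) + snd P1 *\<^sub>R lift t"
      using vector_in_tangent_line[OF tt Pt(1) P'(1)] .
    obtain y2 where y2: "y2 = 1 \<or> y2 = -1" "P2 = y2 *\<^sub>R (\<i> * t, 0) + snd P2 *\<^sub>R lift t"
      using vector_in_tangent_line[OF tt Pt(2) P'(2)] .
    have lneg: "mink (lift t) (lift x) < 0" if "x \<in> hyp_plane" for x
    proof -
      have "mink (lift x) (lift t) < 0"
        by (rule mink_future_neg[OF future_lift future_lift]) (use that tt in \<open>auto simp: hyp_plane_iff mink_lift\<close>)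
      then show ?thesis by (simp add: mink_commute)
    qed
    obtain z1 where z1: "z1 \<in> hyp_plane" "gfun P1 k1 z1 > 0" using gfun_pos_nonempty[OF k(1) _ P(1)] k0 by auto
    obtain z2 where z2: "z2 \<in> hyp_plane" "gfun P2 k2 z2 > 0" using gfun_pos_nonempty[OF k(2) _ P(2)] k0 by auto
    have "y1 \<noteq> y2"
    proof
      assume "y1 = y2"
      then have d: "P2 = P1 + (snd P2 - snd P1) *\<^sub>R lift t"
        by (subst y1(2), subst y2(2)) (simp add: algebra_simps)
      define a where "a = snd P2 - snd P1"
      have g: "gfun P2 0 x = gfun P1 0 x + a * mink (lift t) (lift x)" for x
        by (subst d) (simp add: gfun_def mink_linear a_def)
      show False
      proof (cases "a \<le> 0")
        case True
        have "0 \<le> a * mink (lift t) (lift z1)" using True lneg[OF z1(1)] by (simp add: mult_nonpos_nonpos)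
        then show False using no[OF z1(1)] z1(2) g[of z1] by (simp add: k0)
      next
        case False
        have "a * mink (lift t) (lift z2) \<le> 0" using False lneg[OF z2(1)] by (simp add: mult_nonneg_nonpos)
        then show False using no[OF z2(1)] z2(2) g[of z2] by (simp add: k0)
      qed
    qed
    then have yy: "y2 = - y1" using y1(1) y2(1) by auto
    define \<mu> where "\<mu> = snd P1 + snd P2"
    have s: "P1 + P2 = \<mu> *\<^sub>R lift t"
      using y1(2) y2(2) unfolding yy \<mu>_def by (metis (no_types, lifting) add.assoc add.commute add.left_commute add_cancel_left_right add_uminus_conv_diff diff_add_cancel scaleR_left.add scaleR_minus_left)
    have g: "gfun P1 0 x + gfun P2 0 x = \<mu> * mink (lift t) (lift x)" for x
      using gfun_add[of P1 0 x P2 0] unfolding s by (simp add: mink_linear)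
    have "\<mu> \<noteq> 0"
    proof
      assume "\<mu> = 0"
      then have "gfun P1 0 x = - gfun P2 0 x" for x using g[of x] by simp
      then show False using ne unfolding c k0 by simp
    qed
    moreover have "\<not> \<mu> < 0"
    proof
      assume "\<mu> < 0"
      obtain x where x: "x \<in> hyp_plane" "gfun P1 0 x = 0"
        using curve_nonempty_connected(1)[OF k(1) _ P(1)] k0 by auto
      have gx: "gfun P2 0 x > 0" using g[of x] x mult_neg_neg[OF \<open>\<mu> < 0\<close> lneg[OF x(1)]] by simp
      \<comment> \<open>The weight of a point between x and z1 that is so close to x that the second
        function stays positive. For curvature 0 the functions are affine, so the weight can be
        written down.\<close>
      define e where "e = gfun P2 0 x / (gfun P2 0 x + \<bar>gfun P2 0 z1\<bar> + 1)"
      have e: "0 < e" "e < 1" using gx by (auto simp: e_def)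
      define w where "w = (1 - e) *\<^sub>R x + e *\<^sub>R z1"
      have wh: "w \<in> hyp_plane"
        using e x(1) z1(1) convex_ball[of "0::complex" 1] unfolding w_def hyp_plane_def convex_alt by simp
      have gl: "gfun P 0 w = (1 - e) * gfun P 0 x + e * gfun P 0 z1" for P
        by (simp add: w_def gfun_def lift_affine mink_linear)
      have "gfun P1 0 w > 0" using gl[of P1] x z1 e by (simp add: k0)
      moreover have "gfun P2 0 w > 0"
      proof -
        define N where "N = gfun P2 0 x + \<bar>gfun P2 0 z1\<bar> + 1"
        have N: "N > 0" using gx by (simp add: N_def)
        have "0 < gfun P2 0 x * (N - gfun P2 0 x + gfun P2 0 z1) / N"
          using gx N by (intro divide_pos_pos mult_pos_pos) (auto simp: N_def)
        also have "\<dots> = gfun P2 0 w" using N unfolding gl e_def N_def[symmetric] by (simp add: field_simps)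
        finally show ?thesis .
      qed
      ultimately show False using no[OF wh] by (simp add: k0)
    qed
    moreover have "mink P1 P2 = -1"
    proof -
      have "mink (P1 + P2) (P1 + P2) = 0" unfolding s by (simp add: mink_linear mink_lift tt)
      then show ?thesis using P' by (simp add: mink_linear mink_commute[of P2 P1])
    qed
    ultimately show ?thesis
      using that[of \<mu>] s k0 by (simp add: k1_def k2_def)
  qed
qed

section \<open>Edges of a circle packed triangle\<close>

text \<open>\<open>foot k1 P1 k2 P2\<close> spans the end, at the center of the first circle, of the edge joining the
  centers: for \<open>k1 < 1\<close> it is the vector of the plane of \<open>P1\<close> and \<open>P2\<close> orthogonal to \<open>P1\<close>.\<close>

definition foot :: "real \<Rightarrow> mvec \<Rightarrow> real \<Rightarrow> mvec \<Rightarrow> mvec" where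
  "foot k1 P1 k2 P2 = (if k1 < 1 then (1 + k1 * k2) *\<^sub>R P1 + (1 - k1\<^sup>2) *\<^sub>R P2 else P1)"

text \<open>The algebraic content of external tangency. \<open>f1\<close> and \<open>f2\<close> put
  the vector of a circle with a point as center into the future half of the light cone, and \<mu> >
  0 does the same for the tangency point.\<close>

locale tangent_pair =
  fixes P1 P2 :: mvec and k1 k2 \<mu> :: real and t :: complex
  assumes P11: "mink P1 P1 = 1 - k1\<^sup>2" and P22: "mink P2 P2 = 1 - k2\<^sup>2"
    and P12: "mink P1 P2 = - 1 - k1 * k2" and k1: "k1 \<ge> 0" and k2: "k2 \<ge> 0"
    and f1: "k1 \<ge> 1 \<Longrightarrow> snd P1 > 0" and f2: "k2 \<ge> 1 \<Longrightarrow> snd P2 > 0"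
    and sum: "P1 + P2 = \<mu> *\<^sub>R lift t" and \<mu>: "\<mu> > 0"
begin

lemma P21: "mink P2 P1 = - 1 - k1 * k2"
  using P12 by (simp add: mink_commute)

lemma swap: "tangent_pair P2 P1 k2 k1 \<mu> t"
  using P11 P22 P12 k1 k2 f1 f2 sum \<mu>
  by unfold_locales (auto simp: add.commute mink_commute mult.commute)

lemma foot_orth: "k1 < 1 \<Longrightarrow> mink (foot k1 P1 k2 P2) P1 = 0" "k1 < 1 \<Longrightarrow> mink P1 (foot k1 P1 k2 P2) = 0"
  by (simp_all add: foot_def mink_linear P11 P21 P12 power2_eq_square algebra_simps)

lemma foot_square: "k1 < 1 \<Longrightarrow> mink (foot k1 P1 k2 P2) (foot k1 P1 k2 P2) = - (1 - k1\<^sup>2) * (k1 + k2)\<^sup>2"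
  by (simp add: foot_def mink_linear P11 P12 P21 P22 power2_eq_square algebra_simps)

lemma k1_sq: "k1 < 1 \<Longrightarrow> 0 < 1 - k1\<^sup>2"
  using k1 by (simp add: power_less_one_iff)

text \<open>For k1 < 1 the sign comes from pairing with the future vector P1 + P2. If both
  curvatures vanish that product is 0, but then the foot is P1 + P2 itself.\<close>

lemma foot_snd: "snd (foot k1 P1 k2 P2) > 0"
proof (cases "k1 < 1")
  case False
  then show ?thesis using f1 by (simp add: foot_def)
next
  case True
  note q = k1_sq[OF True]
  show ?thesis
  proof (cases "k1 + k2 = 0")
    case True
    then have "k1 = 0" "k2 = 0" using k1 k2 by auto
    then have "foot k1 P1 k2 P2 = P1 + P2" by (simp add: foot_def)
    then show ?thesis using sum \<mu> by simp
  next
    case False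
    then have kp: "(k1 + k2)\<^sup>2 > 0" by simp
    have "mink (P1 + P2) (P1 + P2) = - (k1 + k2)\<^sup>2"
      by (simp add: mink_linear P11 P12 P21 P22 power2_eq_square algebra_simps)
    then have fu: "future (P1 + P2)" unfolding future_def sum using \<mu> kp by simp
    have "mink (P1 + P2) (foot k1 P1 k2 P2) = - (k1 + k2)\<^sup>2"
      using True by (simp add: foot_def mink_linear P11 P12 P21 P22 power2_eq_square algebra_simps)
    moreover have "mink (foot k1 P1 k2 P2) (foot k1 P1 k2 P2) \<le> 0"
      unfolding foot_square[OF True] using q by (simp add: mult_nonpos_nonneg)
    ultimately have "future (foot k1 P1 k2 P2)"
      using future_of_mink_neg[OF fu] kp by simp
    then show ?thesis by (simp add: future_def)
  qed
qed

lemma foot_axis: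
  assumes "k1 < 1" "k1 + k2 > 0"
  shows "proj (foot k1 P1 k2 P2) \<in> hyp_axis P1"
proof -
  have "mink (foot k1 P1 k2 P2) (foot k1 P1 k2 P2) < 0"
    unfolding foot_square[OF assms(1)] using k1_sq[OF assms(1)] assms(2) by (simp add: mult_neg_pos)
  then show ?thesis
    using proj_in_hyp_plane[OF foot_snd] foot_snd foot_orth(2)[OF assms(1)] by (simp add: hyp_axis_def mink_lift_proj)
qed

text \<open>In the plane of P1 and P2 the cone over the edge is cut out by nonnegative coordinates
  and by the truncations at the axes; its extreme rays are the two feet. This places the tangency
  point on the edge and later identifies three sides of the polygon.\<close>

lemma cone_foot:
  assumes X: "X = x1 *\<^sub>R P1 + x2 *\<^sub>R P2" "x1 \<ge> 0" "x2 \<ge> 0"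
    and c: "k1 < 1 \<Longrightarrow> mink X P1 \<le> 0" "k2 < 1 \<Longrightarrow> mink X P2 \<le> 0"
  obtains a b where "a \<ge> 0" "b \<ge> 0" "X = a *\<^sub>R foot k1 P1 k2 P2 + b *\<^sub>R foot k2 P2 k1 P1"
proof -
  have XP: "mink X P1 = x1 * (1 - k1\<^sup>2) - x2 * (1 + k1 * k2)" "mink X P2 = x2 * (1 - k2\<^sup>2) - x1 * (1 + k1 * k2)"
    by (simp_all add: X mink_linear P11 P12 P21 P22 algebra_simps)
  have m: "1 + k1 * k2 > 0" using k1 k2 by (simp add: add_pos_nonneg)
  note q1 = k1_sq and q2 = tangent_pair.k1_sq[OF swap]
  consider "k1 \<ge> 1" "k2 \<ge> 1" | "k1 \<ge> 1" "k2 < 1" | "k1 < 1" "k2 \<ge> 1" | "k1 < 1" "k2 < 1" "k1 + k2 > 0" | "k1 = 0" "k2 = 0"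
    using k1 k2 by linarith
  then show ?thesis
  proof cases
    case 1
    then show ?thesis using that[of x1 x2] X by (simp add: foot_def)
  next
    case 2
    have "x2 * (1 - k2\<^sup>2) / (1 + k1 * k2) \<le> x1"
      using c(2) 2 m unfolding XP by (simp add: divide_le_eq algebra_simps)
    moreover have "(x2 * (1 - k2\<^sup>2) / (1 + k1 * k2)) *\<^sub>R P1 + x2 *\<^sub>R P2 = (x2 / (1 + k1 * k2)) *\<^sub>R foot k2 P2 k1 P1"
      using 2 m by (simp add: foot_def scaleR_add_right mult.commute[of k2])
    ultimately show ?thesis
      using 2 X m by (intro that[of "x1 - x2 * (1 - k2\<^sup>2) / (1 + k1 * k2)" "x2 / (1 + k1 * k2)"])
        (auto simp: foot_def scaleR_diff_left algebra_simps)
  next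
    case 3
    have "x1 * (1 - k1\<^sup>2) / (1 + k1 * k2) \<le> x2"
      using c(1) 3 m unfolding XP by (simp add: divide_le_eq algebra_simps)
    moreover have "(x1 * (1 - k1\<^sup>2) / (1 + k1 * k2)) *\<^sub>R P2 + x1 *\<^sub>R P1 = (x1 / (1 + k1 * k2)) *\<^sub>R foot k1 P1 k2 P2"
      using 3 m by (simp add: foot_def scaleR_add_right)
    ultimately show ?thesis
      using 3 X m by (intro that[of "x1 / (1 + k1 * k2)" "x2 - x1 * (1 - k1\<^sup>2) / (1 + k1 * k2)"])
        (auto simp: foot_def scaleR_diff_left algebra_simps)
  next
    case 4
    \<comment> \<open>d is the determinant of the change of basis from P1, P2 to the two
      feet.\<close>
    define d where "d = (k1 + k2)\<^sup>2"
    have d: "d > 0" "d = (1 + k1 * k2) * (1 + k1 * k2) - (1 - k1\<^sup>2) * (1 - k2\<^sup>2)"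
      using 4 by (simp add: d_def) (simp add: d_def power2_eq_square algebra_simps)
    have *: "(- mink X P2 / d) * (1 + k1 * k2) + (- mink X P1 / d) * (1 - k2\<^sup>2) = x1"
      "(- mink X P2 / d) * (1 - k1\<^sup>2) + (- mink X P1 / d) * (1 + k1 * k2) = x2"
    proof -
      have "(- mink X P2) * (1 + k1 * k2) + (- mink X P1) * (1 - k2\<^sup>2) = x1 * d"
        "(- mink X P2) * (1 - k1\<^sup>2) + (- mink X P1) * (1 + k1 * k2) = x2 * d"
        unfolding XP d(2) by algebra+
      then show "(- mink X P2 / d) * (1 + k1 * k2) + (- mink X P1 / d) * (1 - k2\<^sup>2) = x1"
        "(- mink X P2 / d) * (1 - k1\<^sup>2) + (- mink X P1 / d) * (1 + k1 * k2) = x2"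
        using d(1) by (simp_all add: divide_simps)
    qed
    define p q where "p = - mink X P2 / d" and "q = - mink X P1 / d"
    show ?thesis
    proof (rule that)
      show "p \<ge> 0" "q \<ge> 0" using c 4 d(1) by (simp_all add: p_def q_def divide_nonpos_pos)
      have "p *\<^sub>R foot k1 P1 k2 P2 + q *\<^sub>R foot k2 P2 k1 P1
        = (p * (1 + k1 * k2) + q * (1 - k2\<^sup>2)) *\<^sub>R P1 + (p * (1 - k1\<^sup>2) + q * (1 + k1 * k2)) *\<^sub>R P2"
        using 4 by (simp add: foot_def algebra_simps)
      then show "X = p *\<^sub>R foot k1 P1 k2 P2 + q *\<^sub>R foot k2 P2 k1 P1"
        unfolding *[folded p_def q_def] X(1) by simp
    qed
  next
    case 5
    then have "x1 = x2" using c unfolding XP by simp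
    then show ?thesis
      using that[of x1 0] X 5 by (simp add: foot_def scaleR_add_right)
  qed
qed

text \<open>In the Klein model a line is perpendicular to an axis iff it passes through the pole of
  the axis, here the projective point P1. So P1 + P2 is a combination of \<open>lift p\<close> and
  P1, and removing the P1 part leaves a multiple of \<open>lift p\<close> that is the foot.\<close>

lemma edge_end_unique:
  assumes r: "rep c1 P1" "rep c2 P2" "curv c1 = k1" "curv c2 = k2" and e: "edge_ends c1 c2 t p q"
  shows "p = proj (foot k1 P1 k2 P2)"
proof (cases "k1 = 0 \<and> k2 = 0")
  case True
  then have "p = t" using e r by (simp add: edge_ends_def)
  then show ?thesis using True sum \<mu> by (simp add: foot_def proj_scale)
next
  case False
  then have e': "t \<in> closed_segment p q" "perpendicular_end c1 p q" using e False r by (auto simp: edge_ends_def)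
  show ?thesis
  proof (cases "k1 < 1")
    case False
    then have "center c1 = {proj P1}" using r by (auto simp: rep_def)
    then show ?thesis using e'(2) False by (simp add: perpendicular_end_def foot_def)
  next
    case True
    then have "center c1 = hyp_axis P1" using r by (auto simp: rep_def)
    then have p: "p \<in> hyp_axis P1" and perp: "\<And>z. z \<in> hyp_axis P1 \<Longrightarrow> klein_metric p (z - p) (q - p) = 0"
      using e'(2) True r(3) by (auto simp: perpendicular_end_def)
    have ph: "p \<in> hyp_plane" "fst P1 \<bullet> p = snd P1" using p by (auto simp: hyp_axis_def mink_def)
    define w where "w = 1 - p \<bullet> p"
    have w: "w > 0" using ph by (simp add: w_def hyp_plane_iff)
    define n where "n = fst P1"
    have n0: "n \<noteq> 0" unfolding n_def using fst_spacelike[of P1] P11 k1_sq[OF True] by simp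
    define v where "v = q - p"
    obtain \<epsilon> where eps: "\<epsilon> > 0" "ball p \<epsilon> \<subseteq> hyp_plane"
      using open_hyp_plane ph(1) open_contains_ball by blast
    \<comment> \<open>The perpendicularity condition is tested on a single point z of the axis,
      close enough to p to stay in the disk.\<close>
    define \<delta> where "\<delta> = \<epsilon> / (2 * norm n)"
    have \<delta>: "\<delta> > 0" "\<delta> * norm n < \<epsilon>" using eps(1) n0 by (auto simp: \<delta>_def)
    define z where "z = p + \<delta> *\<^sub>R (\<i> * n)"
    have nin: "n \<bullet> (\<i> * n) = 0" by (simp add: inner_complex_def)
    have "dist p z < \<epsilon>" using \<delta> by (simp add: z_def dist_norm norm_mult)
    then have "z \<in> hyp_axis P1"
      using eps(2) ph(2) nin by (auto simp: hyp_axis_def mink_def z_def inner_add_right n_def)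
    then have "klein_metric p (\<delta> *\<^sub>R (\<i> * n)) v = 0" using perp by (force simp: z_def v_def)
    then have "\<delta> * (((\<i> * n) \<bullet> v) / w + (p \<bullet> (\<i> * n)) * (p \<bullet> v) / w\<^sup>2) = 0"
      by (simp add: klein_metric_def w_def algebra_simps)
    then have "((\<i> * n) \<bullet> v) / w + (p \<bullet> (\<i> * n)) * (p \<bullet> v) / w\<^sup>2 = 0" using \<delta>(1) by simp
    then have "((\<i> * n) \<bullet> v) * w + (p \<bullet> (\<i> * n)) * (p \<bullet> v) = 0"
      using w by (simp add: field_simps power2_eq_square)
    then have "(\<i> * n) \<bullet> (w *\<^sub>R v + (p \<bullet> v) *\<^sub>R p) = 0"
      by (simp add: inner_add_right inner_commute[of p "\<i> * n"] mult_ac)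
    then have "Re (w *\<^sub>R v + (p \<bullet> v) *\<^sub>R p) * Im n = Im (w *\<^sub>R v + (p \<bullet> v) *\<^sub>R p) * Re n"
      unfolding inner_complex_def[of "\<i> * n"] by (simp add: mult.commute)
    then obtain \<beta> where \<beta>: "w *\<^sub>R v + (p \<bullet> v) *\<^sub>R p = \<beta> *\<^sub>R n" using complex_parallel n0 by metis
    have "p \<bullet> (w *\<^sub>R v + (p \<bullet> v) *\<^sub>R p) = p \<bullet> v" by (simp add: inner_add_right w_def algebra_simps)
    then have pv: "p \<bullet> v = \<beta> * snd P1" unfolding \<beta> using ph(2) by (simp add: n_def inner_commute)
    define g where "g = \<beta> / w"
    have v: "v = g *\<^sub>R (n - snd P1 *\<^sub>R p)"
    proof -
      have "w *\<^sub>R v = \<beta> *\<^sub>R (n - snd P1 *\<^sub>R p)" using \<beta> pv by (simp add: algebra_simps)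
      then have "(1 / w) *\<^sub>R (w *\<^sub>R v) = (1 / w) *\<^sub>R (\<beta> *\<^sub>R (n - snd P1 *\<^sub>R p))" by simp
      then show ?thesis using w by (simp add: g_def)
    qed
    obtain u where u: "t = (1 - u) *\<^sub>R p + u *\<^sub>R q" using e'(1) by (auto simp: in_segment)
    then have "t = p + u *\<^sub>R v" by (simp add: v_def algebra_simps)
    then have lt: "lift t = (1 - u * g * snd P1) *\<^sub>R lift p + (u * g) *\<^sub>R P1"
      unfolding v by (simp add: lift_def prod_eq_iff n_def algebra_simps)
    define A B where "A = \<mu> * (1 - u * g * snd P1)" and "B = \<mu> * (u * g)"
    have AB: "P1 + P2 = A *\<^sub>R lift p + B *\<^sub>R P1"
      unfolding sum lt by (simp add: A_def B_def scaleR_add_right)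
    have "mink P1 (P1 + P2) = B * (1 - k1\<^sup>2)"
      unfolding AB using p P11 by (simp add: mink_linear hyp_axis_def)
    then have B: "B * (1 - k1\<^sup>2) = - k1 * (k1 + k2)"
      by (simp add: mink_linear P11 P12 power2_eq_square algebra_simps)
    have "(A * (1 - k1\<^sup>2)) *\<^sub>R lift p = (1 - k1\<^sup>2) *\<^sub>R (A *\<^sub>R lift p + B *\<^sub>R P1) - (B * (1 - k1\<^sup>2)) *\<^sub>R P1"
      by (simp add: algebra_simps)
    also have "\<dots> = foot k1 P1 k2 P2"
      unfolding AB[symmetric] B using True by (simp add: foot_def algebra_simps power2_eq_square)
    finally have f: "foot k1 P1 k2 P2 = (A * (1 - k1\<^sup>2)) *\<^sub>R lift p" by simp
    then have "A * (1 - k1\<^sup>2) \<noteq> 0" using foot_snd by force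
    then show ?thesis unfolding f by (simp add: proj_scale)
  qed
qed

text \<open>The two feet and P1 are linearly dependent, so the edge runs through the pole of the
  axis; in the Klein model this is perpendicularity.\<close>

lemma perpendicular_end_foot:
  assumes r: "rep c1 P1" "curv c1 = k1" and kp: "k1 + k2 > 0"
  shows "perpendicular_end c1 (proj (foot k1 P1 k2 P2)) (proj (foot k2 P2 k1 P1))"
proof (cases "k1 < 1")
  case False
  then show ?thesis using r by (simp add: perpendicular_end_def rep_def foot_def)
next
  case True
  let ?p = "proj (foot k1 P1 k2 P2)" and ?q = "proj (foot k2 P2 k1 P1)"
  note q = k1_sq[OF True]
  note s = foot_snd tangent_pair.foot_snd[OF swap]
  have p: "?p \<in> hyp_axis P1" by (rule foot_axis[OF True kp])
  then have ph: "?p \<in> hyp_plane" "fst P1 \<bullet> ?p = snd P1" by (auto simp: hyp_axis_def mink_def)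
  have "\<exists>a b. foot k2 P2 k1 P1 = a *\<^sub>R foot k1 P1 k2 P2 + b *\<^sub>R P1"
  proof -
    have P2: "P2 = (1 / (1 - k1\<^sup>2)) *\<^sub>R foot k1 P1 k2 P2 + (- (1 + k1 * k2) / (1 - k1\<^sup>2)) *\<^sub>R P1"
      using True q by (simp add: foot_def scaleR_add_right flip: scaleR_add_left add_divide_distrib)
    show ?thesis
    proof (cases "k2 < 1")
      case False
      then have "foot k2 P2 k1 P1 = P2" by (simp add: foot_def)
      then show ?thesis using P2 by metis
    next
      case True
      then have "foot k2 P2 k1 P1 = (1 + k2 * k1) *\<^sub>R P2 + (1 - k2\<^sup>2) *\<^sub>R P1" by (simp add: foot_def)
      also have "\<dots> = ((1 + k2 * k1) * (1 / (1 - k1\<^sup>2))) *\<^sub>R foot k1 P1 k2 P2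
          + ((1 + k2 * k1) * (- (1 + k1 * k2) / (1 - k1\<^sup>2)) + (1 - k2\<^sup>2)) *\<^sub>R P1"
        by (subst P2) (simp only: scaleR_add_right scaleR_add_left scaleR_scaleR add.assoc)
      finally show ?thesis by blast
    qed
  qed
  then obtain a b where ab: "foot k2 P2 k1 P1 = a *\<^sub>R foot k1 P1 k2 P2 + b *\<^sub>R P1" by blast
  define A B where "A = a * snd (foot k1 P1 k2 P2) / snd (foot k2 P2 k1 P1)" and "B = b / snd (foot k2 P2 k1 P1)"
  have "lift ?q = (1 / snd (foot k2 P2 k1 P1)) *\<^sub>R (a *\<^sub>R foot k1 P1 k2 P2 + b *\<^sub>R P1)"
    using s by (simp add: lift_proj ab[symmetric] divide_inverse)
  also have "foot k1 P1 k2 P2 = snd (foot k1 P1 k2 P2) *\<^sub>R lift ?p"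
    using s by (simp add: lift_proj)
  finally have lq: "lift ?q = A *\<^sub>R lift ?p + B *\<^sub>R P1"
    using s(1) by (simp add: A_def B_def scaleR_add_right)
  then have "A + B * snd P1 = 1" by (metis snd_add snd_scaleR lift_simps(2) mult.right_neutral real_scaleR_def)
  then have A: "A = 1 - B * snd P1" by simp
  have "?q = A *\<^sub>R ?p + B *\<^sub>R fst P1" using arg_cong[OF lq, of fst] by simp
  define m where "m = fst P1 - snd P1 *\<^sub>R ?p"
  have v: "?q - ?p = B *\<^sub>R m" unfolding \<open>?q = _\<close> m_def by (simp add: A algebra_simps)
  define w where "w = 1 - ?p \<bullet> ?p"
  have w: "w > 0" using ph by (simp add: w_def hyp_plane_iff)
  have "klein_metric ?p (z - ?p) (?q - ?p) = 0" if "z \<in> hyp_axis P1" for z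
  proof -
    have "fst P1 \<bullet> z = snd P1" using that by (simp add: hyp_axis_def mink_def)
    then have z: "(z - ?p) \<bullet> fst P1 = 0"
      using ph(2) by (simp add: inner_commute[of _ "fst P1"] inner_diff_right)
    have "?p \<bullet> m = snd P1 * w"
      unfolding m_def using ph(2) by (simp add: inner_diff_right w_def inner_commute algebra_simps)
    moreover have "(z - ?p) \<bullet> m = - snd P1 * (?p \<bullet> (z - ?p))"
      using z by (simp add: m_def inner_diff_right[of "z - ?p"] inner_commute)
    ultimately show ?thesis
      using w unfolding klein_metric_def v w_def[symmetric] by (simp add: power2_eq_square field_simps)
  qed
  then show ?thesis
    using p True r by (simp add: perpendicular_end_def rep_def)
qed

lemma edge_ends_foot:
  assumes r: "rep c1 P1" "rep c2 P2" "curv c1 = k1" "curv c2 = k2"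
  shows "edge_ends c1 c2 t (proj (foot k1 P1 k2 P2)) (proj (foot k2 P2 k1 P1))"
proof (cases "k1 = 0 \<and> k2 = 0")
  case True
  then have "foot k1 P1 k2 P2 = \<mu> *\<^sub>R lift t" "foot k2 P2 k1 P1 = \<mu> *\<^sub>R lift t"
    using sum by (simp_all add: foot_def add.commute)
  then show ?thesis using True r \<mu> by (simp add: edge_ends_def proj_scale)
next
  case False
  then have kp: "k1 + k2 > 0" using k1 k2 by auto
  let ?p = "proj (foot k1 P1 k2 P2)" and ?q = "proj (foot k2 P2 k1 P1)"
  note s = foot_snd tangent_pair.foot_snd[OF swap]
  have "mink (P1 + P2) P1 = - k1 * (k1 + k2)" "mink (P1 + P2) P2 = - k2 * (k1 + k2)"
    by (simp_all add: mink_linear P11 P12 P21 P22 power2_eq_square algebra_simps)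
  then have neg: "mink (P1 + P2) P1 \<le> 0" "mink (P1 + P2) P2 \<le> 0" using k1 k2 by simp_all
  obtain a b where ab: "a \<ge> 0" "b \<ge> 0" "P1 + P2 = a *\<^sub>R foot k1 P1 k2 P2 + b *\<^sub>R foot k2 P2 k1 P1"
    using cone_foot[of "P1 + P2" 1 1] neg by auto
  define A B where "A = a * snd (foot k1 P1 k2 P2) / \<mu>" and "B = b * snd (foot k2 P2 k1 P1) / \<mu>"
  have AB: "A \<ge> 0" "B \<ge> 0" using ab s \<mu> by (simp_all add: A_def B_def)
  have "lift t = (1 / \<mu>) *\<^sub>R (a *\<^sub>R foot k1 P1 k2 P2 + b *\<^sub>R foot k2 P2 k1 P1)"
    using \<mu> unfolding ab(3)[symmetric] sum by simp
  also have "\<dots> = A *\<^sub>R lift ?p + B *\<^sub>R lift ?q"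
  proof -
    have f: "snd (foot k1 P1 k2 P2) *\<^sub>R lift ?p = foot k1 P1 k2 P2" "snd (foot k2 P2 k1 P1) *\<^sub>R lift ?q = foot k2 P2 k1 P1"
      using s by (simp_all add: lift_proj)
    have "A *\<^sub>R lift ?p = (a / \<mu>) *\<^sub>R (snd (foot k1 P1 k2 P2) *\<^sub>R lift ?p)"
      "B *\<^sub>R lift ?q = (b / \<mu>) *\<^sub>R (snd (foot k2 P2 k1 P1) *\<^sub>R lift ?q)"
      by (simp_all add: A_def B_def)
    then show ?thesis unfolding f by (simp add: scaleR_add_right)
  qed
  finally have lt: "lift t = A *\<^sub>R lift ?p + B *\<^sub>R lift ?q" .
  have 1: "A + B = 1" using arg_cong[OF lt, of snd] by simp
  have "t = A *\<^sub>R ?p + B *\<^sub>R ?q" using arg_cong[OF lt, of fst] by simp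
  then have "t \<in> closed_segment ?p ?q"
    using 1 AB unfolding in_segment by (intro exI[of _ B]) auto
  then show ?thesis
    unfolding edge_ends_def using False r perpendicular_end_foot[OF r(1,3) kp]
      tangent_pair.perpendicular_end_foot[OF swap r(2,4)] kp by auto
qed

end

section \<open>Length of the arc\<close>

text \<open>The hyperbolic length of an arc of curvature k from parameter 0 to 1 / sqrt D; the
  integrand is the speed of \<open>curve_vec\<close>. For a triangle D is 1 + k1 k2 + k2 k3 + k3
  k1.\<close>

definition arc_len :: "real \<Rightarrow> real \<Rightarrow> real" where
  "arc_len k D = integral {0..1 / sqrt D} (\<lambda>u. 2 / (1 + (k\<^sup>2 - 1) * u\<^sup>2))"

text \<open>The metric in homogeneous coordinates: the right-hand side is unchanged when V and V'
  are rescaled together and ignores the component of V' along V. W is the velocity u regarded as a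
  vector of height 0.\<close>

lemma klein_metric_proj_deriv:
  fixes V V' :: mvec
  assumes "snd V > 0" "mink V V < 0"
  defines "u \<equiv> fst V' /\<^sub>R snd V - (snd V' / (snd V)\<^sup>2) *\<^sub>R fst V"
  shows "klein_metric (proj V) u u = ((mink V V')\<^sup>2 - mink V V * mink V' V') / (mink V V)\<^sup>2"
proof -
  define s c where "s = snd V" and "c = snd V' / (snd V)\<^sup>2"
  have s: "s > 0" using assms by (simp add: s_def)
  define W :: mvec where "W = (1 / s) *\<^sub>R V' - c *\<^sub>R V"
  have W: "fst W = u" "snd W = 0"
    using s by (simp_all add: W_def u_def s_def c_def divide_inverse power2_eq_square)
  have L: "lift (proj V) = (1 / s) *\<^sub>R V" using s by (simp add: lift_proj s_def divide_inverse)
  define a b d where "a = mink V V" and "b = mink V V'" and "d = mink V' V'"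
  have LL: "1 - proj V \<bullet> proj V = - a / s\<^sup>2"
    using mink_lift[of "proj V" "proj V"] unfolding L by (simp add: mink_linear a_def power2_eq_square)
  have LW: "proj V \<bullet> u = b / s\<^sup>2 - c * a / s"
  proof -
    have "proj V \<bullet> u = mink (lift (proj V)) W" by (simp add: mink_def W)
    also have "\<dots> = b / s\<^sup>2 - c * a / s"
      unfolding L by (simp add: W_def mink_linear a_def b_def power2_eq_square right_diff_distrib)
    finally show ?thesis .
  qed
  have WW: "u \<bullet> u = d / s\<^sup>2 - 2 * c * b / s + c\<^sup>2 * a"
  proof -
    have "u \<bullet> u = mink W W" by (simp add: mink_def W)
    also have "\<dots> = d / s\<^sup>2 - 2 * c * b / s + c\<^sup>2 * a"
      by (simp add: W_def mink_linear a_def b_def d_def mink_commute[of V' V] power2_eq_square algebra_simps)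
    finally show ?thesis .
  qed
  have a: "a < 0" using assms by (simp add: a_def)
  have "klein_metric (proj V) u u = (b\<^sup>2 - a * d) / a\<^sup>2"
    unfolding klein_metric_def LL LW WW using s a by (simp add: field_simps power2_eq_square)
  then show ?thesis by (simp add: a_def b_def d_def)
qed

lemma curve_vec_speed:
  assumes f: "frame X n e" and q: "1 + (k\<^sup>2 - 1) * s\<^sup>2 > 0"
  obtains u where "((\<lambda>s. proj (curve_vec k X n e s)) has_vector_derivative u) (at s)"
    "klein_metric (proj (curve_vec k X n e s)) u u = (2 / (1 + (k\<^sup>2 - 1) * s\<^sup>2))\<^sup>2"
proof -
  let ?V = "curve_vec k X n e s" and ?q = "1 + (k\<^sup>2 - 1) * s\<^sup>2"
  define V' where "V' = (4 * k * s) *\<^sub>R n + 2 *\<^sub>R e + (2 * (1 + k\<^sup>2) * s) *\<^sub>R X"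
  note sp = curve_vec_point(1)[OF f q]
  have VV: "mink ?V ?V = - ?q\<^sup>2" by (rule curve_vec_mink(1)[OF f])
  have neg: "mink ?V ?V < 0" using VV q by simp
  define u where "u = fst V' /\<^sub>R snd ?V - (snd V' / (snd ?V)\<^sup>2) *\<^sub>R fst ?V"
  have d: "((\<lambda>s. proj (curve_vec k X n e s)) has_vector_derivative u) (at s)"
    unfolding u_def V'_def using sp by (intro proj_has_vector_derivative curve_vec_has_vector_derivative) auto
  have VV': "mink ?V V' = - ?q * (2 * (k\<^sup>2 - 1) * s)"
    unfolding V'_def curve_vec_def
    by (simp add: mink_linear frame_cong[OF f]) (simp add: power2_eq_square algebra_simps)
  have V'V': "mink V' V' = 4 - 4 * s\<^sup>2 * (k\<^sup>2 - 1)\<^sup>2"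
    unfolding V'_def
    by (simp add: mink_linear frame_cong[OF f]) (simp add: power2_eq_square algebra_simps)
  have "klein_metric (proj ?V) u u = ((mink ?V V')\<^sup>2 - mink ?V ?V * mink V' V') / (mink ?V ?V)\<^sup>2"
    unfolding u_def by (rule klein_metric_proj_deriv[OF sp neg])
  also have "(mink ?V V')\<^sup>2 - mink ?V ?V * mink V' V' = 4 * ?q\<^sup>2"
    unfolding VV VV' V'V' by (simp add: power2_eq_square algebra_simps)
  also have "4 * ?q\<^sup>2 / (mink ?V ?V)\<^sup>2 = (2 / ?q)\<^sup>2"
    unfolding VV using q by (simp add: power2_eq_square)
  finally show ?thesis using d that by blast
qed

text \<open>The parameter of \<open>curve_vec\<close> as a function of the point.\<close>

definition curve_den :: "real \<Rightarrow> mvec \<Rightarrow> mvec \<Rightarrow> complex \<Rightarrow> real" where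
  "curve_den k X n z = - 2 * mink (lift z) X - (k + 1 / k) * mink (lift z) n"

definition curve_param :: "real \<Rightarrow> mvec \<Rightarrow> mvec \<Rightarrow> mvec \<Rightarrow> complex \<Rightarrow> real" where
  "curve_param k X n e z = mink (lift z) e / curve_den k X n z"

lemma frame_expand:
  assumes "frame X n e"
  shows "Z = mink Z n *\<^sub>R n + mink Z e *\<^sub>R e - mink Z X *\<^sub>R X"
proof -
  have "(det3 X n e)\<^sup>2 = 1" unfolding gram_det by (simp add: frame_cong[OF assms])
  then have "det3 X n e \<noteq> 0" by auto
  then have "Z - (mink Z n *\<^sub>R n + mink Z e *\<^sub>R e - mink Z X *\<^sub>R X) = 0"
    by (rule mink_eq_0_basis) (simp_all add: mink_linear frame_cong[OF assms])
  then show ?thesis by simp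
qed

text \<open>x, y and c are the frame coordinates of the hyperboloid point of z, and c is the
  hyperbolic cosine of its distance from X. On the curve everything except the sign of y is a
  function of c. \<open>curve_den\<close> can vanish there only at the point opposite to X, which
  exists for k > 1.\<close>

lemma curve_point_coords:
  assumes f: "frame X n e" and k: "k > 0" and z: "z \<in> hyp_plane" "gfun (k *\<^sub>R X + n) k z = 0"
  defines "x \<equiv> mink (lift z) n / lor z" and "y \<equiv> mink (lift z) e / lor z" and "c \<equiv> - mink (lift z) X / lor z"
  shows "x = k * (c - 1)" "c \<ge> 1" "y\<^sup>2 = (c - 1) * (2 + (1 - k\<^sup>2) * (c - 1))"
    "curve_den k X n z = lor z * (2 + (1 - k\<^sup>2) * (c - 1))"
    "lift z = lor z *\<^sub>R (x *\<^sub>R n + y *\<^sub>R e + c *\<^sub>R X)"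
proof -
  note l = lor_pos[OF z(1)]
  have m: "mink (lift z) n = lor z * x" "mink (lift z) e = lor z * y" "mink (lift z) X = - lor z * c"
    using l by (simp_all add: x_def y_def c_def)
  have "lor z * (k * (- c) + x + k) = 0"
    using z(2) by (simp add: gfun_def mink_linear mink_commute[of _ "lift z"] m algebra_simps)
  then have "k * (- c) + x + k = 0" using l by simp
  then show x: "x = k * (c - 1)" by (simp add: algebra_simps)
  show lz: "lift z = lor z *\<^sub>R (x *\<^sub>R n + y *\<^sub>R e + c *\<^sub>R X)"
    using frame_expand[OF f, of "lift z"] unfolding m by (simp add: scaleR_add_right)
  have "mink (lift z) (lift z) = (lor z)\<^sup>2 * (x\<^sup>2 + y\<^sup>2 - c\<^sup>2)"
    by (subst (1 2) lz) (simp add: mink_linear frame_cong[OF f] power2_eq_square algebra_simps)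
  then have "(lor z)\<^sup>2 * (x\<^sup>2 + y\<^sup>2 - c\<^sup>2 + 1) = 0" unfolding mink_lift_self[OF z(1)] by (simp add: algebra_simps)
  then have u: "x\<^sup>2 + y\<^sup>2 - c\<^sup>2 = -1" using l by simp
  show y: "y\<^sup>2 = (c - 1) * (2 + (1 - k\<^sup>2) * (c - 1))"
    using u unfolding x by (simp add: power2_eq_square algebra_simps)
  have fX: "mink X X < 0" "future X" using frame_cong[OF f] by (auto simp: future_def)
  have "mink X (lift z) < 0"
    by (rule mink_future_neg[OF fX(2) future_lift fX(1)]) (use z(1) in \<open>auto simp: hyp_plane_iff\<close>)
  then have "c > 0" using l by (simp add: c_def mink_commute[of X] divide_neg_pos)
  moreover have "c\<^sup>2 \<ge> 1\<^sup>2" using u by (smt (verit) one_power2 zero_le_power2)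
  ultimately show "c \<ge> 1" by (smt (verit) power2_le_imp_le)
  show "curve_den k X n z = lor z * (2 + (1 - k\<^sup>2) * (c - 1))"
    unfolding curve_den_def m x using k by (simp add: field_simps power2_eq_square)
qed

text \<open>Away from the opposite point, stereographic projection inverts \<open>curve_vec\<close>.
  The identity behind it is s^2 d = c - 1 for s = y / d.\<close>

lemma curve_param_point:
  assumes f: "frame X n e" and k: "k > 0" and z: "z \<in> hyp_plane" "gfun (k *\<^sub>R X + n) k z = 0"
    and d: "curve_den k X n z > 0"
  shows "1 + (k\<^sup>2 - 1) * (curve_param k X n e z)\<^sup>2 > 0"
    "z = proj (curve_vec k X n e (curve_param k X n e z))"
    "curve_param k X n e z = 0 \<longleftrightarrow> z = proj X"
proof -
  define x y c where "x = mink (lift z) n / lor z" and "y = mink (lift z) e / lor z" and "c = - mink (lift z) X / lor z"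
  note cc = curve_point_coords[OF f k z, folded x_def y_def c_def]
  note l = lor_pos[OF z(1)]
  define d where "d = 2 + (1 - k\<^sup>2) * (c - 1)"
  have d0: "d > 0" using assms(5) l unfolding cc(4) d_def by (simp add: zero_less_mult_iff)
  define s where "s = curve_param k X n e z"
  have s: "s = y / d" unfolding s_def curve_param_def cc(4) using l by (simp add: y_def d_def)
  have s2: "s\<^sup>2 * d = c - 1"
    using d0 cc(3) unfolding s d_def[symmetric] by (simp add: power_divide power2_eq_square)
  have dq: "d * (1 + (k\<^sup>2 - 1) * s\<^sup>2) = 2"
  proof -
    have "d * (1 + (k\<^sup>2 - 1) * s\<^sup>2) = d + (k\<^sup>2 - 1) * (s\<^sup>2 * d)" by (simp add: algebra_simps)
    then show ?thesis unfolding s2 by (simp add: d_def algebra_simps)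
  qed
  then show "1 + (k\<^sup>2 - 1) * (curve_param k X n e z)\<^sup>2 > 0"
    unfolding s_def[symmetric] using d0 by (metis zero_less_mult_pos zero_less_numeral)
  have yd: "y = s * d" using s d0 by simp
  have "lift z = (lor z * d / 2) *\<^sub>R curve_vec k X n e s"
  proof -
    have "(d / 2) *\<^sub>R curve_vec k X n e s = (k * (s\<^sup>2 * d)) *\<^sub>R n + (s * d) *\<^sub>R e + ((d + s\<^sup>2 * d + k\<^sup>2 * (s\<^sup>2 * d)) / 2) *\<^sub>R X"
      by (simp add: curve_vec_def scaleR_add_right algebra_simps add_divide_distrib)
    also have "\<dots> = x *\<^sub>R n + y *\<^sub>R e + c *\<^sub>R X"
      unfolding s2 yd[symmetric] cc(1) by (simp add: d_def algebra_simps)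
    finally show ?thesis using cc(5) by (metis scaleR_scaleR times_divide_eq_right)
  qed
  moreover have "lor z * d / 2 \<noteq> 0" using l d0 by simp
  ultimately show "z = proj (curve_vec k X n e (curve_param k X n e z))"
    unfolding s_def[symmetric] by (metis proj_lift proj_scale)
  then show "curve_param k X n e z = 0 \<longleftrightarrow> z = proj X"
    using frame_cong[OF f] by (auto simp: curve_vec_def curve_param_def lift_proj mink_linear)
qed

lemma curve_param_differentiable:
  assumes "(g has_vector_derivative v) (at \<tau>)" "curve_den k X n (g \<tau>) \<noteq> 0"
  shows "(\<lambda>\<tau>. curve_param k X n e (g \<tau>)) differentiable at \<tau>"
proof -
  have "g differentiable at \<tau>" using assms(1) by (auto simp: differentiable_def has_vector_derivative_def)
  then have "(\<lambda>\<tau>. mink (lift (g \<tau>)) Y) differentiable at \<tau>" for Y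
    unfolding mink_def lift_simps by (intro derivative_intros) auto
  then show ?thesis
    unfolding curve_param_def curve_den_def
    using assms(2) by (intro derivative_intros) (auto simp: curve_den_def)
qed

text \<open>For k < 1 the expression is smallest at u^2 = 1 / D, where positivity is exactly D + k^2
  > 1.\<close>

lemma param_pos:
  fixes k D u :: real
  assumes k: "k > 0" and D: "D > 0" "D + k\<^sup>2 > 1" and u2: "u\<^sup>2 \<le> 1 / D"
  shows "1 + (k\<^sup>2 - 1) * u\<^sup>2 > 0"
proof (cases "k \<ge> 1")
  case True
  then have "0 \<le> (k\<^sup>2 - 1) * u\<^sup>2" using one_le_power[of k 2] by simp
  then show ?thesis by linarith
next
  case False
  then have "k\<^sup>2 < 1" using k by (simp add: power_less_one_iff)
  then have "(1 - k\<^sup>2) * u\<^sup>2 \<le> (1 - k\<^sup>2) * (1 / D)" using u2 by (intro mult_left_mono) auto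
  also have "\<dots> < 1" using D by (simp add: divide_less_eq)
  finally show ?thesis by (simp add: algebra_simps)
qed

text \<open>Along an arc the stereographic parameter is continuous and injective, hence monotone,
  and the integral of the speed telescopes to the primitive \<Psi> at the end parameter. The
  finitely many corners of a valid path do not affect the fundamental theorem.\<close>

lemma arc_length_unique:
  assumes f: "frame X n e" and k: "k > 0" and D: "D > 0" "D + k\<^sup>2 > 1"
    and g: "valid_path g" "arc g" "path_image g \<subseteq> {z \<in> hyp_plane. gfun (k *\<^sub>R X + n) k z = 0}"
    and den: "\<And>z. z \<in> path_image g \<Longrightarrow> curve_den k X n z > 0"
    and ends: "pathstart g = proj X" "(curve_param k X n e (pathfinish g))\<^sup>2 = 1 / D"
  shows "hyp_length g = arc_len k D"
proof -
  define r where "r = 1 / sqrt D"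
  have r: "r > 0" "r\<^sup>2 = 1 / D" using D by (simp_all add: r_def power_divide)
  define s where "s \<tau> = curve_param k X n e (g \<tau>)" for \<tau>
  have gz: "g \<tau> \<in> hyp_plane" "gfun (k *\<^sub>R X + n) k (g \<tau>) = 0" "curve_den k X n (g \<tau>) > 0" if "\<tau> \<in> {0..1}" for \<tau>
  proof -
    have "g \<tau> \<in> path_image g" using that by (simp add: path_image_def)
    then show "g \<tau> \<in> hyp_plane" "gfun (k *\<^sub>R X + n) k (g \<tau>) = 0" "curve_den k X n (g \<tau>) > 0"
      using g(3) den by auto
  qed
  have pt: "1 + (k\<^sup>2 - 1) * (s \<tau>)\<^sup>2 > 0" "g \<tau> = proj (curve_vec k X n e (s \<tau>))"
      "s \<tau> = 0 \<longleftrightarrow> g \<tau> = proj X" if "\<tau> \<in> {0..1}" for \<tau>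
    unfolding s_def by (rule curve_param_point[OF f k gz[OF that]])+
  have cont: "continuous_on {0..1} s"
  proof -
    have "continuous_on {0..1} g" using g(1) by (auto simp: valid_path_def piecewise_C1_differentiable_on_def)
    then have "continuous_on {0..1} (\<lambda>\<tau>. mink (lift (g \<tau>)) e)" "continuous_on {0..1} (\<lambda>\<tau>. curve_den k X n (g \<tau>))"
      unfolding curve_den_def mink_commute[of "lift _"] by (intro continuous_intros; assumption)+
    then show ?thesis
      unfolding s_def curve_param_def
      by (rule continuous_on_divide) (use gz(3) in \<open>metis less_irrefl\<close>)
  qed
  have inj: "inj_on s {0..1}"
  proof (rule inj_onI)
    fix a b assume ab: "a \<in> {0..1}" "b \<in> {0..1}" "s a = s b"
    then have "g a = g b" using pt(2)[OF ab(1)] pt(2)[OF ab(2)] by simp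
    then show "a = b" using g(2) ab by (auto simp: arc_def inj_on_def)
  qed
  have s0: "s 0 = 0" using pt(3)[of 0] ends(1) by (simp add: pathstart_def)
  have s1: "(s 1)\<^sup>2 = r\<^sup>2" using ends(2) r by (simp add: s_def pathfinish_def)
  \<comment> \<open>Only the square of the end parameter is known, so the path may run in either
    direction; \<epsilon> turns the parameter into one that increases from 0 to r.\<close>
  define \<epsilon> :: real where "\<epsilon> = (if s 1 \<ge> 0 then 1 else -1)"
  define h where "h \<tau> = \<epsilon> * s \<tau>" for \<tau>
  have eps: "\<epsilon> * \<epsilon> = 1" "\<bar>\<epsilon>\<bar> = 1" by (auto simp: \<epsilon>_def)
  have h0: "h 0 = 0" by (simp add: h_def s0)
  have h1: "h 1 = r"
  proof -
    have "s 1 = r \<or> s 1 = - r" using s1 by (simp add: power2_eq_iff)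
    then show ?thesis using r(1) by (auto simp: h_def \<epsilon>_def split: if_splits)
  qed
  have hc: "continuous_on {0..1} h" unfolding h_def by (intro continuous_intros cont)
  have hi: "inj_on h {0..1}"
  proof (rule inj_onI)
    fix a b assume ab: "a \<in> {0..1}" "b \<in> {0..1}" "h a = h b"
    have "\<epsilon> \<noteq> 0" using eps(2) by auto
    then have "s a = s b" using ab(3) by (simp add: h_def)
    then show "a = b" using inj_onD[OF inj _ ab(1,2)] by simp
  qed
  have "strict_mono_on {0..1} h"
  proof -
    have "strict_mono_on {0..1} h \<or> strict_antimono_on {0..1} h"
      using injective_eq_monotone_map[OF _ hc] hi by simp
    moreover have "\<not> strict_antimono_on {0..1} h"
    proof
      assume "strict_antimono_on {0..1} h"
      then have "h 1 < h 0" by (rule monotone_onD) auto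
      then show False using h0 h1 r(1) by simp
    qed
    ultimately show ?thesis by blast
  qed
  then have hm: "\<And>a b. a \<in> {0..1} \<Longrightarrow> b \<in> {0..1} \<Longrightarrow> a < b \<Longrightarrow> h a < h b"
    by (auto simp: monotone_on_def)
  define a where "a u = 2 / (1 + (k\<^sup>2 - 1) * u\<^sup>2)" for u :: real
  have qpos: "1 + (k\<^sup>2 - 1) * u\<^sup>2 > 0" if "u \<in> {0..r}" for u
    using that r power_mono[of u r 2] by (intro param_pos[OF k D]) auto
  have ac: "continuous_on {0..r} a" unfolding a_def using qpos by (intro continuous_intros) force
  define \<Psi> where "\<Psi> x = integral {0..x} a" for x
  have \<Psi>d: "(\<Psi> has_real_derivative a x) (at x within {0..r})" if "x \<in> {0..r}" for x
    unfolding \<Psi>_def by (rule integral_has_real_derivative[OF ac that])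
  have \<Psi>c: "continuous_on {0..r} \<Psi>"
    using \<Psi>d by (meson DERIV_continuous_on)
  obtain S D' where S: "finite S" and gd: "\<And>\<tau>. \<tau> \<in> {0..1} - S \<Longrightarrow> (g has_vector_derivative D' \<tau>) (at \<tau>)"
    using g(1) unfolding valid_path_def piecewise_C1_differentiable_on_def C1_differentiable_on_def by blast
  have hr: "h \<tau> \<in> {0..r}" if "\<tau> \<in> {0..1}" for \<tau>
    using hm[of 0 \<tau>] hm[of \<tau> 1] that h0 h1 by (cases "\<tau> = 0"; cases "\<tau> = 1") auto
  have main: "((\<lambda>\<tau>. \<Psi> (h \<tau>)) has_vector_derivative
      sqrt (klein_metric (g \<tau>) (vector_derivative g (at \<tau>)) (vector_derivative g (at \<tau>)))) (at \<tau>)"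
    if \<tau>: "\<tau> \<in> {0<..<1} - S" for \<tau>
  proof -
    have \<tau>1: "\<tau> \<in> {0..1}" "\<tau> \<in> {0..1} - S" using \<tau> by auto
    have "s differentiable at \<tau>"
      unfolding s_def using curve_param_differentiable[OF gd[OF \<tau>1(2)]] gz(3)[OF \<tau>1(1)] by simp
    then obtain s' where s': "(s has_real_derivative s') (at \<tau>)"
      using real_differentiable_def by blast
    then have h': "(h has_real_derivative \<epsilon> * s') (at \<tau>)"
      unfolding h_def by (auto intro!: derivative_eq_intros)
    have "mono_on {0..1} h" using hm by (auto simp: mono_on_def less_le)
    then have hpos: "\<epsilon> * s' \<ge> 0" using h' \<tau> by (intro mono_on_imp_deriv_nonneg) auto
    have hin: "h \<tau> \<in> {0<..<r}" using hm[of 0 \<tau>] hm[of \<tau> 1] \<tau> h0 h1 by auto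
    have "(\<Psi> has_real_derivative a (h \<tau>)) (at (h \<tau>))"
      using \<Psi>d[of "h \<tau>"] hin at_within_interior[of "h \<tau>" "{0..r}"] by auto
    from DERIV_chain2[OF this h'] have pd: "((\<lambda>\<tau>. \<Psi> (h \<tau>)) has_vector_derivative a (h \<tau>) * (\<epsilon> * s')) (at \<tau>)"
      by (simp add: has_real_derivative_iff_has_vector_derivative)
    have q: "1 + (k\<^sup>2 - 1) * (s \<tau>)\<^sup>2 > 0" by (rule pt(1)[OF \<tau>1(1)])
    obtain u where u: "((\<lambda>s. proj (curve_vec k X n e s)) has_vector_derivative u) (at (s \<tau>))"
      "klein_metric (proj (curve_vec k X n e (s \<tau>))) u u = (2 / (1 + (k\<^sup>2 - 1) * (s \<tau>)\<^sup>2))\<^sup>2"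
      using curve_vec_speed[OF f q] .
    have "(s has_vector_derivative s') (at \<tau>)"
      using s' by (simp add: has_real_derivative_iff_has_vector_derivative)
    from vector_diff_chain_at[OF this u(1)]
    have "((\<lambda>\<tau>. proj (curve_vec k X n e (s \<tau>))) has_vector_derivative s' *\<^sub>R u) (at \<tau>)" by (simp add: o_def)
    then have "(g has_vector_derivative s' *\<^sub>R u) (at \<tau>)"
    proof (rule has_vector_derivative_transform_within_open)
      show "open {0<..<1::real}" "\<tau> \<in> {0<..<1}" using \<tau> by auto
      show "proj (curve_vec k X n e (s x)) = g x" if "x \<in> {0<..<1}" for x
        using pt(2)[of x] that by simp
    qed
    then have vd: "vector_derivative g (at \<tau>) = s' *\<^sub>R u" by (rule vector_derivative_at)
    have km: "klein_metric x (c *\<^sub>R v) (c *\<^sub>R v) = c\<^sup>2 * klein_metric x v v" for x v and c :: real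
      by (simp add: klein_metric_def power2_eq_square algebra_simps add_divide_distrib)
    have "klein_metric (g \<tau>) (s' *\<^sub>R u) (s' *\<^sub>R u) = s'\<^sup>2 * (2 / (1 + (k\<^sup>2 - 1) * (s \<tau>)\<^sup>2))\<^sup>2"
      unfolding km using u(2) pt(2)[OF \<tau>1(1)] by simp
    also have "\<dots> = (a (h \<tau>) * (\<epsilon> * s'))\<^sup>2"
    proof -
      have "(h \<tau>)\<^sup>2 = (s \<tau>)\<^sup>2" "\<epsilon>\<^sup>2 = 1" using eps(1) by (simp_all add: h_def power_mult_distrib power2_eq_square)
      then show ?thesis by (simp add: a_def power_mult_distrib power_divide)
    qed
    finally have "sqrt (klein_metric (g \<tau>) (s' *\<^sub>R u) (s' *\<^sub>R u)) = \<bar>a (h \<tau>) * (\<epsilon> * s')\<bar>" by simp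
    also have "\<dots> = a (h \<tau>) * (\<epsilon> * s')"
    proof -
      have "a (h \<tau>) > 0" using qpos[of "h \<tau>"] hin by (simp add: a_def)
      then show ?thesis using hpos by simp
    qed
    finally show ?thesis using pd vd by auto
  qed
  have "((\<lambda>\<tau>. sqrt (klein_metric (g \<tau>) (vector_derivative g (at \<tau>)) (vector_derivative g (at \<tau>))))
      has_integral \<Psi> (h 1) - \<Psi> (h 0)) {0..1}"
  proof (rule fundamental_theorem_of_calculus_interior_strong[OF S])
    show "continuous_on {0..1} (\<lambda>\<tau>. \<Psi> (h \<tau>))"
      using continuous_on_compose2[OF \<Psi>c hc] hr by blast
  qed (use main in auto)
  then have "hyp_length g = \<Psi> (h 1) - \<Psi> (h 0)"
    unfolding hyp_length_def by (rule integral_unique)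
  then show ?thesis unfolding h0 h1 by (simp add: \<Psi>_def arc_len_def r_def a_def[abs_def])
qed

section \<open>The curvature of an arc\<close>

text \<open>The upper half of a sandwich for the filled polygon.\<close>

lemma inside_subset_of_convex:
  fixes P K :: "complex set"
  assumes "convex K" "P \<subseteq> K"
  shows "P \<union> inside P \<subseteq> K"
proof -
  have "- K \<subseteq> outside P"
    using convex_in_outside[OF assms(1)] outside_mono[OF assms(2)] by blast
  then show ?thesis using assms(2) inside_Int_outside[of P] by blast
qed

text \<open>The lower half of the sandwich. Both halves apply to degenerate polygons as well, for
  instance when the vertices shrink to points.\<close>

lemma subset_Un_inside:
  fixes P K :: "complex set"
  assumes "closed K" "bounded K" "frontier K \<subseteq> P"
  shows "K \<subseteq> P \<union> inside P"
proof -
  have "K \<subseteq> interior K \<union> frontier K" using assms(1) by (auto simp: frontier_def)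
  then show ?thesis
    using interior_inside_frontier[OF assms(2)] inside_mono[OF assms(3)] assms(3) by blast
qed

lemma closed_segment_proj:
  assumes "lift z = a *\<^sub>R F + b *\<^sub>R G" "a \<ge> 0" "b \<ge> 0" "snd F > 0" "snd G > 0"
  shows "z \<in> closed_segment (proj F) (proj G)"
proof -
  have 1: "a * snd F + b * snd G = 1" using arg_cong[OF assms(1), of snd] by simp
  have "z = a *\<^sub>R fst F + b *\<^sub>R fst G" using arg_cong[OF assms(1), of fst] by simp
  also have "\<dots> = a *\<^sub>R (snd F *\<^sub>R proj F) + b *\<^sub>R (snd G *\<^sub>R proj G)"
    using assms(4,5) by (simp add: proj_def)
  also have "\<dots> = (a * snd F) *\<^sub>R proj F + (b * snd G) *\<^sub>R proj G"
    by (simp only: scaleR_scaleR)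
  also have "a * snd F = 1 - b * snd G" using 1 by simp
  finally have "z = (1 - b * snd G) *\<^sub>R proj F + (b * snd G) *\<^sub>R proj G" .
  moreover have "0 \<le> b * snd G" "0 \<le> a * snd F" using assms by simp_all
  ultimately show ?thesis
    using 1 unfolding in_segment by (intro exI[of _ "b * snd G"]) linarith
qed

locale triple =
  fixes P1 P2 P3 :: mvec and k1 k2 k3 m12 m23 m31 :: real and t12 t23 t31 :: complex
  assumes p12: "tangent_pair P1 P2 k1 k2 m12 t12" and p23: "tangent_pair P2 P3 k2 k3 m23 t23"
    and p31: "tangent_pair P3 P1 k3 k1 m31 t31" and k1pos: "k1 > 0"
begin

section \<open>Coordinates in the basis of the three vectors\<close>

definition "D = 1 + k1 * k2 + k2 * k3 + k3 * k1"
definition "d = det3 P1 P2 P3"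
definition "co1 Z = det3 Z P2 P3 / d"
definition "co2 Z = det3 P1 Z P3 / d"
definition "co3 Z = det3 P1 P2 Z / d"

lemmas swaps = tangent_pair.swap[OF p12] tangent_pair.swap[OF p23] tangent_pair.swap[OF p31]

lemma gram:
  "mink P1 P1 = 1 - k1\<^sup>2" "mink P2 P2 = 1 - k2\<^sup>2" "mink P3 P3 = 1 - k3\<^sup>2"
  "mink P1 P2 = - 1 - k1 * k2" "mink P2 P1 = - 1 - k1 * k2" "mink P2 P3 = - 1 - k2 * k3"
  "mink P3 P2 = - 1 - k2 * k3" "mink P3 P1 = - 1 - k3 * k1" "mink P1 P3 = - 1 - k3 * k1"
  using p12 p23 p31 by (auto simp: tangent_pair_def mink_commute)

lemma k_nonneg: "k1 \<ge> 0" "k2 \<ge> 0" "k3 \<ge> 0"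
  using p12 p23 by (auto simp: tangent_pair_def)

lemma D_ge_1: "D \<ge> 1"
  using k_nonneg by (simp add: D_def)

lemma D_pos: "D > 0" "D + k1\<^sup>2 > 1"
  using D_ge_1 zero_less_power[OF k1pos, of 2] by linarith+

text \<open>Since D \<ge> 1, the three vectors form a basis; \<open>co1\<close>, \<open>co2\<close>
  and \<open>co3\<close> are the coordinates in it.\<close>

lemma d_square: "d\<^sup>2 = 4 * D"
  unfolding d_def gram_det gram D_def by (simp add: power2_eq_square algebra_simps)

lemma d_nonzero: "d \<noteq> 0"
  using d_square D_ge_1 by auto

lemma co_expand: "Z = co1 Z *\<^sub>R P1 + co2 Z *\<^sub>R P2 + co3 Z *\<^sub>R P3"
proof -
  have "(1 / d) *\<^sub>R (d *\<^sub>R Z) = (1 / d) *\<^sub>R (det3 Z P2 P3 *\<^sub>R P1 + det3 P1 Z P3 *\<^sub>R P2 + det3 P1 P2 Z *\<^sub>R P3)"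
    using expand_coords[of P1 P2 P3 Z] by (simp add: d_def)
  then show ?thesis
    using d_nonzero by (simp add: co1_def co2_def co3_def scaleR_add_right)
qed

lemma co_add: "co1 (Y + Z) = co1 Y + co1 Z" "co2 (Y + Z) = co2 Y + co2 Z" "co3 (Y + Z) = co3 Y + co3 Z"
  and co_scale: "co1 (a *\<^sub>R Y) = a * co1 Y" "co2 (a *\<^sub>R Y) = a * co2 Y" "co3 (a *\<^sub>R Y) = a * co3 Y"
  by (simp_all add: co1_def co2_def co3_def mvec_simps add_divide_distrib diff_divide_distrib algebra_simps)

lemma co2_diff: "co2 (Y - Z) = co2 Y - co2 Z"
  using co_add(2)[of "Y - Z" Z] by simp

lemma co_basis:
  "co1 P1 = 1" "co1 P2 = 0" "co1 P3 = 0" "co2 P1 = 0" "co2 P2 = 1" "co2 P3 = 0" "co3 P1 = 0" "co3 P2 = 0" "co3 P3 = 1"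
  using d_nonzero by (simp_all add: co1_def co2_def co3_def det3_eq d_def[symmetric])

text \<open>A convex container for the triangle. It may be unbounded and may leave the disk.\<close>

definition "tri_cone = {z. co1 (lift z) \<ge> 0 \<and> co2 (lift z) \<ge> 0 \<and> co3 (lift z) \<ge> 0}"

lemma convex_cone: "convex tri_cone"
  unfolding convex_def tri_cone_def by (auto simp: lift_affine co_add co_scale)

lemma proj_cone:
  assumes "Z = a *\<^sub>R P1 + b *\<^sub>R P2 + c *\<^sub>R P3" "a \<ge> 0" "b \<ge> 0" "c \<ge> 0" "snd Z > 0"
  shows "proj Z \<in> tri_cone"
  using assms(2-5) unfolding tri_cone_def by (simp add: lift_proj co_scale) (simp add: assms(1) co_add co_scale co_basis)

section \<open>The polygon of vertices and edges\<close>

definition "p12 = proj (foot k1 P1 k2 P2)"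
definition "p21 = proj (foot k2 P2 k1 P1)"
definition "p23 = proj (foot k2 P2 k3 P3)"
definition "p32 = proj (foot k3 P3 k2 P2)"
definition "p31 = proj (foot k3 P3 k1 P1)"
definition "p13 = proj (foot k1 P1 k3 P3)"

definition "boundary = closed_segment p12 p21 \<union> closed_segment p23 p32 \<union> closed_segment p31 p13 \<union>
  closed_segment p13 p12 \<union> closed_segment p21 p23 \<union> closed_segment p32 p31"

lemma feet_snd:
  "snd (foot k1 P1 k2 P2) > 0" "snd (foot k2 P2 k1 P1) > 0" "snd (foot k2 P2 k3 P3) > 0"
  "snd (foot k3 P3 k2 P2) > 0" "snd (foot k3 P3 k1 P1) > 0" "snd (foot k1 P1 k3 P3) > 0"
  using tangent_pair.foot_snd[OF p12] tangent_pair.foot_snd[OF p23] tangent_pair.foot_snd[OF p31]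
    swaps[THEN tangent_pair.foot_snd] by auto

lemma sq_pos: "k1 < 1 \<Longrightarrow> 0 < 1 - k1\<^sup>2" "k2 < 1 \<Longrightarrow> 0 < 1 - k2\<^sup>2" "k3 < 1 \<Longrightarrow> 0 < 1 - k3\<^sup>2"
  using k_nonneg by (auto simp: power_less_one_iff)

lemma feet_cone: "p12 \<in> tri_cone" "p21 \<in> tri_cone" "p23 \<in> tri_cone" "p32 \<in> tri_cone" "p31 \<in> tri_cone" "p13 \<in> tri_cone"
proof -
  show "p12 \<in> tri_cone" unfolding p12_def using feet_snd(1) sq_pos(1) k_nonneg
    by (intro proj_cone[of _ "if k1 < 1 then 1 + k1 * k2 else 1" "if k1 < 1 then 1 - k1\<^sup>2 else 0" 0]) (auto simp: foot_def)
  show "p21 \<in> tri_cone" unfolding p21_def using feet_snd(2) sq_pos(2) k_nonneg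
    by (intro proj_cone[of _ "if k2 < 1 then 1 - k2\<^sup>2 else 0" "if k2 < 1 then 1 + k2 * k1 else 1" 0]) (auto simp: foot_def)
  show "p23 \<in> tri_cone" unfolding p23_def using feet_snd(3) sq_pos(2) k_nonneg
    by (intro proj_cone[of _ 0 "if k2 < 1 then 1 + k2 * k3 else 1" "if k2 < 1 then 1 - k2\<^sup>2 else 0"]) (auto simp: foot_def)
  show "p32 \<in> tri_cone" unfolding p32_def using feet_snd(4) sq_pos(3) k_nonneg
    by (intro proj_cone[of _ 0 "if k3 < 1 then 1 - k3\<^sup>2 else 0" "if k3 < 1 then 1 + k3 * k2 else 1"]) (auto simp: foot_def)
  show "p31 \<in> tri_cone" unfolding p31_def using feet_snd(5) sq_pos(3) k_nonneg
    by (intro proj_cone[of _ "if k3 < 1 then 1 - k3\<^sup>2 else 0" 0 "if k3 < 1 then 1 + k3 * k1 else 1"]) (auto simp: foot_def)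
  show "p13 \<in> tri_cone" unfolding p13_def using feet_snd(6) sq_pos(1) k_nonneg
    by (intro proj_cone[of _ "if k1 < 1 then 1 + k1 * k3 else 1" 0 "if k1 < 1 then 1 - k1\<^sup>2 else 0"]) (auto simp: foot_def)
qed

lemma boundary_cone: "boundary \<union> inside boundary \<subseteq> tri_cone"
  unfolding boundary_def using feet_cone
  by (intro inside_subset_of_convex convex_cone Un_least closed_segment_subset) auto

subsection \<open>The frame at the first tangency point\<close>

definition "X = (1 / (k1 + k2)) *\<^sub>R (P1 + P2)"
definition "n = P1 - k1 *\<^sub>R X"
text \<open>The sign makes e point to the side of the third circle.\<close>

definition "e = (if mink P3 (lcross X n) > 0 then lcross X n else - lcross X n)"

lemma k12: "k1 + k2 > 0" and k13: "k1 + k3 > 0"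
  using k1pos k_nonneg by auto

lemma P1_frame: "k1 *\<^sub>R X + n = P1"
  by (simp add: n_def)

lemma P2_frame: "k2 *\<^sub>R X - n = P2"
proof -
  have "(k1 + k2) *\<^sub>R X = P1 + P2" using k12 by (simp add: X_def)
  then show ?thesis by (simp add: n_def algebra_simps)
qed

lemma mink_X: "mink P1 X = - k1" "mink P2 X = - k2" "mink P3 X = - k3 - 2 / (k1 + k2)"
proof -
  have "mink P1 (P1 + P2) = - k1 * (k1 + k2)" "mink P2 (P1 + P2) = - k2 * (k1 + k2)"
    "mink P3 (P1 + P2) = - k3 * (k1 + k2) - 2"
    unfolding mink_add_right gram by (simp_all add: power2_eq_square algebra_simps)
  then show "mink P1 X = - k1" "mink P2 X = - k2" "mink P3 X = - k3 - 2 / (k1 + k2)"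
    using k12 unfolding X_def mink_scale_right by (simp_all add: diff_divide_distrib)
qed

lemma frame: "frame X n e"
proof -
  have XX: "mink X X = -1"
  proof -
    have "mink X X = (1 / (k1 + k2)) * (mink P1 X + mink P2 X)" by (subst (1) X_def) (simp only: mink_scale_left mink_add_left)
    then show ?thesis unfolding mink_X using k12 by (simp add: divide_eq_eq)
  qed
  have "snd X > 0"
  proof -
    have "P1 + P2 = m12 *\<^sub>R lift t12" "m12 > 0" using p12 by (auto simp: tangent_pair_def)
    then show ?thesis using k12 by (simp add: X_def)
  qed
  moreover have "mink n n = 1" "mink X n = 0"
    using XX mink_X gram by (simp_all add: n_def mink_linear mink_commute[of X P1] power2_eq_square)
  ultimately show ?thesis
    using frame_lcross[OF XX] frame_minus(2) by (simp add: e_def)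
qed

lemma proj_X: "proj X = t12"
proof -
  have "P1 + P2 = m12 *\<^sub>R lift t12" "m12 > 0" using p12 by (auto simp: tangent_pair_def)
  then show ?thesis using k12 by (simp add: X_def proj_scale)
qed

text \<open>The only obstruction is the point opposite to \<open>t12\<close> on the first circle.
  Its lift is a positive multiple of x P1 - X, so its coordinate along P2 is negative and it lies
  outside the cone. This is what excludes the complementary arc of a circle.\<close>

lemma den_pos:
  assumes z: "z \<in> hyp_plane" "gfun P1 k1 z = 0" "z \<in> tri_cone"
  shows "curve_den k1 X n z > 0"
proof -
  define x y c where "x = mink (lift z) n / lor z" and "y = mink (lift z) e / lor z" and "c = - mink (lift z) X / lor z"
  have z2: "gfun (k1 *\<^sub>R X + n) k1 z = 0" using z(2) by (simp add: P1_frame)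
  note cc = curve_point_coords[OF frame k1pos z(1) z2, folded x_def y_def c_def]
  note l = lor_pos[OF z(1)]
  define b where "b = 2 + (1 - k1\<^sup>2) * (c - 1)"
  have "b > 0"
  proof (cases "c = 1")
    case False
    then have c: "c - 1 > 0" using cc(2) by simp
    have y: "y\<^sup>2 = (c - 1) * b" using cc(3) by (simp add: b_def)
    then have "0 \<le> (c - 1) * b" by (metis zero_le_power2)
    then have "b \<ge> 0" using c by (simp add: zero_le_mult_iff)
    moreover have "b \<noteq> 0"
    proof
      assume b0: "b = 0"
      then have y0: "y = 0" using y by simp
      have "lift z = lor z *\<^sub>R (x *\<^sub>R P1 + (c - k1 * x) *\<^sub>R X)"
        using cc(5) y0 by (simp add: n_def algebra_simps)
      also have "c - k1 * x = -1" using b0 unfolding cc(1) b_def by (simp add: power2_eq_square algebra_simps)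
      finally have "co2 (lift z) = - lor z * co2 X" by (simp add: co_scale co2_diff co_basis)
      moreover have "co2 X = 1 / (k1 + k2)" by (simp add: X_def co_scale co_add co_basis)
      ultimately have "co2 (lift z) < 0" using l k12 by (simp add: divide_neg_pos)
      then show False using z(3) by (simp add: tri_cone_def)
    qed
    ultimately show ?thesis by simp
  qed (simp add: b_def)
  then show ?thesis using l unfolding cc(4) b_def by simp
qed

text \<open>The product q = (k1 + k2) (k1 + k3) equals D - 1 + k1^2. The product of
  \<open>t31\<close> with X gives c - 1 = 2 / q, and the parameter follows from the coordinates of
  the curve; this is where D comes from.\<close>

lemma t31_param:
  assumes t: "t31 \<in> hyp_plane" "gfun P1 k1 t31 = 0"
  shows "(curve_param k1 X n e t31)\<^sup>2 = 1 / D"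
proof -
  have s: "P3 + P1 = m31 *\<^sub>R lift t31" "m31 > 0" using p31 by (auto simp: tangent_pair_def)
  have ab: "(k1 + k2) * (k1 + k3) > 0" using k12 k13 by simp
  define q where "q = (k1 + k2) * (k1 + k3)"
  have q: "q > 0" "q = D - 1 + k1\<^sup>2" using ab by (auto simp: q_def D_def power2_eq_square algebra_simps)
  define c y where "c = - mink (lift t31) X / lor t31" and "y = mink (lift t31) e / lor t31"
  have t2: "gfun (k1 *\<^sub>R X + n) k1 t31 = 0" using t(2) by (simp add: P1_frame)
  note cc = curve_point_coords[OF frame k1pos t(1) t2, folded c_def y_def]
  note l = lor_pos[OF t(1)]
  have "(k3 + k1)\<^sup>2 = m31\<^sup>2 * (1 - t31 \<bullet> t31)"
    by (rule sum_tangent_square[OF gram(3,1,8) s(1)])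
  also have "\<dots> = (m31 * lor t31)\<^sup>2" using t(1) by (simp add: power_mult_distrib lor_def hyp_plane_iff)
  finally have ml: "k3 + k1 = m31 * lor t31" using s(2) l k13 by (intro power2_eq_imp_eq[of "k3 + k1"]) auto
  have "m31 * mink (lift t31) X = mink (P3 + P1) X" unfolding s(1) by (simp add: mink_linear)
  then have "m31 * mink (lift t31) X = - (k3 + k1) - 2 / (k1 + k2)" using mink_X by (simp add: mink_linear)
  then have "m31 * lor t31 * c = (k3 + k1) + 2 / (k1 + k2)" using l by (simp add: c_def)
  then have "(k1 + k3) * c = (k1 + k3) + 2 / (k1 + k2)" unfolding ml[symmetric] by (simp add: add.commute)
  then have "(k1 + k3) * (c - 1) = 2 / (k1 + k2)" by (simp add: algebra_simps)
  moreover have "(k1 + k2) * (2 / (k1 + k2)) = 2" using k12 by (simp add: field_simps)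
  ultimately have "(k1 + k2) * ((k1 + k3) * (c - 1)) = 2" by (simp only:)
  then have "q * (c - 1) = 2" by (simp add: q_def mult.assoc)
  then have "c - 1 = 2 / q" using q(1) by (simp add: eq_divide_eq mult.commute)
  moreover have "D = q + 1 - k1\<^sup>2" using q(2) by simp
  moreover have "2 + (1 - k1\<^sup>2) * (2 / q) = 2 * (q + 1 - k1\<^sup>2) / q" using q(1) by (simp add: field_simps)
  ultimately have den: "2 + (1 - k1\<^sup>2) * (c - 1) = 2 * D / q" by (simp only:)
  have "curve_param k1 X n e t31 = y / (2 * D / q)"
    using l unfolding curve_param_def cc(4) den by (simp add: y_def)
  then have "(curve_param k1 X n e t31)\<^sup>2 = y\<^sup>2 / (2 * D / q)\<^sup>2" by (simp only: power_divide)
  also have "y\<^sup>2 = (2 / q) * (2 * D / q)" unfolding cc(3) den using \<open>c - 1 = 2 / q\<close> by simp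
  also have "(2 / q) * (2 * D / q) / (2 * D / q)\<^sup>2 = 1 / D" using q(1) D_pos(1) by (simp add: power2_eq_square)
  finally show ?thesis .
qed

text \<open>The edge ends of any admissible triangle must be the feet, so the polygon is
  \<open>boundary\<close> and the given arc runs in the cone, where the stereographic parameter is
  defined.\<close>

theorem arc_length_in_triangle:
  assumes r: "rep c1 P1" "rep c2 P2" "rep c3 P3" "curv c1 = k1" "curv c2 = k2" "curv c3 = k3"
    and tri: "circle_packed_triangle c1 c2 c3 t12 t23 t31 \<Delta>"
    and g: "valid_path g" "arc g" "pathstart g = t12" "pathfinish g = t31" "path_image g \<subseteq> curve c1 \<inter> \<Delta>"
  shows "hyp_length g = arc_len k1 D"
proof -
  obtain q12 q21 q23 q32 q31 q13 where *:
    "edge_ends c1 c2 t12 q12 q21 \<and> edge_ends c2 c3 t23 q23 q32 \<and> edge_ends c3 c1 t31 q31 q13 \<and>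
     (let P = closed_segment q12 q21 \<union> closed_segment q23 q32 \<union> closed_segment q31 q13 \<union>
              closed_segment q13 q12 \<union> closed_segment q21 q23 \<union> closed_segment q32 q31
      in \<Delta> = P \<union> inside P)"
    using tri unfolding circle_packed_triangle_def by (elim exE) (rule that)
  note ee = *[THEN conjunct1] *[THEN conjunct2, THEN conjunct1] *[THEN conjunct2, THEN conjunct2, THEN conjunct1]
  note \<Delta> = *[THEN conjunct2, THEN conjunct2, THEN conjunct2, unfolded Let_def]
  have sw: "edge_ends c' c t q p" if "edge_ends c c' t p q" for c c' t p q
    using that unfolding edge_ends_def by (auto simp: closed_segment_commute split: if_splits)
  have "q12 = p12" "q23 = p23" "q31 = p31" "q21 = p21" "q32 = p32" "q13 = p13"
    unfolding p12_def p23_def p31_def p21_def p32_def p13_def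
    using tangent_pair.edge_end_unique[OF p12 r(1,2,4,5) ee(1)] tangent_pair.edge_end_unique[OF p23 r(2,3,5,6) ee(2)]
      tangent_pair.edge_end_unique[OF p31 r(3,1,6,4) ee(3)] tangent_pair.edge_end_unique[OF swaps(1) r(2,1,5,4) sw[OF ee(1)]]
      tangent_pair.edge_end_unique[OF swaps(2) r(3,2,6,5) sw[OF ee(2)]] tangent_pair.edge_end_unique[OF swaps(3) r(1,3,4,6) sw[OF ee(3)]]
    by simp_all
  then have "\<Delta> = boundary \<union> inside boundary" unfolding \<Delta> boundary_def by simp
  then have \<Delta>c: "\<Delta> \<subseteq> tri_cone" using boundary_cone by simp
  have cu: "curve c1 = {z \<in> hyp_plane. gfun P1 k1 z = 0}" using r by (auto simp: rep_def)
  have pz: "z \<in> hyp_plane \<and> gfun P1 k1 z = 0 \<and> z \<in> tri_cone" if "z \<in> path_image g" for z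
    using that g(5) \<Delta>c cu by auto
  have "t31 \<in> path_image g" using pathfinish_in_path_image[of g] g(4) by simp
  then have "(curve_param k1 X n e (pathfinish g))\<^sup>2 = 1 / D" using t31_param pz g(4) by simp
  moreover have "path_image g \<subseteq> {z \<in> hyp_plane. gfun (k1 *\<^sub>R X + n) k1 z = 0}" using pz unfolding P1_frame by auto
  moreover have "pathstart g = proj X" using g(3) proj_X by simp
  moreover have "curve_den k1 X n z > 0" if "z \<in> path_image g" for z using den_pos pz[OF that] by simp
  ultimately show ?thesis
    using arc_length_unique[OF frame k1pos D_pos g(1,2)] by blast
qed

subsection \<open>Existence of the arc\<close>

text \<open>A truncation is imposed only at circles that have an axis. For k \<ge> 1 the vertex is
  the point P itself, and the corresponding inequality holds on the whole cone.\<close>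

definition "hexagon = {z \<in> tri_cone. (k1 < 1 \<longrightarrow> mink P1 (lift z) \<le> 0) \<and> (k2 < 1 \<longrightarrow> mink P2 (lift z) \<le> 0) \<and>
  (k3 < 1 \<longrightarrow> mink P3 (lift z) \<le> 0)}"

lemma continuous_co: "continuous_on A (\<lambda>z. co1 (lift z))" "continuous_on A (\<lambda>z. co2 (lift z))" "continuous_on A (\<lambda>z. co3 (lift z))"
proof -
  have "co1 (lift z) = mink (lcross P2 P3) (lift z) / d" "co2 (lift z) = mink (lcross P3 P1) (lift z) / d"
    "co3 (lift z) = mink (lcross P1 P2) (lift z) / d" for z
    unfolding co1_def co2_def co3_def by (simp_all add: mvec_simps algebra_simps)
  then show "continuous_on A (\<lambda>z. co1 (lift z))" "continuous_on A (\<lambda>z. co2 (lift z))" "continuous_on A (\<lambda>z. co3 (lift z))"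
    by (simp_all only:) (intro continuous_intros; simp add: d_nonzero)+
qed

lemma closed_hexagon: "closed hexagon"
proof -
  have c1: "closed {z. c < (1::real) \<longrightarrow> mink P (lift z) \<le> 0}" for c P
    by (cases "c < 1") (auto intro!: closed_Collect_le continuous_intros)
  have c2: "closed {z. co1 (lift z) \<ge> 0}" "closed {z. co2 (lift z) \<ge> 0}" "closed {z. co3 (lift z) \<ge> 0}"
    by (intro closed_Collect_le continuous_intros continuous_co)+
  have "hexagon = {z. co1 (lift z) \<ge> 0} \<inter> {z. co2 (lift z) \<ge> 0} \<inter> {z. co3 (lift z) \<ge> 0} \<inter>
    {z. k1 < 1 \<longrightarrow> mink P1 (lift z) \<le> 0} \<inter> {z. k2 < 1 \<longrightarrow> mink P2 (lift z) \<le> 0} \<inter> {z. k3 < 1 \<longrightarrow> mink P3 (lift z) \<le> 0}"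
    by (auto simp: hexagon_def tri_cone_def)
  then show ?thesis by (simp only:) (intro closed_Int c1 c2)
qed

text \<open>The square of \<open>lift z\<close> is the sum of its coordinates times its products
  with P1, P2 and P3. The coordinates are nonnegative and the products nonpositive, so the hexagon
  lies in the closed disk.\<close>

lemma bounded_hexagon: "bounded hexagon"
proof -
  have "z \<bullet> z \<le> 1" if z: "z \<in> hexagon" for z
  proof -
    define a b c where "a = co1 (lift z)" and "b = co2 (lift z)" and "c = co3 (lift z)"
    have nn: "a \<ge> 0" "b \<ge> 0" "c \<ge> 0" using z by (auto simp: hexagon_def tri_cone_def a_def b_def c_def)
    have L: "lift z = a *\<^sub>R P1 + b *\<^sub>R P2 + c *\<^sub>R P3" unfolding a_def b_def c_def by (rule co_expand)
    have m: "mink P1 (lift z) = a * (1 - k1\<^sup>2) - b * (1 + k1 * k2) - c * (1 + k3 * k1)"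
      "mink P2 (lift z) = b * (1 - k2\<^sup>2) - a * (1 + k1 * k2) - c * (1 + k2 * k3)"
      "mink P3 (lift z) = c * (1 - k3\<^sup>2) - b * (1 + k2 * k3) - a * (1 + k3 * k1)"
      unfolding L mink_linear gram by (simp_all add: algebra_simps)
    have pos: "0 \<le> u * (1 + v * w)" if "u \<ge> 0" "v \<ge> 0" "w \<ge> 0" for u v w :: real using that by simp
    have np: "u * (1 - k\<^sup>2) \<le> 0" if "u \<ge> 0" "\<not> k < 1" for u k :: real
      using that one_le_power[of k 2] by (simp add: mult_nonneg_nonpos)
    have "mink P1 (lift z) \<le> 0"
    proof (cases "k1 < 1")
      case False
      then show ?thesis unfolding m using np[OF nn(1)] pos[OF nn(2) k_nonneg(1,2)] pos[OF nn(3) k_nonneg(3,1)] by (smt (verit))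
    qed (use z in \<open>auto simp: hexagon_def\<close>)
    moreover have "mink P2 (lift z) \<le> 0"
    proof (cases "k2 < 1")
      case False
      then show ?thesis unfolding m using np[OF nn(2)] pos[OF nn(1) k_nonneg(1,2)] pos[OF nn(3) k_nonneg(2,3)] by (smt (verit))
    qed (use z in \<open>auto simp: hexagon_def\<close>)
    moreover have "mink P3 (lift z) \<le> 0"
    proof (cases "k3 < 1")
      case False
      then show ?thesis unfolding m using np[OF nn(3)] pos[OF nn(2) k_nonneg(2,3)] pos[OF nn(1) k_nonneg(3,1)] by (smt (verit))
    qed (use z in \<open>auto simp: hexagon_def\<close>)
    moreover have "mink (lift z) (lift z) = a * mink P1 (lift z) + b * mink P2 (lift z) + c * mink P3 (lift z)"
      by (subst (1) L) (simp only: mink_linear)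
    ultimately have "mink (lift z) (lift z) \<le> 0"
      using nn by (simp add: add_nonpos_nonpos mult_nonneg_nonpos)
    then show ?thesis by (simp add: mink_lift)
  qed
  then have "hexagon \<subseteq> cball 0 1"
    by (auto simp: norm_eq_sqrt_inner)
  then show ?thesis using bounded_cball bounded_subset by blast
qed

text \<open>The set where all inequalities are strict is open and contained in the hexagon, so at a
  frontier point one of them is tight. A vanishing coordinate puts the point on an edge, a vanishing
  product on the part of an axis between two feet.\<close>

lemma frontier_hexagon: "frontier hexagon \<subseteq> boundary"
proof
  fix z assume z: "z \<in> frontier hexagon"
  have zh: "z \<in> hexagon" using z closed_hexagon frontier_subset_closed by blast
  define a b c where "a = co1 (lift z)" and "b = co2 (lift z)" and "c = co3 (lift z)"
  have nn: "a \<ge> 0" "b \<ge> 0" "c \<ge> 0" using zh by (auto simp: hexagon_def tri_cone_def a_def b_def c_def)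
  have L: "lift z = a *\<^sub>R P1 + b *\<^sub>R P2 + c *\<^sub>R P3" unfolding a_def b_def c_def by (rule co_expand)
  have mle': "k1 < 1 \<Longrightarrow> mink (lift z) P1 \<le> 0" "k2 < 1 \<Longrightarrow> mink (lift z) P2 \<le> 0" "k3 < 1 \<Longrightarrow> mink (lift z) P3 \<le> 0"
    using zh by (auto simp: hexagon_def mink_commute[of "lift z"])
  have mle: "k1 < 1 \<Longrightarrow> mink P1 (lift z) \<le> 0" "k2 < 1 \<Longrightarrow> mink P2 (lift z) \<le> 0" "k3 < 1 \<Longrightarrow> mink P3 (lift z) \<le> 0"
    using zh by (auto simp: hexagon_def)
  define U where "U = {z. co1 (lift z) > 0} \<inter> {z. co2 (lift z) > 0} \<inter> {z. co3 (lift z) > 0} \<inter>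
    {z. k1 < 1 \<longrightarrow> mink P1 (lift z) < 0} \<inter> {z. k2 < 1 \<longrightarrow> mink P2 (lift z) < 0} \<inter> {z. k3 < 1 \<longrightarrow> mink P3 (lift z) < 0}"
  have o1: "open {z. c < (1::real) \<longrightarrow> mink P (lift z) < 0}" for c P
    by (cases "c < 1") (auto intro!: open_Collect_less continuous_intros)
  have o2: "open {z. co1 (lift z) > 0}" "open {z. co2 (lift z) > 0}" "open {z. co3 (lift z) > 0}"
    by (intro open_Collect_less continuous_intros continuous_co)+
  have "open U" unfolding U_def by (intro open_Int o1 o2)
  moreover have "U \<subseteq> hexagon" by (auto simp: U_def hexagon_def tri_cone_def less_imp_le)
  ultimately have "U \<subseteq> interior hexagon" by (rule interior_maximal[rotated])
  then have "z \<notin> U" using z by (auto simp: frontier_def)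
  then consider "c = 0" | "a = 0" | "b = 0" | "k1 < 1" "mink P1 (lift z) = 0" | "k2 < 1" "mink P2 (lift z) = 0" | "k3 < 1" "mink P3 (lift z) = 0"
    using nn mle unfolding U_def a_def b_def c_def by fastforce
  then show "z \<in> boundary"
  proof cases
    case 1
    then have Lz: "lift z = a *\<^sub>R P1 + b *\<^sub>R P2" using L by (simp add: add.commute)
    obtain x y where "x \<ge> 0" "y \<ge> 0" "lift z = x *\<^sub>R foot k1 P1 k2 P2 + y *\<^sub>R foot k2 P2 k1 P1"
      using tangent_pair.cone_foot[OF p12 Lz nn(1) nn(2)] mle'(1,2) by blast
    then have "z \<in> closed_segment p12 p21"
      unfolding p12_def p21_def by - (rule closed_segment_proj, assumption+, (rule feet_snd)+)
    then show ?thesis by (simp add: boundary_def)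
  next
    case 2
    then have Lz: "lift z = b *\<^sub>R P2 + c *\<^sub>R P3" using L by (simp add: add.commute)
    obtain x y where "x \<ge> 0" "y \<ge> 0" "lift z = x *\<^sub>R foot k2 P2 k3 P3 + y *\<^sub>R foot k3 P3 k2 P2"
      using tangent_pair.cone_foot[OF p23 Lz nn(2) nn(3)] mle'(2,3) by blast
    then have "z \<in> closed_segment p23 p32"
      unfolding p23_def p32_def by - (rule closed_segment_proj, assumption+, (rule feet_snd)+)
    then show ?thesis by (simp add: boundary_def)
  next
    case 3
    then have Lz: "lift z = c *\<^sub>R P3 + a *\<^sub>R P1" using L by (simp add: add.commute)
    obtain x y where "x \<ge> 0" "y \<ge> 0" "lift z = x *\<^sub>R foot k3 P3 k1 P1 + y *\<^sub>R foot k1 P1 k3 P3"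
      using tangent_pair.cone_foot[OF p31 Lz nn(3) nn(1)] mle'(3,1) by blast
    then have "z \<in> closed_segment p31 p13"
      unfolding p31_def p13_def by - (rule closed_segment_proj, assumption+, (rule feet_snd)+)
    then show ?thesis by (simp add: boundary_def)
  next
    case 4
    \<comment> \<open>Tightness determines the coordinate along P1; after substituting it, the
      remaining terms group into the two feet on this axis. The next two cases are alike.\<close>
    have m: "a * (1 - k1\<^sup>2) = b * (1 + k1 * k2) + c * (1 + k3 * k1)"
      using 4(2) unfolding L mink_linear gram by (simp add: algebra_simps)
    have "(1 - k1\<^sup>2) *\<^sub>R lift z = (a * (1 - k1\<^sup>2)) *\<^sub>R P1 + (1 - k1\<^sup>2) *\<^sub>R (b *\<^sub>R P2 + c *\<^sub>R P3)"
      unfolding L by (simp add: scaleR_add_right mult.commute)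
    also have "\<dots> = c *\<^sub>R foot k1 P1 k3 P3 + b *\<^sub>R foot k1 P1 k2 P2"
      using 4(1) unfolding m by (simp add: foot_def algebra_simps)
    finally have "(1 / (1 - k1\<^sup>2)) *\<^sub>R ((1 - k1\<^sup>2) *\<^sub>R lift z) = (1 / (1 - k1\<^sup>2)) *\<^sub>R (c *\<^sub>R foot k1 P1 k3 P3 + b *\<^sub>R foot k1 P1 k2 P2)" by simp
    then have "lift z = (c / (1 - k1\<^sup>2)) *\<^sub>R foot k1 P1 k3 P3 + (b / (1 - k1\<^sup>2)) *\<^sub>R foot k1 P1 k2 P2"
      using sq_pos(1)[OF 4(1)] by (simp add: scaleR_add_right)
    then have "z \<in> closed_segment p13 p12" unfolding p13_def p12_def
      by (rule closed_segment_proj) (use nn sq_pos(1)[OF 4(1)] feet_snd in \<open>simp_all\<close>)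
    then show ?thesis by (simp add: boundary_def)
  next
    case 5
    have m: "b * (1 - k2\<^sup>2) = a * (1 + k1 * k2) + c * (1 + k2 * k3)"
      using 5(2) unfolding L mink_linear gram by (simp add: algebra_simps)
    have "(1 - k2\<^sup>2) *\<^sub>R lift z = (b * (1 - k2\<^sup>2)) *\<^sub>R P2 + (1 - k2\<^sup>2) *\<^sub>R (a *\<^sub>R P1 + c *\<^sub>R P3)"
      unfolding L by (simp add: scaleR_add_right mult.commute)
    also have "\<dots> = a *\<^sub>R foot k2 P2 k1 P1 + c *\<^sub>R foot k2 P2 k3 P3"
      using 5(1) unfolding m by (simp add: foot_def algebra_simps)
    finally have "(1 / (1 - k2\<^sup>2)) *\<^sub>R ((1 - k2\<^sup>2) *\<^sub>R lift z) = (1 / (1 - k2\<^sup>2)) *\<^sub>R (a *\<^sub>R foot k2 P2 k1 P1 + c *\<^sub>R foot k2 P2 k3 P3)" by simp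
    then have "lift z = (a / (1 - k2\<^sup>2)) *\<^sub>R foot k2 P2 k1 P1 + (c / (1 - k2\<^sup>2)) *\<^sub>R foot k2 P2 k3 P3"
      using sq_pos(2)[OF 5(1)] by (simp add: scaleR_add_right)
    then have "z \<in> closed_segment p21 p23" unfolding p21_def p23_def
      by (rule closed_segment_proj) (use nn sq_pos(2)[OF 5(1)] feet_snd in \<open>simp_all\<close>)
    then show ?thesis by (simp add: boundary_def)
  next
    case 6
    have m: "c * (1 - k3\<^sup>2) = b * (1 + k2 * k3) + a * (1 + k3 * k1)"
      using 6(2) unfolding L mink_linear gram by (simp add: algebra_simps)
    have "(1 - k3\<^sup>2) *\<^sub>R lift z = (c * (1 - k3\<^sup>2)) *\<^sub>R P3 + (1 - k3\<^sup>2) *\<^sub>R (a *\<^sub>R P1 + b *\<^sub>R P2)"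
      unfolding L by (simp add: scaleR_add_right mult.commute)
    also have "\<dots> = b *\<^sub>R foot k3 P3 k2 P2 + a *\<^sub>R foot k3 P3 k1 P1"
      using 6(1) unfolding m by (simp add: foot_def algebra_simps)
    finally have "(1 / (1 - k3\<^sup>2)) *\<^sub>R ((1 - k3\<^sup>2) *\<^sub>R lift z) = (1 / (1 - k3\<^sup>2)) *\<^sub>R (b *\<^sub>R foot k3 P3 k2 P2 + a *\<^sub>R foot k3 P3 k1 P1)" by simp
    then have "lift z = (b / (1 - k3\<^sup>2)) *\<^sub>R foot k3 P3 k2 P2 + (a / (1 - k3\<^sup>2)) *\<^sub>R foot k3 P3 k1 P1"
      using sq_pos(3)[OF 6(1)] by (simp add: scaleR_add_right)
    then have "z \<in> closed_segment p32 p31" unfolding p32_def p31_def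
      by (rule closed_segment_proj) (use nn sq_pos(3)[OF 6(1)] feet_snd in \<open>simp_all\<close>)
    then show ?thesis by (simp add: boundary_def)
  qed
qed

lemma hexagon_subset: "hexagon \<subseteq> boundary \<union> inside boundary"
  by (rule subset_Un_inside[OF closed_hexagon bounded_hexagon frontier_hexagon])

lemma circle_packed_triangle_boundary:
  assumes "rep c1 P1" "rep c2 P2" "rep c3 P3" "curv c1 = k1" "curv c2 = k2" "curv c3 = k3"
  shows "circle_packed_triangle c1 c2 c3 t12 t23 t31 (boundary \<union> inside boundary)"
proof -
  have "edge_ends c1 c2 t12 p12 p21" "edge_ends c2 c3 t23 p23 p32" "edge_ends c3 c1 t31 p31 p13"
    unfolding p12_def p23_def p31_def p21_def p32_def p13_def
    using tangent_pair.edge_ends_foot[OF p12 assms(1,2,4,5)] tangent_pair.edge_ends_foot[OF p23 assms(2,3,5,6)]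
      tangent_pair.edge_ends_foot[OF p31 assms(3,1,6,4)] by auto
  then show ?thesis
    unfolding circle_packed_triangle_def Let_def boundary_def by blast
qed

text \<open>The Gram matrix determines the coordinate along e up to sign, and the choice of e makes
  it the positive root.\<close>

lemma P3_frame:
  obtains a c where "P3 = a *\<^sub>R n + (2 * sqrt D / (k1 + k2)) *\<^sub>R e + c *\<^sub>R X"
    "a = (k1 - k2) / (k1 + k2)" "c = k3 + 2 / (k1 + k2)"
proof -
  define h where "h = k1 + k2"
  have h: "h > 0" using k12 by (simp add: h_def)
  define a b c where "a = mink P3 n" and "b = mink P3 e" and "c = - mink P3 X"
  have c: "c = k3 + 2 / h" using mink_X(3) by (simp add: c_def h_def)
  have "a = - 1 - k3 * k1 + k1 * c" by (simp add: a_def n_def mink_linear gram c_def)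
  then have a: "a = (k1 - k2) / h" unfolding c using h by (simp add: field_simps h_def)
  have P3: "P3 = a *\<^sub>R n + b *\<^sub>R e + c *\<^sub>R X"
    using frame_expand[OF frame, of P3] by (simp add: a_def b_def c_def)
  have "mink P3 P3 = a\<^sup>2 + b\<^sup>2 - c\<^sup>2"
    by (subst (1 2) P3) (simp add: mink_linear frame_cong[OF frame] power2_eq_square algebra_simps)
  then have "b\<^sup>2 = 1 - k3\<^sup>2 - a\<^sup>2 + c\<^sup>2" using gram by simp
  then have "b\<^sup>2 * h\<^sup>2 = (1 - k3\<^sup>2) * h\<^sup>2 - (a * h)\<^sup>2 + (c * h)\<^sup>2"
    by (simp add: power_mult_distrib left_diff_distrib distrib_right)
  moreover have "a * h = k1 - k2" "c * h = k3 * h + 2" using h by (simp_all add: a c field_simps)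
  ultimately have "b\<^sup>2 * h\<^sup>2 = (1 - k3\<^sup>2) * h\<^sup>2 - (k1 - k2)\<^sup>2 + (k3 * h + 2)\<^sup>2" by (simp only:)
  also have "(1 - k3\<^sup>2) * h\<^sup>2 - (k1 - k2)\<^sup>2 + (k3 * h + 2)\<^sup>2 = 4 * D"
    by (simp add: h_def D_def power2_eq_square algebra_simps)
  finally have bh: "(b * h)\<^sup>2 = (2 * sqrt D)\<^sup>2" using D_pos by (simp add: power_mult_distrib)
  have "b \<ge> 0" unfolding b_def e_def by (auto simp: mink_linear)
  then have "b * h = 2 * sqrt D"
    using h D_pos by (intro power2_eq_imp_eq[OF bh]) auto
  then have "b = 2 * sqrt D / h" using h by (simp add: field_simps)
  with P3 a c that show ?thesis by (simp add: h_def)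
qed

text \<open>The coordinates are found by comparing the coefficients of n, e and X, with \<tau> = s
  sqrt D running from 0 to 1. The form of y1 is arranged for the proof of nonnegativity. At \<tau> =
  1 only equal multiples of P1 and P3 are left, so the arc ends at the other tangency point.\<close>

lemma arc_coords:
  assumes s: "0 \<le> s" "s \<le> 1 / sqrt D"
  obtains y1 y2 y3 where "curve_vec k1 X n e s = y1 *\<^sub>R P1 + y2 *\<^sub>R P2 + y3 *\<^sub>R P3"
    "y1 \<ge> 0" "y2 \<ge> 0" "y3 \<ge> 0" "s = 1 / sqrt D \<Longrightarrow> y2 = 0 \<and> y1 = y3 \<and> y3 > 0"
proof -
  define h \<rho> where "h = k1 + k2" and "\<rho> = sqrt D"
  have h: "h > 0" using k12 by (simp add: h_def)
  have \<rho>: "\<rho> > 0" "\<rho> * \<rho> = D" using D_pos by (auto simp: \<rho>_def)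
  obtain a c where P3: "P3 = a *\<^sub>R n + (2 * \<rho> / h) *\<^sub>R e + c *\<^sub>R X" and a: "a = (k1 - k2) / h" and c: "c = k3 + 2 / h"
    using P3_frame unfolding h_def \<rho>_def by blast
  define \<tau> where "\<tau> = \<rho> * s"
  have \<tau>: "0 \<le> \<tau>" "\<tau> \<le> 1" using s \<rho> by (auto simp: \<tau>_def \<rho>_def[symmetric] field_simps)
  have s_eq: "s = \<tau> / \<rho>" using \<rho> by (simp add: \<tau>_def)
  have s2: "s\<^sup>2 = \<tau>\<^sup>2 / D" using \<rho> unfolding s_eq by (simp add: power_divide power2_eq_square)
  define y3 where "y3 = h * \<tau> / D"
  define y2 where "y2 = (1 - \<tau>) * (1 - \<tau> * (1 - k1\<^sup>2) / D) / h"
  define y1 where "y1 = ((1 - \<tau>)\<^sup>2 + \<tau> * (h\<^sup>2 / D - (1 - \<tau>) * ((1 + k1\<^sup>2 + 2 * k1 * k2) / D - 1))) / h"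
  have Dne: "D \<noteq> 0" using D_pos by auto
  have Dh: "D = 1 + k1 * k2 + k3 * h" by (simp add: D_def h_def algebra_simps)
  have eqn: "y1 - y2 + y3 * a = 2 * k1 * s\<^sup>2"
  proof -
    have h1: "h * D * y1 = D * (1 - \<tau>)\<^sup>2 + \<tau> * (h\<^sup>2 - (1 - \<tau>) * (1 + k1\<^sup>2 + 2 * k1 * k2 - D))"
      using h Dne by (simp add: y1_def field_simps)
    have h2: "h * D * y2 = (1 - \<tau>) * (D - \<tau> * (1 - k1\<^sup>2))"
      using h Dne by (simp add: y2_def field_simps)
    have h3: "h * D * (y3 * a) = h * \<tau> * (k1 - k2)"
      using h Dne by (simp add: y3_def a field_simps)
    have "h * D * (y1 - y2 + y3 * a) = h * D * y1 - h * D * y2 + h * D * (y3 * a)"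
      by (simp only: right_diff_distrib distrib_left)
    also have "\<dots> = 2 * k1 * h * \<tau>\<^sup>2"
      unfolding h1 h2 h3 by (simp add: h_def power2_eq_square algebra_simps)
    also have "\<dots> = h * D * (2 * k1 * s\<^sup>2)" using Dne by (simp add: s2)
    finally have "h * D * (y1 - y2 + y3 * a) = h * D * (2 * k1 * s\<^sup>2)" .
    then show ?thesis using h Dne by simp
  qed
  have eqe: "y3 * (2 * \<rho> / h) = 2 * s"
  proof -
    have "y3 * (2 * \<rho> / h) = 2 * \<tau> * \<rho> / D" using h by (simp add: y3_def)
    also have "\<dots> = 2 * s" using \<rho> by (simp add: s_eq flip: \<rho>(2))
    finally show ?thesis .
  qed
  have eqX: "k1 * y1 + k2 * y2 + c * y3 = 1 + (1 + k1\<^sup>2) * s\<^sup>2"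
  proof -
    have "k1 * y1 + k2 * y2 + c * y3 = k1 * (2 * k1 * s\<^sup>2) + h * y2 + (c - k1 * a) * y3"
      unfolding eqn[symmetric] by (simp add: h_def algebra_simps)
    also have "h * y2 = (1 - \<tau>) * (1 - \<tau> * (1 - k1\<^sup>2) / D)" using h by (simp add: y2_def)
    also have "(c - k1 * a) * y3 = (c - k1 * a) * h * \<tau> / D" by (simp add: y3_def)
    also have "(c - k1 * a) * h = k3 * h + 2 - k1 * (k1 - k2)" using h by (simp add: c a field_simps)
    also have "k3 * h + 2 - k1 * (k1 - k2) = D + 1 - k1\<^sup>2" by (simp add: Dh power2_eq_square algebra_simps)
    also have "k1 * (2 * k1 * s\<^sup>2) + (1 - \<tau>) * (1 - \<tau> * (1 - k1\<^sup>2) / D) + (D + 1 - k1\<^sup>2) * \<tau> / D = 1 + (1 + k1\<^sup>2) * s\<^sup>2"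
      unfolding s2 using Dne by (simp add: field_simps power2_eq_square)
    finally show ?thesis .
  qed
  have "y1 *\<^sub>R P1 + y2 *\<^sub>R P2 + y3 *\<^sub>R P3 = (y1 - y2 + y3 * a) *\<^sub>R n + (y3 * (2 * \<rho> / h)) *\<^sub>R e + (k1 * y1 + k2 * y2 + c * y3) *\<^sub>R X"
    by (subst P3, subst P1_frame[symmetric], subst P2_frame[symmetric]) (simp add: algebra_simps)
  also have "\<dots> = curve_vec k1 X n e s" unfolding eqn eqe eqX by (simp add: curve_vec_def)
  finally have V: "curve_vec k1 X n e s = y1 *\<^sub>R P1 + y2 *\<^sub>R P2 + y3 *\<^sub>R P3" by simp
  have "y3 \<ge> 0" using h \<tau> D_pos by (simp add: y3_def)
  moreover have "y2 \<ge> 0"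
  proof -
    have "\<tau> * (1 - k1\<^sup>2) \<le> D"
    proof (cases "k1\<^sup>2 \<le> 1")
      case True
      then have "\<tau> * (1 - k1\<^sup>2) \<le> 1 * 1" using \<tau> by (intro mult_mono) auto
      then show ?thesis using D_ge_1 by simp
    next
      case False
      then have "\<tau> * (1 - k1\<^sup>2) \<le> 0" using \<tau> by (simp add: mult_nonneg_nonpos)
      then show ?thesis using D_pos by simp
    qed
    then have "\<tau> * (1 - k1\<^sup>2) / D \<le> 1" using D_pos by (simp add: divide_le_eq)
    then show ?thesis using h \<tau> by (simp add: y2_def)
  qed
  moreover have "y1 \<ge> 0"
  proof -
    define R where "R = (1 + k1\<^sup>2 + 2 * k1 * k2) / D - 1"
    have "R = (1 + k1\<^sup>2 + 2 * k1 * k2 - D) / D" using Dne by (simp add: R_def field_simps)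
    also have "\<dots> \<le> h\<^sup>2 / D"
    proof -
      have "1 + k1\<^sup>2 + 2 * k1 * k2 - D \<le> h\<^sup>2"
        using D_ge_1 zero_le_power2[of k2] unfolding h_def power2_sum by linarith
      then show ?thesis using D_pos by (simp add: divide_right_mono)
    qed
    finally have R: "R \<le> h\<^sup>2 / D" .
    have "(1 - \<tau>) * R \<le> h\<^sup>2 / D"
    proof (cases "R \<ge> 0")
      case True
      then have "(1 - \<tau>) * R \<le> 1 * R" using \<tau> by (intro mult_right_mono) auto
      then show ?thesis using R by simp
    next
      case False
      then have "(1 - \<tau>) * R \<le> 0" using \<tau> by (simp add: mult_nonneg_nonpos)
      moreover have "0 \<le> h\<^sup>2 / D" using D_pos by simp
      ultimately show ?thesis by linarith
    qed
    then have "0 \<le> \<tau> * (h\<^sup>2 / D - (1 - \<tau>) * R)" using \<tau> by simp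
    then show ?thesis using h unfolding y1_def R_def[symmetric] by simp
  qed
  moreover have "y2 = 0 \<and> y1 = y3 \<and> y3 > 0" if "s = 1 / sqrt D"
  proof -
    have "\<tau> = 1" using that \<rho>(1) by (simp add: \<tau>_def \<rho>_def)
    then show ?thesis using h D_pos by (simp add: y1_def y2_def y3_def power2_eq_square)
  qed
  ultimately show ?thesis using V that by blast
qed

text \<open>The piece of \<open>curve_vec\<close> up to 1 / sqrt D. It lies in the cone by its
  explicit coordinates. It lies on the right side of the axes because the functions of both
  neighbors are nonpositive along the first circle.\<close>

lemma arc_exists:
  assumes r: "rep c1 P1" "curv c1 = k1"
  obtains g where "valid_path g" "arc g" "pathstart g = t12" "pathfinish g = t31"
    "path_image g \<subseteq> curve c1 \<inter> (boundary \<union> inside boundary)"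
proof -
  define \<rho> where "\<rho> = 1 / sqrt D"
  have \<rho>: "\<rho> > 0" "\<rho>\<^sup>2 = 1 / D" using D_pos by (auto simp: \<rho>_def power_divide)
  have q: "1 + (k1\<^sup>2 - 1) * s\<^sup>2 > 0" if "0 \<le> s" "s \<le> \<rho>" for s
    using that \<rho> power_mono[of s \<rho> 2] by (intro param_pos[OF k1pos D_pos]) auto
  define V where "V s = curve_vec k1 X n e s" for s
  note pt = curve_vec_point[OF frame q, folded V_def, unfolded P1_frame]
  have hex: "proj (V s) \<in> hexagon" if s: "0 \<le> s" "s \<le> \<rho>" for s
  proof -
    obtain y1 y2 y3 where y: "V s = y1 *\<^sub>R P1 + y2 *\<^sub>R P2 + y3 *\<^sub>R P3" "y1 \<ge> 0" "y2 \<ge> 0" "y3 \<ge> 0"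
      using arc_coords[OF s[unfolded \<rho>_def]] unfolding V_def by metis
    have "proj (V s) \<in> tri_cone" using y pt(1)[OF s] by (rule proj_cone)
    moreover have z: "proj (V s) \<in> hyp_plane" "gfun P1 k1 (proj (V s)) = 0" using pt(2,3)[OF s] by auto
    have l: "lor (proj (V s)) > 0" using z(1) by (rule lor_pos)
    have s12: "P1 + P2 = m12 *\<^sub>R lift t12" "m12 > 0" and s31: "P3 + P1 = m31 *\<^sub>R lift t31" "m31 > 0"
      using p12 p31 by (auto simp: tangent_pair_def)
    have "gfun P1 k1 (proj (V s)) + gfun P2 k2 (proj (V s)) \<le> 0"
      by (rule tangent_sides_gap(1)[OF gram(1,2,4) s12 k_nonneg(1,2) z(1)])
    moreover have "gfun P3 k3 (proj (V s)) + gfun P1 k1 (proj (V s)) \<le> 0"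
      by (rule tangent_sides_gap(1)[OF gram(3,1,8) s31 k_nonneg(3,1) z(1)])
    moreover have "0 \<le> k1 * lor (proj (V s))" "0 \<le> k2 * lor (proj (V s))" "0 \<le> k3 * lor (proj (V s))"
      using l k_nonneg by simp_all
    ultimately show ?thesis using z(2) unfolding hexagon_def gfun_def by auto
  qed
  define g where "g \<tau> = proj (V (\<rho> * \<tau>))" for \<tau>
  have range: "0 \<le> \<rho> * \<tau>" "\<rho> * \<tau> \<le> \<rho>" if "\<tau> \<in> {0..1}" for \<tau>
    using that \<rho>(1) by (auto simp: mult_le_cancel_left1)
  define V' where "V' \<tau> = \<rho> *\<^sub>R ((4 * k1 * (\<rho> * \<tau>)) *\<^sub>R n + 2 *\<^sub>R e + (2 * (1 + k1\<^sup>2) * (\<rho> * \<tau>)) *\<^sub>R X)" for \<tau>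
  have Vd: "((\<lambda>\<tau>. V (\<rho> * \<tau>)) has_vector_derivative V' \<tau>) (at \<tau>)" for \<tau>
  proof -
    have "((\<lambda>\<tau>. \<rho> * \<tau>) has_vector_derivative \<rho>) (at \<tau>)" by (auto intro!: derivative_eq_intros)
    from vector_diff_chain_at[OF this curve_vec_has_vector_derivative[of k1 X n e "\<rho> * \<tau>" UNIV]]
    show ?thesis by (simp add: V_def[abs_def] V'_def o_def)
  qed
  have sn: "snd (V (\<rho> * \<tau>)) \<noteq> 0" if "\<tau> \<in> {0..1}" for \<tau>
    using pt(1)[OF range[OF that]] by simp
  define G where "G \<tau> = fst (V' \<tau>) /\<^sub>R snd (V (\<rho> * \<tau>)) - (snd (V' \<tau>) / (snd (V (\<rho> * \<tau>)))\<^sup>2) *\<^sub>R fst (V (\<rho> * \<tau>))" for \<tau>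
  have gd: "(g has_vector_derivative G \<tau>) (at \<tau>)" if "\<tau> \<in> {0..1}" for \<tau>
    unfolding g_def G_def using proj_has_vector_derivative[OF Vd sn[OF that]] .
  have Vc: "continuous_on {0..1} (\<lambda>\<tau>. V (\<rho> * \<tau>))"
    using Vd by (meson continuous_at_imp_continuous_on has_vector_derivative_continuous)
  have "continuous_on {0..1} G"
    unfolding G_def using sn by (intro continuous_intros Vc) (auto simp: V'_def intro!: continuous_intros)
  then have "g C1_differentiable_on {0..1}"
    unfolding C1_differentiable_on_def using gd by blast
  then have vp: "valid_path g"
    unfolding valid_path_def by (rule C1_differentiable_imp_piecewise)
  have par: "curve_param k1 X n e (proj (V s)) = s" if "0 \<le> s" "s \<le> \<rho>" for s
  proof -
    have m: "mink (V s) e = 2 * s" "mink (V s) X = - (1 + (1 + k1\<^sup>2) * s\<^sup>2)" "mink (V s) n = 2 * k1 * s\<^sup>2"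
      by (simp_all add: V_def curve_vec_def mink_linear frame_cong[OF frame])
    have sv: "snd (V s) > 0" using pt(1)[OF that] .
    have "(k1 + 1 / k1) * (2 * k1 * s\<^sup>2) = 2 * (1 + k1\<^sup>2) * s\<^sup>2" using k1pos by (simp add: field_simps power2_eq_square)
    then have "curve_den k1 X n (proj (V s)) = 2 / snd (V s)"
      using sv unfolding curve_den_def mink_commute[of "lift _"]
      by (simp add: mink_lift_proj mink_commute[of _ "V s"] m field_simps)
    then show ?thesis
      using sv by (simp add: curve_param_def mink_commute[of "lift _"] mink_lift_proj mink_commute[of _ "V s"] m)
  qed
  have "inj_on g {0..1}"
  proof (rule inj_onI)
    fix a b assume ab: "a \<in> {0..1}" "b \<in> {0..1}" "g a = g b"
    then have "\<rho> * a = \<rho> * b"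
      using par[OF range[OF ab(1)]] par[OF range[OF ab(2)]] unfolding g_def by metis
    then show "a = b" using \<rho>(1) by simp
  qed
  then have "arc g" using vp by (simp add: arc_def valid_path_imp_path)
  moreover have "pathstart g = t12"
    by (simp add: pathstart_def g_def V_def curve_vec_def proj_X)
  moreover have "pathfinish g = t31"
  proof -
    have s31: "P3 + P1 = m31 *\<^sub>R lift t31" "m31 > 0" using p31 by (auto simp: tangent_pair_def)
    obtain y1 y2 y3 where y: "V \<rho> = y1 *\<^sub>R P1 + y2 *\<^sub>R P2 + y3 *\<^sub>R P3" "y2 = 0 \<and> y1 = y3 \<and> y3 > 0"
      using arc_coords[of \<rho>] \<rho>(1) unfolding V_def \<rho>_def by force
    then have "V \<rho> = y3 *\<^sub>R (P3 + P1)" by (simp add: scaleR_add_right)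
    then have "V \<rho> = (y3 * m31) *\<^sub>R lift t31" by (simp add: s31(1))
    then show ?thesis using y(2) s31(2) by (simp add: pathfinish_def g_def proj_scale)
  qed
  moreover have "path_image g \<subseteq> curve c1 \<inter> (boundary \<union> inside boundary)"
  proof
    fix z assume "z \<in> path_image g"
    then obtain \<tau> where \<tau>: "\<tau> \<in> {0..1}" "z = proj (V (\<rho> * \<tau>))" by (auto simp: path_image_def g_def)
    then show "z \<in> curve c1 \<inter> (boundary \<union> inside boundary)"
      using hexagon_subset hex[OF range[OF \<tau>(1)]] pt(2,3)[OF range[OF \<tau>(1)]] r by (auto simp: rep_def)
  qed
  ultimately show ?thesis using that vp by blast
qed

end

lemma tangent_pair_of_rep:
  assumes r: "rep c1 P1" "rep c2 P2" and t: "externally_tangent_at c1 c2 t"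
  obtains \<mu> where "tangent_pair P1 P2 (curv c1) (curv c2) \<mu> t"
proof -
  obtain \<mu> where "\<mu> > 0" "P1 + P2 = \<mu> *\<^sub>R lift t" "mink P1 P2 = - 1 - curv c1 * curv c2"
    using rep_of_externally_tangent[OF r t] .
  then have "tangent_pair P1 P2 (curv c1) (curv c2) \<mu> t"
    using r by unfold_locales (auto simp: rep_def)
  then show ?thesis by (rule that)
qed

definition circle_of :: "real \<Rightarrow> mvec \<Rightarrow> gen_circle" where
  "circle_of k P = \<lparr>curv = k, center = (if k < 1 then hyp_axis P else {proj P}),
     curve = {x \<in> hyp_plane. gfun P k x = 0}, side = {x \<in> hyp_plane. gfun P k x \<ge> 0}\<rparr>"

lemma rep_circle_of:
  assumes "k \<ge> 0" "mink P P = 1 - k\<^sup>2" "k \<ge> 1 \<Longrightarrow> snd P > 0"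
  shows "rep (circle_of k P) P" "curv (circle_of k P) = k"
  using assms by (auto simp: rep_def circle_of_def)

text \<open>The configuration with the first tangency point at the origin.\<close>

lemma triple_exists:
  assumes k: "k1 > 0" "k2 \<ge> 0" "k3 \<ge> 0"
  obtains P1 P2 P3 m12 m23 m31 t12 t23 t31 where "triple P1 P2 P3 k1 k2 k3 m12 m23 m31 t12 t23 t31"
    "counterclockwise t12 t23 t31"
proof -
  define h D where "h = k1 + k2" and "D = 1 + k1 * k2 + k2 * k3 + k3 * k1"
  have h: "h > 0" using k by (simp add: h_def)
  have D: "D > 0" using k by (simp add: D_def add_pos_nonneg)
  define a b c where "a = (k1 - k2) / h" and "b = - (2 * sqrt D / h)" and "c = k3 + 2 / h"
  define P1 P2 P3 :: mvec where "P1 = (1, k1)" and "P2 = (-1, k2)" and "P3 = (Complex a b, c)"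
  have c: "c > 0" using k h by (simp add: c_def add_nonneg_pos)
  have ah: "a * h = k1 - k2" and ch: "c * h = k3 * h + 2" and bh: "(b * h)\<^sup>2 = 4 * D"
    using h D by (simp_all add: a_def b_def c_def field_simps power_mult_distrib)
  have "h\<^sup>2 * (a\<^sup>2 + b\<^sup>2 - c\<^sup>2) = (a * h)\<^sup>2 + (b * h)\<^sup>2 - (c * h)\<^sup>2"
    by (simp add: power_mult_distrib algebra_simps)
  also have "\<dots> = h\<^sup>2 * (1 - k3\<^sup>2)"
    unfolding ah ch bh by (simp add: D_def h_def power2_eq_square algebra_simps)
  finally have P33: "a\<^sup>2 + b\<^sup>2 - c\<^sup>2 = 1 - k3\<^sup>2" using h by simp
  have "h * (a - k1 * c) = h * (- 1 - k3 * k1)"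
  proof -
    have "h * (a - k1 * c) = a * h - k1 * (c * h)" by (simp add: algebra_simps)
    then show ?thesis unfolding ah ch by (simp add: h_def algebra_simps)
  qed
  then have P31: "a - k1 * c = - 1 - k3 * k1" using h by simp
  have "h * (- a - k2 * c) = h * (- 1 - k2 * k3)"
  proof -
    have "h * (- a - k2 * c) = - (a * h) - k2 * (c * h)" by (simp add: algebra_simps)
    then show ?thesis unfolding ah ch by (simp add: h_def algebra_simps)
  qed
  then have P23: "- a - k2 * c = - 1 - k2 * k3" using h by simp
  have m: "mink P1 P1 = 1 - k1\<^sup>2" "mink P2 P2 = 1 - k2\<^sup>2" "mink P3 P3 = 1 - k3\<^sup>2"
    "mink P1 P2 = - 1 - k1 * k2" "mink P2 P3 = - 1 - k2 * k3" "mink P3 P1 = - 1 - k3 * k1"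
    using P33 P31 P23 by (simp_all add: P1_def P2_def P3_def mink_def inner_complex_def power2_eq_square mult.commute)
  have s: "snd P1 > 0" "k2 \<ge> 1 \<Longrightarrow> snd P2 > 0" "snd P3 > 0" using k c by (auto simp: P1_def P2_def P3_def)
  have lp: "Y = snd Y *\<^sub>R lift (proj Y)" if "snd Y > 0" for Y using that by (simp add: lift_proj)
  have s2: "snd (P1 + P2) > 0" "snd (P2 + P3) > 0" "snd (P3 + P1) > 0" using k c h by (auto simp: P1_def P2_def P3_def h_def)
  have tr: "triple P1 P2 P3 k1 k2 k3 (snd (P1 + P2)) (snd (P2 + P3)) (snd (P3 + P1)) (proj (P1 + P2)) (proj (P2 + P3)) (proj (P3 + P1))"
    using m s k lp[OF s2(1)] lp[OF s2(2)] lp[OF s2(3)] s2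
    by (intro triple.intro tangent_pair.intro) simp_all
  have "counterclockwise (proj (P1 + P2)) (proj (P2 + P3)) (proj (P3 + P1))"
  proof -
    have p0: "proj (P1 + P2) = 0" by (simp add: proj_def P1_def P2_def)
    have "b < 0" using h D by (simp add: b_def)
    moreover have "Im (cnj (proj (P2 + P3)) * proj (P3 + P1)) = (- 2 * b) / ((k2 + c) * (k1 + c))"
    proof -
      have "proj (P2 + P3) = Complex ((a - 1) / (k2 + c)) (b / (k2 + c))"
        "proj (P3 + P1) = Complex ((a + 1) / (k1 + c)) (b / (k1 + c))"
        by (simp_all add: proj_def P1_def P2_def P3_def complex_eq_iff divide_inverse add.commute mult.commute)
      moreover have "Im (cnj (Complex (x / A) (y / A)) * Complex (z / B) (y / B)) = (x * y - y * z) / (A * B)"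
        for x y z A B :: real by (simp add: times_divide_times_eq diff_divide_distrib)
      ultimately have "Im (cnj (proj (P2 + P3)) * proj (P3 + P1)) =
          ((a - 1) * b - b * (a + 1)) / ((k2 + c) * (k1 + c))"
        by (simp only:)
      then show ?thesis by (simp add: algebra_simps)
    qed
    moreover have "(k2 + c) * (k1 + c) > 0" using k c by simp
    ultimately show ?thesis unfolding counterclockwise_def p0 by (simp add: divide_neg_pos)
  qed
  with tr show ?thesis by (rule that)
qed

theorem arc_curvature_eq:
  assumes k: "k1 > 0" "k2 \<ge> 0" "k3 \<ge> 0"
  shows "arc_curvature k1 k2 k3 = k1 * arc_len k1 (1 + k1 * k2 + k2 * k3 + k3 * k1)"
proof -
  let ?Q = "\<lambda>T. \<exists>c1 c2 c3 t12 t23 t31 \<Delta> g. curv c1 = k1 \<and> curv c2 = k2 \<and> curv c3 = k3 \<and>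
        tangent_triple c1 c2 c3 t12 t23 t31 \<and> circle_packed_triangle c1 c2 c3 t12 t23 t31 \<Delta> \<and>
        valid_path g \<and> arc g \<and> pathstart g = t12 \<and> pathfinish g = t31 \<and>
        path_image g \<subseteq> curve c1 \<inter> \<Delta> \<and> T = k1 * hyp_length g"
  have unique: "T = k1 * arc_len k1 (1 + k1 * k2 + k2 * k3 + k3 * k1)" if Q: "?Q T" for T
  proof -
    obtain c1 c2 c3 t12 t23 t31 \<Delta> g where c: "curv c1 = k1" "curv c2 = k2" "curv c3 = k3"
      and tt: "tangent_triple c1 c2 c3 t12 t23 t31" and tri: "circle_packed_triangle c1 c2 c3 t12 t23 t31 \<Delta>"
      and g: "valid_path g" "arc g" "pathstart g = t12" "pathfinish g = t31" "path_image g \<subseteq> curve c1 \<inter> \<Delta>"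
      and T: "T = k1 * hyp_length g"
      using Q by blast
    obtain P1 P2 P3 where r: "rep c1 P1" "rep c2 P2" "rep c3 P3"
      using tt unfolding tangent_triple_def generalized_circle_iff_rep by blast
    have et: "externally_tangent_at c1 c2 t12" "externally_tangent_at c2 c3 t23" "externally_tangent_at c3 c1 t31"
      using tt unfolding tangent_triple_def by auto
    obtain m12 where m12: "tangent_pair P1 P2 k1 k2 m12 t12" using tangent_pair_of_rep[OF r(1,2) et(1)] c by auto
    obtain m23 where m23: "tangent_pair P2 P3 k2 k3 m23 t23" using tangent_pair_of_rep[OF r(2,3) et(2)] c by auto
    obtain m31 where m31: "tangent_pair P3 P1 k3 k1 m31 t31" using tangent_pair_of_rep[OF r(3,1) et(3)] c by auto
    interpret triple P1 P2 P3 k1 k2 k3 m12 m23 m31 t12 t23 t31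
      using m12 m23 m31 k(1) by (rule triple.intro)
    show ?thesis
      unfolding T using arc_length_in_triangle[OF r c tri g] by (simp add: D_def)
  qed
  obtain P1 P2 P3 m12 m23 m31 t12 t23 t31 where tr: "triple P1 P2 P3 k1 k2 k3 m12 m23 m31 t12 t23 t31"
    and cc: "counterclockwise t12 t23 t31"
    using triple_exists[OF k] .
  interpret triple P1 P2 P3 k1 k2 k3 m12 m23 m31 t12 t23 t31 by (rule tr)
  have f: "k1 \<ge> 1 \<Longrightarrow> snd P1 > 0" "k2 \<ge> 1 \<Longrightarrow> snd P2 > 0" "k3 \<ge> 1 \<Longrightarrow> snd P3 > 0"
    using p12 p23 by (auto simp: tangent_pair_def)
  define c1 c2 c3 where "c1 = circle_of k1 P1" and "c2 = circle_of k2 P2" and "c3 = circle_of k3 P3"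
  have r: "rep c1 P1" "rep c2 P2" "rep c3 P3" and c: "curv c1 = k1" "curv c2 = k2" "curv c3 = k3"
    unfolding c1_def c2_def c3_def
    using rep_circle_of[OF k_nonneg(1) gram(1) f(1)] rep_circle_of[OF k_nonneg(2) gram(2) f(2)]
      rep_circle_of[OF k_nonneg(3) gram(3) f(3)] by auto
  have "externally_tangent_at c1 c2 t12" "externally_tangent_at c2 c3 t23" "externally_tangent_at c3 c1 t31"
    using externally_tangent_of_rep[OF r(1,2), of m12 t12] externally_tangent_of_rep[OF r(2,3), of m23 t23]
      externally_tangent_of_rep[OF r(3,1), of m31 t31] p12 p23 p31 c by (auto simp: tangent_pair_def)
  then have tt: "tangent_triple c1 c2 c3 t12 t23 t31"
    unfolding tangent_triple_def generalized_circle_iff_rep using r cc by blast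
  obtain g where g: "valid_path g" "arc g" "pathstart g = t12" "pathfinish g = t31"
    "path_image g \<subseteq> curve c1 \<inter> (boundary \<union> inside boundary)"
    using arc_exists[OF r(1) c(1)] .
  have "?Q (k1 * hyp_length g)"
    using c tt circle_packed_triangle_boundary[OF r c] g by blast
  \<comment> \<open>The realized value is itself subject to \<open>unique\<close>, so the formula
    satisfies the description.\<close>
  then have "?Q (k1 * arc_len k1 (1 + k1 * k2 + k2 * k3 + k3 * k1))" using unique by metis
  then have "(THE T. ?Q T) = k1 * arc_len k1 (1 + k1 * k2 + k2 * k3 + k3 * k1)"
    by (rule the_equality) (rule unique)
  then show ?thesis unfolding arc_curvature_def using k(1) by simp
qed

section \<open>The curvature function\<close>

definition arc_den :: "real \<Rightarrow> real \<Rightarrow> real" where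
  "arc_den x \<phi> = sqrt ((sin \<phi>)\<^sup>2 + exp x * (cos \<phi>)\<^sup>2)"

text \<open>The total curvature of an arc in an angle variable. For x = - 2 ln k the scale of the
  curvatures enters only through x and their ratios only through \<theta>, so monotonicity and
  Lipschitz bounds can be proved in each variable separately. On the angles used the integrand lies
  between 0 and 2.\<close>

definition arc_int :: "real \<Rightarrow> real \<Rightarrow> real" where
  "arc_int \<theta> x = integral {\<theta>..pi/2} (\<lambda>\<phi>. 2 * sin \<phi> / arc_den x \<phi>)"

lemma arc_den_arg_pos: "0 < (sin (\<phi>::real))\<^sup>2 + exp (x::real) * (cos \<phi>)\<^sup>2"
proof (cases "cos \<phi> = 0")
  case True
  then have "(sin \<phi>)\<^sup>2 = 1" using sin_cos_squared_add[of \<phi>] by simp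
  then show ?thesis using True by simp
qed (simp add: add_nonneg_pos)

lemma arc_den_pos: "arc_den x \<phi> > 0"
  unfolding arc_den_def using arc_den_arg_pos by simp

lemma arc_den_mono: "x \<le> y \<Longrightarrow> arc_den x \<phi> \<le> arc_den y \<phi>"
  by (simp add: arc_den_def mult_right_mono)

lemma arc_den_ge_sin: "0 \<le> sin \<phi> \<Longrightarrow> sin \<phi> \<le> arc_den x \<phi>"
  unfolding arc_den_def by (intro real_le_rsqrt) simp

lemma continuous_arc_int [continuous_intros]: "continuous_on A (\<lambda>\<phi>. 2 * sin \<phi> / arc_den x \<phi>)"
proof -
  have "(sin \<phi>)\<^sup>2 + exp x * (cos \<phi>)\<^sup>2 \<noteq> 0" for \<phi> using arc_den_arg_pos[of \<phi> x] by linarith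
  then show ?thesis unfolding arc_den_def by (intro continuous_intros) auto
qed

lemma integrable_arc_int: "(\<lambda>\<phi>. 2 * sin \<phi> / arc_den x \<phi>) integrable_on {a..b}"
  by (intro integrable_continuous_real continuous_intros)

lemma arc_int_integrand_bounds:
  assumes "\<phi> \<in> {0..pi/2}" shows "0 \<le> 2 * sin \<phi> / arc_den x \<phi>" "2 * sin \<phi> / arc_den x \<phi> \<le> 2"
proof -
  have "sin \<phi> \<ge> 0" using assms pi_gt_zero by (intro sin_ge_zero) auto
  then show "0 \<le> 2 * sin \<phi> / arc_den x \<phi>" "2 * sin \<phi> / arc_den x \<phi> \<le> 2"
    using arc_den_pos[of x \<phi>] arc_den_ge_sin[of \<phi> x] by (auto simp: divide_le_eq)
qed

lemma arc_int_split:
  assumes "0 \<le> \<theta>" "\<theta> \<le> \<theta>'" "\<theta>' \<le> pi/2"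
  shows "arc_int \<theta> x = integral {\<theta>..\<theta>'} (\<lambda>\<phi>. 2 * sin \<phi> / arc_den x \<phi>) + arc_int \<theta>' x"
  unfolding arc_int_def using assms by (intro Henstock_Kurzweil_Integration.integral_combine[symmetric] integrable_arc_int) auto

lemma arc_int_nonneg: "0 \<le> \<theta> \<Longrightarrow> 0 \<le> arc_int \<theta> x"
  unfolding arc_int_def by (intro integral_nonneg integrable_arc_int) (auto intro!: arc_int_integrand_bounds)

lemma arc_int_diff_theta:
  assumes "0 \<le> \<theta>" "\<theta> \<le> \<theta>'" "\<theta>' \<le> pi/2"
  shows "arc_int \<theta>' x \<le> arc_int \<theta> x" "arc_int \<theta> x - arc_int \<theta>' x \<le> 2 * (\<theta>' - \<theta>)"
proof -
  let ?i = "integral {\<theta>..\<theta>'} (\<lambda>\<phi>. 2 * sin \<phi> / arc_den x \<phi>)"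
  have "0 \<le> ?i"
    using assms by (intro integral_nonneg integrable_arc_int arc_int_integrand_bounds) auto
  moreover have "?i \<le> integral {\<theta>..\<theta>'} (\<lambda>\<phi>. 2)"
    using assms by (intro integral_le integrable_arc_int arc_int_integrand_bounds) auto
  ultimately show "arc_int \<theta>' x \<le> arc_int \<theta> x" "arc_int \<theta> x - arc_int \<theta>' x \<le> 2 * (\<theta>' - \<theta>)"
    using arc_int_split[OF assms] assms by auto
qed

lemma arc_int_le_pi: "0 \<le> \<theta> \<Longrightarrow> \<theta> \<le> pi/2 \<Longrightarrow> arc_int \<theta> x \<le> pi"
  using arc_int_diff_theta(2)[of \<theta> "pi/2" x] by (simp add: arc_int_def)

lemma arc_int_antimono_x:
  assumes "0 \<le> \<theta>" "x \<le> y" shows "arc_int \<theta> y \<le> arc_int \<theta> x"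
  unfolding arc_int_def
proof (intro integral_le integrable_arc_int)
  fix \<phi> assume "\<phi> \<in> {\<theta>..pi/2}"
  then have "sin \<phi> \<ge> 0" using assms by (intro sin_ge_zero) auto
  then show "2 * sin \<phi> / arc_den y \<phi> \<le> 2 * sin \<phi> / arc_den x \<phi>"
    using arc_den_pos arc_den_mono[OF assms(2)] by (intro divide_left_mono) auto
qed

lemma arc_int_strict_antimono_x:
  assumes "0 \<le> \<theta>" "\<theta> < pi/2" "x < y" shows "arc_int \<theta> y < arc_int \<theta> x"
  unfolding arc_int_def
proof (rule integral_less_real)
  show "{\<theta><..<pi/2} \<noteq> {}" using assms by auto
  fix \<phi> assume \<phi>: "\<phi> \<in> {\<theta><..<pi/2}"
  have s: "sin \<phi> > 0" using \<phi> assms by (intro sin_gt_zero) auto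
  have c: "cos \<phi> > 0" using \<phi> assms by (intro cos_gt_zero) auto
  have "arc_den x \<phi> < arc_den y \<phi>" using assms c by (simp add: arc_den_def)
  then show "2 * sin \<phi> / arc_den y \<phi> < 2 * sin \<phi> / arc_den x \<phi>"
    using s arc_den_pos by (intro divide_strict_left_mono) auto
qed (intro continuous_intros)+

lemma arc_int_pos: "0 \<le> \<theta> \<Longrightarrow> \<theta> < pi/2 \<Longrightarrow> 0 < arc_int \<theta> x"
  using arc_int_strict_antimono_x[of \<theta> x "x + 1"] arc_int_nonneg[of \<theta> "x + 1"] by simp

text \<open>Passing from x to y multiplies \<open>arc_den\<close> at most by exp ((y - x) / 2), so
  the integral is multiplied at least by l. The loss is at most 1 - l times the bound pi on the
  integral.\<close>

lemma arc_int_lipschitz_x: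
  assumes "0 \<le> \<theta>" "\<theta> \<le> pi/2" "x \<le> y" shows "arc_int \<theta> x - arc_int \<theta> y \<le> pi * (y - x)"
proof -
  define l where "l = exp (- (y - x) / 2)"
  have l: "0 < l" "l \<le> 1" "l * l = exp (x - y)"
    using assms by (auto simp: l_def simp flip: exp_add)
  have "l * arc_int \<theta> x = integral {\<theta>..pi/2} (\<lambda>\<phi>. l * (2 * sin \<phi> / arc_den x \<phi>))"
    unfolding arc_int_def by (rule Henstock_Kurzweil_Integration.integral_mult_right[symmetric])
  also have "\<dots> \<le> arc_int \<theta> y" unfolding arc_int_def
  proof (rule integral_le)
    show "(\<lambda>\<phi>. l * (2 * sin \<phi> / arc_den x \<phi>)) integrable_on {\<theta>..pi/2}" by (intro integrable_on_mult_right integrable_arc_int)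
    show "(\<lambda>\<phi>. 2 * sin \<phi> / arc_den y \<phi>) integrable_on {\<theta>..pi/2}" by (rule integrable_arc_int)
    fix \<phi> assume "\<phi> \<in> {\<theta>..pi/2}"
    then have s: "sin \<phi> \<ge> 0" using assms by (intro sin_ge_zero) auto
    have "l * arc_den y \<phi> \<le> arc_den x \<phi>"
    proof (rule power2_le_imp_le)
      have "(l * arc_den y \<phi>)\<^sup>2 = (l * l) * ((sin \<phi>)\<^sup>2 + exp y * (cos \<phi>)\<^sup>2)"
        using arc_den_arg_pos[of \<phi> y] by (simp add: arc_den_def power_mult_distrib power2_eq_square)
      also have "\<dots> = (l * l) * (sin \<phi>)\<^sup>2 + exp x * (cos \<phi>)\<^sup>2"
        unfolding l(3) by (simp add: distrib_left mult.assoc[symmetric] exp_add[symmetric])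
      also have "\<dots> \<le> 1 * (sin \<phi>)\<^sup>2 + exp x * (cos \<phi>)\<^sup>2"
        using l by (intro add_right_mono mult_right_mono mult_le_one) auto
      also have "\<dots> = (arc_den x \<phi>)\<^sup>2" using arc_den_arg_pos[of \<phi> x] by (simp add: arc_den_def)
      finally show "(l * arc_den y \<phi>)\<^sup>2 \<le> (arc_den x \<phi>)\<^sup>2" .
    qed (use arc_den_pos in \<open>simp add: less_imp_le\<close>)
    then have "l / arc_den x \<phi> \<le> 1 / arc_den y \<phi>"
      using arc_den_pos by (simp add: field_simps)
    then have "2 * sin \<phi> * (l / arc_den x \<phi>) \<le> 2 * sin \<phi> * (1 / arc_den y \<phi>)"
      using s by (intro mult_left_mono) auto
    then show "l * (2 * sin \<phi> / arc_den x \<phi>) \<le> 2 * sin \<phi> / arc_den y \<phi>" by (simp add: mult_ac)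
  qed
  finally have "arc_int \<theta> x - arc_int \<theta> y \<le> (1 - l) * arc_int \<theta> x" by (simp add: left_diff_distrib)
  also have "\<dots> \<le> (y - x) * pi"
  proof (rule mult_mono)
    have "1 + (- (y - x) / 2) \<le> l" unfolding l_def by (rule exp_ge_add_one_self)
    then show "1 - l \<le> y - x" using assms by (simp add: field_simps)
  qed (use assms arc_int_le_pi arc_int_nonneg l in auto)
  finally show ?thesis by (simp add: mult.commute)
qed

lemma arc_int_lipschitz:
  assumes "\<theta> \<in> {0..pi/2}" "\<theta>' \<in> {0..pi/2}"
  shows "\<bar>arc_int \<theta> x - arc_int \<theta>' y\<bar> \<le> 2 * \<bar>\<theta> - \<theta>'\<bar> + pi * \<bar>x - y\<bar>"
proof -
  have "\<bar>arc_int \<theta> x - arc_int \<theta>' x\<bar> \<le> 2 * \<bar>\<theta> - \<theta>'\<bar>"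
    using arc_int_diff_theta[of \<theta> \<theta>' x] arc_int_diff_theta[of \<theta>' \<theta> x] assms by (cases "\<theta> \<le> \<theta>'") auto
  moreover have "\<bar>arc_int \<theta>' x - arc_int \<theta>' y\<bar> \<le> pi * \<bar>x - y\<bar>"
    using arc_int_lipschitz_x[of \<theta>' x y] arc_int_lipschitz_x[of \<theta>' y x] arc_int_antimono_x[of \<theta>' x y] arc_int_antimono_x[of \<theta>' y x] assms
    by (cases "x \<le> y") auto
  ultimately show ?thesis by linarith
qed

text \<open>Outside a window of length d next to pi/2 the cosine is at least sin d, which makes the
  integrand small for large x; the window contributes at most 2 d. The bound is uniform in \<theta>,
  since \<theta> need not converge when the curvature at the vertex tends to 0.\<close>

lemma arc_int_zero_bound:
  assumes "0 \<le> \<theta>" "0 < d" "d < pi/2"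
  shows "arc_int \<theta> x \<le> 2 * d + pi / (exp (x / 2) * sin d)"
proof (cases "\<theta> \<le> pi/2")
  case True
  have sd: "sin d > 0" using assms by (intro sin_gt_zero) auto
  define b where "b = 2 / (exp (x / 2) * sin d)"
  have b: "b > 0" using sd by (simp add: b_def)
  have "arc_int \<theta> x \<le> arc_int 0 x" using arc_int_diff_theta(1)[of 0 \<theta> x] assms True by simp
  also have "\<dots> = integral {0..pi/2 - d} (\<lambda>\<phi>. 2 * sin \<phi> / arc_den x \<phi>) + arc_int (pi/2 - d) x"
    using assms by (intro arc_int_split) auto
  also have "arc_int (pi/2 - d) x \<le> 2 * d" using arc_int_diff_theta(2)[of "pi/2 - d" "pi/2" x] assms by (simp add: arc_int_def)
  also have "integral {0..pi/2 - d} (\<lambda>\<phi>. 2 * sin \<phi> / arc_den x \<phi>) \<le> integral {0..pi/2 - d} (\<lambda>\<phi>. b)"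
  proof (intro integral_le integrable_arc_int integrable_const_ivl)
    fix \<phi> assume \<phi>: "\<phi> \<in> {0..pi/2 - d}"
    have "sin d = cos (pi/2 - d)" by (simp add: cos_diff)
    also have "\<dots> \<le> cos \<phi>" using \<phi> assms by (intro cos_monotone_0_pi_le) auto
    finally have "exp (x / 2) * sin d \<le> exp (x / 2) * cos \<phi>" by simp
    also have "\<dots> \<le> arc_den x \<phi>"
      unfolding arc_den_def by (intro real_le_rsqrt) (simp add: power_mult_distrib flip: exp_of_nat_mult exp_double)
    finally have le: "exp (x / 2) * sin d \<le> arc_den x \<phi>" .
    have "2 * sin \<phi> / arc_den x \<phi> \<le> 2 / arc_den x \<phi>" using arc_den_pos[of x \<phi>] by (intro divide_right_mono) auto
    also have "\<dots> \<le> b" unfolding b_def using le sd arc_den_pos[of x \<phi>] by (intro divide_left_mono) auto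
    finally show "2 * sin \<phi> / arc_den x \<phi> \<le> b" .
  qed
  also have "\<dots> \<le> b * (pi / 2)" using assms b by (simp add: mult.commute)
  finally show ?thesis by (simp add: b_def)
next
  case False
  then have "arc_int \<theta> x = 0" by (simp add: arc_int_def)
  moreover have "sin d > 0" using assms by (intro sin_gt_zero) auto
  ultimately show ?thesis using assms by simp
qed

text \<open>The substitution \<open>u = cos \<phi> / sqrt (cos\<^sup>2 \<phi> + k\<^sup>2 sin\<^sup>2 \<phi>)\<close>.\<close>

lemma arc_len_eq_arc_int:
  assumes k: "k > 0" and D: "D \<ge> 1"
  shows "k * arc_len k D = arc_int (arctan (sqrt ((D - 1) / k\<^sup>2))) (- 2 * ln k)"
proof -
  define c \<theta> r where "c = (D - 1) / k\<^sup>2" and "\<theta> = arctan (sqrt c)" and "r = 1 / sqrt D"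
  have c: "c \<ge> 0" "D = 1 + k\<^sup>2 * c" using k D by (auto simp: c_def)
  have \<theta>: "0 \<le> \<theta>" "\<theta> < pi/2" using c arctan_ubound[of "sqrt c"] by (simp_all add: \<theta>_def)
  have Dp: "D > 0" "D + k\<^sup>2 > 1" using D zero_less_power[OF k, of 2] by linarith+
  define W where "W \<phi> = (cos \<phi>)\<^sup>2 + k\<^sup>2 * (sin \<phi>)\<^sup>2" for \<phi>
  have W: "W \<phi> > 0" for \<phi>
  proof (cases "sin \<phi> = 0")
    case True
    then have "(cos \<phi>)\<^sup>2 = 1" using sin_cos_squared_add[of \<phi>] by simp
    then show ?thesis using True by (simp add: W_def)
  next
    case False
    then show ?thesis using k by (simp add: W_def add_nonneg_pos)
  qed
  define \<sigma> where "\<sigma> \<phi> = cos \<phi> / sqrt (W \<phi>)" for \<phi>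
  define a where "a u = 2 / (1 + (k\<^sup>2 - 1) * u\<^sup>2)" for u :: real
  have r: "r > 0" "r\<^sup>2 = 1 / D" using Dp by (auto simp: r_def power_divide)
  have "1 + (k\<^sup>2 - 1) * u\<^sup>2 > 0" if "u \<in> {0..r}" for u
    using that r power_mono[of u r 2] by (intro param_pos[OF k Dp]) auto
  then have ac: "continuous_on {0..r} a" unfolding a_def by (intro continuous_intros) force
  define \<Psi> where "\<Psi> x = integral {0..x} a" for x
  have \<Psi>d: "(\<Psi> has_real_derivative a x) (at x within {0..r})" if "x \<in> {0..r}" for x
    unfolding \<Psi>_def by (rule integral_has_real_derivative[OF ac that])
  have tan\<theta>: "sqrt c * cos \<theta> = sin \<theta>"
    using tan_arctan[of "sqrt c"] cos_arctan_not_zero[of "sqrt c"] unfolding \<theta>_def tan_def by (simp add: field_simps)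
  \<comment> \<open>The angle \<theta> corresponds to the end u = r of the original interval and
    pi/2 to u = 0, so the substitution reverses the orientation.\<close>
  have \<sigma>r: "\<sigma> \<phi> \<in> {0..r}" if \<phi>: "\<phi> \<in> {\<theta>..pi/2}" for \<phi>
  proof -
    have cp: "cos \<phi> \<ge> 0" using \<phi> \<theta> by (intro cos_ge_zero) auto
    have "0 \<le> sin (\<phi> - \<theta>)" using \<phi> \<theta> by (intro sin_ge_zero) auto
    have "sqrt c * cos \<phi> \<le> sin \<phi>"
    proof -
      have "0 \<le> sin \<phi> * cos \<theta> - cos \<phi> * sin \<theta>" using \<open>0 \<le> sin (\<phi> - \<theta>)\<close> by (simp add: sin_diff)
      also have "\<dots> = cos \<theta> * (sin \<phi> - sqrt c * cos \<phi>)" unfolding tan\<theta>[symmetric] by (simp add: algebra_simps)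
      finally have "0 \<le> cos \<theta> * (sin \<phi> - sqrt c * cos \<phi>)" .
      moreover have "cos \<theta> > 0" using \<theta> by (intro cos_gt_zero_pi) auto
      ultimately show ?thesis by (simp add: zero_le_mult_iff)
    qed
    then have "(sqrt c * cos \<phi>)\<^sup>2 \<le> (sin \<phi>)\<^sup>2" using c cp by (intro power_mono) auto
    then have "c * (cos \<phi>)\<^sup>2 \<le> (sin \<phi>)\<^sup>2" using c by (simp add: power_mult_distrib)
    then have "k\<^sup>2 * (c * (cos \<phi>)\<^sup>2) \<le> k\<^sup>2 * (sin \<phi>)\<^sup>2" by (intro mult_left_mono) auto
    then have "D * (cos \<phi>)\<^sup>2 \<le> W \<phi>" unfolding c(2) W_def by (simp add: algebra_simps)
    then have "(\<sigma> \<phi>)\<^sup>2 \<le> r\<^sup>2" unfolding r(2) \<sigma>_def using W[of \<phi>] Dp by (simp add: power_divide field_simps)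
    then have "\<sigma> \<phi> \<le> r" using r(1) by (smt (verit) power2_le_imp_le)
    moreover have "\<sigma> \<phi> \<ge> 0" using cp W[of \<phi>] by (simp add: \<sigma>_def)
    ultimately show ?thesis by simp
  qed
  have \<sigma>d: "(\<sigma> has_real_derivative - k\<^sup>2 * sin \<phi> / (W \<phi> * sqrt (W \<phi>))) (at \<phi> within A)" for \<phi> A
  proof -
    have Wd: "(W has_real_derivative 2 * (k\<^sup>2 - 1) * sin \<phi> * cos \<phi>) (at \<phi> within A)"
      unfolding W_def by (auto intro!: derivative_eq_intros simp: algebra_simps)
    have sd: "((\<lambda>\<phi>. sqrt (W \<phi>)) has_real_derivative ((k\<^sup>2 - 1) * sin \<phi> * cos \<phi>) / sqrt (W \<phi>)) (at \<phi> within A)"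
      using W[of \<phi>] by (auto intro!: derivative_eq_intros Wd simp: field_simps)
    have sq: "sqrt (W \<phi>) * sqrt (W \<phi>) = W \<phi>" "sqrt (W \<phi>) > 0" using W[of \<phi>] by auto
    have "(\<sigma> has_real_derivative (- sin \<phi> * sqrt (W \<phi>) - cos \<phi> * (((k\<^sup>2 - 1) * sin \<phi> * cos \<phi>) / sqrt (W \<phi>))) / (sqrt (W \<phi>) * sqrt (W \<phi>))) (at \<phi> within A)"
      unfolding \<sigma>_def using sq(2) by (intro DERIV_divide sd) (auto intro!: derivative_eq_intros)
    also have "(- sin \<phi> * sqrt (W \<phi>) - cos \<phi> * (((k\<^sup>2 - 1) * sin \<phi> * cos \<phi>) / sqrt (W \<phi>))) / (sqrt (W \<phi>) * sqrt (W \<phi>))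
      = - sin \<phi> * (W \<phi> + (k\<^sup>2 - 1) * (cos \<phi>)\<^sup>2) / (W \<phi> * sqrt (W \<phi>))"
    proof -
      have "- sin \<phi> * sqrt (W \<phi>) - cos \<phi> * (((k\<^sup>2 - 1) * sin \<phi> * cos \<phi>) / sqrt (W \<phi>))
        = - sin \<phi> * (W \<phi> + (k\<^sup>2 - 1) * (cos \<phi>)\<^sup>2) / sqrt (W \<phi>)"
        using sq by (simp add: field_simps power2_eq_square)
      then show ?thesis using sq by (simp add: mult.commute)
    qed
    also have "W \<phi> + (k\<^sup>2 - 1) * (cos \<phi>)\<^sup>2 = k\<^sup>2"
    proof -
      have "W \<phi> + (k\<^sup>2 - 1) * (cos \<phi>)\<^sup>2 = k\<^sup>2 * ((sin \<phi>)\<^sup>2 + (cos \<phi>)\<^sup>2)"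
        unfolding W_def by algebra
      then show ?thesis by simp
    qed
    finally show ?thesis by (simp add: mult.commute)
  qed
  have a\<sigma>: "a (\<sigma> \<phi>) = 2 * W \<phi> / k\<^sup>2" for \<phi>
  proof -
    have "1 + (k\<^sup>2 - 1) * (\<sigma> \<phi>)\<^sup>2 = (W \<phi> + (k\<^sup>2 - 1) * (cos \<phi>)\<^sup>2) / W \<phi>"
      using W[of \<phi>] by (simp add: \<sigma>_def power_divide add_divide_distrib)
    also have "W \<phi> + (k\<^sup>2 - 1) * (cos \<phi>)\<^sup>2 = k\<^sup>2 * ((sin \<phi>)\<^sup>2 + (cos \<phi>)\<^sup>2)"
        unfolding W_def by algebra
    finally show ?thesis by (simp add: a_def)
  qed
  have main: "((\<lambda>\<phi>. - k * \<Psi> (\<sigma> \<phi>)) has_vector_derivative 2 * sin \<phi> / arc_den (- 2 * ln k) \<phi>) (at \<phi> within {\<theta>..pi/2})"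
    if \<phi>: "\<phi> \<in> {\<theta>..pi/2}" for \<phi>
  proof -
    have "(\<Psi> has_real_derivative a (\<sigma> \<phi>)) (at (\<sigma> \<phi>) within \<sigma> ` {\<theta>..pi/2})"
      using \<Psi>d[OF \<sigma>r[OF \<phi>]] by (rule DERIV_subset) (use \<sigma>r in auto)
    from DERIV_image_chain[OF this \<sigma>d]
    have "((\<lambda>\<phi>. \<Psi> (\<sigma> \<phi>)) has_real_derivative a (\<sigma> \<phi>) * (- k\<^sup>2 * sin \<phi> / (W \<phi> * sqrt (W \<phi>)))) (at \<phi> within {\<theta>..pi/2})"
      by (simp add: o_def)
    then have "((\<lambda>\<phi>. - k * \<Psi> (\<sigma> \<phi>)) has_real_derivative - k * (a (\<sigma> \<phi>) * (- k\<^sup>2 * sin \<phi> / (W \<phi> * sqrt (W \<phi>))))) (at \<phi> within {\<theta>..pi/2})"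
      by (rule DERIV_cmult)
    also have "- k * (a (\<sigma> \<phi>) * (- k\<^sup>2 * sin \<phi> / (W \<phi> * sqrt (W \<phi>)))) = 2 * sin \<phi> / (sqrt (W \<phi>) / k)"
      unfolding a\<sigma> using W[of \<phi>] k by simp
    also have "sqrt (W \<phi>) / k = arc_den (- 2 * ln k) \<phi>"
    proof -
      have "exp (- 2 * ln k) = inverse (exp (2 * ln k))" using exp_minus[of "2 * ln k"] by simp
      also have "\<dots> = 1 / k\<^sup>2" using k by (simp only: exp_double exp_ln inverse_eq_divide)
      finally have "exp (- 2 * ln k) = 1 / k\<^sup>2" .
      then have "(sin \<phi>)\<^sup>2 + exp (- 2 * ln k) * (cos \<phi>)\<^sup>2 = W \<phi> / k\<^sup>2" using k by (simp add: W_def field_simps)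
      then show ?thesis using k by (simp add: arc_den_def real_sqrt_divide)
    qed
    finally show ?thesis by (simp add: has_real_derivative_iff_has_vector_derivative)
  qed
  have "((\<lambda>\<phi>. 2 * sin \<phi> / arc_den (- 2 * ln k) \<phi>) has_integral (- k * \<Psi> (\<sigma> (pi/2)) - (- k * \<Psi> (\<sigma> \<theta>)))) {\<theta>..pi/2}"
    using \<theta> main by (intro fundamental_theorem_of_calculus) auto
  then have "arc_int \<theta> (- 2 * ln k) = - k * \<Psi> (\<sigma> (pi/2)) - (- k * \<Psi> (\<sigma> \<theta>))"
    unfolding arc_int_def by (rule integral_unique)
  moreover have "\<sigma> (pi/2) = 0" by (simp add: \<sigma>_def)
  moreover have "\<sigma> \<theta> = r"
  proof -
    have cp: "cos \<theta> > 0" using \<theta> by (intro cos_gt_zero_pi) auto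
    have "W \<theta> = D * (cos \<theta>)\<^sup>2"
      unfolding W_def tan\<theta>[symmetric] c(2) using c(1) by (simp add: power_mult_distrib algebra_simps)
    then show ?thesis using cp Dp by (simp add: \<sigma>_def r_def real_sqrt_mult)
  qed
  ultimately show ?thesis
    unfolding arc_len_def \<theta>_def c_def[symmetric] by (simp add: \<Psi>_def r_def a_def[abs_def])
qed

text \<open>Enlarging the denominator to 1 + (k u)^2 leaves an arctangent. For the D of a triangle,
  D - 1 in place of D would give half the angle in the Euclidean triangle of tangent circles with
  radii 1 / k1, 1 / k2, 1 / k3, so little is lost when the curvatures are large.\<close>

lemma arc_len_lower:
  assumes k: "k > 0" and D: "D \<ge> 1"
  shows "2 * arctan (k / sqrt D) \<le> k * arc_len k D"
proof -
  define r where "r = 1 / sqrt D"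
  have Dp: "D > 0" "D + k\<^sup>2 > 1" using D zero_less_power[OF k, of 2] by linarith+
  have r: "r > 0" "r\<^sup>2 = 1 / D" using Dp by (auto simp: r_def power_divide)
  have q: "1 + (k\<^sup>2 - 1) * u\<^sup>2 > 0" if "u \<in> {0..r}" for u
    using that r power_mono[of u r 2] by (intro param_pos[OF k Dp]) auto
  have "((\<lambda>u. 2 * k / (1 + (k * u)\<^sup>2)) has_integral (2 * arctan (k * r) - 2 * arctan (k * 0))) {0..r}"
  proof (rule fundamental_theorem_of_calculus)
    fix u assume "u \<in> {0..r}"
    show "((\<lambda>u. 2 * arctan (k * u)) has_vector_derivative 2 * k / (1 + (k * u)\<^sup>2)) (at u within {0..r})"
      unfolding has_real_derivative_iff_has_vector_derivative[symmetric]
      by (auto intro!: derivative_eq_intros simp: divide_inverse)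
  qed (use r in simp)
  then have i: "((\<lambda>u. 2 * k / (1 + (k * u)\<^sup>2)) has_integral 2 * arctan (k * r)) {0..r}" by simp
  have "continuous_on {0..r} (\<lambda>u. 2 / (1 + (k\<^sup>2 - 1) * u\<^sup>2))"
    using q by (intro continuous_intros) force
  then have "(\<lambda>u. 2 / (1 + (k\<^sup>2 - 1) * u\<^sup>2)) integrable_on {0..r}" by (rule integrable_continuous_real)
  then have "((\<lambda>u. k * (2 / (1 + (k\<^sup>2 - 1) * u\<^sup>2))) has_integral k * arc_len k D) {0..r}"
    unfolding arc_len_def r_def by (intro has_integral_mult_right) (simp add: has_integral_integral[symmetric])
  with i have "2 * arctan (k * r) \<le> k * arc_len k D"
  proof (rule has_integral_le)
    fix u assume u: "u \<in> {0..r}"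
    have "1 + (k\<^sup>2 - 1) * u\<^sup>2 \<le> 1 + (k * u)\<^sup>2" by (simp add: power_mult_distrib algebra_simps)
    then have "2 * k / (1 + (k * u)\<^sup>2) \<le> 2 * k / (1 + (k\<^sup>2 - 1) * u\<^sup>2)"
      using q[OF u] k by (intro divide_left_mono mult_pos_pos) (auto intro: add_pos_nonneg)
    then show "2 * k / (1 + (k * u)\<^sup>2) \<le> k * (2 / (1 + (k\<^sup>2 - 1) * u\<^sup>2))" by (simp add: mult.commute)
  qed
  then show ?thesis by (simp add: r_def)
qed

section \<open>One corner of a triangle as a function of the three curvatures\<close>

definition curv_ratio :: "real \<Rightarrow> real \<Rightarrow> real \<Rightarrow> real" where
  "curv_ratio a b c = (a * b + b * c + c * a) / a\<^sup>2"

text \<open>The ratio is (D - 1) / a^2. It is homogeneous of degree 0, and its square root is the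
  tangent of the lower limit of integration.\<close>

definition tri_curv :: "real \<Rightarrow> real \<Rightarrow> real \<Rightarrow> real" where
  "tri_curv a b c = (if a = 0 then 0 else arc_int (arctan (sqrt (curv_ratio a b c))) (- 2 * ln a))"

lemma tri_curv_0 [simp]: "tri_curv 0 b c = 0"
  by (simp add: tri_curv_def)

lemma arctan_sqrt_range: "c \<ge> 0 \<Longrightarrow> arctan (sqrt c) \<in> {0..<pi/2}"
  using arctan_ubound[of "sqrt c"] by simp

lemma curv_ratio_nonneg: "a \<ge> 0 \<Longrightarrow> b \<ge> 0 \<Longrightarrow> c \<ge> 0 \<Longrightarrow> curv_ratio a b c \<ge> 0"
  by (simp add: curv_ratio_def)

lemma tri_curv_eq_arc_len:
  assumes "a > 0" "b \<ge> 0" "c \<ge> 0"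
  shows "tri_curv a b c = a * arc_len a (1 + a * b + b * c + c * a)"
  using arc_len_eq_arc_int[of a "1 + a * b + b * c + c * a"] assms
  by (simp add: tri_curv_def curv_ratio_def add.assoc)

lemma tri_curv_lower:
  assumes "a > 0" "b \<ge> 0" "c \<ge> 0"
  shows "2 * arctan (a / sqrt (1 + a * b + b * c + c * a)) \<le> tri_curv a b c"
  using arc_len_lower[of a "1 + a * b + b * c + c * a"] assms by (simp add: tri_curv_eq_arc_len)

lemma tri_curv_bounds:
  assumes "a \<ge> 0" "b \<ge> 0" "c \<ge> 0"
  shows "0 \<le> tri_curv a b c" "tri_curv a b c \<le> pi" "a > 0 \<Longrightarrow> 0 < tri_curv a b c"
  using arctan_sqrt_range[OF curv_ratio_nonneg[OF assms]]
  by (auto simp: tri_curv_def intro!: arc_int_nonneg arc_int_le_pi arc_int_pos)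

lemma tri_curv_antimono:
  assumes "a \<ge> 0" "b \<ge> 0" "c \<ge> 0" "b \<le> b'" "c \<le> c'"
  shows "tri_curv a b' c' \<le> tri_curv a b c"
proof (cases "a = 0")
  case False
  have "b * c \<le> b' * c'" using assms by (intro mult_mono) auto
  moreover have "a * b \<le> a * b'" "c * a \<le> c' * a" using assms by (simp_all add: mult_left_mono mult_right_mono)
  ultimately have "curv_ratio a b c \<le> curv_ratio a b' c'"
    unfolding curv_ratio_def by (intro divide_right_mono) auto
  moreover have "curv_ratio a b' c' \<ge> 0" "curv_ratio a b c \<ge> 0" using assms by (auto intro!: curv_ratio_nonneg)
  ultimately have "arc_int (arctan (sqrt (curv_ratio a b' c'))) (- 2 * ln a) \<le> arc_int (arctan (sqrt (curv_ratio a b c))) (- 2 * ln a)"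
    using arctan_sqrt_range[of "curv_ratio a b c"] arctan_sqrt_range[of "curv_ratio a b' c'"]
    by (intro arc_int_diff_theta(1)) (auto simp: arctan_monotone' real_sqrt_le_mono)
  then show ?thesis using False by (simp add: tri_curv_def)
qed simp

text \<open>Scaling keeps the ratio, hence \<theta>, and lowers x = - 2 ln a. The inequality is
  strict because \<theta> < pi/2.\<close>

lemma tri_curv_scale:
  assumes "a > 0" "b \<ge> 0" "c \<ge> 0" "l > 1"
  shows "tri_curv a b c < tri_curv (l * a) (l * b) (l * c)"
proof -
  have "l * a * (l * b) + l * b * (l * c) + l * c * (l * a) = l\<^sup>2 * (a * b + b * c + c * a)"
    by (simp add: power2_eq_square algebra_simps)
  then have "curv_ratio (l * a) (l * b) (l * c) = curv_ratio a b c"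
    using assms by (simp add: curv_ratio_def power_mult_distrib)
  moreover have "ln (l * a) = ln l + ln a" "ln l > 0" using assms by (simp_all add: ln_mult)
  moreover have "arc_int (arctan (sqrt (curv_ratio a b c))) (- 2 * ln a) < arc_int (arctan (sqrt (curv_ratio a b c))) (- 2 * (ln l + ln a))"
    using arctan_sqrt_range[OF curv_ratio_nonneg, of a b c] assms \<open>ln l > 0\<close> by (intro arc_int_strict_antimono_x) auto
  ultimately show ?thesis using assms by (simp add: tri_curv_def)
qed

text \<open>The bound involves only the curvature at the vertex itself, so it gives continuity at a
  = 0 whatever the other two curvatures do.\<close>

lemma tri_curv_small:
  assumes "0 < d" "d < pi/2" "a \<ge> 0" "b \<ge> 0" "c \<ge> 0"
  shows "tri_curv a b c \<le> 2 * d + pi * a / sin d"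
proof (cases "a = 0")
  case True
  then show ?thesis using assms by simp
next
  case False
  then have a: "a > 0" using assms by simp
  have "- 2 * ln a / 2 = - ln a" by simp
  then have e: "exp (- 2 * ln a / 2) = 1 / a" using a by (simp only: exp_minus exp_ln inverse_eq_divide)
  have "arc_int (arctan (sqrt (curv_ratio a b c))) (- 2 * ln a) \<le> 2 * d + pi / (exp (- 2 * ln a / 2) * sin d)"
    using arctan_sqrt_range[OF curv_ratio_nonneg, of a b c] assms by (intro arc_int_zero_bound) auto
  then show ?thesis unfolding e using a by (simp add: tri_curv_def)
qed

lemma continuous_arc_int_pair:
  assumes "continuous_on A f" "continuous_on A g" "\<And>z. z \<in> A \<Longrightarrow> f z \<in> {0..pi/2}"
  shows "continuous_on A (\<lambda>z. arc_int (f z) (g z))"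
  unfolding continuous_on_def
proof
  fix z assume z: "z \<in> A"
  have f: "(f \<longlongrightarrow> f z) (at z within A)" and g: "(g \<longlongrightarrow> g z) (at z within A)"
    using assms z by (auto simp: continuous_on_def)
  have "((\<lambda>w. 2 * \<bar>f w - f z\<bar> + pi * \<bar>g w - g z\<bar>) \<longlongrightarrow> 2 * \<bar>f z - f z\<bar> + pi * \<bar>g z - g z\<bar>) (at z within A)"
    by (intro tendsto_intros f g)
  then have l: "((\<lambda>w. 2 * \<bar>f w - f z\<bar> + pi * \<bar>g w - g z\<bar>) \<longlongrightarrow> 0) (at z within A)" by simp
  have "((\<lambda>w. arc_int (f w) (g w) - arc_int (f z) (g z)) \<longlongrightarrow> 0) (at z within A)"
  proof (rule Lim_null_comparison[OF _ l])
    show "\<forall>\<^sub>F w in at z within A. norm (arc_int (f w) (g w) - arc_int (f z) (g z)) \<le> 2 * \<bar>f w - f z\<bar> + pi * \<bar>g w - g z\<bar>"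
      unfolding eventually_at_topological
      by (rule exI[of _ UNIV]) (auto intro!: arc_int_lipschitz assms(3) z)
  qed
  then show "((\<lambda>w. arc_int (f w) (g w)) \<longlongrightarrow> arc_int (f z) (g z)) (at z within A)"
    by (simp add: LIM_zero_iff)
qed

text \<open>Near a positive first curvature the formula is a continuous composition. Where it
  vanishes the ratio breaks down, and the uniform bound for small curvature takes over.\<close>

lemma tri_curv_continuous:
  fixes f g h :: "'a::metric_space \<Rightarrow> real"
  assumes c: "continuous_on A f" "continuous_on A g" "continuous_on A h"
    and nn: "\<And>z. z \<in> A \<Longrightarrow> f z \<ge> 0" "\<And>z. z \<in> A \<Longrightarrow> g z \<ge> 0" "\<And>z. z \<in> A \<Longrightarrow> h z \<ge> 0"
  shows "continuous_on A (\<lambda>z. tri_curv (f z) (g z) (h z))"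
  unfolding continuous_on_def
proof
  fix z assume z: "z \<in> A"
  have fz: "(f \<longlongrightarrow> f z) (at z within A)" using c(1) z unfolding continuous_on_def by blast
  show "((\<lambda>z. tri_curv (f z) (g z) (h z)) \<longlongrightarrow> tri_curv (f z) (g z) (h z)) (at z within A)"
  proof (cases "f z = 0")
    case False
    define B where "B = A \<inter> {w. f w > 0}"
    have zB: "z \<in> B" using z False nn(1)[OF z] by (simp add: B_def)
    have BA: "B \<subseteq> A" by (simp add: B_def)
    have cB: "continuous_on B f" "continuous_on B g" "continuous_on B h"
      using c BA by (auto intro: continuous_on_subset)
    have "continuous_on B (\<lambda>z. arc_int (arctan (sqrt (curv_ratio (f z) (g z) (h z)))) (- 2 * ln (f z)))"
    proof (rule continuous_arc_int_pair)
      show "continuous_on B (\<lambda>z. arctan (sqrt (curv_ratio (f z) (g z) (h z))))"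
        unfolding curv_ratio_def by (intro continuous_intros cB) (auto simp: B_def)
      show "continuous_on B (\<lambda>z. - 2 * ln (f z))" by (intro continuous_intros cB) (auto simp: B_def)
      fix w assume "w \<in> B"
      then show "arctan (sqrt (curv_ratio (f w) (g w) (h w))) \<in> {0..pi/2}"
        using arctan_sqrt_range[OF curv_ratio_nonneg[OF nn(1) nn(2) nn(3)], of w w w] BA by (auto simp: less_imp_le)
    qed
    then have "continuous_on B (\<lambda>z. tri_curv (f z) (g z) (h z))"
      by (rule continuous_on_eq) (auto simp: tri_curv_def B_def)
    then have "((\<lambda>z. tri_curv (f z) (g z) (h z)) \<longlongrightarrow> tri_curv (f z) (g z) (h z)) (at z within B)"
      using zB by (simp add: continuous_on_def)
    moreover have "at z within B = at z within A"
    proof -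
      have "openin (top_of_set A) (A \<inter> f -` {0<..})"
        using c(1) by (rule continuous_openin_preimage_gen) simp
      then obtain U where "open U" "A \<inter> f -` {0<..} = A \<inter> U" by (auto simp: openin_open)
      then show ?thesis
        using zB by (intro at_within_nhd[of z U]) (auto simp: B_def)
    qed
    ultimately show ?thesis by simp
  next
    case True
    have "((\<lambda>z. tri_curv (f z) (g z) (h z)) \<longlongrightarrow> 0) (at z within A)"
    proof (rule tendstoI)
      fix e :: real assume e: "e > 0"
      define d where "d = min (e / 4) (pi / 4)"
      have d: "0 < d" "d < pi/2" "2 * d \<le> e / 2" using e pi_gt_zero by (auto simp: d_def min_def)
      have sd: "sin d > 0" using d by (intro sin_gt_zero) auto
      have "((\<lambda>w. pi * f w / sin d) \<longlongrightarrow> pi * f z / sin d) (at z within A)" using sd by (intro tendsto_intros fz) auto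
      then have "\<forall>\<^sub>F w in at z within A. pi * f w / sin d < e / 2"
        by (rule order_tendstoD) (use True e in simp)
      moreover have "\<forall>\<^sub>F w in at z within A. w \<in> A" by (simp add: eventually_at_filter)
      ultimately show "\<forall>\<^sub>F w in at z within A. dist (tri_curv (f w) (g w) (h w)) 0 < e"
      proof eventually_elim
        case (elim w)
        then show ?case
          using tri_curv_small[OF d(1,2) nn(1)[OF elim(2)] nn(2)[OF elim(2)] nn(3)[OF elim(2)]]
            tri_curv_bounds(1)[OF nn(1)[OF elim(2)] nn(2)[OF elim(2)] nn(3)[OF elim(2)]] d(3)
          unfolding dist_real_def by linarith
      qed
    qed
    then show ?thesis using True by simp
  qed
qed

text \<open>The derivative exp z / (1 + (exp z)^2) is at most 1/2 by the inequality of
  means.\<close>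

lemma arctan_exp_lipschitz: "\<bar>arctan (exp x) - arctan (exp y)\<bar> \<le> \<bar>x - y\<bar> / 2"
proof -
  have "norm (arctan (exp x) - arctan (exp y)) \<le> 1/2 * norm (x - y)"
  proof (rule field_differentiable_bound[of UNIV _ "\<lambda>x. exp x / (1 + (exp x)\<^sup>2)"])
    fix z :: real
    show "((\<lambda>x. arctan (exp x)) has_field_derivative exp z / (1 + (exp z)\<^sup>2)) (at z within UNIV)"
      by (auto intro!: derivative_eq_intros simp: divide_inverse)
    have "0 \<le> (1 - exp z)\<^sup>2" by simp
    then have "2 * exp z \<le> 1 + (exp z)\<^sup>2" by (simp add: power2_eq_square algebra_simps)
    then show "norm (exp z / (1 + (exp z)\<^sup>2)) \<le> 1/2"
      by (simp add: divide_le_eq add_pos_nonneg abs_of_pos)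
  qed auto
  then show ?thesis by simp
qed

text \<open>In logarithmic coordinates every term of the ratio S changes at most by the factor exp
  (4 d), so ln S changes by at most 4 d and - 2 x by at most 2 d. With the constants 2 and pi of
  \<open>arc_int_lipschitz\<close> this stays below (4 + 2 pi) d.\<close>

lemma tri_curv_lipschitz:
  assumes d: "\<bar>x - x'\<bar> \<le> d" "\<bar>y - y'\<bar> \<le> d" "\<bar>z - z'\<bar> \<le> d"
  shows "\<bar>tri_curv (exp x) (exp y) (exp z) - tri_curv (exp x') (exp y') (exp z')\<bar> \<le> (4 + 2 * pi) * d"
proof -
  define S where "S x y z = exp (y - x) + exp (y + z - 2 * x) + exp (z - x)" for x y z :: real
  have S: "curv_ratio (exp x) (exp y) (exp z) = S x y z" "S x y z > 0" for x y z
  proof -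
    show "S x y z > 0" by (simp add: S_def add_pos_pos)
    show "curv_ratio (exp x) (exp y) (exp z) = S x y z"
      by (simp add: curv_ratio_def S_def exp_add exp_diff exp_double add_divide_distrib power2_eq_square)
  qed
  have d0: "d \<ge> 0" using d by linarith
  have le: "S x y z \<le> exp (4 * d) * S x' y' z'"
    if "\<bar>x - x'\<bar> \<le> d" "\<bar>y - y'\<bar> \<le> d" "\<bar>z - z'\<bar> \<le> d" for x y z x' y' z'
  proof -
    have "exp (y - x) \<le> exp (4 * d + (y' - x'))" "exp (y + z - 2 * x) \<le> exp (4 * d + (y' + z' - 2 * x'))"
      "exp (z - x) \<le> exp (4 * d + (z' - x'))"
      using that by (auto simp: abs_le_iff)
    then show ?thesis unfolding S_def distrib_left exp_add[symmetric] by linarith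
  qed
  have "ln (S x y z) \<le> ln (exp (4 * d) * S x' y' z')" "ln (S x' y' z') \<le> ln (exp (4 * d) * S x y z)"
    using le[OF d] le[of x' x y' y z' z] d S(2) by (simp_all add: abs_minus_commute)
  then have l: "\<bar>ln (S x y z) - ln (S x' y' z')\<bar> \<le> 4 * d"
    using S(2)[THEN less_imp_neq, symmetric] by (simp add: ln_mult abs_le_iff)
  have sq: "sqrt (S x y z) = exp (ln (S x y z) / 2)" for x y z
    using S(2)[of x y z] by (intro real_sqrt_unique) (simp_all add: flip: exp_double)
  have tc: "tri_curv (exp x) (exp y) (exp z) = arc_int (arctan (exp (ln (S x y z) / 2))) (- 2 * x)" for x y z
    by (simp add: tri_curv_def S(1) sq)
  have rg: "arctan (exp u) \<in> {0..pi/2}" for u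
    using arctan_ubound[of "exp u"] by (simp add: less_imp_le)
  have "\<bar>arc_int (arctan (exp (ln (S x y z) / 2))) (- 2 * x) - arc_int (arctan (exp (ln (S x' y' z') / 2))) (- 2 * x')\<bar>
    \<le> 2 * \<bar>arctan (exp (ln (S x y z) / 2)) - arctan (exp (ln (S x' y' z') / 2))\<bar> + pi * \<bar>- 2 * x - - 2 * x'\<bar>"
    by (intro arc_int_lipschitz rg)
  also have "\<dots> \<le> 2 * (2 * d) + pi * (2 * d)"
  proof (intro add_mono mult_left_mono)
    have "\<bar>arctan (exp (ln (S x y z) / 2)) - arctan (exp (ln (S x' y' z') / 2))\<bar> \<le> \<bar>ln (S x y z) / 2 - ln (S x' y' z') / 2\<bar> / 2"
      by (rule arctan_exp_lipschitz)
    also have "\<dots> = \<bar>ln (S x y z) - ln (S x' y' z')\<bar> / 4" by (simp add: diff_divide_distrib[symmetric])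
    also have "\<dots> \<le> 4 * d / 4" using l by (rule divide_right_mono) simp
    also have "\<dots> \<le> 2 * d" using d0 by simp
    finally show "\<bar>arctan (exp (ln (S x y z) / 2)) - arctan (exp (ln (S x' y' z') / 2))\<bar> \<le> 2 * d" .
    show "\<bar>- 2 * x - - 2 * x'\<bar> \<le> 2 * d" using d(1) by (simp add: abs_le_iff)
  qed auto
  finally show ?thesis unfolding tc by (simp add: algebra_simps)
qed

section \<open>Large curvatures\<close>

text \<open>In each of the following lemmas the cosine of the sum of the angles \<open>arctan (a / sqrt D)\<close> is
  computed; the sum tends to \<open>\<pi>/2\<close>, as in a Euclidean triangle.\<close>

lemma cos_arctan_prod: "cos (arctan x) > 0" "sin (arctan x) = x * cos (arctan x)"
  by (simp_all add: cos_arctan sin_arctan add_pos_nonneg)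

lemma arctan_sum_lower:
  assumes "cos s \<le> r" "0 \<le> s" "0 \<le> r" "r \<le> 1"
  shows "arccos r \<le> s"
proof (cases "s \<le> pi")
  case True
  then show ?thesis using assms arccos_le_arccos[of "cos s" r] arccos_cos[of s] by simp
next
  case False
  then show ?thesis using arccos_lbound arccos_ubound[of r] assms by linarith
qed

text \<open>In a Euclidean triangle the pairwise products of the tangents of the half-angles sum to
  1. Here the sum falls short by 1 / D, and this bounds the cosine.\<close>

lemma tri_curv_3_lower:
  assumes "a > 0" "b > 0" "c > 0"
  shows "2 * arccos (1 / (1 + a * b + b * c + c * a)) \<le> tri_curv a b c + tri_curv b c a + tri_curv c a b"
proof -
  define D where "D = 1 + a * b + b * c + c * a"
  have D: "D \<ge> 1" using assms by (simp add: D_def)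
  define x y z where "x = a / sqrt D" and "y = b / sqrt D" and "z = c / sqrt D"
  have p: "x > 0" "y > 0" "z > 0" using assms D by (auto simp: x_def y_def z_def)
  have xyz: "1 - (x * y + y * z + z * x) = 1 / D"
  proof -
    have "x * y + y * z + z * x = (a * b + b * c + c * a) / D"
      using D by (simp add: x_def y_def z_def add_divide_distrib)
    also have "\<dots> = (D - 1) / D" by (simp add: D_def)
    finally show ?thesis using D by (simp add: diff_divide_distrib)
  qed
  let ?s = "arctan x + arctan y + arctan z"
  define C where "C = cos (arctan x) * cos (arctan y) * cos (arctan z)"
  have C: "0 \<le> C" "C \<le> 1" unfolding C_def using cos_arctan_prod(1)
    by (simp_all add: less_imp_le mult_le_one)
  have "cos ?s = C * (1 - (x * y + y * z + z * x))"
    unfolding cos_add sin_add cos_arctan_prod(2) C_def by (simp add: algebra_simps)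
  also have "\<dots> \<le> 1 * (1 / D)" unfolding xyz using C D by (intro mult_right_mono) auto
  finally have "arccos (1 / D) \<le> ?s"
    using p D by (intro arctan_sum_lower) (auto intro!: add_nonneg_nonneg)
  moreover have "2 * arctan x \<le> tri_curv a b c" "2 * arctan y \<le> tri_curv b c a" "2 * arctan z \<le> tri_curv c a b"
    using tri_curv_lower[of a b c] tri_curv_lower[of b c a] tri_curv_lower[of c a b] assms
    by (simp_all add: x_def y_def z_def D_def algebra_simps)
  ultimately show ?thesis by (simp add: D_def)
qed

text \<open>Two circles shrink while the third stays bounded: the defect 1 - x y is of order 1 / N,
  so the two small circles alone account for nearly pi.\<close>

lemma tri_curv_2_lower:
  assumes "N > 0" "a \<ge> N" "b \<ge> N" "0 \<le> c" "c \<le> M" "1 / N\<^sup>2 + 2 * M / N \<le> 1"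
  shows "2 * arccos (1 / N\<^sup>2 + 2 * M / N) \<le> tri_curv a b c + tri_curv b c a"
proof -
  define D where "D = 1 + a * b + b * c + c * a"
  have ab: "a > 0" "b > 0" using assms by auto
  have M: "M \<ge> 0" using assms by simp
  have D: "D \<ge> 1" using assms ab by (simp add: D_def)
  define x y where "x = a / sqrt D" and "y = b / sqrt D"
  have p: "x > 0" "y > 0" using ab D by (auto simp: x_def y_def)
  have abD: "a * b \<le> D" using assms ab by (simp add: D_def)
  have xy: "1 - x * y = (1 + c * (a + b)) / D"
  proof -
    have "x * y = a * b / D" using D by (simp add: x_def y_def)
    also have "a * b = D - (1 + c * (a + b))" by (simp add: D_def algebra_simps)
    finally show ?thesis using D by (simp add: diff_divide_distrib)
  qed
  have "(1 + c * (a + b)) / D \<le> (1 + c * (a + b)) / (a * b)"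
    using abD ab assms D by (intro divide_left_mono) (auto intro!: add_nonneg_nonneg)
  also have "\<dots> = 1 / (a * b) + c / b + c / a" using ab by (simp add: field_simps)
  also have "\<dots> \<le> 1 / N\<^sup>2 + M / N + M / N"
  proof (intro add_mono frac_le)
    show "N\<^sup>2 \<le> a * b" using assms unfolding power2_eq_square by (intro mult_mono) auto
  qed (use assms M in auto)
  finally have le: "1 - x * y \<le> 1 / N\<^sup>2 + 2 * M / N" unfolding xy by simp
  have nn: "0 \<le> 1 - x * y" unfolding xy using assms ab D by (intro divide_nonneg_nonneg add_nonneg_nonneg) auto
  let ?s = "arctan x + arctan y"
  define C where "C = cos (arctan x) * cos (arctan y)"
  have C: "0 \<le> C" "C \<le> 1" unfolding C_def using cos_arctan_prod(1)
    by (simp_all add: less_imp_le mult_le_one)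
  have "cos ?s = C * (1 - x * y)"
    unfolding cos_add cos_arctan_prod(2) C_def by (simp add: algebra_simps)
  also have "\<dots> \<le> 1 * (1 - x * y)" using C nn by (intro mult_right_mono) auto
  also have "\<dots> \<le> 1 / N\<^sup>2 + 2 * M / N" using le by simp
  finally have "arccos (1 / N\<^sup>2 + 2 * M / N) \<le> ?s"
    using p assms M by (intro arctan_sum_lower) auto
  moreover have "2 * arctan x \<le> tri_curv a b c" "2 * arctan y \<le> tri_curv b c a"
    using tri_curv_lower[of a b c] tri_curv_lower[of b c a] assms ab
    by (simp_all add: x_def y_def D_def algebra_simps)
  ultimately show ?thesis by simp
qed

text \<open>One circle shrinks between two bounded ones: D / a^2 tends to 0, so its angle tends to
  pi.\<close>

lemma tri_curv_1_lower:
  assumes "N > 0" "a \<ge> N" "0 \<le> b" "b \<le> M" "0 \<le> c" "c \<le> M" "sqrt ((1 + M\<^sup>2) / N\<^sup>2 + 2 * M / N) \<le> 1"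
  shows "2 * arccos (sqrt ((1 + M\<^sup>2) / N\<^sup>2 + 2 * M / N)) \<le> tri_curv a b c"
proof -
  define D where "D = 1 + a * b + b * c + c * a"
  have a: "a > 0" using assms by auto
  have M: "M \<ge> 0" using assms by simp
  have D: "D \<ge> 1" using assms a by (simp add: D_def)
  define x where "x = a / sqrt D"
  have x: "x > 0" using a D by (simp add: x_def)
  have "D \<le> 1 + a * M + M * M + M * a"
    unfolding D_def using assms a by (intro add_mono mult_mono) auto
  then have "D / a\<^sup>2 \<le> (1 + M\<^sup>2 + 2 * M * a) / a\<^sup>2" by (intro divide_right_mono) (auto simp: power2_eq_square)
  also have "\<dots> = (1 + M\<^sup>2) / a\<^sup>2 + 2 * M / a" using a by (simp add: add_divide_distrib power2_eq_square)
  also have "\<dots> \<le> (1 + M\<^sup>2) / N\<^sup>2 + 2 * M / N"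
    using assms M by (intro add_mono frac_le power_mono) auto
  finally have le: "D / a\<^sup>2 \<le> (1 + M\<^sup>2) / N\<^sup>2 + 2 * M / N" .
  have "cos (arctan x) = 1 / sqrt (1 + x\<^sup>2)" by (rule cos_arctan)
  also have "\<dots> \<le> 1 / x" using x by (intro divide_left_mono mult_pos_pos) (auto intro!: real_le_rsqrt add_pos_nonneg)
  also have "\<dots> = sqrt (D / a\<^sup>2)" using a D by (simp add: x_def real_sqrt_divide)
  also have "\<dots> \<le> sqrt ((1 + M\<^sup>2) / N\<^sup>2 + 2 * M / N)" using le by simp
  finally have "arccos (sqrt ((1 + M\<^sup>2) / N\<^sup>2 + 2 * M / N)) \<le> arctan x"
    using x assms M by (intro arctan_sum_lower) auto
  moreover have "2 * arctan x \<le> tri_curv a b c"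
    using tri_curv_lower[of a b c] assms a by (simp add: x_def D_def)
  ultimately show ?thesis by simp
qed

lemma arccos_small_eventually:
  assumes "(r \<longlongrightarrow> 0) F" "e > (0::real)"
  shows "\<forall>\<^sub>F N in F. r N \<le> 1 \<and> (r N \<ge> 0 \<longrightarrow> 2 * arccos (r N) \<ge> pi - e)"
proof -
  have "isCont arccos 0" by (rule isCont_arccos) auto
  from isCont_tendsto_compose[OF this assms(1)] have "((\<lambda>N. arccos (r N)) \<longlongrightarrow> pi/2) F" by simp
  then have "\<forall>\<^sub>F N in F. arccos (r N) > pi/2 - e/2" using assms(2) by (intro order_tendstoD) auto
  moreover have "\<forall>\<^sub>F N in F. r N < 1" using assms(1) by (intro order_tendstoD) auto
  ultimately show ?thesis by eventually_elim auto
qed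

text \<open>The three cases are triangles with one, two or three corners of large curvature. The
  estimate is uniform in how far these exceed N, which is what an argument about unbounded
  coordinates requires.\<close>

lemma tri_curv_sum_lower_eventually:
  assumes e: "e > 0" and M: "M \<ge> 0"
  shows "\<forall>\<^sub>F N in at_top. \<forall>a\<ge>N. \<forall>b\<ge>0. \<forall>c\<ge>0.
     (b \<le> M \<and> c \<le> M \<longrightarrow> pi - e \<le> tri_curv a b c) \<and>
     (b \<ge> N \<and> c \<le> M \<longrightarrow> pi - e \<le> tri_curv a b c + tri_curv b c a) \<and>
     (b \<ge> N \<and> c \<ge> N \<longrightarrow> pi - e \<le> tri_curv a b c + tri_curv b c a + tri_curv c a b)"
proof -
  have i1: "((\<lambda>N::real. 1 / N) \<longlongrightarrow> 0) at_top" by (rule tendsto_divide_0[OF tendsto_const filterlim_at_top_imp_at_infinity[OF filterlim_ident]])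
  have i2: "((\<lambda>N::real. 1 / N\<^sup>2) \<longlongrightarrow> 0) at_top"
    using tendsto_power[OF i1, of 2] by (simp add: power_divide)
  have "((\<lambda>N. sqrt ((1 + M\<^sup>2) * (1 / N\<^sup>2) + 2 * M * (1 / N))) \<longlongrightarrow> sqrt ((1 + M\<^sup>2) * 0 + 2 * M * 0)) at_top"
    by (intro tendsto_intros i1 i2)
  then have l1: "((\<lambda>N. sqrt ((1 + M\<^sup>2) / N\<^sup>2 + 2 * M / N)) \<longlongrightarrow> 0) at_top" by simp
  have "((\<lambda>N. 1 / N\<^sup>2 + 2 * M * (1 / N)) \<longlongrightarrow> 0 + 2 * M * 0) at_top" by (intro tendsto_intros i1 i2)
  then have l2: "((\<lambda>N. 1 / N\<^sup>2 + 2 * M / N) \<longlongrightarrow> 0) at_top" by simp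
  show ?thesis
    using arccos_small_eventually[OF l1 e] arccos_small_eventually[OF l2 e] arccos_small_eventually[OF i2 e] eventually_gt_at_top[of 0]
  proof eventually_elim
    case (elim N)
    show ?case
    proof (intro allI impI conjI)
      fix a b c :: real assume abc: "N \<le> a" "0 \<le> b" "0 \<le> c"
      show "pi - e \<le> tri_curv a b c" if "b \<le> M \<and> c \<le> M"
      proof -
        have "2 * arccos (sqrt ((1 + M\<^sup>2) / N\<^sup>2 + 2 * M / N)) \<le> tri_curv a b c"
          using elim abc that by (intro tri_curv_1_lower) auto
        moreover have "0 \<le> sqrt ((1 + M\<^sup>2) / N\<^sup>2 + 2 * M / N)" using elim M by simp
        ultimately show ?thesis using elim(1) by linarith
      qed
      show "pi - e \<le> tri_curv a b c + tri_curv b c a" if "b \<ge> N \<and> c \<le> M"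
      proof -
        have "2 * arccos (1 / N\<^sup>2 + 2 * M / N) \<le> tri_curv a b c + tri_curv b c a"
          using elim abc that by (intro tri_curv_2_lower) auto
        moreover have "0 \<le> 1 / N\<^sup>2 + 2 * M / N" using elim M by simp
        ultimately show ?thesis using elim(2) by linarith
      qed
      show "pi - e \<le> tri_curv a b c + tri_curv b c a + tri_curv c a b" if "b \<ge> N \<and> c \<ge> N"
      proof -
        have p: "a > 0" "b > 0" "c > 0" using elim abc that by auto
        have "N\<^sup>2 \<le> a * b" using elim abc that unfolding power2_eq_square by (intro mult_mono) auto
        also have "\<dots> \<le> 1 + a * b + b * c + c * a" using p by simp
        finally have le: "1 / (1 + a * b + b * c + c * a) \<le> 1 / N\<^sup>2" using elim(4) by (intro frac_le) auto
        have "arccos (1 / N\<^sup>2) \<le> arccos (1 / (1 + a * b + b * c + c * a))"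
        proof (rule arccos_le_arccos)
          have "0 \<le> 1 / (1 + a * b + b * c + c * a)" using p by simp
          then show "- 1 \<le> 1 / (1 + a * b + b * c + c * a)" by linarith
        qed (use le elim(3) in auto)
        moreover have "pi - e \<le> 2 * arccos (1 / N\<^sup>2)" using elim(3) by simp
        ultimately show ?thesis using tri_curv_3_lower[OF p] by linarith
      qed
    qed
  qed
qed

section \<open>Existence of global solutions\<close>

lemma integral_has_vector_derivative_atLeast:
  fixes g :: "real \<Rightarrow> 'a::euclidean_space"
  assumes "continuous_on UNIV g" "t \<ge> 0"
  shows "((\<lambda>s. integral {0..s} g) has_vector_derivative g t) (at t within {0..})"
proof -
  have "((\<lambda>s. integral {0..s} g) has_vector_derivative g t) (at t within {0..t+1})"
    using assms by (intro integral_has_vector_derivative) (auto intro: continuous_on_subset)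
  moreover have "at t within {0..t+1} = at t within {0..}"
    using assms(2) by (intro at_within_nhd[of t "{..<t+1}"]) auto
  ultimately show ?thesis by simp
qed

text \<open>Picard iteration in the norm weighted by \<open>exp (- c t)\<close>, which gives the solution on the whole
  half-line at once.\<close>

lemma lipschitz_ode_solution:
  fixes f :: "'a::euclidean_space \<Rightarrow> 'a"
  assumes lip: "\<And>x y. norm (f x - f y) \<le> L * norm (x - y)" and L: "L \<ge> 0"
    and bnd: "\<And>x. norm (f x) \<le> M"
  obtains u where "u 0 = x0" "\<And>t. t \<ge> 0 \<Longrightarrow> (u has_vector_derivative f (u t)) (at t within {0..})"
proof -
  \<comment> \<open>With this weight the iteration contracts by L / c, which is at most 1/2.\<close>
  define c where "c = 2 * L + 1"
  have c: "c > 0" "L / c \<le> 1/2" using L by (auto simp: c_def)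
  have M: "M \<ge> 0" using bnd[of 0] norm_ge_zero order_trans by blast
  have fc: "continuous_on UNIV f"
    by (rule lipschitz_on_continuous_on[of L]) (use lip L in \<open>auto simp: lipschitz_on_def dist_norm\<close>)
  \<comment> \<open>The unknown v is the weighted displacement: the solution will be x0 + exp (c t)
    v.\<close>
  define g where "g v r = f (x0 + exp (c * r) *\<^sub>R apply_bcontfun v r)" for v r
  have gc: "continuous_on UNIV (g v)" for v
    unfolding g_def by (intro continuous_on_compose2[OF fc] continuous_intros) auto
  define G where "G v s = integral {0..s} (g v)" for v s
  have Gd: "(G v has_vector_derivative g v t) (at t within {0..})" if "t \<ge> 0" for v t
    unfolding G_def by (rule integral_has_vector_derivative_atLeast[OF gc that])
  have gi: "g v integrable_on {0..s}" for v s
    by (intro integrable_continuous_real continuous_on_subset[OF gc]) auto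
  have Gc: "continuous_on {0..} (G v)" for v
    using Gd by (intro continuous_on_vector_derivative) auto
  \<comment> \<open>The fixed point is sought among bounded continuous functions on all of the
    reals, so the iterate is extended to t < 0 by its value 0 at t = 0.\<close>
  define \<Phi> where "\<Phi> v t = exp (- c * max t 0) *\<^sub>R G v (max t 0)" for v t
  have \<Phi>c: "continuous_on UNIV (\<Phi> v)" for v
    unfolding \<Phi>_def by (intro continuous_intros continuous_on_compose2[OF Gc]) (auto simp: le_max_iff_disj)
  have \<Phi>b: "norm (\<Phi> v t) \<le> M / c" for v t
  proof -
    define s where "s = max t 0"
    have s: "s \<ge> 0" by (simp add: s_def le_max_iff_disj)
    have "norm (G v s) \<le> M * (s - 0)"
      unfolding G_def by (rule integral_bound[OF s continuous_on_subset[OF gc]]) (auto simp: g_def bnd)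
    then have "exp (- c * s) * norm (G v s) \<le> exp (- c * s) * (M * s)" by (intro mult_left_mono) auto
    also have "\<dots> = M / c * (exp (- c * s) * (c * s))" using c by simp
    also have "\<dots> \<le> M / c * 1"
    proof (intro mult_left_mono)
      have "c * s \<le> exp (c * s)" using exp_ge_add_one_self[of "c * s"] by linarith
      then have "exp (- c * s) * (c * s) \<le> exp (- c * s) * exp (c * s)" by (intro mult_left_mono) auto
      also have "\<dots> = 1" by (simp flip: exp_add)
      finally show "exp (- c * s) * (c * s) \<le> 1" .
    qed (use M c in auto)
    finally show ?thesis by (simp add: \<Phi>_def s_def)
  qed
  have \<Phi>B: "\<Phi> v \<in> bcontfun" for v
    using \<Phi>c[of v] \<Phi>b[of v] by (intro bcontfun_normI) auto
  define F where "F v = Bcontfun (\<Phi> v)" for v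
  have F: "apply_bcontfun (F v) = \<Phi> v" for v
    unfolding F_def by (rule Bcontfun_inverse[OF \<Phi>B])
  have contr: "dist (F v) (F w) \<le> 1/2 * dist v w" for v w
  proof (rule dist_bound)
    fix t :: real
    define s where "s = max t 0"
    have s: "s \<ge> 0" by (simp add: s_def le_max_iff_disj)
    define d where "d = dist v w"
    have d: "d \<ge> 0" by (simp add: d_def)
    have "norm (G v s - G w s) = norm (integral {0..s} (\<lambda>r. g v r - g w r))"
      unfolding G_def by (simp add: Henstock_Kurzweil_Integration.integral_diff[OF gi gi])
    also have "\<dots> \<le> integral {0..s} (\<lambda>r. L * d * exp (c * r))"
    proof (rule integral_norm_bound_integral)
      show "(\<lambda>r. g v r - g w r) integrable_on {0..s}" by (intro integrable_diff gi)
      show "(\<lambda>r. L * d * exp (c * r)) integrable_on {0..s}" by (intro integrable_continuous_real continuous_intros)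
      fix r
      have "norm (g v r - g w r) \<le> L * norm (exp (c * r) *\<^sub>R (apply_bcontfun v r - apply_bcontfun w r))"
        unfolding g_def using lip[of "x0 + exp (c * r) *\<^sub>R apply_bcontfun v r" "x0 + exp (c * r) *\<^sub>R apply_bcontfun w r"]
        by (simp add: scaleR_diff_right)
      also have "\<dots> \<le> L * (exp (c * r) * d)"
        using L dist_bounded[of v r w] by (intro mult_left_mono) (auto simp: d_def dist_norm)
      finally show "norm (g v r - g w r) \<le> L * d * exp (c * r)" by (simp add: mult_ac)
    qed
    also have "\<dots> = L * d * (exp (c * s) / c - exp (c * 0) / c)"
    proof -
      have "((\<lambda>r. exp (c * r)) has_integral (exp (c * s) / c - exp (c * 0) / c)) {0..s}"
        using s c by (intro fundamental_theorem_of_calculus)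
          (auto intro!: derivative_eq_intros simp flip: has_real_derivative_iff_has_vector_derivative)
      then show ?thesis by (intro integral_unique has_integral_mult_right)
    qed
    also have "\<dots> \<le> L * d * (exp (c * s) / c)" using L d c by (intro mult_left_mono) auto
    finally have "norm (G v s - G w s) \<le> L / c * d * exp (c * s)" by (simp add: mult_ac)
    then have "exp (- c * s) * norm (G v s - G w s) \<le> exp (- c * s) * (L / c * d * exp (c * s))"
      by (intro mult_left_mono) auto
    also have "\<dots> = L / c * d * (exp (- c * s) * exp (c * s))" by simp
    also have "exp (- c * s) * exp (c * s) = 1" by (simp flip: exp_add)
    also have "L / c * d * 1 \<le> 1/2 * d"
      using mult_right_mono[OF c(2) d] by (simp only: mult_1_right)
    finally have "exp (- c * s) * norm (G v s - G w s) \<le> 1/2 * d" .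
    moreover have "\<Phi> v t - \<Phi> w t = exp (- c * s) *\<^sub>R (G v s - G w s)"
      by (simp add: \<Phi>_def s_def scaleR_diff_right)
    ultimately show "dist (apply_bcontfun (F v) t) (apply_bcontfun (F w) t) \<le> 1/2 * dist v w"
      by (simp add: F dist_norm d_def)
  qed
  have "\<exists>!v. F v = v" by (rule banach_fix_type[of "1/2"]) (use contr in auto)
  then obtain v where v: "F v = v" by blast
  define u where "u t = x0 + G v t" for t
  have uv: "u t = x0 + exp (c * t) *\<^sub>R apply_bcontfun v t" if "t \<ge> 0" for t
  proof -
    have "apply_bcontfun v t = exp (- c * t) *\<^sub>R G v t" using F[of v] v that by (simp add: \<Phi>_def)
    then show ?thesis by (simp add: u_def flip: exp_add)
  qed
  show ?thesis
  proof (rule that)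
    show "u 0 = x0" by (simp add: u_def G_def)
    fix t :: real assume t: "t \<ge> 0"
    have "(u has_vector_derivative g v t) (at t within {0..})"
      unfolding u_def using Gd[OF t, of v] by (auto intro!: derivative_eq_intros)
    then show "(u has_vector_derivative f (u t)) (at t within {0..})" using uv[OF t] by (simp add: g_def)
  qed
qed

section \<open>A maximum principle\<close>

text \<open>The barrier b starts above all coordinates and decays to m0. The rate \<rho> is chosen
  so that b falls at speed at most r / 2. At a first contact the leading coordinate falls at speed
  at least r, faster than b, so it was above b shortly before: a contradiction. Only the leading
  coordinate ever has to be controlled.\<close>

lemma max_barrier:
  fixes y y' :: "'i \<Rightarrow> real \<Rightarrow> real"
  assumes J: "finite J"
    and d: "\<And>i t. i \<in> J \<Longrightarrow> t \<ge> 0 \<Longrightarrow> (y i has_real_derivative y' i t) (at t within {0..})"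
    and r: "r > 0"
    and dec: "\<And>i t. i \<in> J \<Longrightarrow> t \<ge> 0 \<Longrightarrow> (\<And>j. j \<in> J \<Longrightarrow> y j t \<le> y i t) \<Longrightarrow> m0 \<le> y i t \<Longrightarrow> y' i t \<le> - r"
    and e: "e > 0"
  shows "\<forall>\<^sub>F t in at_top. \<forall>i\<in>J. y i t < m0 + e"
proof -
  define C where "C = 1 + (\<Sum>i\<in>J. \<bar>y i 0 - m0\<bar>)"
  have C: "C > 0" by (simp add: C_def add_pos_nonneg sum_nonneg)
  have y0: "y i 0 < m0 + C" if "i \<in> J" for i
    using member_le_sum[OF that, of "\<lambda>i. \<bar>y i 0 - m0\<bar>"] J by (auto simp: C_def)
  define \<rho> where "\<rho> = r / (2 * C)"
  have \<rho>: "\<rho> > 0" "C * \<rho> = r / 2" using r C by (auto simp: \<rho>_def)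
  define b where "b t = m0 + C * exp (- \<rho> * t)" for t
  have bd: "(b has_real_derivative - (r / 2) * exp (- \<rho> * t)) (at t within {0..})" for t
    unfolding b_def \<rho>(2)[symmetric] by (auto intro!: derivative_eq_intros)
  have bm: "b t > m0" for t using C by (simp add: b_def)
  have yc: "continuous_on {0..} (y i)" if "i \<in> J" for i
    using d[OF that] by (meson DERIV_continuous_on atLeast_iff)
  have bc: "continuous_on {0..} b" unfolding b_def by (intro continuous_intros)
  define S where "S = (\<Union>i\<in>J. {t \<in> {0..}. b t \<le> y i t})"
  have "S = {}"
  proof (rule ccontr)
    assume ne: "S \<noteq> {}"
    have "closed {t \<in> {0..}. b t \<le> y i t}" if "i \<in> J" for i
      by (rule continuous_on_closed_Collect_le[OF bc yc[OF that]]) simp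
    then have "closed S" unfolding S_def using J by (intro closed_UN) auto
    moreover have bb: "bdd_below S" by (rule bdd_belowI[of _ 0]) (auto simp: S_def)
    ultimately have "Inf S \<in> S" using ne by (intro closed_contains_Inf)
    define t where "t = Inf S"
    have tS: "t \<in> S" using \<open>Inf S \<in> S\<close> by (simp add: t_def)
    have t0: "t \<ge> 0" using tS by (auto simp: S_def)
    have Jne: "J \<noteq> {}" using tS by (auto simp: S_def)
    obtain i where i: "i \<in> J" "\<And>j. j \<in> J \<Longrightarrow> y j t \<le> y i t"
    proof -
      have "Max ((\<lambda>i. y i t) ` J) \<in> (\<lambda>i. y i t) ` J" using J Jne by (intro Max_in) auto
      then obtain i where "i \<in> J" "Max ((\<lambda>i. y i t) ` J) = y i t" by auto
      then show ?thesis using that[of i] J Max_ge[of "(\<lambda>i. y i t) ` J"] by auto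
    qed
    obtain j where "j \<in> J" "b t \<le> y j t" using tS by (auto simp: S_def)
    then have yb: "b t \<le> y i t" using i(2) by force
    have tpos: "t > 0"
    proof (rule ccontr)
      assume "\<not> t > 0"
      then have "t = 0" using t0 by simp
      then show False using yb y0[OF i(1)] by (simp add: b_def)
    qed
    have y'i: "y' i t \<le> - r" using yb bm[of t] by (intro dec[OF i(1) t0 i(2)]) auto
    have "((\<lambda>t. y i t - b t) has_real_derivative y' i t - - (r / 2) * exp (- \<rho> * t)) (at t within {0..})"
      by (intro DERIV_diff d i t0 bd)
    moreover have "y' i t - - (r / 2) * exp (- \<rho> * t) < 0"
    proof -
      have "exp (- \<rho> * t) \<le> 1" using \<rho> t0 by simp
      then have "(r / 2) * exp (- \<rho> * t) \<le> (r / 2) * 1" using r by (intro mult_left_mono) auto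
      then show ?thesis using y'i r by linarith
    qed
    ultimately obtain \<delta> where \<delta>: "\<delta> > 0" "\<And>h. h > 0 \<Longrightarrow> t - h \<in> {0..} \<Longrightarrow> h < \<delta> \<Longrightarrow> y i t - b t < y i (t - h) - b (t - h)"
      using has_real_derivative_neg_dec_left[of "\<lambda>t. y i t - b t"] by blast
    define h where "h = min t (\<delta> / 2)"
    have h: "h > 0" "h < \<delta>" "h \<le> t" using \<delta>(1) tpos by (auto simp: h_def)
    then have "b (t - h) \<le> y i (t - h)" using \<delta>(2)[of h] yb by simp
    then have "t - h \<in> S" using h i(1) by (auto simp: S_def)
    then have "t \<le> t - h" unfolding t_def using bb by (intro cInf_lower)
    then show False using h by simp
  qed
  then have lt: "y i t < b t" if "i \<in> J" "t \<ge> 0" for i t using that unfolding S_def by force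
  have "((\<lambda>t. exp (- \<rho> * t)) \<longlongrightarrow> 0) at_top"
  proof -
    have "filterlim (\<lambda>t. \<rho> * t) at_top at_top"
      using \<rho> by (intro filterlim_tendsto_pos_mult_at_top[OF tendsto_const]) (auto simp: filterlim_ident)
    then have "filterlim (\<lambda>t. - (\<rho> * t)) at_bot at_top" by (simp add: filterlim_uminus_at_bot_at_top filterlim_uminus_at_top)
    from filterlim_compose[OF exp_at_bot this] show ?thesis by simp
  qed
  then have "((\<lambda>t. m0 + C * exp (- \<rho> * t)) \<longlongrightarrow> m0 + C * 0) at_top" by (intro tendsto_intros)
  then have "(b \<longlongrightarrow> m0) at_top" by (simp add: b_def[abs_def])
  then have "\<forall>\<^sub>F t in at_top. b t < m0 + e" using e by (intro order_tendstoD) auto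
  then show ?thesis
    using eventually_ge_at_top[of 0] by eventually_elim (use lt in force)
qed

section \<open>Monotone curvature maps\<close>

definition exp_vec :: "real^'v \<Rightarrow> real^'v" where
  "exp_vec x = (\<chi> i. exp (x $ i))"

lemma exp_vec_nth [simp]: "exp_vec x $ i = exp (x $ i)"
  by (simp add: exp_vec_def)

lemma exp_vec_pos: "exp_vec x \<in> \<Omega>k"
  by (simp add: \<Omega>k_def)

lemma \<Omega>k_subset: "k \<in> \<Omega>k \<Longrightarrow> k \<in> \<Omega>k_closed"
  by (auto simp: \<Omega>k_def \<Omega>k_closed_def less_imp_le)

lemma closed_\<Omega>k_closed: "closed (\<Omega>k_closed :: (real^'v::finite) set)"
proof -
  have *: "\<Omega>k_closed = (\<Inter>i. {k::real^'v. 0 \<le> k $ i})" by (auto simp: \<Omega>k_closed_def)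
  show ?thesis unfolding * by (intro closed_INT ballI closed_Collect_le continuous_intros)
qed

text \<open>What the triangulation contributes to the dynamics. \<open>cap I\<close> stands for pi
  |F_I|, and \<open>large\<close> says that the total curvature on I comes close to it when the
  curvatures on I are large and the others bounded. \<open>lip\<close> refers to logarithmic
  coordinates, in which the flow is solved.\<close>

locale curvature_map =
  fixes \<tau> :: "real^'v::finite \<Rightarrow> real^'v" and cap :: "'v set \<Rightarrow> real" and L M0 :: real
  assumes mono: "\<And>k k' i. k \<in> \<Omega>k_closed \<Longrightarrow> k' \<in> \<Omega>k_closed \<Longrightarrow> (\<And>j. k $ j \<le> k' $ j) \<Longrightarrow> k $ i = k' $ i \<Longrightarrow> \<tau> k' $ i \<le> \<tau> k $ i"
    and scale: "\<And>k i l. k \<in> \<Omega>k_closed \<Longrightarrow> k $ i > 0 \<Longrightarrow> l > 1 \<Longrightarrow> \<tau> k $ i < \<tau> (l *\<^sub>R k) $ i"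
    and cont: "continuous_on \<Omega>k_closed \<tau>"
    and zero: "\<And>k i. k \<in> \<Omega>k_closed \<Longrightarrow> k $ i = 0 \<Longrightarrow> \<tau> k $ i = 0"
    and pos: "\<And>k i. k \<in> \<Omega>k_closed \<Longrightarrow> k $ i > 0 \<Longrightarrow> \<tau> k $ i > 0"
    and bound: "\<And>k. k \<in> \<Omega>k_closed \<Longrightarrow> norm (\<tau> k) \<le> M0"
    and lip: "\<And>x y. norm (\<tau> (exp_vec x) - \<tau> (exp_vec y)) \<le> L * norm (x - y)" and L: "L \<ge> 0"
    and large: "\<And>I M e. I \<noteq> {} \<Longrightarrow> M \<ge> 0 \<Longrightarrow> e > 0 \<Longrightarrow>
      \<exists>N. \<forall>k\<in>\<Omega>k_closed. (\<forall>i\<in>I. N \<le> k $ i) \<longrightarrow> (\<forall>i. i \<notin> I \<longrightarrow> k $ i \<le> M) \<longrightarrow> cap I - e \<le> (\<Sum>i\<in>I. \<tau> k $ i)"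
begin

lemma scaleR_closed: "k \<in> \<Omega>k_closed \<Longrightarrow> l \<ge> 0 \<Longrightarrow> l *\<^sub>R k \<in> \<Omega>k_closed"
  by (simp add: \<Omega>k_closed_def)

lemma scale_le:
  assumes "k \<in> \<Omega>k_closed" "k $ i > 0" "1 \<le> l"
  shows "\<tau> k $ i \<le> \<tau> (l *\<^sub>R k) $ i"
  using scale[OF assms(1,2), of l] assms(3) by (cases "l = 1") auto

definition admissible :: "real^'v \<Rightarrow> bool" where
  "admissible T \<longleftrightarrow> (\<forall>i. 0 \<le> T $ i) \<and> (\<forall>I. I \<noteq> {} \<longrightarrow> (\<Sum>i\<in>I. T $ i) < cap I)"

section \<open>Subsolutions and the prescribed curvature problem\<close>

definition sub :: "real^'v \<Rightarrow> (real^'v) set" where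
  "sub T = {k \<in> \<Omega>k_closed. \<forall>i. \<tau> k $ i \<le> T $ i}"

definition join :: "real^'v \<Rightarrow> real^'v \<Rightarrow> real^'v" where
  "join k k' = (\<chi> i. max (k $ i) (k' $ i))"

text \<open>At each coordinate the join agrees with one of the two vectors and dominates it
  elsewhere, so monotonicity applies to that one.\<close>

lemma join_sub:
  assumes "k \<in> sub T" "k' \<in> sub T" shows "join k k' \<in> sub T"
proof -
  have c: "k \<in> \<Omega>k_closed" "k' \<in> \<Omega>k_closed" "join k k' \<in> \<Omega>k_closed"
    using assms by (auto simp: sub_def \<Omega>k_closed_def join_def le_max_iff_disj)
  have "\<tau> (join k k') $ i \<le> T $ i" for i
  proof (cases "k $ i \<ge> k' $ i")
    case True
    then have "\<tau> (join k k') $ i \<le> \<tau> k $ i" by (intro mono c) (auto simp: join_def)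
    then show ?thesis using assms(1) by (auto simp: sub_def intro: order_trans)
  next
    case False
    then have "\<tau> (join k k') $ i \<le> \<tau> k' $ i" by (intro mono c) (auto simp: join_def)
    then show ?thesis using assms(2) by (auto simp: sub_def intro: order_trans)
  qed
  then show ?thesis using c by (simp add: sub_def)
qed

text \<open>Otherwise let I be the set of unbounded coordinates. Joins produce a single subsolution
  that is large on all of I, while the other coordinates stay below M. Its total curvature on I is
  then within e of \<open>cap I\<close>, more than T allows.\<close>

lemma sub_bounded:
  assumes T: "admissible T"
  obtains M where "M \<ge> 0" "\<And>k i. k \<in> sub T \<Longrightarrow> k $ i \<le> M"
proof -
  define I where "I = {i. \<forall>M. \<exists>k\<in>sub T. M < k $ i}"
  have "\<forall>i. \<exists>M. i \<notin> I \<longrightarrow> (\<forall>k\<in>sub T. k $ i \<le> M)" by (auto simp: I_def not_less)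
  then obtain b where b: "\<And>i k. i \<notin> I \<Longrightarrow> k \<in> sub T \<Longrightarrow> k $ i \<le> b i" by metis
  define M where "M = (\<Sum>i\<in>UNIV. \<bar>b i\<bar>)"
  have M: "M \<ge> 0" by (simp add: M_def sum_nonneg)
  have bM: "k $ i \<le> M" if "i \<notin> I" "k \<in> sub T" for i k
    using b[OF that] member_le_sum[of i UNIV "\<lambda>i. \<bar>b i\<bar>"] by (simp add: M_def)
  have "I = {}"
  proof (rule ccontr)
    assume I: "I \<noteq> {}"
    define e where "e = (cap I - (\<Sum>i\<in>I. T $ i)) / 2"
    have e: "e > 0" using T I by (simp add: admissible_def e_def)
    obtain N where N: "\<And>k. k \<in> \<Omega>k_closed \<Longrightarrow> (\<forall>i\<in>I. N \<le> k $ i) \<Longrightarrow> (\<forall>i. i \<notin> I \<longrightarrow> k $ i \<le> M) \<Longrightarrow> cap I - e \<le> (\<Sum>i\<in>I. \<tau> k $ i)"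
      using large[OF I M e] by blast
    have ex: "\<exists>k\<in>sub T. \<forall>i\<in>K. N \<le> k $ i" if "finite K" "K \<noteq> {}" "K \<subseteq> I" for K
      using that
    proof (induction K rule: finite_ne_induct)
      case (singleton i)
      then show ?case unfolding I_def by (force intro: less_imp_le)
    next
      case (insert i K)
      then obtain k where k: "k \<in> sub T" "\<forall>i\<in>K. N \<le> k $ i" by auto
      obtain k' where k': "k' \<in> sub T" "N < k' $ i" using insert.prems unfolding I_def by blast
      show ?case
        using join_sub[OF k(1) k'(1)] k(2) k'(2)
        by (intro bexI[of _ "join k k'"]) (auto simp: join_def le_max_iff_disj less_imp_le)
    qed
    obtain k where k: "k \<in> sub T" "\<forall>i\<in>I. N \<le> k $ i" using ex[of I] I by auto
    have "cap I - e \<le> (\<Sum>i\<in>I. \<tau> k $ i)" using k bM by (intro N) (auto simp: sub_def)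
    also have "\<dots> \<le> (\<Sum>i\<in>I. T $ i)" using k by (intro sum_mono) (auto simp: sub_def)
    finally show False using e by (simp add: e_def field_simps)
  qed
  then show ?thesis using that[OF M] bM by blast
qed

lemma sub_compact:
  assumes "admissible T" shows "compact (sub T)"
  unfolding compact_eq_bounded_closed
proof
  obtain M where M: "M \<ge> 0" "\<And>k i. k \<in> sub T \<Longrightarrow> k $ i \<le> M" using sub_bounded[OF assms] by blast
  have "norm k \<le> real CARD('v) * M" if "k \<in> sub T" for k
  proof -
    have "norm k \<le> (\<Sum>i\<in>UNIV. \<bar>k $ i\<bar>)" by (rule norm_le_l1_cart)
    also have "\<dots> \<le> (\<Sum>i\<in>(UNIV::'v set). M)"
      using M(2)[OF that] that by (intro sum_mono) (auto simp: sub_def \<Omega>k_closed_def)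
    finally show ?thesis by simp
  qed
  then show "bounded (sub T)" unfolding bounded_iff by blast
  have "closed {k \<in> \<Omega>k_closed. \<tau> k $ i \<le> T $ i}" for i
    by (intro continuous_on_closed_Collect_le continuous_intros cont closed_\<Omega>k_closed)
  moreover have "sub T = (\<Inter>i. {k \<in> \<Omega>k_closed. \<tau> k $ i \<le> T $ i})" by (auto simp: sub_def)
  ultimately show "closed (sub T)" by auto
qed

text \<open>The largest subsolution is a solution, as raising a coordinate with \<open>\<tau>\<^sub>i < T\<^sub>i\<close> would give a
  larger subsolution.\<close>

lemma max_sub_solution:
  assumes "admissible T"
  obtains K where "K \<in> \<Omega>k_closed" "\<tau> K = T" "\<And>k i. k \<in> sub T \<Longrightarrow> k $ i \<le> K $ i"
proof -
  have "0 \<in> sub T" using assms zero[of 0] by (auto simp: sub_def \<Omega>k_closed_def admissible_def)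
  moreover have "continuous_on (sub T) (\<lambda>k. \<Sum>i\<in>UNIV. k $ i)" by (intro continuous_intros)
  ultimately obtain K where K: "K \<in> sub T" "\<And>k. k \<in> sub T \<Longrightarrow> (\<Sum>i\<in>UNIV. k $ i) \<le> (\<Sum>i\<in>UNIV. K $ i)"
    using continuous_attains_sup[OF sub_compact[OF assms]] by blast
  have Kc: "K \<in> \<Omega>k_closed" using K by (simp add: sub_def)
  have strict: False if "k \<in> sub T" "\<And>j. K $ j \<le> k $ j" "K $ i < k $ i" for k i
  proof -
    have "(\<Sum>i\<in>UNIV. K $ i) < (\<Sum>i\<in>UNIV. k $ i)" using that by (intro sum_strict_mono_ex1) auto
    then show False using K(2)[OF that(1)] by simp
  qed
  have le: "k $ i \<le> K $ i" if "k \<in> sub T" for k i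
  proof (rule ccontr)
    assume "\<not> k $ i \<le> K $ i"
    then show False using strict[OF join_sub[OF K(1) that], of i] by (auto simp: join_def)
  qed
  have "\<tau> K $ i = T $ i" for i
  proof (rule ccontr)
    assume "\<tau> K $ i \<noteq> T $ i"
    then have lt: "\<tau> K $ i < T $ i" using K(1) by (auto simp: sub_def order_less_le)
    have "continuous_on \<Omega>k_closed (\<lambda>k. \<tau> k $ i)" by (intro continuous_intros cont)
    then obtain d where d: "d > 0" "\<And>k. k \<in> \<Omega>k_closed \<Longrightarrow> dist k K < d \<Longrightarrow> dist (\<tau> k $ i) (\<tau> K $ i) < T $ i - \<tau> K $ i"
      using Kc lt unfolding continuous_on_iff by (metis diff_gt_0_iff_gt)
    define k where "k = K + (d / 2) *\<^sub>R axis i 1"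
    have kn: "k $ j = (if j = i then K $ j + d / 2 else K $ j)" for j
      by (simp add: k_def axis_def)
    have kc: "k \<in> \<Omega>k_closed" using Kc d(1) by (auto simp: \<Omega>k_closed_def kn)
    have "dist k K < d" using d(1) by (simp add: k_def dist_norm norm_axis_1)
    then have "\<tau> k $ i < T $ i" using d(2)[OF kc] by (simp add: dist_real_def)
    moreover have "\<tau> k $ j \<le> T $ j" if "j \<noteq> i" for j
    proof -
      have "\<tau> k $ j \<le> \<tau> K $ j" using that d(1) by (intro mono kc Kc) (auto simp: kn)
      then show ?thesis using K(1) by (auto simp: sub_def intro: order_trans)
    qed
    ultimately have "k \<in> sub T" using kc by (auto simp: sub_def) (metis less_imp_le)
    moreover have "K $ j \<le> k $ j" for j using d(1) by (simp add: kn)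
    ultimately show False using strict[of k i] d(1) by (simp add: kn)
  qed
  then have "\<tau> K = T" by (simp add: vec_eq_iff)
  with Kc show ?thesis using le that by blast
qed

lemma solution_pos_iff:
  assumes "k \<in> \<Omega>k_closed" shows "k $ i > 0 \<longleftrightarrow> \<tau> k $ i > 0"
  using zero[OF assms, of i] pos[OF assms, of i] assms by (cases "k $ i = 0") (auto simp: \<Omega>k_closed_def order_less_le)

text \<open>Both solutions are compared with the largest subsolution K. If k is smaller somewhere,
  scale it by the largest ratio l of K to k over the positive coordinates. Then l k dominates K and
  touches it at m, so its curvature at m is at most that of K, although scaling has strictly
  increased it.\<close>

lemma solution_unique:
  assumes T: "admissible T" and k: "k \<in> \<Omega>k_closed" "\<tau> k = T" and k': "k' \<in> \<Omega>k_closed" "\<tau> k' = T"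
  shows "k = k'"
proof -
  obtain K where K: "K \<in> \<Omega>k_closed" "\<tau> K = T" "\<And>k i. k \<in> sub T \<Longrightarrow> k $ i \<le> K $ i"
    using max_sub_solution[OF T] by blast
  have "k = K" if k: "k \<in> \<Omega>k_closed" "\<tau> k = T" for k
  proof -
    have le: "k $ i \<le> K $ i" for i using K(3)[of k] k by (simp add: sub_def)
    have pi: "k $ i > 0 \<longleftrightarrow> K $ i > 0" for i
      using solution_pos_iff[OF k(1)] solution_pos_iff[OF K(1)] k K by simp
    define P where "P = {i. k $ i > 0}"
    have "K $ i \<le> k $ i" for i
    proof (rule ccontr)
      assume i: "\<not> K $ i \<le> k $ i"
      have k0: "k $ j \<ge> 0" for j using k(1) by (simp add: \<Omega>k_closed_def)
      have "K $ i > 0" using i k0[of i] by linarith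
      then have iP: "i \<in> P" using pi by (simp add: P_def)
      define l where "l = Max ((\<lambda>j. K $ j / k $ j) ` P)"
      have "l \<in> (\<lambda>j. K $ j / k $ j) ` P" unfolding l_def using iP by (intro Max_in) auto
      then obtain m where m: "m \<in> P" "l = K $ m / k $ m" by auto
      have lmax: "K $ j / k $ j \<le> l" if "j \<in> P" for j unfolding l_def using that by (intro Max_ge) auto
      have "1 < K $ i / k $ i" using i iP by (simp add: P_def)
      then have l1: "l > 1" using lmax[OF iP] by simp
      have Kl: "K $ j \<le> (l *\<^sub>R k) $ j" for j
      proof (cases "j \<in> P")
        case True
        then show ?thesis using lmax[OF True] by (simp add: P_def divide_le_eq)
      next
        case False
        then have "K $ j = 0" "k $ j = 0" using pi[of j] K(1) k0[of j] by (auto simp: P_def \<Omega>k_closed_def order_less_le)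
        then show ?thesis by simp
      qed
      have "\<tau> (l *\<^sub>R k) $ m \<le> \<tau> K $ m"
        using m l1 by (intro mono K scaleR_closed k Kl) (auto simp: P_def)
      moreover have "\<tau> k $ m < \<tau> (l *\<^sub>R k) $ m" using m l1 by (intro scale k) (auto simp: P_def)
      ultimately show False using k K by simp
    qed
    then show ?thesis using le by (simp add: vec_eq_iff order_antisym)
  qed
  then show ?thesis using k k' by metis
qed

section \<open>Dependence of the solution on the prescribed curvatures\<close>

definition sol :: "real^'v \<Rightarrow> real^'v" where
  "sol T = (SOME K. K \<in> \<Omega>k_closed \<and> \<tau> K = T)"

lemma sol:
  assumes "admissible T"
  shows "sol T \<in> \<Omega>k_closed" "\<tau> (sol T) = T" "\<And>k i. k \<in> sub T \<Longrightarrow> k $ i \<le> sol T $ i"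
proof -
  obtain K where K: "K \<in> \<Omega>k_closed" "\<tau> K = T" "\<And>k i. k \<in> sub T \<Longrightarrow> k $ i \<le> K $ i"
    using max_sub_solution[OF assms] by blast
  have "\<exists>K. K \<in> \<Omega>k_closed \<and> \<tau> K = T" using K by blast
  from someI_ex[OF this] show s: "sol T \<in> \<Omega>k_closed" "\<tau> (sol T) = T" by (auto simp: sol_def)
  have "sol T = K" by (rule solution_unique[OF assms s K(1,2)])
  then show "\<And>k i. k \<in> sub T \<Longrightarrow> k $ i \<le> sol T $ i" using K(3) by simp
qed

text \<open>Raising the vanishing entries makes the solution positive everywhere, so that its
  multiples can dominate a flow line. Positive entries are left as they are.\<close>

definition perturb :: "real^'v \<Rightarrow> real \<Rightarrow> real^'v" where
  "perturb T d = (\<chi> i. if T $ i = 0 then d else T $ i)"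

text \<open>Finitely many strict inequalities have a common positive slack. Dividing it by one more
  than the number of vertices leaves room for raising every entry of I by d.\<close>

lemma perturb_admissible:
  assumes T: "admissible T"
  obtains d0 where "d0 > 0" "\<And>d. 0 < d \<Longrightarrow> d \<le> d0 \<Longrightarrow> admissible (perturb T d) \<and> (\<forall>i. perturb T d $ i > 0)"
proof -
  define A where "A = (\<lambda>I. (cap I - (\<Sum>i\<in>I. T $ i)) / (real CARD('v) + 1)) ` {I. I \<noteq> {}}"
  define d0 where "d0 = Min A"
  have fA: "finite A" "A \<noteq> {}" by (auto simp: A_def)
  have "d0 \<in> A" unfolding d0_def using fA by (rule Min_in)
  then have d0: "d0 > 0" using T by (auto simp: A_def admissible_def intro!: divide_pos_pos)
  have "admissible (perturb T d) \<and> (\<forall>i. perturb T d $ i > 0)" if d: "0 < d" "d \<le> d0" for d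
  proof -
    have "0 < perturb T d $ i" for i
      using T d unfolding perturb_def admissible_def by (auto simp: order_less_le)
    moreover have "(\<Sum>i\<in>I. perturb T d $ i) < cap I" if I: "I \<noteq> {}" for I
    proof -
      have "(\<Sum>i\<in>I. perturb T d $ i) \<le> (\<Sum>i\<in>I. T $ i + d)"
        using T d by (intro sum_mono) (auto simp: perturb_def admissible_def)
      also have "\<dots> = (\<Sum>i\<in>I. T $ i) + real (card I) * d" by (simp add: sum.distrib)
      also have "real (card I) * d \<le> real CARD('v) * d0"
        using d d0 by (intro mult_mono) (auto intro: card_mono)
      also have "\<dots> < (real CARD('v) + 1) * d0" using d0 by simp
      also have "(real CARD('v) + 1) * d0 \<le> cap I - (\<Sum>i\<in>I. T $ i)"
      proof -
        have "d0 \<le> (cap I - (\<Sum>i\<in>I. T $ i)) / (real CARD('v) + 1)"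
          unfolding d0_def using fA I by (intro Min_le) (auto simp: A_def)
        then show ?thesis by (simp add: le_divide_eq add_pos_nonneg mult.commute)
      qed
      finally show ?thesis by simp
    qed
    ultimately show ?thesis unfolding admissible_def by (auto intro: less_imp_le)
  qed
  with d0 show ?thesis by (rule that)
qed

text \<open>The solution for a smaller increase is a subsolution for a larger one, so along d0 / (n
  + 1) the solutions decrease. By continuity their limit solves the problem for T, and uniqueness
  identifies it with \<open>sol T\<close>.\<close>

lemma sol_perturb_approx:
  assumes T: "admissible T" and e: "e > 0"
  obtains d where "d > 0" "admissible (perturb T d)" "\<And>i. perturb T d $ i > 0" "sol (perturb T d) $ i < sol T $ i + e"
proof -
  obtain d0 where d0: "d0 > 0" "\<And>d. 0 < d \<Longrightarrow> d \<le> d0 \<Longrightarrow> admissible (perturb T d) \<and> (\<forall>i. perturb T d $ i > 0)"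
    using perturb_admissible[OF T] by blast
  define d where "d n = d0 / real (Suc n)" for n
  have d: "0 < d n" "d n \<le> d0" "d (Suc n) \<le> d n" for n
    using d0(1) by (auto simp: d_def field_simps)
  have adm: "admissible (perturb T (d n))" for n using d0(2)[OF d(1,2)] by blast
  define K where "K n = sol (perturb T (d n))" for n
  have Kc: "K n \<in> \<Omega>k_closed" "\<tau> (K n) = perturb T (d n)" for n unfolding K_def by (rule sol[OF adm])+
  have dec: "decseq (\<lambda>n. K n $ j)" for j
  proof (rule decseq_SucI)
    fix n
    have "K (Suc n) \<in> sub (perturb T (d n))"
      using Kc[of "Suc n"] d(3)[of n] by (auto simp: sub_def perturb_def)
    then show "K (Suc n) $ j \<le> K n $ j" unfolding K_def by (rule sol(3)[OF adm])
  qed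
  have "\<exists>l. (\<lambda>n. K n $ j) \<longlonglongrightarrow> l" for j
  proof -
    have "\<forall>n. 0 \<le> K n $ j" using Kc(1) by (simp add: \<Omega>k_closed_def)
    from decseq_convergent[OF dec this] show ?thesis by blast
  qed
  then obtain l where l: "\<And>j. (\<lambda>n. K n $ j) \<longlonglongrightarrow> l j" by metis
  define K' where "K' = (\<chi> j. l j)"
  have Kl: "K \<longlonglongrightarrow> K'" by (intro vec_tendstoI) (simp add: K'_def l)
  have K'c: "K' \<in> \<Omega>k_closed" using closed_sequentially[OF closed_\<Omega>k_closed _ Kl] Kc by blast
  have "(\<lambda>n. \<tau> (K n)) \<longlonglongrightarrow> \<tau> K'"
    using cont K'c Kl Kc(1) by (auto simp: continuous_on_sequentially o_def)
  moreover have "(\<lambda>n. perturb T (d n)) \<longlonglongrightarrow> T"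
  proof (rule vec_tendstoI)
    fix j
    have "(\<lambda>n. d0 / real (Suc n)) \<longlonglongrightarrow> 0" by (rule LIMSEQ_Suc[OF lim_const_over_n])
    then show "(\<lambda>n. perturb T (d n) $ j) \<longlonglongrightarrow> T $ j"
      by (cases "T $ j = 0") (auto simp: perturb_def d_def)
  qed
  ultimately have "\<tau> K' = T" unfolding Kc(2) by (rule LIMSEQ_unique)
  then have "K' = sol T" using solution_unique[OF T K'c _ sol(1,2)[OF T]] by simp
  then have "(\<lambda>n. K n $ i) \<longlonglongrightarrow> sol T $ i" using l[of i] by (simp add: K'_def) (metis vec_lambda_beta)
  then have "\<forall>\<^sub>F n in sequentially. K n $ i < sol T $ i + e" using e by (intro order_tendstoD) auto
  then obtain n where "K n $ i < sol T $ i + e" using eventually_sequentially by auto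
  then show ?thesis using that[of "d n"] d(1)[of n] d0(2)[OF d(1,2)] by (auto simp: K_def)
qed

section \<open>The flow and its barriers\<close>

definition flow :: "real^'v \<Rightarrow> (real \<Rightarrow> real^'v) \<Rightarrow> bool" where
  "flow T k \<longleftrightarrow> (\<forall>t\<ge>0. k t \<in> \<Omega>k) \<and>
     (\<forall>t\<ge>0. (k has_vector_derivative (\<chi> i. - (\<tau> (k t) $ i - T $ i) * k t $ i)) (at t within {0..}))"

text \<open>The substitution u = ln k turns the flow into an equation with bounded, globally
  Lipschitz right-hand side T - \<tau> (exp u). Positivity of k is then automatic.\<close>

lemma flow_exists:
  assumes "k0 \<in> \<Omega>k"
  obtains k where "k 0 = k0" "flow T k"
proof -
  define f where "f x = T - \<tau> (exp_vec x)" for x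
  have "norm (f x - f y) \<le> L * norm (x - y)" for x y
    using lip[of y x] by (simp add: f_def norm_minus_commute)
  moreover have "norm (f x) \<le> norm T + M0" for x
    using norm_triangle_ineq4[of T "\<tau> (exp_vec x)"] bound[OF \<Omega>k_subset[OF exp_vec_pos], of x] by (simp add: f_def)
  ultimately obtain u where u: "u 0 = (\<chi> i. ln (k0 $ i))" "\<And>t. t \<ge> 0 \<Longrightarrow> (u has_vector_derivative f (u t)) (at t within {0..})"
    using lipschitz_ode_solution[of f L "norm T + M0"] L by metis
  define k where "k t = exp_vec (u t)" for t
  have "k 0 = k0" using assms by (simp add: k_def u(1) vec_eq_iff \<Omega>k_def)
  moreover have "flow T k"
    unfolding flow_def
  proof (intro conjI allI impI)
    fix t :: real assume t: "t \<ge> 0"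
    show "k t \<in> \<Omega>k" unfolding k_def by (rule exp_vec_pos)
    have "((\<lambda>t. k t $ i) has_vector_derivative - (\<tau> (k t) $ i - T $ i) * k t $ i) (at t within {0..})" for i
    proof -
      have "((\<lambda>t. u t $ i) has_vector_derivative f (u t) $ i) (at t within {0..})"
        using bounded_linear.has_vector_derivative[OF bounded_linear_vec_nth u(2)[OF t]] .
      then have "((\<lambda>t. u t $ i) has_real_derivative f (u t) $ i) (at t within {0..})"
        by (simp add: has_real_derivative_iff_has_vector_derivative)
      then have "((\<lambda>t. exp (u t $ i)) has_real_derivative exp (u t $ i) * f (u t) $ i) (at t within {0..})"
        using DERIV_chain2[OF DERIV_exp] by blast
      then show ?thesis
        unfolding has_real_derivative_iff_has_vector_derivative[symmetric]
        by (simp add: k_def f_def algebra_simps)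
    qed
    then show "(k has_vector_derivative (\<chi> i. - (\<tau> (k t) $ i - T $ i) * k t $ i)) (at t within {0..})"
      unfolding has_vector_derivative_def
      by (subst has_derivative_componentwise_within) (auto simp: Basis_vec_def cart_eq_inner_axis[symmetric] inner_axis)
  qed
  ultimately show ?thesis by (rule that)
qed

lemma flow_ln_deriv:
  assumes "flow T k" "t \<ge> 0"
  shows "((\<lambda>t. ln (k t $ i)) has_real_derivative T $ i - \<tau> (k t) $ i) (at t within {0..})"
proof -
  have p: "k t $ i > 0" using assms by (auto simp: flow_def \<Omega>k_def)
  have "(k has_vector_derivative (\<chi> i. - (\<tau> (k t) $ i - T $ i) * k t $ i)) (at t within {0..})"
    using assms by (auto simp: flow_def)
  from bounded_linear.has_vector_derivative[OF bounded_linear_vec_nth[of i] this]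
  have "((\<lambda>t. k t $ i) has_real_derivative - (\<tau> (k t) $ i - T $ i) * k t $ i) (at t within {0..})"
    by (simp add: has_real_derivative_iff_has_vector_derivative)
  from DERIV_ln_divide[THEN DERIV_chain2, OF p this]
  show ?thesis by (rule DERIV_cong) (use p in simp)
qed

text \<open>The barrier consists of multiples of the positive solution K for the perturbed T. If ln
  (k / K) is largest at j with value m \<ge> m0, then k lies below exp m K and touches it at j.
  Monotonicity and scaling then push the curvature of k at j above T by at least r.\<close>

lemma flow_upper:
  assumes T: "admissible T" and f: "flow T k" and e: "e > 0"
  shows "\<forall>\<^sub>F t in at_top. k t $ i < sol T $ i + e"
proof -
  obtain d where d: "d > 0" "admissible (perturb T d)" "\<And>i. perturb T d $ i > 0" "sol (perturb T d) $ i < sol T $ i + e"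
    using sol_perturb_approx[OF T e] by blast
  define K where "K = sol (perturb T d)"
  have K: "K \<in> \<Omega>k_closed" "\<tau> K = perturb T d" unfolding K_def by (rule sol[OF d(2)])+
  have Kp: "K $ j > 0" for j using solution_pos_iff[OF K(1), of j] d(3)[of j] K(2) by simp
  \<comment> \<open>Half of the available logarithmic gap: one m0 is the level to which the barrier
    decays, the other the tolerance, so the final bound is exactly
    \<open>sol T $ i + e\<close>.\<close>
  define m0 where "m0 = ln ((sol T $ i + e) / K $ i) / 2"
  have "1 < (sol T $ i + e) / K $ i" using d(4) Kp[of i] by (simp add: K_def)
  then have m0: "m0 > 0" by (simp add: m0_def)
  have em: "exp (m0 + m0) * K $ i = sol T $ i + e"
    using \<open>1 < (sol T $ i + e) / K $ i\<close> Kp[of i] by (simp add: m0_def)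
  define r where "r = Min (range (\<lambda>j. \<tau> (exp m0 *\<^sub>R K) $ j - \<tau> K $ j))"
  have "r \<in> range (\<lambda>j. \<tau> (exp m0 *\<^sub>R K) $ j - \<tau> K $ j)" unfolding r_def by (intro Min_in) auto
  then have r: "r > 0" using scale[OF K(1) Kp, of "exp m0"] m0 by auto
  have rle: "r \<le> \<tau> (exp m0 *\<^sub>R K) $ j - \<tau> K $ j" for j unfolding r_def by (intro Min_le) auto
  have "\<forall>\<^sub>F t in at_top. \<forall>j\<in>UNIV. ln (k t $ j) - ln (K $ j) < m0 + m0"
  proof (rule max_barrier)
    show "((\<lambda>t. ln (k t $ j) - ln (K $ j)) has_real_derivative T $ j - \<tau> (k t) $ j) (at t within {0..})" if "t \<ge> 0" for j t
      by (rule DERIV_cong[OF DERIV_diff[OF flow_ln_deriv[OF f that] DERIV_const]]) simp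
    fix j t assume t: "(t::real) \<ge> 0" and mx: "\<And>l. l \<in> UNIV \<Longrightarrow> ln (k t $ l) - ln (K $ l) \<le> ln (k t $ j) - ln (K $ j)"
      and ge: "m0 \<le> ln (k t $ j) - ln (K $ j)"
    have ko: "k t \<in> \<Omega>k" using f t by (auto simp: flow_def)
    then have kp: "k t $ l > 0" for l by (simp add: \<Omega>k_def)
    define m where "m = ln (k t $ j) - ln (K $ j)"
    have kl: "k t $ l \<le> exp m * K $ l" for l
    proof -
      have "ln (k t $ l) \<le> m + ln (K $ l)" using mx[of l] by (simp add: m_def)
      then have "exp (ln (k t $ l)) \<le> exp (m + ln (K $ l))" by simp
      then show ?thesis using kp[of l] Kp[of l] by (simp add: exp_add)
    qed
    have kj: "k t $ j = exp m * K $ j" using kp[of j] Kp[of j] by (simp add: m_def exp_diff)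
    have "\<tau> (exp m *\<^sub>R K) $ j \<le> \<tau> (k t) $ j"
      by (intro mono \<Omega>k_subset ko scaleR_closed K) (auto simp: kl kj)
    moreover have "\<tau> (exp m0 *\<^sub>R K) $ j \<le> \<tau> (exp m *\<^sub>R K) $ j"
    proof -
      have "exp m *\<^sub>R K = exp (m - m0) *\<^sub>R (exp m0 *\<^sub>R K)" by (simp add: exp_diff)
      moreover have "\<tau> (exp m0 *\<^sub>R K) $ j \<le> \<tau> (exp (m - m0) *\<^sub>R (exp m0 *\<^sub>R K)) $ j"
        using ge Kp[of j] by (intro scale_le scaleR_closed K) (auto simp: m_def)
      ultimately show ?thesis by (simp only:)
    qed
    moreover have "T $ j \<le> \<tau> K $ j" using d(1) K(2) by (simp add: perturb_def)
    ultimately show "T $ j - \<tau> (k t) $ j \<le> - r" using rle[of j] by linarith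
  qed (use r m0 in auto)
  then show ?thesis
    using eventually_ge_at_top[of 0]
  proof eventually_elim
    case (elim t)
    have kp: "k t $ i > 0" using f elim(2) by (auto simp: flow_def \<Omega>k_def)
    have "ln (k t $ i) < m0 + m0 + ln (K $ i)" using elim(1) by (simp add: algebra_simps)
    then have "exp (ln (k t $ i)) < exp (m0 + m0 + ln (K $ i))" by simp
    then have "k t $ i < exp (m0 + m0) * K $ i" using kp Kp[of i] by (simp add: exp_add)
    then show ?case using em by simp
  qed
qed

text \<open>The mirror image, with K = \<open>sol T\<close> itself. Only coordinates with K > 0 are
  compared; in the others every multiple of K is 0 and lies below k. If K is at most e at i, the
  claim is the positivity of k.\<close>

lemma flow_lower:
  assumes T: "admissible T" and f: "flow T k" and e: "e > 0"
  shows "\<forall>\<^sub>F t in at_top. sol T $ i - e < k t $ i"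
proof -
  define K where "K = sol T"
  have K: "K \<in> \<Omega>k_closed" "\<tau> K = T" unfolding K_def by (rule sol[OF T])+
  show ?thesis
  proof (cases "K $ i > e")
    case False
    show ?thesis
      using eventually_ge_at_top[of 0]
    proof eventually_elim
      case (elim t)
      then have "k t $ i > 0" using f by (auto simp: flow_def \<Omega>k_def)
      then show ?case using False by (simp add: K_def)
    qed
  next
    case True
    define P where "P = {j. K $ j > 0}"
    have iP: "i \<in> P" using True e by (simp add: P_def)
    define m0 where "m0 = ln (K $ i / (K $ i - e)) / 2"
    have q: "1 < K $ i / (K $ i - e)" using True e by simp
    then have m0: "m0 > 0" by (simp add: m0_def)
    have em: "exp (m0 + m0) * (K $ i - e) = K $ i" using q True e by (simp add: m0_def)
    define r where "r = Min ((\<lambda>j. \<tau> K $ j - \<tau> (exp (- m0) *\<^sub>R K) $ j) ` P)"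
    have pr: "\<tau> (exp (- m) *\<^sub>R K) $ j \<le> \<tau> (exp (- m') *\<^sub>R K) $ j" if "j \<in> P" "m' \<le> m" for j m m'
    proof -
      have "exp (- m') *\<^sub>R K = exp (m - m') *\<^sub>R (exp (- m) *\<^sub>R K)" by (simp flip: exp_add)
      moreover have "\<tau> (exp (- m) *\<^sub>R K) $ j \<le> \<tau> (exp (m - m') *\<^sub>R (exp (- m) *\<^sub>R K)) $ j"
        using that by (intro scale_le scaleR_closed K) (auto simp: P_def)
      ultimately show ?thesis by (simp only:)
    qed
    have "r \<in> (\<lambda>j. \<tau> K $ j - \<tau> (exp (- m0) *\<^sub>R K) $ j) ` P" unfolding r_def using iP by (intro Min_in) auto
    moreover have "\<tau> (exp (- m0) *\<^sub>R K) $ j < \<tau> K $ j" if "j \<in> P" for j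
      using scale[OF scaleR_closed[OF K(1), of "exp (- m0)"], of j "exp m0"] m0 that by (simp add: P_def flip: exp_add)
    ultimately have r: "r > 0" by auto
    have rle: "r \<le> \<tau> K $ j - \<tau> (exp (- m0) *\<^sub>R K) $ j" if "j \<in> P" for j unfolding r_def using that by (intro Min_le) auto
    have "\<forall>\<^sub>F t in at_top. \<forall>j\<in>P. ln (K $ j) - ln (k t $ j) < m0 + m0"
    proof (rule max_barrier)
      show "((\<lambda>t. ln (K $ j) - ln (k t $ j)) has_real_derivative - (T $ j - \<tau> (k t) $ j)) (at t within {0..})" if "t \<ge> 0" for j t
        by (rule DERIV_cong[OF DERIV_diff[OF DERIV_const flow_ln_deriv[OF f that]]]) simp
      fix j t assume t: "(t::real) \<ge> 0" and jP: "j \<in> P"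
        and mx: "\<And>l. l \<in> P \<Longrightarrow> ln (K $ l) - ln (k t $ l) \<le> ln (K $ j) - ln (k t $ j)"
        and ge: "m0 \<le> ln (K $ j) - ln (k t $ j)"
      have ko: "k t \<in> \<Omega>k" using f t by (auto simp: flow_def)
      then have kp: "k t $ l > 0" for l by (simp add: \<Omega>k_def)
      define m where "m = ln (K $ j) - ln (k t $ j)"
      have kl: "exp (- m) * K $ l \<le> k t $ l" for l
      proof (cases "l \<in> P")
        case True
        then have Kl: "K $ l > 0" by (simp add: P_def)
        have "- m + ln (K $ l) \<le> ln (k t $ l)" using mx[OF True] by (simp add: m_def)
        then have "exp (- m + ln (K $ l)) \<le> exp (ln (k t $ l))" by simp
        then show ?thesis using kp[of l] Kl unfolding exp_add by simp
      next
        case False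
        then have "K $ l = 0" using K(1) by (auto simp: P_def \<Omega>k_closed_def order_less_le)
        then show ?thesis using kp[of l] by simp
      qed
      have kj: "exp (- m) * K $ j = k t $ j" using kp[of j] jP by (simp add: m_def exp_diff P_def)
      have "\<tau> (k t) $ j \<le> \<tau> (exp (- m) *\<^sub>R K) $ j"
        by (intro mono \<Omega>k_subset ko scaleR_closed K) (auto simp: kl kj)
      moreover have "\<tau> (exp (- m) *\<^sub>R K) $ j \<le> \<tau> (exp (- m0) *\<^sub>R K) $ j"
        using ge by (intro pr jP) (simp add: m_def)
      ultimately show "- (T $ j - \<tau> (k t) $ j) \<le> - r" using rle[OF jP] K(2) by simp
    qed (use r m0 in auto)
    then show ?thesis
      using eventually_ge_at_top[of 0]
    proof eventually_elim
      case (elim t)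
      have kp: "k t $ i > 0" using f elim(2) by (auto simp: flow_def \<Omega>k_def)
      have "ln (K $ i) < m0 + m0 + ln (k t $ i)" using elim(1) iP by (simp add: algebra_simps)
      then have "exp (ln (K $ i)) < exp (m0 + m0 + ln (k t $ i))" by simp
      then have "K $ i < exp (m0 + m0) * k t $ i" using kp True e by (simp add: exp_add)
      then have "exp (m0 + m0) * (K $ i - e) < exp (m0 + m0) * k t $ i" unfolding em .
      then show ?case by (simp add: K_def)
    qed
  qed
qed

theorem flow_converges:
  assumes T: "admissible T" and f: "flow T k"
  shows "(k \<longlongrightarrow> sol T) at_top"
proof (rule vec_tendstoI)
  fix i
  show "((\<lambda>t. k t $ i) \<longlongrightarrow> sol T $ i) at_top"
  proof (rule tendstoI)
    fix e :: real assume e: "e > 0"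
    show "\<forall>\<^sub>F t in at_top. dist (k t $ i) (sol T $ i) < e"
      using flow_upper[OF T f e, of i] flow_lower[OF T f e, of i]
      by eventually_elim (simp add: dist_real_def abs_less_iff)
  qed
qed

end

section \<open>Triangulated surfaces\<close>

lemma arc_curvature_tri_curv:
  assumes "a \<ge> 0" "b \<ge> 0" "c \<ge> 0"
  shows "arc_curvature a b c = tri_curv a b c"
proof (cases "a = 0")
  case True
  then show ?thesis by (simp add: arc_curvature_def)
next
  case False
  then show ?thesis using assms by (simp add: arc_curvature_eq tri_curv_eq_arc_len)
qed

text \<open>Every corner is the first corner of some cyclic rotation of its triangle.\<close>

lemma face_curvature_cases:
  assumes "v \<in> verts f"
  obtains b c where "\<forall>k\<in>\<Omega>k_closed. face_curvature k f v = tri_curv (k $ v) (k $ b) (k $ c)"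
proof -
  obtain x y z where f: "f = (x, y, z)" by (metis surj_pair)
  have nn: "k $ i \<ge> 0" if "k \<in> \<Omega>k_closed" for k :: "real^'a" and i using that by (simp add: \<Omega>k_closed_def)
  consider "v = x" | "v \<noteq> x" "v = y" | "v \<noteq> x" "v \<noteq> y" "v = z" using assms f by auto
  then show ?thesis
  proof cases
    case 1
    then show ?thesis using that[of y z] f nn by (simp add: arc_curvature_tri_curv)
  next
    case 2
    then show ?thesis using that[of z x] f nn by (simp add: arc_curvature_tri_curv)
  next
    case 3
    then show ?thesis using that[of x y] f nn by (simp add: arc_curvature_tri_curv)
  qed
qed

text \<open>One, two or three corners lie in I; a cyclic rotation brings each of the seven patterns
  into the order of an estimate for a single triangle.\<close>

lemma face_curvature_sum_lower:
  assumes "e > 0" "M \<ge> 0"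
  shows "\<forall>\<^sub>F N in at_top. \<forall>f I. \<forall>k\<in>\<Omega>k_closed. card (verts f) = 3 \<longrightarrow> verts f \<inter> I \<noteq> {} \<longrightarrow>
    (\<forall>i\<in>I. N \<le> k $ i) \<longrightarrow> (\<forall>i. i \<notin> I \<longrightarrow> k $ i \<le> M) \<longrightarrow>
    pi - e \<le> (\<Sum>i\<in>{i \<in> I. i \<in> verts f}. face_curvature (k :: real^'v::finite) f i)"
  using tri_curv_sum_lower_eventually[OF assms]
proof eventually_elim
  case (elim N)
  show ?case
  proof (intro allI ballI impI)
    fix f I and k :: "real^'v"
    assume k: "k \<in> \<Omega>k_closed" and c3: "card (verts f) = 3" and ne: "verts f \<inter> I \<noteq> {}"
      and ge: "\<forall>i\<in>I. N \<le> k $ i" and le: "\<forall>i. i \<notin> I \<longrightarrow> k $ i \<le> M"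
    obtain x y z where f: "f = (x, y, z)" by (metis surj_pair)
    have nn: "k $ i \<ge> 0" for i using k by (simp add: \<Omega>k_closed_def)
    have d: "x \<noteq> y" "y \<noteq> z" "x \<noteq> z" using c3 f by (auto simp: card_insert_if split: if_splits)
    have fc: "face_curvature k f x = tri_curv (k $ x) (k $ y) (k $ z)" "face_curvature k f y = tri_curv (k $ y) (k $ z) (k $ x)"
      "face_curvature k f z = tri_curv (k $ z) (k $ x) (k $ y)"
      using d f nn by (auto simp: arc_curvature_tri_curv)
    have L1: "pi - e \<le> tri_curv a b c" if "N \<le> a" "0 \<le> b" "0 \<le> c" "b \<le> M" "c \<le> M" for a b c
      using elim that by blast
    have L2: "pi - e \<le> tri_curv a b c + tri_curv b c a" if "N \<le> a" "0 \<le> b" "0 \<le> c" "N \<le> b" "c \<le> M" for a b c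
      using elim that by blast
    have L3: "pi - e \<le> tri_curv a b c + tri_curv b c a + tri_curv c a b" if "N \<le> a" "0 \<le> b" "0 \<le> c" "N \<le> b" "N \<le> c" for a b c
      using elim that by blast
    have cases: "{i \<in> I. i \<in> verts f} = (if x \<in> I then {x} else {}) \<union> (if y \<in> I then {y} else {}) \<union> (if z \<in> I then {z} else {})"
      using f by auto
    consider "x \<in> I" "y \<in> I" "z \<in> I" | "x \<in> I" "y \<in> I" "z \<notin> I" | "x \<in> I" "y \<notin> I" "z \<in> I" | "x \<in> I" "y \<notin> I" "z \<notin> I"
      | "x \<notin> I" "y \<in> I" "z \<in> I" | "x \<notin> I" "y \<in> I" "z \<notin> I" | "x \<notin> I" "y \<notin> I" "z \<in> I"
      using ne f by auto
    then show "pi - e \<le> (\<Sum>i\<in>{i \<in> I. i \<in> verts f}. face_curvature k f i)"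
    proof cases
      case 1
      then have "(\<Sum>i\<in>{i \<in> I. i \<in> verts f}. face_curvature k f i) = face_curvature k f x + face_curvature k f y + face_curvature k f z"
        unfolding cases using d by simp
      then show ?thesis unfolding fc using L3[of "k $ x" "k $ y" "k $ z"] 1 ge nn by simp
    next
      case 2
      then have "(\<Sum>i\<in>{i \<in> I. i \<in> verts f}. face_curvature k f i) = face_curvature k f x + face_curvature k f y"
        unfolding cases using d by simp
      then show ?thesis unfolding fc using L2[of "k $ x" "k $ y" "k $ z"] 2 ge le nn by simp
    next
      case 3
      then have "(\<Sum>i\<in>{i \<in> I. i \<in> verts f}. face_curvature k f i) = face_curvature k f z + face_curvature k f x"
        unfolding cases using d by simp
      then show ?thesis unfolding fc using L2[of "k $ z" "k $ x" "k $ y"] 3 ge le nn by simp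
    next
      case 4
      then have "(\<Sum>i\<in>{i \<in> I. i \<in> verts f}. face_curvature k f i) = face_curvature k f x"
        unfolding cases using d by simp
      then show ?thesis unfolding fc using L1[of "k $ x" "k $ y" "k $ z"] 4 ge le nn by simp
    next
      case 5
      then have "(\<Sum>i\<in>{i \<in> I. i \<in> verts f}. face_curvature k f i) = face_curvature k f y + face_curvature k f z"
        unfolding cases using d by simp
      then show ?thesis unfolding fc using L2[of "k $ y" "k $ z" "k $ x"] 5 ge le nn by simp
    next
      case 6
      then have "(\<Sum>i\<in>{i \<in> I. i \<in> verts f}. face_curvature k f i) = face_curvature k f y"
        unfolding cases using d by simp
      then show ?thesis unfolding fc using L1[of "k $ y" "k $ z" "k $ x"] 6 ge le nn by simp
    next
      case 7
      then have "(\<Sum>i\<in>{i \<in> I. i \<in> verts f}. face_curvature k f i) = face_curvature k f z"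
        unfolding cases using d by simp
      then show ?thesis unfolding fc using L1[of "k $ z" "k $ x" "k $ y"] 7 ge le nn by simp
    qed
  qed
qed

section \<open>Summing over the triangles at a vertex\<close>

context
  fixes F :: "'v::finite face set"
  assumes card3: "\<And>f. f \<in> F \<Longrightarrow> card (verts f) = 3" and cover: "(\<Union>f\<in>F. verts f) = UNIV"
begin

lemma total_curvature_nth:
  "total_curvature F k $ v = (\<Sum>f\<in>{f \<in> F. v \<in> verts f}. face_curvature k f v)"
  by (simp add: total_curvature_def)

lemma star_nonempty: "{f \<in> F. v \<in> verts f} \<noteq> {}"
proof -
  have "v \<in> (\<Union>f\<in>F. verts f)" unfolding cover by simp
  then show ?thesis by blast
qed

text \<open>Double counting: the corners at vertices of I are grouped by triangle instead of by
  vertex.\<close>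

lemma total_curvature_sum:
  "(\<Sum>i\<in>I. total_curvature F k $ i) = (\<Sum>f\<in>{f \<in> F. verts f \<inter> I \<noteq> {}}. \<Sum>i\<in>{i \<in> I. i \<in> verts f}. face_curvature k f i)"
proof -
  have "(\<Sum>i\<in>I. total_curvature F k $ i) = (\<Sum>f\<in>F. \<Sum>i\<in>{i \<in> I. i \<in> verts f}. face_curvature k f i)"
    unfolding total_curvature_nth by (rule sum.swap_restrict) auto
  also have "\<dots> = (\<Sum>f\<in>{f \<in> F. verts f \<inter> I \<noteq> {}}. \<Sum>i\<in>{i \<in> I. i \<in> verts f}. face_curvature k f i)"
    by (intro sum.mono_neutral_right) (auto intro!: sum.neutral)
  finally show ?thesis .
qed

lemma face_curvature_nonneg_le_pi:
  assumes "v \<in> verts f" "k \<in> \<Omega>k_closed"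
  shows "0 \<le> face_curvature k f v" "face_curvature k f v \<le> pi"
    "k $ v = 0 \<Longrightarrow> face_curvature k f v = 0" "k $ v > 0 \<Longrightarrow> 0 < face_curvature k f v"
proof -
  obtain b c where bc: "\<forall>k\<in>\<Omega>k_closed. face_curvature k f v = tri_curv (k $ v) (k $ b) (k $ c)"
    using face_curvature_cases[OF assms(1)] .
  have nn: "k $ i \<ge> 0" for i using assms(2) by (simp add: \<Omega>k_closed_def)
  show "0 \<le> face_curvature k f v" "face_curvature k f v \<le> pi"
    "k $ v = 0 \<Longrightarrow> face_curvature k f v = 0" "k $ v > 0 \<Longrightarrow> 0 < face_curvature k f v"
    using tri_curv_bounds[OF nn nn nn] by (auto simp: bspec[OF bc assms(2)])
qed

text \<open>Every property passes from a single corner to the sum over the star of a vertex, which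
  is nonempty and so keeps strict inequalities strict. The constants count at most
  \<open>card F\<close> corners per vertex and pass to the norm through the sum of the
  coordinates.\<close>

lemma curvature_map_total_curvature:
  "curvature_map (total_curvature F) (\<lambda>I. pi * real (card {f \<in> F. verts f \<inter> I \<noteq> {}}))
     (real CARD('v) * (real (card F) * (4 + 2 * pi))) (real CARD('v) * (real (card F) * pi))"
proof
  have nn: "k $ i \<ge> 0" if "k \<in> \<Omega>k_closed" for k :: "real^'v" and i using that by (simp add: \<Omega>k_closed_def)
  fix k k' :: "real^'v" and i
  assume k: "k \<in> \<Omega>k_closed"
  {
    assume k': "k' \<in> \<Omega>k_closed" and le: "\<And>j. k $ j \<le> k' $ j" and eq: "k $ i = k' $ i"
    show "total_curvature F k' $ i \<le> total_curvature F k $ i"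
      unfolding total_curvature_nth
    proof (rule sum_mono)
      fix f assume "f \<in> {f \<in> F. i \<in> verts f}"
      then have vf: "i \<in> verts f" by simp
      obtain b c where bc: "\<forall>k\<in>\<Omega>k_closed. face_curvature k f i = tri_curv (k $ i) (k $ b) (k $ c)"
        using face_curvature_cases[OF vf] .
      show "face_curvature k' f i \<le> face_curvature k f i"
        unfolding bspec[OF bc k] bspec[OF bc k'] eq[symmetric] using le k nn by (intro tri_curv_antimono) auto
    qed
  }
  {
    fix l :: real assume p: "k $ i > 0" and l: "l > 1"
    have lk: "l *\<^sub>R k \<in> \<Omega>k_closed" using k l by (simp add: \<Omega>k_closed_def)
    show "total_curvature F k $ i < total_curvature F (l *\<^sub>R k) $ i"
      unfolding total_curvature_nth
    proof (rule sum_strict_mono)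
      fix f assume "f \<in> {f \<in> F. i \<in> verts f}"
      then have vf: "i \<in> verts f" by simp
      obtain b c where bc: "\<forall>k\<in>\<Omega>k_closed. face_curvature k f i = tri_curv (k $ i) (k $ b) (k $ c)"
        using face_curvature_cases[OF vf] .
      show "face_curvature k f i < face_curvature (l *\<^sub>R k) f i"
        unfolding bspec[OF bc k] bspec[OF bc lk] using tri_curv_scale[OF p nn[OF k] nn[OF k] l] by simp
    qed (use star_nonempty in auto)
  }
  {
    assume "k $ i = 0"
    then show "total_curvature F k $ i = 0"
      unfolding total_curvature_nth using face_curvature_nonneg_le_pi(3)[OF _ k] by (intro sum.neutral) auto
  }
  {
    assume "k $ i > 0"
    then show "total_curvature F k $ i > 0"
      unfolding total_curvature_nth using face_curvature_nonneg_le_pi(4)[OF _ k] star_nonempty by (intro sum_pos) auto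
  }
  have "\<bar>total_curvature F k $ j\<bar> \<le> real (card F) * pi" for j
  proof -
    have "\<bar>total_curvature F k $ j\<bar> \<le> (\<Sum>f\<in>{f \<in> F. j \<in> verts f}. \<bar>face_curvature k f j\<bar>)"
      unfolding total_curvature_nth by (rule sum_abs)
    also have "\<dots> \<le> (\<Sum>f\<in>{f \<in> F. j \<in> verts f}. pi)"
      using face_curvature_nonneg_le_pi(1,2)[OF _ k] by (intro sum_mono) auto
    also have "\<dots> = real (card {f \<in> F. j \<in> verts f}) * pi" by simp
    also have "\<dots> \<le> real (card F) * pi" by (intro mult_right_mono) (auto intro!: card_mono)
    finally show ?thesis .
  qed
  then have "(\<Sum>j\<in>UNIV. \<bar>total_curvature F k $ j\<bar>) \<le> (\<Sum>j\<in>(UNIV::'v set). real (card F) * pi)" by (intro sum_mono)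
  then show "norm (total_curvature F k) \<le> real CARD('v) * (real (card F) * pi)"
    using norm_le_l1_cart[of "total_curvature F k"] by simp
next
  have nn: "k $ i \<ge> 0" if "k \<in> \<Omega>k_closed" for k :: "real^'v" and i using that by (simp add: \<Omega>k_closed_def)
  have "continuous_on \<Omega>k_closed (\<lambda>k. face_curvature k f v)" if vf: "v \<in> verts f" for f and v :: 'v
  proof -
    obtain b c where bc: "\<forall>k\<in>\<Omega>k_closed. face_curvature k f v = tri_curv (k $ v) (k $ b) (k $ c)"
      using face_curvature_cases[OF vf] .
    have "continuous_on \<Omega>k_closed (\<lambda>k. tri_curv (k $ v) (k $ b) (k $ c))"
      by (intro tri_curv_continuous continuous_intros nn)
    then show ?thesis by (rule continuous_on_eq) (simp add: bc)
  qed
  then show "continuous_on \<Omega>k_closed (total_curvature F)"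
    unfolding total_curvature_def by (intro continuous_on_vec_lambda continuous_intros) auto
next
  fix x y :: "real^'v"
  have c: "exp_vec x \<in> \<Omega>k_closed" "exp_vec y \<in> \<Omega>k_closed" by (intro \<Omega>k_subset exp_vec_pos)+
  have d: "\<bar>x $ j - y $ j\<bar> \<le> norm (x - y)" for j using component_le_norm_cart[of "x - y" j] by simp
  have fl: "\<bar>face_curvature (exp_vec x) f v - face_curvature (exp_vec y) f v\<bar> \<le> (4 + 2 * pi) * norm (x - y)" if vf: "v \<in> verts f" for f v
  proof -
    obtain b c where bc: "\<forall>k\<in>\<Omega>k_closed. face_curvature k f v = tri_curv (k $ v) (k $ b) (k $ c)"
      using face_curvature_cases[OF vf] .
    show ?thesis unfolding bspec[OF bc c(1)] bspec[OF bc c(2)] exp_vec_nth by (intro tri_curv_lipschitz d)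
  qed
  have "\<bar>(total_curvature F (exp_vec x) - total_curvature F (exp_vec y)) $ j\<bar> \<le> real (card F) * (4 + 2 * pi) * norm (x - y)" for j
  proof -
    have "\<bar>(total_curvature F (exp_vec x) - total_curvature F (exp_vec y)) $ j\<bar>
      \<le> (\<Sum>f\<in>{f \<in> F. j \<in> verts f}. \<bar>face_curvature (exp_vec x) f j - face_curvature (exp_vec y) f j\<bar>)"
      unfolding vector_minus_component total_curvature_nth sum_subtractf[symmetric] by (rule sum_abs)
    also have "\<dots> \<le> (\<Sum>f\<in>{f \<in> F. j \<in> verts f}. (4 + 2 * pi) * norm (x - y))" using fl by (intro sum_mono) auto
    also have "\<dots> = real (card {f \<in> F. j \<in> verts f}) * ((4 + 2 * pi) * norm (x - y))" by simp
    also have "\<dots> \<le> real (card F) * ((4 + 2 * pi) * norm (x - y))"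
      by (intro mult_right_mono) (auto intro!: card_mono)
    finally show ?thesis by (simp add: mult.assoc)
  qed
  then have "(\<Sum>j\<in>UNIV. \<bar>(total_curvature F (exp_vec x) - total_curvature F (exp_vec y)) $ j\<bar>)
      \<le> (\<Sum>j\<in>(UNIV::'v set). real (card F) * (4 + 2 * pi) * norm (x - y))" by (intro sum_mono)
  then show "norm (total_curvature F (exp_vec x) - total_curvature F (exp_vec y))
      \<le> real CARD('v) * (real (card F) * (4 + 2 * pi)) * norm (x - y)"
    using norm_le_l1_cart[of "total_curvature F (exp_vec x) - total_curvature F (exp_vec y)"] by (simp add: mult.assoc)
next
  show "0 \<le> real CARD('v) * (real (card F) * (4 + 2 * pi))" using pi_gt_zero by (intro mult_nonneg_nonneg) auto
next
  fix I :: "'v set" and M e :: real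
  assume "M \<ge> 0" "e > 0"
  \<comment> \<open>The losses of at most \<open>card F\<close> triangles add up to at most e; the +
    1 keeps the divisor positive.\<close>
  define e' where "e' = e / (real (card F) + 1)"
  have e': "e' > 0" "real (card F) * e' \<le> e" using \<open>e > 0\<close> by (auto simp: e'_def field_simps)
  obtain N where N: "\<forall>f I. \<forall>k\<in>\<Omega>k_closed. card (verts f) = 3 \<longrightarrow> verts f \<inter> I \<noteq> {} \<longrightarrow>
    (\<forall>i\<in>I. N \<le> k $ i) \<longrightarrow> (\<forall>i. i \<notin> I \<longrightarrow> k $ i \<le> M) \<longrightarrow>
    pi - e' \<le> (\<Sum>i\<in>{i \<in> I. i \<in> verts f}. face_curvature (k :: real^'v) f i)"
    using eventually_happens[OF face_curvature_sum_lower[OF e'(1) \<open>M \<ge> 0\<close>]] by auto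
  show "\<exists>N. \<forall>k\<in>\<Omega>k_closed. (\<forall>i\<in>I. N \<le> k $ i) \<longrightarrow> (\<forall>i. i \<notin> I \<longrightarrow> k $ i \<le> M) \<longrightarrow>
    pi * real (card {f \<in> F. verts f \<inter> I \<noteq> {}}) - e \<le> (\<Sum>i\<in>I. total_curvature F k $ i)"
  proof (intro exI ballI impI)
    fix k :: "real^'v" assume k: "k \<in> \<Omega>k_closed" "\<forall>i\<in>I. N \<le> k $ i" "\<forall>i. i \<notin> I \<longrightarrow> k $ i \<le> M"
    let ?FI = "{f \<in> F. verts f \<inter> I \<noteq> {}}"
    have "real (card ?FI) * e' \<le> real (card F) * e'" using e'(1) by (intro mult_right_mono) (auto intro!: card_mono)
    then have "pi * real (card ?FI) - e \<le> (\<Sum>f\<in>?FI. pi - e')" using e'(2) by (simp add: algebra_simps)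
    also have "\<dots> \<le> (\<Sum>f\<in>?FI. \<Sum>i\<in>{i \<in> I. i \<in> verts f}. face_curvature k f i)"
      using N k card3 by (intro sum_mono) auto
    finally show "pi * real (card ?FI) - e \<le> (\<Sum>i\<in>I. total_curvature F k $ i)"
      unfolding total_curvature_sum .
  qed
qed

end

theorem corollary1p5:
  fixes S :: "'s topology" and F :: "'v::finite face set"
    and T :: "real^'v" and k0 :: "real^'v"
  assumes "closed_surface S" and "connected_space S"
    and "simple_triangulation S F" and "coherently_oriented F"
    and "T \<in> \<Omega>T_boundary0 F" and "k0 \<in> \<Omega>k"
  shows "(\<exists>k. flow_ray F T k0 k) \<and>
    (\<forall>k. flow_ray F T k0 k \<longrightarrow>
       \<not> (\<exists>l\<in>\<Omega>k. (k \<longlongrightarrow> l) at_top) \<and>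
       (\<exists>l\<in>\<Omega>k_boundary. total_curvature F -` {T} \<inter> \<Omega>k_closed = {l} \<and> (k \<longlongrightarrow> l) at_top))"
proof -
  have "\<And>f. f \<in> F \<Longrightarrow> card (verts f) = 3" "(\<Union>f\<in>F. verts f) = UNIV"
    using assms(3) by (auto simp: simple_triangulation_def)
  then interpret curvature_map "total_curvature F" "\<lambda>I. pi * real (card {f \<in> F. verts f \<inter> I \<noteq> {}})"
      "real CARD('v) * (real (card F) * (4 + 2 * pi))" "real CARD('v) * (real (card F) * pi)"
    by (rule curvature_map_total_curvature)
  have T: "admissible T"
    using assms(5) by (auto simp: admissible_def \<Omega>T_boundary0_def \<Omega>T_hat_def \<eta>_def)
  \<comment> \<open>Leaving \<open>\<Omega>T F\<close> inside \<open>\<Omega>T_hat F\<close> means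
    that some entry of T is 0. The solution vanishes at that vertex, so the limit of the flow cannot
    lie in \<open>\<Omega>k\<close>.\<close>
  have "\<exists>v. \<not> T $ v > 0" "\<forall>v. T $ v \<ge> 0"
    using assms(5) unfolding \<Omega>T_boundary0_def \<Omega>T_hat_def \<Omega>T_def by blast+
  then obtain v where v: "T $ v = 0" by (metis order_less_le)
  note s = sol(1,2)[OF T]
  have "sol T $ v = 0" using solution_pos_iff[OF s(1), of v] s v by (simp add: \<Omega>k_closed_def order_less_le)
  then have "sol T \<notin> \<Omega>k" unfolding \<Omega>k_def by (metis less_irrefl mem_Collect_eq)
  then have sb: "sol T \<in> \<Omega>k_boundary" "sol T \<notin> \<Omega>k" using s(1) unfolding \<Omega>k_boundary_def by blast+
  have pre: "total_curvature F -` {T} \<inter> \<Omega>k_closed = {sol T}"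
  proof (intro subset_antisym subsetI)
    fix k assume "k \<in> total_curvature F -` {T} \<inter> \<Omega>k_closed"
    then show "k \<in> {sol T}" using solution_unique[OF T _ _ s] by blast
  qed (use s in blast)
  have fr: "flow_ray F T k0 k \<longleftrightarrow> k 0 = k0 \<and> flow T k" for k
    by (simp add: flow_ray_def flow_def)
  have "\<exists>k. flow_ray F T k0 k" using flow_exists[OF assms(6)] unfolding fr by metis
  moreover have "\<not> (\<exists>l\<in>\<Omega>k. (k \<longlongrightarrow> l) at_top) \<and>
       (\<exists>l\<in>\<Omega>k_boundary. total_curvature F -` {T} \<inter> \<Omega>k_closed = {l} \<and> (k \<longlongrightarrow> l) at_top)"
    if "flow_ray F T k0 k" for k
  proof -
    have lim: "(k \<longlongrightarrow> sol T) at_top" using flow_converges[OF T] that fr by blast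
    have "l = sol T" if "(k \<longlongrightarrow> l) at_top" for l
      using tendsto_unique[OF trivial_limit_at_top_linorder that lim] .
    then show ?thesis using sb pre lim by blast
  qed
  ultimately show ?thesis by blast
qed

end
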